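(* In the setting described in the context, suppose $\mathbb E[\mu^p]<\infty$ for some $p>1$, and suppose that there are a measurable even function $K$ on $\mathbb R^d$ with $C_1\le K(z)\le C_2$ for some constants $C_1,C_2>0$, and a set $\Omega_0\subset\Omega$ of full probability measure such that for every $\omega\in\Omega_0$ the following (i)--(iv) hold. (i) If $\{f_\varepsilon:\varepsilon\in(0,1]\}$ are functions with $f_\varepsilon\in\mathcal F^{\varepsilon,\omega}$ for all $\varepsilon\in(0,1]$ and $\limsup_{\varepsilon\to0}(\|f_\varepsilon\|_\infty+\mathcal E^{\varepsilon,\omega}(f_\varepsilon,f_\varepsilon))<\infty$, then for any sequence $\{\varepsilon_n\}\subset(0,1]$ with $\lim_{n\to\infty}\varepsilon_n=0$ there are a subsequence $\{\varepsilon_{n_k}\}$ and $f\in L^1_{loc}(\mathbb R^d;dx)$ such that $f_{\varepsilon_{n_k}}\to f$ in $L^1(B(0,r);dx)$ for every $r>1$. (ii) For any $g\in C_c^\infty(\mathbb R^d)$, $$\lim_{\eta\to0}\limsup_{\varepsilon\to0}\iint_{\mathbb R^d\times\mathbb R^d\setminus\Delta}(g(x)-g(y))^2\frac{\kappa(x/\varepsilon,y/\varepsilon;\omega)}{|x-y|^{d+\alpha}}\mathbf 1_{\{|x-y|\le\eta\}}\,dx\,dy=0$$ and $$\lim_{\eta\to0}\limsup_{\varepsilon\to0}\iint_{\mathbb R^d\times\mathbb R^d}(g(x)-g(y))^2\frac{\kappa(x/\varepsilon,y/\varepsilon;\omega)}{|x-y|^{d+\alpha}}\mathbf 1_{\{|x-y|\ge1/\eta\}}\,dx\,dy=0.$$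 (iii) There is a constant $p>1$ such that $\limsup_{\varepsilon\to0}\int_{B(0,R)}\big(\int_{B(0,R)}\kappa(x/\varepsilon,y/\varepsilon;\omega)\,dy\big)^p\,dx<\infty$ for every $R\ge1$. (iv) For every $\eta>0$, every bounded measurable $f$ on $\mathbb R^d$ and every $g\in C_c^\infty(\mathbb R^d)$, $$\lim_{\varepsilon\to0}\iint_{\mathbb R^d\times\mathbb R^d}(f(x)-f(y))(g(x)-g(y))\frac{\kappa(x/\varepsilon,y/\varepsilon;\omega)}{|x-y|^{d+\alpha}}\mathbf 1_{\{\eta<|x-y|<1/\eta,\,x-y\in\Gamma\}}\,dx\,dy$$ $$=\iint_{\mathbb R^d\times\mathbb R^d}(f(x)-f(y))(g(x)-g(y))\frac{K(x-y)}{|x-y|^{d+\alpha}}\mathbf 1_{\{\eta<|x-y|<1/\eta,\,x-y\in\Gamma\}}\,dx\,dy.$$ Then there is a subset $\Omega_2\subset\Omega$ of full probability measure such that for every $\omega\in\Omega_2$, every $\lambda>0$ and any $f\in C_c(\mathbb R^d)$: (a) $U^{\varepsilon,\omega}_\lambda f$ converges to $U^K_\lambda f$ in $L^1(B(0,r);dx)$ as $\varepsilon\to0$, for every $r>1$; (b) $\lim_{\varepsilon\to0}\langle U^{\varepsilon,\omega}_\lambda f,g\rangle_{L^2(\mathbb R^d;\mu^{\varepsilon,\omega}(dx))}=\langle U^K_\lambda f,g\rangle_{L^2(\mathbb R^d;dx)}$ for every $g\in C_c(\mathbb R^d)$; (c) $\lim_{\varepsilon\to0}\mathcal E^{\varepsilon,\omega}(U^{\varepsilon,\omega}_\lambda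 f,g)=\mathcal E^K(U^K_\lambda f,g)$ for every $g\in C_c^\infty(\mathbb R^d)$.
   Context: Environment. $d\ge1$; $(\Omega,\mathcal F,\mathbb P)$ is a probability space with expectation $\mathbb E$, carrying a group of transformations $\{\tau_x\}_{x\in\mathbb R^d}$ of $\Omega$ with $\tau_0=\mathrm{id}$, $\tau_x\circ\tau_y=\tau_{x+y}$, such that (1) $\mathbb P(\tau_xA)=\mathbb P(A)$ for all $A\in\mathcal F$, $x\in\mathbb R^d$; (2) if $A\in\mathcal F$ and $\tau_xA=A$ for all $x$, then $\mathbb P(A)\in\{0,1\}$; (3) $(x,\omega)\mapsto\tau_x\omega$ is $\mathscr B(\mathbb R^d)\times\mathcal F$-measurable. Coefficients. $\alpha\in(0,2)$. $\mu:\Omega\to[0,\infty)$ is a random variable with $\mathbb E[\mu]=1$ and, for every $\omega$, $\mu(\tau_x\omega)>0$ for a.e. $x\in\mathbb R^d$. $\kappa:\mathbb R^d\times\mathbb R^d\times\Omega\to[0,\infty)$ is a (measurable) random function such that for every $\omega$ and all $x,y,z$: $\kappa(x,y;\omega)=\kappa(y,x;\omega)$, $\kappa(x+z,y+z;\omega)=\kappa(x,y;\tau_z\omega)$; and for $\mathbb P$-a.e. $\omega$ the function $x\mapsto\int_{\mathbb R^d}(1\wedge|z|^2)\frac{\kappa(x,x+z;\omega)}{|z|^{d+\alpha}}\,dz$ is in $L^1_{loc}(\mathbb R^d;dx)$. $\Gamma\subset\mathbb R^d$ is a non-empty open symmetric cone: $rx\in\Gamma$ for every $x\in\Gamma$ and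 $r\in\mathbb R\setminus\{0\}$. Forms. $\Delta=\{(x,x):x\in\mathbb R^d\}$. For $\varepsilon>0$, $\mu^{\varepsilon,\omega}(dx)=\mu(\tau_{x/\varepsilon}\omega)\,dx$, and $(\mathcal E^{\varepsilon,\omega},\mathcal F^{\varepsilon,\omega})$ is the regular symmetric Dirichlet form on $L^2(\mathbb R^d;\mu^{\varepsilon,\omega}(dx))$ given by $$\mathcal E^{\varepsilon,\omega}(f,g)=\frac12\iint_{\mathbb R^d\times\mathbb R^d\setminus\Delta}(f(x)-f(y))(g(x)-g(y))\frac{\kappa(x/\varepsilon,y/\varepsilon;\omega)}{|x-y|^{d+\alpha}}\mathbf 1_{\{x-y\in\Gamma\}}\,dx\,dy,$$ with $\mathcal F^{\varepsilon,\omega}$ the closure of $C^1_c(\mathbb R^d)$ (compactly supported $C^1$ functions) under the norm $(\mathcal E^{\varepsilon,\omega}(\cdot,\cdot)+\|\cdot\|^2_{L^2(\mathbb R^d;\mu^{\varepsilon,\omega}(dx))})^{1/2}$. $(\mathcal E^K,\mathcal F^K)$ is the regular Dirichlet form on $L^2(\mathbb R^d;dx)$ given by $$\mathcal E^K(f,g)=\frac12\iint_{\mathbb R^d\times\mathbb R^d\setminus\Delta}(f(x)-f(y))(g(x)-g(y))\frac{K(x-y)}{|x-y|^{d+\alpha}}\mathbf 1_{\{x-y\in\Gamma\}}\,dx\,dy,$$ with $\mathcal F^K$ the closure of $C^1_c(\mathbb R^d)$ under $(\mathcal E^K(\cdot,\cdot)+\|\cdot\|^2_{L^2(\mathbb R^d;dx)})^{1/2}$.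 $U^{\varepsilon,\omega}_\lambda$ and $U^K_\lambda$ are the $\lambda$-order resolvents of $(\mathcal E^{\varepsilon,\omega},\mathcal F^{\varepsilon,\omega})$ on $L^2(\mathbb R^d;\mu^{\varepsilon,\omega}(dx))$ and of $(\mathcal E^K,\mathcal F^K)$ on $L^2(\mathbb R^d;dx)$. The $\lambda$-order resolvent $U_\lambda$ of a Dirichlet form $(\mathcal E,\mathcal F)$ on $L^2(m)$ sends $f\in L^2(m)$ to the unique $u\in\mathcal F$ with $\mathcal E(u,g)+\lambda\langle u,g\rangle_{L^2(m)}=\langle f,g\rangle_{L^2(m)}$ for all $g\in\mathcal F$. $C_c$, $C_c^\infty$: continuous, resp. smooth, compactly supported functions; $B(x,r)$: open ball; $a\wedge b=\min(a,b)$. *)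

theory Defs
  imports "HOL-Probability.Probability"
begin

section \<open>Function spaces on a Euclidean space\<close>

text \<open>
  Elements of Lebesgue spaces and of form domains are represented by Borel measurable
  functions rather than by equivalence classes.
\<close>

text \<open>\<open>Ck k f\<close>: all iterated directional derivatives of \<open>f\<close> of order at most \<open>k\<close> exist
  and those of order \<open>k\<close> are continuous.\<close>

primrec Ck :: "nat \<Rightarrow> ('a::euclidean_space \<Rightarrow> real) \<Rightarrow> bool" where
  "Ck 0 f \<longleftrightarrow> continuous_on UNIV f"
| "Ck (Suc k) f \<longleftrightarrow>
     (\<forall>x. f differentiable (at x)) \<and> (\<forall>v. Ck k (\<lambda>x. frechet_derivative f (at x) v))"

definition compact_support :: "('a::euclidean_space \<Rightarrow> real) \<Rightarrow> bool" where
  "compact_support f \<longleftrightarrow> compact (closure {x. f x \<noteq> 0})"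

definition Cc :: "('a::euclidean_space \<Rightarrow> real) set" where
  "Cc = {f. continuous_on UNIV f \<and> compact_support f}"

definition Cc_1 :: "('a::euclidean_space \<Rightarrow> real) set" where
  "Cc_1 = {f. Ck 1 f \<and> compact_support f}"

definition Cc_infinity :: "('a::euclidean_space \<Rightarrow> real) set" where
  "Cc_infinity = {f. (\<forall>k. Ck k f) \<and> compact_support f}"

definition L1_loc :: "('a::euclidean_space \<Rightarrow> real) set" where
  "L1_loc = {f \<in> borel_measurable borel. \<forall>C. compact C \<longrightarrow> set_integrable lborel C f}"

text \<open>Local integrability of a nonnegative function that may take the value \<open>\<infinity>\<close>.\<close>

definition nn_L1_loc :: "('a::euclidean_space \<Rightarrow> ennreal) \<Rightarrow> bool" where
  "nn_L1_loc h \<longleftrightarrow> (\<forall>C. compact C \<longrightarrow> (\<integral>\<^sup>+x\<in>C. h x \<partial>lborel) < \<infinity>)"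

text \<open>Convergence in \<open>L\<^sup>1(S; dx)\<close> along a filter. The approximating functions only need to
  belong to \<open>L\<^sup>1(S; dx)\<close> eventually.\<close>

definition tendsto_L1 ::
  "'a::euclidean_space set \<Rightarrow> ('i \<Rightarrow> 'a \<Rightarrow> real) \<Rightarrow> ('a \<Rightarrow> real) \<Rightarrow> 'i filter \<Rightarrow> bool" where
  "tendsto_L1 S u l F \<longleftrightarrow>
     set_integrable lborel S l \<and>
     (\<forall>\<^sub>F i in F. set_integrable lborel S (u i)) \<and>
     ((\<lambda>i. LINT x:S|lborel. \<bar>u i x - l x\<bar>) \<longlongrightarrow> 0) F"

definition L2 :: "'a measure \<Rightarrow> ('a \<Rightarrow> real) set" where
  "L2 m = {f \<in> borel_measurable m. integrable m (\<lambda>x. (f x)\<^sup>2)}"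

definition L2_inner :: "'a measure \<Rightarrow> ('a \<Rightarrow> real) \<Rightarrow> ('a \<Rightarrow> real) \<Rightarrow> real" where
  "L2_inner m f g = (LINT x|m. f x * g x)"

definition ennreal_powr :: "ennreal \<Rightarrow> real \<Rightarrow> ennreal" where
  "ennreal_powr a p = (if a = \<infinity> then \<infinity> else ennreal (enn2real a powr p))"


section \<open>Symmetric jump forms and their resolvents\<close>

text \<open>\<open>J\<close> is the density of the jump measure. \<open>- Id\<close> is the complement of the diagonal.\<close>

definition jump_form ::
  "('a::euclidean_space \<Rightarrow> 'a \<Rightarrow> real) \<Rightarrow> ('a \<Rightarrow> real) \<Rightarrow> ('a \<Rightarrow> real) \<Rightarrow> real" where
  "jump_form J f g =
     1 / 2 * (LINT (x, y):(- Id)|(lborel \<Otimes>\<^sub>M lborel). (f x - f y) * (g x - g y) * J x y)"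

text \<open>The quadratic form \<open>f \<mapsto> \<E>(f, f)\<close> as an extended nonnegative number: the Bochner
  integral in \<open>jump_form\<close> is \<open>0\<close>, not \<open>\<infinity>\<close>, when the energy is infinite.\<close>

definition jump_energy ::
  "('a::euclidean_space \<Rightarrow> 'a \<Rightarrow> real) \<Rightarrow> ('a \<Rightarrow> real) \<Rightarrow> ennreal" where
  "jump_energy J f =
     ennreal (1 / 2) *
       (\<integral>\<^sup>+(x, y)\<in>(- Id). ennreal ((f x - f y)\<^sup>2 * J x y) \<partial>(lborel \<Otimes>\<^sub>M lborel))"

text \<open>The closure of \<open>C\<^sup>1\<^sub>c\<close> in \<open>L\<^sup>2(m)\<close> under the norm
  \<open>(\<E>(f, f) + \<parallel>f\<parallel>\<^sup>2)\<^bsup>1/2\<^esup>\<close>, where \<open>\<parallel>f\<parallel>\<close> is the \<open>L\<^sup>2(m)\<close> norm.\<close>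

definition jump_domain ::
  "'a::euclidean_space measure \<Rightarrow> ('a \<Rightarrow> 'a \<Rightarrow> real) \<Rightarrow> ('a \<Rightarrow> real) set" where
  "jump_domain m J =
     {f \<in> L2 m. \<exists>\<phi>. (\<forall>n::nat. \<phi> n \<in> Cc_1) \<and>
        (\<lambda>n. jump_energy J (\<lambda>x. f x - \<phi> n x) + (\<integral>\<^sup>+x. ennreal ((f x - \<phi> n x)\<^sup>2) \<partial>m))
          \<longlonglongrightarrow> 0}"

text \<open>The resolvent is unique only up to \<open>m\<close>-null sets, so a representative is chosen.\<close>

definition resolvent ::
  "'a measure \<Rightarrow> (('a \<Rightarrow> real) \<Rightarrow> ('a \<Rightarrow> real) \<Rightarrow> real) \<Rightarrow> ('a \<Rightarrow> real) set \<Rightarrow>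
     real \<Rightarrow> ('a \<Rightarrow> real) \<Rightarrow> ('a \<Rightarrow> real)" where
  "resolvent m E D l f =
     (SOME u. u \<in> D \<and> (\<forall>g\<in>D. E u g + l * L2_inner m u g = L2_inner m f g))"


section \<open>Stationary ergodic environments\<close>

locale ergodic_environment = prob_space M
  for M :: "'w measure" +
  fixes \<tau> :: "'a::euclidean_space \<Rightarrow> 'w \<Rightarrow> 'w"
  assumes shift_space: "\<omega> \<in> space M \<Longrightarrow> \<tau> x \<omega> \<in> space M"
    and shift_zero: "\<omega> \<in> space M \<Longrightarrow> \<tau> 0 \<omega> = \<omega>"
    and shift_add: "\<omega> \<in> space M \<Longrightarrow> \<tau> x (\<tau> y \<omega>) = \<tau> (x + y) \<omega>"
    and shift_invariant: "A \<in> events \<Longrightarrow> prob (\<tau> x ` A) = prob A"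
    and shift_ergodic: "A \<in> events \<Longrightarrow> (\<And>x. \<tau> x ` A = A) \<Longrightarrow> prob A = 0 \<or> prob A = 1"
    and shift_measurable: "(\<lambda>(x, \<omega>). \<tau> x \<omega>) \<in> borel \<Otimes>\<^sub>M M \<rightarrow>\<^sub>M M"


section \<open>The rescaled random forms and the limit form\<close>

definition env_measure ::
  "('a::euclidean_space \<Rightarrow> 'w \<Rightarrow> 'w) \<Rightarrow> ('w \<Rightarrow> real) \<Rightarrow> real \<Rightarrow> 'w \<Rightarrow> 'a measure" where
  "env_measure \<tau> \<mu> \<epsilon> \<omega> = density lborel (\<lambda>x. ennreal (\<mu> (\<tau> (x /\<^sub>R \<epsilon>) \<omega>)))"

definition env_kernel ::
  "real \<Rightarrow> 'a::euclidean_space set \<Rightarrow> ('a \<Rightarrow> 'a \<Rightarrow> 'w \<Rightarrow> real) \<Rightarrow> real \<Rightarrow> 'w \<Rightarrow>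
     'a \<Rightarrow> 'a \<Rightarrow> real" where
  "env_kernel \<alpha> \<Gamma> \<kappa> \<epsilon> \<omega> x y =
     \<kappa> (x /\<^sub>R \<epsilon>) (y /\<^sub>R \<epsilon>) \<omega> / norm (x - y) powr (real DIM('a) + \<alpha>) * indicator \<Gamma> (x - y)"

definition limit_kernel ::
  "real \<Rightarrow> 'a::euclidean_space set \<Rightarrow> ('a \<Rightarrow> real) \<Rightarrow> 'a \<Rightarrow> 'a \<Rightarrow> real" where
  "limit_kernel \<alpha> \<Gamma> K x y =
     K (x - y) / norm (x - y) powr (real DIM('a) + \<alpha>) * indicator \<Gamma> (x - y)"

definition env_form where
  "env_form \<alpha> \<Gamma> \<kappa> \<epsilon> \<omega> = jump_form (env_kernel \<alpha> \<Gamma> \<kappa> \<epsilon> \<omega>)"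

definition env_domain where
  "env_domain \<alpha> \<Gamma> \<tau> \<mu> \<kappa> \<epsilon> \<omega> =
     jump_domain (env_measure \<tau> \<mu> \<epsilon> \<omega>) (env_kernel \<alpha> \<Gamma> \<kappa> \<epsilon> \<omega>)"

definition env_resolvent where
  "env_resolvent \<alpha> \<Gamma> \<tau> \<mu> \<kappa> \<epsilon> \<omega> =
     resolvent (env_measure \<tau> \<mu> \<epsilon> \<omega>) (env_form \<alpha> \<Gamma> \<kappa> \<epsilon> \<omega>) (env_domain \<alpha> \<Gamma> \<tau> \<mu> \<kappa> \<epsilon> \<omega>)"

definition limit_form where
  "limit_form \<alpha> \<Gamma> K = jump_form (limit_kernel \<alpha> \<Gamma> K)"

definition limit_domain where
  "limit_domain \<alpha> \<Gamma> K = jump_domain lborel (limit_kernel \<alpha> \<Gamma> K)"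

definition limit_resolvent where
  "limit_resolvent \<alpha> \<Gamma> K = resolvent lborel (limit_form \<alpha> \<Gamma> K) (limit_domain \<alpha> \<Gamma> K)"

end

theory Submission
  imports Defs
begin

text \<open>
  Almost surely the densities \<open>\<mu>(\<tau>\<^bsub>x/\<epsilon>\<^esub> \<omega>)\<close> are locally uniformly integrable and converge weakly
  to \<open>1\<close>, by the ergodic theorem. Fix such an \<open>\<omega>\<close>. The resolvents \<open>u\<^sub>\<epsilon>\<close> of a bounded \<open>f\<close> are
  uniformly bounded with bounded energy, so by (i) every sequence \<open>\<epsilon> \<rightarrow> 0\<close> has a subsequence along
  which they converge in \<open>L\<^sup>1\<^sub>l\<^sub>o\<^sub>c\<close> to some bounded \<open>h\<close>. Uniform integrability of the densities
  gives \<open>\<langle>u\<^sub>\<epsilon>, g\<rangle> \<rightarrow> \<langle>h, g\<rangle>\<close>. On the band \<open>\<eta> < |x - y| < 1/\<eta>\<close> the form converges by (iii), which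
  controls \<open>u\<^sub>\<epsilon> - h\<close>, and (iv), applied to \<open>h\<close>; off the band it is small by (ii) and Cauchy-Schwarz.
  Thus \<open>h\<close> has finite limit energy and satisfies the limit resolvent equation for smooth test
  functions. As the limit form is translation invariant, averaging over translations shows that this
  equation has at most one bounded solution of finite energy, so \<open>h\<close> is the limit resolvent.
\<close>

section \<open>Test functions\<close>

text \<open>The functions to be compared live in different weighted L2 spaces and only L1
  compactness is available, so norm and energy of the limit h are bounded by duality: 2<u,g> - <g,g>
  <= <u,u> is passed to the limit for a fixed g, and g is optimised afterwards. Hypothesis (iv)
  admits bounded measurable first arguments and so can be applied to h, but its second argument must
  be smooth; hence h is approximated by smooth g in L2 on a band, where the limit form is
  L2-bounded. The limit h is then known to have finite energy, but not to lie in the closure of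
  \<open>Cc_1\<close>, so it cannot serve as a test function in its own equation. This obstacle
  dictates the uniqueness argument: averages are Lipschitz, and bounded Lipschitz functions of
  finite energy do lie in the closure. Since \<open>resolvent\<close> picks some solution, existence
  has to be proved for every form. Minimising over truncated functions gives existence together with
  the uniform sup bound; truncation has to stay inside \<open>Cc_1\<close>, which costs the bound M
  + 1 in place of M.\<close>

lemma Ck_Suc_imp_Ck: "Ck (Suc k) f \<Longrightarrow> Ck k f"
proof (induction k arbitrary: f)
  case 0
  then show ?case
    by (auto intro!: differentiable_imp_continuous_on simp: differentiable_on_def)
next
  case (Suc k)
  then show ?case by auto
qed

lemma frechet_derivative_eqI:
  "(f has_derivative f') (at x) \<Longrightarrow> frechet_derivative f (at x) = f'"
  using frechet_derivative_at by metis

lemma Ck_add: "Ck k f \<Longrightarrow> Ck k g \<Longrightarrow> Ck k (\<lambda>x. f x + g x)"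
proof (induction k arbitrary: f g)
  case 0
  then show ?case by (auto intro: continuous_intros)
next
  case (Suc k)
  have "frechet_derivative (\<lambda>x. f x + g x) (at x) =
      (\<lambda>v. frechet_derivative f (at x) v + frechet_derivative g (at x) v)" for x
    using Suc.prems by (intro frechet_derivative_eqI has_derivative_add)
      (auto simp: frechet_derivative_works)
  with Suc show ?case by auto
qed

lemma Ck_mult: "Ck k f \<Longrightarrow> Ck k g \<Longrightarrow> Ck k (\<lambda>x. f x * g x)"
proof (induction k arbitrary: f g)
  case 0
  then show ?case by (auto intro: continuous_intros)
next
  case (Suc k)
  have "frechet_derivative (\<lambda>x. f x * g x) (at x) =
      (\<lambda>v. f x * frechet_derivative g (at x) v + frechet_derivative f (at x) v * g x)" for x
    using Suc.prems by (intro frechet_derivative_eqI has_derivative_mult)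
      (auto simp: frechet_derivative_works)
  moreover have "Ck k f" "Ck k g"
    using Suc.prems Ck_Suc_imp_Ck by blast+
  ultimately show ?case using Suc by (auto intro!: Ck_add)
qed

lemma Ck_const: "Ck k (\<lambda>x. c)"
proof (induction k arbitrary: c)
  case (Suc k)
  then show ?case by (simp add: frechet_derivative_eqI[OF has_derivative_const])
qed auto

lemma Ck_linear: assumes "bounded_linear f" shows "Ck k f"
proof (cases k)
  case 0
  then show ?thesis using assms by (simp add: linear_continuous_on)
next
  case (Suc n)
  have "(f has_derivative f) (at x)" for x
    using assms by (rule bounded_linear_imp_has_derivative)
  then show ?thesis
    using Suc frechet_derivative_eqI[of f f] Ck_const by (auto simp: differentiable_def) 
qed

lemma compact_support_iff:
  "compact_support f \<longleftrightarrow> (\<exists>R. \<forall>x. f x \<noteq> 0 \<longrightarrow> norm x \<le> R)"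
  unfolding compact_support_def compact_closure bounded_iff by auto

lemma compact_support_pos:
  assumes "compact_support f"
  obtains R where "R > 0" "\<And>x. R < norm x \<Longrightarrow> f x = 0"
proof -
  obtain R where R: "\<And>x. f x \<noteq> 0 \<Longrightarrow> norm x \<le> R"
    using assms unfolding compact_support_iff by blast
  show thesis
    by (rule that[of "max R 1"]) (use R in force)+
qed

lemma Cc_1_add: "f \<in> Cc_1 \<Longrightarrow> g \<in> Cc_1 \<Longrightarrow> (\<lambda>x. f x + g x) \<in> Cc_1"
proof -
  assume a: "f \<in> Cc_1" "g \<in> Cc_1"
  from a obtain R S where "\<And>x. f x \<noteq> 0 \<longrightarrow> norm x \<le> R" "\<And>x. g x \<noteq> 0 \<longrightarrow> norm x \<le> S"
    unfolding Cc_1_def compact_support_iff by blast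
  then have "\<forall>x. f x + g x \<noteq> 0 \<longrightarrow> norm x \<le> max R S"
    by (metis add_cancel_right_right le_max_iff_disj)
  with a show ?thesis
    unfolding Cc_1_def compact_support_iff using Ck_add by blast
qed

lemma Cc_1_cmult: "f \<in> Cc_1 \<Longrightarrow> (\<lambda>x. c * f x) \<in> Cc_1"
  unfolding Cc_1_def compact_support_iff
  using Ck_mult[OF Ck_const, of 1 f c] by (auto simp del: One_nat_def Ck.simps)

lemma Cc_1_zero: "(\<lambda>x. 0) \<in> Cc_1"
  unfolding Cc_1_def compact_support_iff using Ck_const by auto

lemma Cc_infinity_sub_Cc_1: "f \<in> Cc_infinity \<Longrightarrow> f \<in> Cc_1"
  unfolding Cc_1_def Cc_infinity_def by blast

lemma Cc_1_sub_Cc: "f \<in> Cc_1 \<Longrightarrow> f \<in> Cc"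
  unfolding Cc_1_def Cc_def using Ck_Suc_imp_Ck[of 0 f] by (simp add: numeral_eq_Suc)

text \<open>The Lipschitz constant, the sup bound and the support radius are kept as parameters
  because the dominating functions built later depend on these three numbers only, so they serve
  whole sequences at once.\<close>

definition lipc :: "real \<Rightarrow> real \<Rightarrow> real \<Rightarrow> ('a::euclidean_space \<Rightarrow> real) \<Rightarrow> bool" where
  "lipc L B R g \<longleftrightarrow> (\<forall>x y. \<bar>g x - g y\<bar> \<le> L * dist x y) \<and> (\<forall>x. \<bar>g x\<bar> \<le> B) \<and>
     (\<forall>x. R < norm x \<longrightarrow> g x = 0) \<and> 0 \<le> L \<and> 0 \<le> B \<and> 0 < R"

lemma Cc_bounded:
  assumes "f \<in> Cc"
  obtains B where "B \<ge> 0" "\<And>x. \<bar>f x\<bar> \<le> B"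
proof -
  obtain R where R: "R > 0" "\<And>x. R < norm x \<Longrightarrow> f x = 0"
    using assms compact_support_pos unfolding Cc_def by blast
  have "compact (f ` cball 0 R)"
    using assms by (intro compact_continuous_image)
      (auto simp: Cc_def intro: continuous_on_subset)
  then have "bounded (f ` cball 0 R)" by (rule compact_imp_bounded)
  then obtain B where "\<forall>y\<in>f ` cball 0 R. norm y \<le> B"
    unfolding bounded_iff by blast
  then have B: "\<bar>f x\<bar> \<le> B" if "x \<in> cball 0 R" for x
    using that by auto
  have "\<bar>f x\<bar> \<le> max B 0" for x
    using R(2)[of x] B[of x] by (cases "norm x \<le> R") auto
  then show thesis using that[of "max B 0"] by auto
qed

lemma Cc_uniformly_continuous:
  fixes f :: "'a::euclidean_space \<Rightarrow> real"
  assumes "f \<in> Cc" "e > 0"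
  obtains d where "d > 0" "\<And>x y. dist x y < d \<Longrightarrow> \<bar>f x - f y\<bar> < e"
proof -
  obtain R where R: "R > 0" "\<And>x. R < norm x \<Longrightarrow> f x = 0"
    using assms compact_support_pos unfolding Cc_def by blast
  \<comment> \<open>The margin 1 matches the cap in \<open>min d 1\<close>: if one of two such close
    points lies in the ball of radius R, both lie in the larger ball; otherwise both values are
    0.\<close>
  have "uniformly_continuous_on (cball 0 (R+1)) f"
    using assms by (intro compact_uniformly_continuous)
      (auto simp: Cc_def intro: continuous_on_subset)
  then obtain d where d: "d > 0" "\<And>x y. x \<in> cball 0 (R+1) \<Longrightarrow> y \<in> cball 0 (R+1) \<Longrightarrow>
      dist x y < d \<Longrightarrow> dist (f x) (f y) < e"
    using \<open>e > 0\<close> unfolding uniformly_continuous_on_def by metis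
  show thesis
  proof (rule that[of "min d 1"])
    fix x y :: 'a assume xy: "dist x y < min d 1"
    show "\<bar>f x - f y\<bar> < e"
    proof (cases "norm x \<le> R \<or> norm y \<le> R")
      case True
      have "norm x \<le> norm y + dist x y" "norm y \<le> norm x + dist x y"
        by (metis dist_norm norm_triangle_sub add.commute, metis dist_norm dist_commute norm_triangle_sub add.commute)
      then have "x \<in> cball 0 (R+1)" "y \<in> cball 0 (R+1)"
        using True xy by auto
      then show ?thesis using d xy by (simp add: dist_real_def)
    next
      case False
      then show ?thesis using R \<open>e > 0\<close> by simp
    qed
  qed (use d in auto)
qed

lemma frechet_derivative_Cc:
  assumes "f \<in> Cc_1"
  shows "(\<lambda>x::'a::euclidean_space. frechet_derivative f (at x) v) \<in> Cc"
proof -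
  obtain R where R: "R > 0" "\<And>x. R < norm x \<Longrightarrow> f x = 0"
    using assms compact_support_pos unfolding Cc_1_def by blast
  have "frechet_derivative f (at x) v = 0" if "R < norm x" for x
  proof -
    have "(f has_derivative (\<lambda>_. 0)) (at x)"
    proof (rule has_derivative_transform_within_open)
      show "open {x::'a. R < norm x}"
        by (intro open_Collect_less continuous_intros)
    qed (use that R in auto)
    then show ?thesis using frechet_derivative_eqI by metis
  qed
  then have "compact_support (\<lambda>x. frechet_derivative f (at x) v)"
    unfolding compact_support_iff using not_le by blast
  then show ?thesis using assms by (auto simp: Cc_1_def Cc_def)
qed

lemma Cc_1_lipc:
  assumes "f \<in> Cc_1"
  obtains L B R where "lipc L B R f" "\<And>x v. \<bar>frechet_derivative f (at x) v\<bar> \<le> L * norm v"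
proof -
  obtain R where R: "R > 0" "\<And>x. R < norm x \<Longrightarrow> f x = 0"
    using assms compact_support_pos unfolding Cc_1_def by blast
  obtain B where B: "B \<ge> 0" "\<And>x. \<bar>f x\<bar> \<le> B"
    using Cc_bounded[OF Cc_1_sub_Cc[OF assms]] by metis
  have "\<exists>C. C \<ge> 0 \<and> (\<forall>x. \<bar>frechet_derivative f (at x) v\<bar> \<le> C)" for v
    using Cc_bounded[OF frechet_derivative_Cc[OF assms, of v]] by metis
  then obtain C where C: "\<And>v. C v \<ge> 0" "\<And>v x. \<bar>frechet_derivative f (at x) v\<bar> \<le> C v"
    by metis
  \<comment> \<open>Expanding v in the basis bounds the derivative by the sum of the bounds in the
    basis directions, since each coordinate of v is at most \<open>norm v\<close>; the mean value
    inequality then makes L a Lipschitz constant.\<close>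
  define L where "L = (\<Sum>b\<in>Basis. C b)"
  have der: "(f has_derivative frechet_derivative f (at x)) (at x)" for x
    using assms by (auto simp: Cc_1_def frechet_derivative_works[symmetric])
  have on: "onorm (frechet_derivative f (at x)) \<le> L" for x
  proof (rule onorm_bound)
    interpret bounded_linear "frechet_derivative f (at x)"
      using der has_derivative_bounded_linear by blast
    show "norm (frechet_derivative f (at x) v) \<le> L * norm v" for v
    proof -
      have "frechet_derivative f (at x) v = frechet_derivative f (at x) (\<Sum>b\<in>Basis. (v \<bullet> b) *\<^sub>R b)"
        by (simp add: euclidean_representation)
      also have "\<dots> = (\<Sum>b\<in>Basis. (v \<bullet> b) * frechet_derivative f (at x) b)"
        by (simp add: sum scaleR)
      also have "norm \<dots> \<le> (\<Sum>b\<in>Basis. norm v * C b)"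
        by (intro sum_norm_le) (auto simp: abs_mult intro!: mult_mono C Basis_le_norm)
      finally show ?thesis by (simp add: L_def sum_distrib_left mult.commute)
    qed
  qed (simp add: L_def sum_nonneg C)
  have "\<bar>f x - f y\<bar> \<le> L * dist x y" for x y
    using differentiable_bound[of UNIV f "\<lambda>x. frechet_derivative f (at x)" L x y] der on
    by (auto simp: dist_norm has_derivative_at_withinI)
  moreover have "L \<ge> 0" by (simp add: L_def sum_nonneg C)
  moreover have "\<bar>frechet_derivative f (at x) v\<bar> \<le> L * norm v" for x v
    using onorm[OF has_derivative_bounded_linear[OF der], of x v] on[of x]
      mult_right_mono[OF on, of "norm v" x] by auto
  ultimately show thesis using that[of L B R] R B unfolding lipc_def by auto
qed

lemma lipc_continuous: "lipc L B R g \<Longrightarrow> continuous_on UNIV g"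
  unfolding continuous_on_iff
proof clarify
  fix x e :: real and y assume *: "lipc L B R g" "e > 0"
  have "dist (g x') (g y) < e" if "dist x' y < e / (L + 1)" for x'
  proof -
    have "\<bar>g x' - g y\<bar> \<le> L * dist x' y" "L \<ge> 0" using * by (auto simp: lipc_def)
    moreover have "(L+1) * dist x' y < e" using that \<open>L \<ge> 0\<close> by (simp add: field_simps)
    moreover have "L * dist x' y \<le> (L+1) * dist x' y" by (simp add: mult_right_mono)
    ultimately show ?thesis by (simp add: dist_real_def)
  qed
  moreover have "e / (L+1) > 0" using * by (auto simp: lipc_def)
  ultimately show "\<exists>d>0. \<forall>x'\<in>UNIV. dist x' y < d \<longrightarrow> dist (g x') (g y) < e" by blast
qed

lemma lipc_Cc: "lipc L B R g \<Longrightarrow> g \<in> Cc"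
  using lipc_continuous[of L B R g] unfolding Cc_def compact_support_iff lipc_def
  by (auto simp: not_le[symmetric])

section \<open>Mollification\<close>

text \<open>The family exp(-1/t) p(1/t), extended by 0, from which the standard bump is built. The
  polynomial factor is carried along because the family is then closed under
  differentiation.\<close>

definition flat :: "real poly \<Rightarrow> real \<Rightarrow> real" where
  "flat p t = (if t \<le> 0 then 0 else exp (- (1 / t)) * poly p (1 / t))"

lemma poly_over_exp_tendsto_0: "((\<lambda>s::real. poly p s / exp s) \<longlongrightarrow> 0) at_top"
proof -
  have "((\<lambda>s::real. \<Sum>i\<le>degree p. coeff p i * (s ^ i / exp s)) \<longlongrightarrow> (\<Sum>i\<le>degree p. coeff p i * 0)) at_top"
    by (intro tendsto_intros tendsto_power_div_exp_0)
  then show ?thesis by (simp add: poly_altdef sum_divide_distrib)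
qed

text \<open>With s = 1/t, the derivative of exp(-s) p(s) in t is s^2 (p - p')(s) exp(-s), and
  \<open>[:0,0,1:]\<close> is the polynomial s^2. At t = 0 the exponential decay beats every
  polynomial in s.\<close>

lemma flat_deriv: "(flat p has_real_derivative flat ([:0,0,1:] * (p - pderiv p)) t) (at t)"
proof -
  consider "t < 0" | "t = 0" | "t > 0" by linarith
  then show ?thesis
  proof cases
    case 1
    then have "((\<lambda>_. 0) has_real_derivative 0) (at t)" by simp
    then show ?thesis
      by (rule DERIV_cong_ev[THEN iffD2, rotated 3, OF _ ])
        (use 1 in \<open>auto simp: flat_def eventually_nhds intro!: exI[of _ "{..<0}"]\<close>)
  next
    case 3
    have "((\<lambda>t. exp (- (1 / t)) * poly p (1 / t)) has_real_derivative
        flat ([:0,0,1:] * (p - pderiv p)) t) (at t)"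
      using 3
      by (auto intro!: derivative_eq_intros DERIV_chain'[OF _ poly_DERIV] simp: flat_def field_simps power2_eq_square)
    then show ?thesis
      by (rule DERIV_cong_ev[THEN iffD2, rotated 3, OF _])
        (use 3 in \<open>auto simp: flat_def eventually_nhds intro!: exI[of _ "{0<..}"]\<close>)
  next
    case 2
    \<comment> \<open>Dividing by y contributes one more factor s = 1/y, hence the polynomial
      \<open>p * [:0,1:]\<close>.\<close>
    have "((\<lambda>y. poly (p * [:0,1:]) (inverse y) / exp (inverse y)) \<longlongrightarrow> 0) (at_right 0)"
      by (rule filterlim_compose[OF poly_over_exp_tendsto_0 filterlim_inverse_at_top_right])
    then have "((\<lambda>y. flat p y / y) \<longlongrightarrow> 0) (at_right 0)"
      by (rule Lim_transform_eventually)
        (auto simp: eventually_at_right_field flat_def field_simps exp_minus intro!: exI[of _ 1])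
    moreover have "((\<lambda>y. flat p y / y) \<longlongrightarrow> 0) (at_left 0)"
      by (rule Lim_transform_eventually[of "\<lambda>_. 0"])
        (auto simp: eventually_at_left_field flat_def intro!: exI[of _ "-1"])
    ultimately have "((\<lambda>y. flat p y / y) \<longlongrightarrow> 0) (at 0)"
      using filterlim_split_at by blast
    then show ?thesis using 2 by (simp add: DERIV_def flat_def)
  qed
qed

text \<open>The squared norm enters as \<open>x \<bullet> x\<close>, which is smooth at the origin.
  Each derivative is again a member of the family times a linear function, so the induction has to
  quantify over p.\<close>

lemma Ck_flat_ball: "Ck k (\<lambda>x::'a::euclidean_space. flat p (r - x \<bullet> x))"
proof (induction k arbitrary: p)
  case 0
  have "continuous_on UNIV (flat p)"
    using flat_deriv by (meson DERIV_isCont continuous_at_imp_continuous_on)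
  then show ?case
    by (auto intro!: continuous_on_compose2[of UNIV "flat p"] continuous_intros)
next
  case (Suc k)
  let ?p = "[:0,0,1:] * (p - pderiv p)"
  have d: "((\<lambda>x::'a. flat p (r - x \<bullet> x)) has_derivative
      (\<lambda>v. flat ?p (r - x \<bullet> x) * (- 2 * (x \<bullet> v)))) (at x)" for x
  proof -
    have "((\<lambda>x::'a. r - x \<bullet> x) has_derivative (\<lambda>v. - 2 * (x \<bullet> v))) (at x)"
      by (auto intro!: derivative_eq_intros simp: inner_commute)
    from has_derivative_compose[OF this flat_deriv[unfolded has_field_derivative_def]]
    show ?thesis by simp
  qed
  have "Ck k (\<lambda>x::'a. flat ?p (r - x \<bullet> x) * (- 2 * (x \<bullet> v)))" for v
    by (intro Ck_mult Suc Ck_const Ck_linear bounded_linear_inner_left)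
  then show ?case
    using d by (auto simp: frechet_derivative_eqI[OF d] differentiable_def)
qed


lemma bounded_support_integrable:
  fixes f :: "'a::euclidean_space \<Rightarrow> real"
  assumes "f \<in> borel_measurable borel" "\<And>x. \<bar>f x\<bar> \<le> B" "\<And>x. R < norm x \<Longrightarrow> f x = 0"
  shows "integrable lborel f"
proof (rule Bochner_Integration.integrable_bound)
  show "integrable lborel (\<lambda>x::'a. B * indicator (cball 0 R) x :: real)"
    by (intro integrable_mult_right integrable_real_indicator)
      (use emeasure_lborel_cball_finite[of "0::'a" R] in auto)
  show "AE x in lborel. norm (f x) \<le> norm (B * indicator (cball 0 R) x)"
  proof (intro AE_I2)
    show "norm (f x) \<le> norm (B * indicator (cball 0 R) x)" for x
      using assms(2)[of x] assms(3)[of x] by (cases "norm x \<le> R") (auto simp: indicator_def)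
  qed
qed (use assms in auto)

lemma Cc_measurable: "f \<in> Cc \<Longrightarrow> f \<in> borel_measurable borel"
  unfolding Cc_def by (auto intro: borel_measurable_continuous_onI)

lemma Cc_integrable: assumes "f \<in> Cc" shows "integrable lborel f"
proof -
  obtain R where R: "R > 0" "\<And>x. R < norm x \<Longrightarrow> f x = 0"
    using assms compact_support_pos unfolding Cc_def by blast
  obtain B where B: "B \<ge> 0" "\<And>x. \<bar>f x\<bar> \<le> B"
    using Cc_bounded[OF assms] by metis
  show ?thesis by (rule bounded_support_integrable[OF Cc_measurable[OF assms] B(2) R(2)])
qed

lemma bump_exists:
  assumes "\<delta> > 0"
  obtains \<rho> :: "'a::euclidean_space \<Rightarrow> real" where "\<rho> \<in> Cc_infinity" "\<And>x. 0 \<le> \<rho> x"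
    "\<And>x. \<delta> < norm x \<Longrightarrow> \<rho> x = 0" "(LINT x|lborel. \<rho> x) = 1"
proof -
  \<comment> \<open>The classical bump exp(-1/(\<delta>^2 - |x|^2)); the polynomial is the constant
    1.\<close>
  define \<phi> where "\<phi> = (\<lambda>x::'a. flat 1 (\<delta>\<^sup>2 - x \<bullet> x))"
  have z: "\<phi> x = 0" if "\<delta> < norm x" for x
  proof -
    have "\<delta>\<^sup>2 \<le> (norm x)\<^sup>2" using that assms by (intro power_mono) auto
    then show ?thesis by (simp add: \<phi>_def flat_def power2_norm_eq_inner)
  qed
  have pos: "\<phi> x > 0" if "x \<in> ball 0 \<delta>" for x
  proof -
    have "(norm x)\<^sup>2 < \<delta>\<^sup>2" using that assms by (intro power_strict_mono) auto
    then show ?thesis by (simp add: \<phi>_def flat_def power2_norm_eq_inner)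
  qed
  have nn: "\<phi> x \<ge> 0" for x by (simp add: \<phi>_def flat_def)
  have C: "\<phi> \<in> Cc_infinity"
    unfolding Cc_infinity_def compact_support_iff using z
    by (auto simp: \<phi>_def Ck_flat_ball not_le[symmetric] intro!: exI[of _ \<delta>])
  have int: "integrable lborel \<phi>"
    by (intro Cc_integrable Cc_1_sub_Cc Cc_infinity_sub_Cc_1 C)
  have "integral\<^sup>L lborel \<phi> \<noteq> 0"
  proof
    assume "integral\<^sup>L lborel \<phi> = 0"
    then have "AE x in lborel. \<phi> x = 0"
      using integral_nonneg_eq_0_iff_AE[OF int] nn by auto
    then have "AE x::'a in lborel. x \<notin> ball 0 \<delta>"
      by eventually_elim (metis pos less_irrefl)
    then have "emeasure lborel (ball (0::'a) \<delta>) = 0"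
      by (subst (asm) AE_iff_measurable[OF _ refl]) (auto simp: ball_def)
    then show False
      using assms emeasure_ball[of \<delta> "0::'a"] unit_ball_vol_pos[of "real DIM('a)"]
      by (simp add: mult_le_0_iff not_le)
  qed
  then have I: "integral\<^sup>L lborel \<phi> > 0"
    using nn by (metis integral_nonneg_AE AE_I2 order_less_le)
  show thesis
  proof (rule that[of "\<lambda>x. inverse (integral\<^sup>L lborel \<phi>) * \<phi> x"])
    show "(\<lambda>x. inverse (integral\<^sup>L lborel \<phi>) * \<phi> x) \<in> Cc_infinity"
      using C Ck_mult[OF Ck_const] unfolding Cc_infinity_def compact_support_iff by auto
  qed (use z nn I in auto)
qed

text \<open>Convolution, written so that all dependence on x sits in \<theta>; derivatives then fall
  on \<theta>, and integrability of g suffices.\<close>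

definition cnv :: "('a::euclidean_space \<Rightarrow> real) \<Rightarrow> ('a \<Rightarrow> real) \<Rightarrow> 'a \<Rightarrow> real" where
  "cnv g \<theta> x = (LINT y|lborel. g y * \<theta> (x - y))"

lemma integrable_mult_bounded:
  fixes g \<theta> :: "'b \<Rightarrow> real"
  assumes "integrable M g" "\<theta> \<in> borel_measurable M" "\<And>x. \<bar>\<theta> x\<bar> \<le> B"
  shows "integrable M (\<lambda>x. g x * \<theta> x)"
proof (rule Bochner_Integration.integrable_bound)
  show "integrable M (\<lambda>x. \<bar>B\<bar> * \<bar>g x\<bar>)" using assms(1) by auto
  show "AE x in M. norm (g x * \<theta> x) \<le> norm (\<bar>B\<bar> * \<bar>g x\<bar>)"
    using assms(3) by (intro AE_I2) (auto simp: abs_mult mult.commute intro!: mult_right_mono order_trans[OF assms(3)])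
qed (use assms in auto)

lemma cnv_integrable:
  assumes "integrable lborel g" "\<theta> \<in> Cc"
  shows "integrable lborel (\<lambda>y. g y * \<theta> (x - y))"
proof -
  obtain B where B: "\<And>x. \<bar>\<theta> x\<bar> \<le> B" using Cc_bounded[OF assms(2)] by metis
  have [measurable]: "\<theta> \<in> borel_measurable borel" using Cc_measurable assms(2) .
  show ?thesis by (rule integrable_mult_bounded[OF assms(1)]) (use B in auto)
qed

lemma cnv_continuous:
  fixes g :: "'a::euclidean_space \<Rightarrow> real"
  assumes "integrable lborel g" "\<theta> \<in> Cc"
  shows "continuous_on UNIV (cnv g \<theta>)"
proof (rule continuous_on_sequentiallyI)
  fix u and a :: 'a assume u: "u \<longlonglongrightarrow> a"
  obtain B where B: "\<And>x. \<bar>\<theta> x\<bar> \<le> B" using Cc_bounded[OF assms(2)] by metis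
  have [measurable]: "\<theta> \<in> borel_measurable borel" using Cc_measurable assms(2) .
  have [measurable]: "g \<in> borel_measurable borel" using assms(1) by auto
  show "(\<lambda>n. cnv g \<theta> (u n)) \<longlonglongrightarrow> cnv g \<theta> a"
    unfolding cnv_def
  proof (rule integral_dominated_convergence[where w="\<lambda>y. B * \<bar>g y\<bar>"])
    have "continuous (at z) \<theta>" for z
      using assms(2) by (auto simp: Cc_def continuous_on_eq_continuous_at)
    then have "(\<lambda>n. \<theta> (u n - y)) \<longlonglongrightarrow> \<theta> (a - y)" for y
      by (intro isCont_tendsto_compose[of _ \<theta>] tendsto_intros u)
    then show "AE y in lborel. (\<lambda>n. g y * \<theta> (u n - y)) \<longlonglongrightarrow> g y * \<theta> (a - y)"
      by (auto intro!: tendsto_intros)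
    have "norm (g y * \<theta> (u i - y)) \<le> B * \<bar>g y\<bar>" for i y
      using mult_right_mono[OF B, of "\<bar>g y\<bar>" "u i - y"] by (simp add: abs_mult mult.commute)
    then show "\<And>i. AE y in lborel. norm (g y * \<theta> (u i - y)) \<le> B * \<bar>g y\<bar>"
      by simp
  qed (use assms in auto)
qed

text \<open>Differentiation under the integral along sequences: the normalised remainder of \<theta>
  tends to 0 pointwise and is at most 2 L, one L from the Lipschitz bound and one from the bound on
  the derivative, so 2 L |g| dominates.\<close>

lemma cnv_deriv:
  fixes g :: "'a::euclidean_space \<Rightarrow> real"
  assumes g: "integrable lborel g" and t: "\<theta> \<in> Cc_1"
  shows "(cnv g \<theta> has_derivative (\<lambda>v. cnv g (\<lambda>z. frechet_derivative \<theta> (at z) v) x)) (at x)"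
proof -
  obtain L B R where L: "lipc L B R \<theta>" "\<And>x v. \<bar>frechet_derivative \<theta> (at x) v\<bar> \<le> L * norm v"
    using Cc_1_lipc[OF t] by metis
  note tc = Cc_1_sub_Cc[OF t] and td = frechet_derivative_Cc[OF t]
  have [measurable]: "\<theta> \<in> borel_measurable borel" using Cc_measurable tc .
  have [measurable]: "(\<lambda>z. frechet_derivative \<theta> (at z) v) \<in> borel_measurable borel" for v
    using Cc_measurable td .
  have [measurable]: "g \<in> borel_measurable borel" using g by auto
  have der: "(\<theta> has_derivative frechet_derivative \<theta> (at z)) (at z)" for z
    using t by (auto simp: Cc_1_def frechet_derivative_works[symmetric])
  have lin: "linear (frechet_derivative \<theta> (at z))" for z
    using der has_derivative_linear by blast
  let ?D = "\<lambda>v. cnv g (\<lambda>z. frechet_derivative \<theta> (at z) v) x"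
  have int1: "integrable lborel (\<lambda>y. g y * \<theta> (a - y))" for a
    by (rule cnv_integrable[OF g tc])
  have int2: "integrable lborel (\<lambda>y. g y * frechet_derivative \<theta> (at (x - y)) v)" for v
    by (rule cnv_integrable[OF g td])
  have "linear ?D"
  proof
    show "?D (a + b) = ?D a + ?D b" for a b
      unfolding cnv_def using int2
      by (subst Bochner_Integration.integral_add[symmetric])
        (auto simp: linear_add[OF lin] distrib_left)
    show "?D (c *\<^sub>R a) = c *\<^sub>R ?D a" for c a
      unfolding cnv_def by (subst integral_scaleR_right[symmetric])
        (auto simp: linear_scale[OF lin] mult_ac)
  qed
  moreover have "((\<lambda>h. norm (cnv g \<theta> (x + h) - cnv g \<theta> x - ?D h) / norm h) \<longlongrightarrow> 0) (at 0)"
    unfolding tendsto_at_iff_sequentially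
  proof (intro allI impI, unfold comp_def)
    fix X :: "nat \<Rightarrow> 'a" assume X: "\<forall>i. X i \<in> UNIV - {0}" "X \<longlonglongrightarrow> 0"
    let ?r = "\<lambda>i y. (\<theta> (x + X i - y) - \<theta> (x - y) - frechet_derivative \<theta> (at (x - y)) (X i)) / norm (X i)"
    have "(\<lambda>i. LINT y|lborel. g y * ?r i y) \<longlonglongrightarrow> (LINT y|(lborel::'a measure). 0)"
    proof (rule integral_dominated_convergence[where w="\<lambda>y. (2 * L) * \<bar>g y\<bar>"])
      have "(\<lambda>i. ?r i y) \<longlonglongrightarrow> 0" for y
      proof -
        have "((\<lambda>h. norm (\<theta> (x - y + h) - \<theta> (x - y) - frechet_derivative \<theta> (at (x - y)) h) / norm h) \<longlongrightarrow> 0) (at 0)"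
          using der[of "x - y"] by (simp add: has_derivative_at)
        then have "(\<lambda>i. norm (\<theta> (x - y + X i) - \<theta> (x - y) - frechet_derivative \<theta> (at (x - y)) (X i)) / norm (X i)) \<longlonglongrightarrow> 0"
          using X unfolding tendsto_at_iff_sequentially comp_def by blast
        then have "(\<lambda>i. norm (?r i y)) \<longlonglongrightarrow> 0" by (simp add: algebra_simps)
        then show ?thesis by (rule tendsto_norm_zero_cancel)
      qed
      from tendsto_mult_right_zero[OF this]
      show "AE y in lborel. (\<lambda>i. g y * ?r i y) \<longlonglongrightarrow> 0" by auto
      have "\<bar>?r i y\<bar> \<le> 2 * L" for i y
      proof -
        have "\<bar>\<theta> (x + X i - y) - \<theta> (x - y)\<bar> \<le> L * dist (x + X i - y) (x - y)"
          using L(1) unfolding lipc_def by blast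
        then have "\<bar>\<theta> (x + X i - y) - \<theta> (x - y)\<bar> \<le> L * norm (X i)" by (simp add: dist_norm)
        with L(2)[of "x - y" "X i"]
        have "\<bar>\<theta> (x + X i - y) - \<theta> (x - y) - frechet_derivative \<theta> (at (x - y)) (X i)\<bar> \<le> 2 * L * norm (X i)"
          by linarith
        moreover have "norm (X i) > 0" using X by auto
        ultimately show ?thesis by (simp add: field_simps)
      qed
      then show "\<And>i. AE y in lborel. norm (g y * ?r i y) \<le> (2 * L) * \<bar>g y\<bar>"
        by (intro AE_I2) (simp only: real_norm_def abs_mult mult.commute[of "2*L"] mult_left_mono abs_ge_zero)
    qed (use g in auto)
    moreover have "(LINT y|lborel. g y * ?r i y) = (cnv g \<theta> (x + X i) - cnv g \<theta> x - ?D (X i)) / norm (X i)" for i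
    proof -
      have "(LINT y|lborel. g y * ?r i y) = (LINT y|lborel. (g y * \<theta> (x + X i - y) - g y * \<theta> (x - y)
         - g y * frechet_derivative \<theta> (at (x - y)) (X i)) / norm (X i))"
        by (intro Bochner_Integration.integral_cong) (auto simp: algebra_simps diff_divide_distrib)
      also have "\<dots> = (cnv g \<theta> (x + X i) - cnv g \<theta> x - ?D (X i)) / norm (X i)"
        unfolding cnv_def using int1 int2 by (simp add: Bochner_Integration.integral_diff)
      finally show ?thesis .
    qed
    ultimately have "(\<lambda>i. (cnv g \<theta> (x + X i) - cnv g \<theta> x - ?D (X i)) / norm (X i)) \<longlonglongrightarrow> 0"
      by (simp only: Bochner_Integration.integral_zero)
    from tendsto_norm_zero[OF this]
    show "(\<lambda>i. norm (cnv g \<theta> (x + X i) - cnv g \<theta> x - ?D (X i)) / norm (X i)) \<longlonglongrightarrow> 0"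
      by simp
  qed
  ultimately show ?thesis
    unfolding has_derivative_at using linear_conv_bounded_linear by blast
qed

lemma cnv_Ck:
  assumes g: "integrable lborel g"
  shows "\<theta> \<in> Cc_infinity \<Longrightarrow> Ck k (cnv g \<theta>)"
proof (induction k arbitrary: \<theta>)
  case 0
  then show ?case
    using cnv_continuous[OF g Cc_1_sub_Cc[OF Cc_infinity_sub_Cc_1]] by simp
next
  case (Suc k)
  note d = cnv_deriv[OF g Cc_infinity_sub_Cc_1[OF Suc.prems]]
  have "(\<lambda>z. frechet_derivative \<theta> (at z) v) \<in> Cc_infinity" for v
    using frechet_derivative_Cc[OF Cc_infinity_sub_Cc_1[OF Suc.prems], of v] Suc.prems
    unfolding Cc_infinity_def Cc_def using Ck.simps(2)[of _ \<theta>] by blast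
  from Suc.IH[OF this] show ?case
    using d by (auto simp: frechet_derivative_eqI[OF d] differentiable_def)
qed

lemma lborel_integral_reflect:
  fixes f :: "'a::euclidean_space \<Rightarrow> real"
  assumes [measurable]: "f \<in> borel_measurable borel"
  shows "(LINT y|lborel. f (x - y)) = (LINT y|lborel. f y)"
proof -
  have "(LINT y|lborel. f y) = (LINT y|density (distr lborel borel (\<lambda>y::'a. x + (-1) *\<^sub>R y)) (\<lambda>_. \<bar>-1::real\<bar>^DIM('a)). f y)"
    by (subst lborel_affine[of "-1" x]) auto
  also have "\<dots> = (LINT y|lborel. f (x - y))"
    by (simp add: density_1 integral_distr)
  finally show ?thesis ..
qed

text \<open>Averaging translates of g against a probability density on a small ball preserves every
  bound that holds for all translates: oscillation, sup norm and Lipschitz constant. The last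
  conclusion quantifies over L so that continuous functions without a Lipschitz constant are covered
  as well.\<close>

lemma mollify:
  fixes g :: "'a::euclidean_space \<Rightarrow> real"
  assumes "g \<in> Cc" "0 < \<delta>"
    and u: "\<And>x y. norm y \<le> \<delta> \<Longrightarrow> \<bar>g (x - y) - g x\<bar> \<le> e"
    and B: "\<And>x. \<bar>g x\<bar> \<le> B" and R: "\<And>x. R < norm x \<Longrightarrow> g x = 0"
  obtains h where "h \<in> Cc_infinity" "\<And>x. \<bar>h x - g x\<bar> \<le> e" "\<And>x. \<bar>h x\<bar> \<le> B"
    "\<And>x. R + \<delta> < norm x \<Longrightarrow> h x = 0"
    "\<forall>L. (\<forall>x y. \<bar>g x - g y\<bar> \<le> L * dist x y) \<longrightarrow> (\<forall>x y. \<bar>h x - h y\<bar> \<le> L * dist x y)"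
proof -
  obtain \<rho> :: "'a \<Rightarrow> real" where r: "\<rho> \<in> Cc_infinity" "\<And>x. 0 \<le> \<rho> x"
    "\<And>x. \<delta> < norm x \<Longrightarrow> \<rho> x = 0" "(LINT x|lborel. \<rho> x) = 1"
    using bump_exists[OF \<open>0 < \<delta>\<close>] by metis
  define h where "h = cnv g \<rho>"
  have gi: "integrable lborel g" by (rule Cc_integrable[OF assms(1)])
  have rc: "\<rho> \<in> Cc" using r(1) Cc_1_sub_Cc Cc_infinity_sub_Cc_1 by blast
  have [measurable]: "g \<in> borel_measurable borel" "\<rho> \<in> borel_measurable borel"
    using Cc_measurable assms(1) rc by auto
  have ri: "integrable lborel \<rho>" by (rule Cc_integrable[OF rc])
  \<comment> \<open>Reflecting the variable moves the translation from the kernel to g, so that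
    bounds on g apply directly.\<close>
  have heq: "h x = (LINT y|lborel. g (x - y) * \<rho> y)" for x
    unfolding h_def cnv_def
    by (subst lborel_integral_reflect[of "\<lambda>y. g y * \<rho> (x - y)" x, symmetric]) auto
  have int: "integrable lborel (\<lambda>y. g (x - y) * \<rho> y)" for x
    using integrable_mult_bounded[OF ri, of "\<lambda>y. g (x - y)" B] B by (simp add: mult.commute)
  have key: "\<bar>LINT y|lborel. f y * \<rho> y\<bar> \<le> c"
    if "\<And>y. norm y \<le> \<delta> \<Longrightarrow> \<bar>f y\<bar> \<le> c" "integrable lborel (\<lambda>y. f y * \<rho> y)" for f c
  proof -
    have "\<bar>LINT y|lborel. f y * \<rho> y\<bar> \<le> (LINT y|lborel. \<bar>f y * \<rho> y\<bar>)"
      by (rule integral_abs_bound)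
    also have "\<dots> \<le> (LINT y|lborel. c * \<rho> y)"
    proof (rule integral_mono)
      show "\<bar>f y * \<rho> y\<bar> \<le> c * \<rho> y" for y
        using that(1)[of y] r(2)[of y] r(3)[of y]
        by (cases "norm y \<le> \<delta>") (auto simp: abs_mult intro!: mult_right_mono)
    qed (use that ri in auto)
    finally show ?thesis using r(4) by simp
  qed
  have z: "h x = 0" if "R + \<delta> < norm x" for x
  proof -
    have "\<bar>h x\<bar> \<le> 0" unfolding heq
    proof (rule key[OF _ int])
      fix y :: 'a assume "norm y \<le> \<delta>"
      then have "R < norm (x - y)" using that norm_triangle_ineq2[of x y] by linarith
      then show "\<bar>g (x - y)\<bar> \<le> 0" using R by simp
    qed
    then show ?thesis by simp
  qed
  show thesis
  proof (rule that[of h])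
    show "h \<in> Cc_infinity"
      unfolding Cc_infinity_def compact_support_iff using z cnv_Ck[OF gi r(1)]
      by (auto simp: h_def[symmetric] not_le[symmetric] intro!: exI[of _ "R + \<delta>"])
    show "\<bar>h x - g x\<bar> \<le> e" for x
    proof -
      have "h x - g x = (LINT y|lborel. g (x - y) * \<rho> y) - (LINT y|lborel. g x * \<rho> y)"
        by (simp add: heq r(4))
      also have "\<dots> = (LINT y|lborel. (g (x - y) - g x) * \<rho> y)"
        using int ri by (subst Bochner_Integration.integral_diff[symmetric]) (auto simp: algebra_simps)
      finally show ?thesis
        using key[of "\<lambda>y. g (x - y) - g x" e] u int ri by (simp add: left_diff_distrib)
    qed
    show "\<bar>h x\<bar> \<le> B" for x
      unfolding heq by (rule key[OF B int])
    have "\<bar>h x - h y\<bar> \<le> L * dist x y" if "\<And>x y. \<bar>g x - g y\<bar> \<le> L * dist x y" for L x y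
    proof -
      have "h x - h y = (LINT s|lborel. (g (x - s) - g (y - s)) * \<rho> s)"
        unfolding heq using int by (subst Bochner_Integration.integral_diff[symmetric]) (auto simp: algebra_simps)
      moreover have "\<bar>g (x - s) - g (y - s)\<bar> \<le> L * dist x y" for s
        using that[of "x - s" "y - s"] by (simp add: dist_norm)
      ultimately show ?thesis
        using key[of "\<lambda>s. g (x - s) - g (y - s)"] int by (simp add: left_diff_distrib)
    qed
    then show "\<forall>L. (\<forall>x y. \<bar>g x - g y\<bar> \<le> L * dist x y) \<longrightarrow> (\<forall>x y. \<bar>h x - h y\<bar> \<le> L * dist x y)"
      by blast
  qed (use z in auto)
qed

text \<open>All approximants share the Lipschitz constant, the sup bound and one support radius, so
  a single weight will dominate their increments; the radius R + 1 absorbs the mollification radius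
  1/(n + 1).\<close>

lemma lipc_approx:
  fixes g :: "'a::euclidean_space \<Rightarrow> real"
  assumes g: "lipc L B R g"
  obtains h where "\<And>n::nat. h n \<in> Cc_infinity" "\<And>n. lipc L B (R + 1) (h n)" "\<And>x. (\<lambda>n. h n x) \<longlonglongrightarrow> g x"
proof -
  have "\<exists>h. h \<in> Cc_infinity \<and> lipc L B (R + 1) h \<and> (\<forall>x. \<bar>h x - g x\<bar> \<le> L * (1 / Suc n))" for n
  proof -
    have u: "\<bar>g (x - y) - g x\<bar> \<le> L * (1 / Suc n)" if "norm y \<le> 1 / Suc n" for x y
    proof -
      have "\<bar>g (x - y) - g x\<bar> \<le> L * dist (x - y) x" "L \<ge> 0" using g unfolding lipc_def by blast+
      then show ?thesis using mult_left_mono[OF that, of L] by (simp add: dist_norm)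
    qed
    have B: "\<bar>g x\<bar> \<le> B" "R < norm x \<Longrightarrow> g x = 0" for x
      using g unfolding lipc_def by auto
    have pos: "0 < 1 / real (Suc n)" by simp
    have Lg: "\<bar>g x - g y\<bar> \<le> L * dist x y" for x y using g unfolding lipc_def by blast
    obtain h where h: "h \<in> Cc_infinity" "\<And>x. \<bar>h x - g x\<bar> \<le> L * (1 / Suc n)" "\<And>x. \<bar>h x\<bar> \<le> B"
      and s: "\<And>x. R + 1 / Suc n < norm x \<Longrightarrow> h x = 0"
      and l: "\<forall>L. (\<forall>x y. \<bar>g x - g y\<bar> \<le> L * dist x y) \<longrightarrow> (\<forall>x y. \<bar>h x - h y\<bar> \<le> L * dist x y)"
      by (rule mollify[OF lipc_Cc[OF g] pos u B], assumption, assumption) (rule that; assumption)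
    have "\<bar>h x - h y\<bar> \<le> L * dist x y" for x y using l Lg by blast
    note h this
    moreover have "h x = 0" if "R + 1 < norm x" for x
    proof (rule s)
      have "1 / real (Suc n) \<le> 1" by simp
      with that show "R + 1 / real (Suc n) < norm x" by linarith
    qed
    ultimately show ?thesis using g unfolding lipc_def
      by (intro exI[of _ h]) auto
  qed
  then obtain h where h: "\<And>n. h n \<in> Cc_infinity" "\<And>n. lipc L B (R + 1) (h n)"
    "\<And>n x. \<bar>h n x - g x\<bar> \<le> L * (1 / Suc n)" by metis
  have "(\<lambda>n. h n x) \<longlonglongrightarrow> g x" for x
  proof -
    have "(\<lambda>n. L * (1 / Suc n)) \<longlonglongrightarrow> L * 0"
      by (intro tendsto_intros) (use lim_1_over_n LIMSEQ_Suc in blast)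
    then have "(\<lambda>n. L * (1 / Suc n)) \<longlonglongrightarrow> 0" by simp
    then have "(\<lambda>n. h n x - g x) \<longlonglongrightarrow> 0"
      by (rule Lim_null_comparison[rotated]) (use h(3) in auto)
    then show ?thesis by (rule LIM_zero_cancel)
  qed
  with h show thesis using that by blast
qed


text \<open>The ramp has slope 1 at every scale, so the increments of the cutoffs are bounded
  uniformly in n.\<close>

definition cutoff :: "nat \<Rightarrow> 'a::euclidean_space \<Rightarrow> real" where
  "cutoff n x = max 0 (min 1 (real n + 1 - norm x))"

lemma cutoff_bounds: "0 \<le> cutoff n x" "cutoff n x \<le> 1"
  by (auto simp: cutoff_def)

lemma cutoff_measurable [measurable]: "cutoff n \<in> borel_measurable borel"
  unfolding cutoff_def by measurable

lemma cutoff_tendsto: "(\<lambda>n. cutoff n x) \<longlonglongrightarrow> 1"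
proof -
  have "eventually (\<lambda>n. cutoff n x = 1) sequentially"
    using eventually_ge_at_top[of "nat \<lceil>norm x\<rceil>"]
  proof eventually_elim
    case (elim n)
    then have "norm x \<le> real n" by linarith
    then show ?case by (simp add: cutoff_def)
  qed
  then show ?thesis by (rule tendsto_eventually)
qed

lemma cutoff_lipc: "lipc 1 1 (real n + 1) (cutoff n)"
proof -
  have "\<bar>cutoff n x - cutoff n y\<bar> \<le> 1 * dist x y" for x y :: 'a
    using norm_triangle_ineq3[of x y] by (auto simp: cutoff_def dist_norm)
  then show ?thesis using cutoff_bounds[of n] unfolding lipc_def by (auto simp: cutoff_def)
qed

text \<open>Cut off in space, replace by continuous functions, then mollify. The sup bound on h
  turns the middle step into dominated convergence.\<close>

lemma Cc_infinity_dense_L2: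
  fixes h :: "'a::euclidean_space \<Rightarrow> real"
  assumes [measurable]: "h \<in> borel_measurable borel"
    and B: "\<And>x. \<bar>h x\<bar> \<le> B" and h2: "integrable lborel (\<lambda>x. (h x)\<^sup>2)" and "0 < e"
  obtains g where "g \<in> Cc_infinity" "integrable lborel (\<lambda>x. (g x - h x)\<^sup>2)"
    "(LINT x|lborel. (g x - h x)\<^sup>2) < e"
proof -
  have "B \<ge> 0" using B[of 0] by linarith
  have B2: "(h x)\<^sup>2 \<le> B\<^sup>2" for x using B[of x] \<open>B \<ge> 0\<close> by (simp add: abs_le_square_iff[symmetric])
  have "(\<lambda>n. LINT x|lborel. (cutoff n x * h x - h x)\<^sup>2) \<longlonglongrightarrow> (LINT x|(lborel::'a measure). 0)"
  proof (rule integral_dominated_convergence[where w="\<lambda>x. (h x)\<^sup>2"])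
    have "(\<lambda>n. (cutoff n x * h x - h x)\<^sup>2) \<longlonglongrightarrow> (1 * h x - h x)\<^sup>2" for x
      by (intro tendsto_intros cutoff_tendsto)
    then show "AE x in lborel. (\<lambda>n. (cutoff n x * h x - h x)\<^sup>2) \<longlonglongrightarrow> 0" by simp
    have "(cutoff n x * h x - h x)\<^sup>2 \<le> (h x)\<^sup>2" for n x
    proof -
      have "(cutoff n x * h x - h x)\<^sup>2 = (1 - cutoff n x)\<^sup>2 * (h x)\<^sup>2" by algebra
      also have "\<dots> \<le> 1 * (h x)\<^sup>2"
        using cutoff_bounds[of n x] by (intro mult_right_mono) (auto simp: power_le_one)
      finally show ?thesis by simp
    qed
    then show "\<And>n. AE x in lborel. norm ((cutoff n x * h x - h x)\<^sup>2) \<le> (h x)\<^sup>2" by simp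
  qed (use h2 in auto)
  \<comment> \<open>Three errors are added through (a + b + c)^2 <= 3 a^2 + 3 b^2 + 3 c^2, so each
    of them may use e/9.\<close>
  then have "eventually (\<lambda>n. (LINT x|lborel. (cutoff n x * h x - h x)\<^sup>2) < e / 9) sequentially"
    using \<open>0 < e\<close> by (intro order_tendstoD) auto
  then obtain n where n: "(LINT x|lborel. (cutoff n x * h x - h x)\<^sup>2) < e / 9"
    using eventually_happens' sequentially_bot by blast
  have n_int: "integrable lborel (\<lambda>x. (cutoff n x * h x - h x)\<^sup>2)"
  proof (rule Bochner_Integration.integrable_bound[OF h2])
    have "(cutoff n x * h x - h x)\<^sup>2 \<le> (h x)\<^sup>2" for x
    proof -
      have "(cutoff n x * h x - h x)\<^sup>2 = (1 - cutoff n x)\<^sup>2 * (h x)\<^sup>2" by algebra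
      also have "\<dots> \<le> 1 * (h x)\<^sup>2"
        using cutoff_bounds[of n x] by (intro mult_right_mono) (auto simp: power_le_one)
      finally show ?thesis by simp
    qed
    then show "AE x in lborel. norm ((cutoff n x * h x - h x)\<^sup>2) \<le> norm ((h x)\<^sup>2)" by simp
  qed auto
  let ?V = "cball (0::'a) (real n + 2)"
  have Vint: "integrable lborel (\<lambda>x::'a. c * indicator ?V x)" for c :: real
    by (intro integrable_mult_right integrable_real_indicator)
      (use emeasure_lborel_cball_finite[of "0::'a" "real n + 2"] in auto)
  \<comment> \<open>A measurable function is an almost everywhere limit of continuous ones. The
    negligible exceptional set is enlarged to a Borel null set because \<open>lborel\<close> is not
    complete.\<close>
  have "h measurable_on UNIV"
    by (intro lebesgue_measurable_imp_measurable_on) (auto simp: measurable_completion)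
  then obtain N \<phi> where N: "negligible N" and \<phi>c: "\<And>k. continuous_on UNIV (\<phi> k)"
    and \<phi>: "\<And>x. x \<notin> N \<Longrightarrow> (\<lambda>k. \<phi> k x) \<longlonglongrightarrow> h x"
    unfolding measurable_on_def by auto
  obtain N' where N': "N' \<in> null_sets lborel" "N \<subseteq> N'"
    using N unfolding negligible_iff_null_sets null_sets_completion_iff2 by blast
  have N_AE: "AE x in lborel. x \<notin> N"
    using AE_not_in[OF N'(1)] by eventually_elim (use N'(2) in auto)
  \<comment> \<open>Clamping to [-B, B] does not disturb the convergence to h and supplies the
    bound; the cutoff supplies the compact support.\<close>
  define \<psi> where "\<psi> k x = cutoff n x * max (- B) (min B (\<phi> k x))" for k x
  have \<psi>c: "continuous_on UNIV (\<psi> k)" for k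
    unfolding \<psi>_def by (intro continuous_intros \<phi>c lipc_continuous[OF cutoff_lipc])
  have \<psi>0: "\<psi> k x = 0" if "real n + 1 < norm x" for k x
    using that by (simp add: \<psi>_def cutoff_def)
  have \<psi>Cc: "\<psi> k \<in> Cc" for k
    unfolding Cc_def compact_support_iff using \<psi>c \<psi>0 not_le by blast
  have [measurable]: "\<psi> k \<in> borel_measurable borel" for k
    using Cc_measurable \<psi>Cc .
  have \<psi>B: "\<bar>\<psi> k x\<bar> \<le> B" for k x
  proof -
    have "\<bar>\<psi> k x\<bar> = cutoff n x * \<bar>max (- B) (min B (\<phi> k x))\<bar>"
      using cutoff_bounds[of n x] by (simp add: \<psi>_def abs_mult)
    also have "\<dots> \<le> 1 * B" using cutoff_bounds[of n x] \<open>B \<ge> 0\<close> by (intro mult_mono) auto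
    finally show ?thesis by simp
  qed
  have hB: "\<bar>cutoff n x * h x\<bar> \<le> B" for x
  proof -
    have "\<bar>cutoff n x * h x\<bar> = cutoff n x * \<bar>h x\<bar>"
      using cutoff_bounds[of n x] by (simp add: abs_mult)
    also have "\<dots> \<le> 1 * B" using cutoff_bounds[of n x] B by (intro mult_mono) auto
    finally show ?thesis by simp
  qed
  have bd: "(\<psi> k x - cutoff n x * h x)\<^sup>2 \<le> (2 * B)\<^sup>2 * indicator ?V x" for k x
  proof (cases "norm x \<le> real n + 2")
    case True
    have "\<bar>\<psi> k x - cutoff n x * h x\<bar> \<le> \<bar>2 * B\<bar>" using \<psi>B[of k x] hB[of x] by linarith
    then show ?thesis using True by (simp only: abs_le_square_iff) simp
  qed (auto simp: \<psi>0 cutoff_def)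
  have "(\<lambda>k. LINT x|lborel. (\<psi> k x - cutoff n x * h x)\<^sup>2) \<longlonglongrightarrow> (LINT x|(lborel::'a measure). 0)"
  proof (rule integral_dominated_convergence[where w="\<lambda>x. (2 * B)\<^sup>2 * indicator ?V x"])
    have "(\<lambda>k. (\<psi> k x - cutoff n x * h x)\<^sup>2) \<longlonglongrightarrow> 0" if "x \<notin> N" for x
    proof -
      have "(\<lambda>k. (\<psi> k x - cutoff n x * h x)\<^sup>2) \<longlonglongrightarrow>
          (cutoff n x * max (- B) (min B (h x)) - cutoff n x * h x)\<^sup>2"
        unfolding \<psi>_def by (intro tendsto_intros \<phi> that)
      then show ?thesis using B[of x] by (simp add: min_absorb2 max_absorb2 abs_le_iff)
    qed
    then show "AE x in lborel. (\<lambda>k. (\<psi> k x - cutoff n x * h x)\<^sup>2) \<longlonglongrightarrow> 0"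
      using N_AE by auto
  qed (use bd Vint in auto)
  then have "eventually (\<lambda>k. (LINT x|lborel. (\<psi> k x - cutoff n x * h x)\<^sup>2) < e / 9) sequentially"
    using \<open>0 < e\<close> by (intro order_tendstoD) auto
  then obtain k where k: "(LINT x|lborel. (\<psi> k x - cutoff n x * h x)\<^sup>2) < e / 9"
    using eventually_happens' sequentially_bot by blast
  have k_int: "integrable lborel (\<lambda>x. (\<psi> k x - cutoff n x * h x)\<^sup>2)"
    by (rule Bochner_Integration.integrable_bound[OF Vint[of "(2 * B)\<^sup>2"]]) (use bd in auto)
  define v where "v = measure lborel ?V"
  have v: "v \<ge> 0" by (simp add: v_def)
  \<comment> \<open>Mollification is uniform, so its squared L2 error is at most e'^2 times the
    volume v; v + 1 avoids dividing by 0, and 10 in place of 9 keeps the inequality strict.\<close>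
  define e' where "e' = sqrt (e / (10 * (v + 1)))"
  have e': "e' > 0" "e'\<^sup>2 = e / (10 * (v + 1))" using \<open>0 < e\<close> v by (auto simp: e'_def)
  obtain d where d: "d > 0" "\<And>x y. dist x y < d \<Longrightarrow> \<bar>\<psi> k x - \<psi> k y\<bar> < e'"
    using Cc_uniformly_continuous[OF \<psi>Cc e'(1)] by metis
  have d2: "min (d / 2) 1 > 0" using d by simp
  have u: "\<bar>\<psi> k (x - y) - \<psi> k x\<bar> \<le> e'" if "norm y \<le> min (d / 2) 1" for x y
  proof -
    have "dist (x - y) x < d" using that d(1) by (simp add: dist_norm)
    then show ?thesis using d(2) by (simp add: less_imp_le)
  qed
  obtain g where g: "g \<in> Cc_infinity" "\<And>x. \<bar>g x - \<psi> k x\<bar> \<le> e'"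
    and g0: "\<And>x. real n + 1 + min (d / 2) 1 < norm x \<Longrightarrow> g x = 0"
    by (rule mollify[OF \<psi>Cc d2 u \<psi>B \<psi>0], assumption, assumption) (rule that; assumption)
  have gc: "g \<in> Cc" using g(1) Cc_1_sub_Cc Cc_infinity_sub_Cc_1 by blast
  have [measurable]: "g \<in> borel_measurable borel" using Cc_measurable gc .
  have bg: "(g x - \<psi> k x)\<^sup>2 \<le> e'\<^sup>2 * indicator ?V x" for x
  proof (cases "norm x \<le> real n + 2")
    case True
    then show ?thesis using g(2)[of x] e'(1) by (simp add: abs_le_square_iff[symmetric])
  qed (auto simp: \<psi>0 g0)
  have g_int: "integrable lborel (\<lambda>x. (g x - \<psi> k x)\<^sup>2)"
    by (rule Bochner_Integration.integrable_bound[OF Vint[of "e'\<^sup>2"]]) (use bg in auto)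
  have "(LINT x|lborel. (g x - \<psi> k x)\<^sup>2) \<le> (LINT x|lborel. e'\<^sup>2 * indicator ?V x)"
    by (rule integral_mono[OF g_int Vint bg])
  also have "\<dots> = e'\<^sup>2 * v" by (simp add: v_def)
  also have "\<dots> < e / 9"
  proof -
    have "e'\<^sup>2 * v \<le> e'\<^sup>2 * (v + 1)" by (intro mult_left_mono) auto
    also have "\<dots> = e / 10" using v by (simp add: e'(2) field_simps)
    finally show ?thesis using \<open>0 < e\<close> by simp
  qed
  finally have gk: "(LINT x|lborel. (g x - \<psi> k x)\<^sup>2) < e / 9" .
  let ?s = "\<lambda>x. 3 * (g x - \<psi> k x)\<^sup>2 + 3 * (\<psi> k x - cutoff n x * h x)\<^sup>2 + 3 * (cutoff n x * h x - h x)\<^sup>2"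
  have s_int: "integrable lborel ?s"
    using g_int k_int n_int by auto
  have s: "(g x - h x)\<^sup>2 \<le> ?s x" for x
  proof -
    have "(a + b + c)\<^sup>2 \<le> 3 * a\<^sup>2 + 3 * b\<^sup>2 + 3 * c\<^sup>2" for a b c :: real
    proof -
      have "0 \<le> (a - b)\<^sup>2 + (b - c)\<^sup>2 + (a - c)\<^sup>2" by simp
      then show ?thesis by (simp add: power2_eq_square algebra_simps)
    qed
    from this[of "g x - \<psi> k x" "\<psi> k x - cutoff n x * h x" "cutoff n x * h x - h x"]
    show ?thesis by simp
  qed
  have int: "integrable lborel (\<lambda>x. (g x - h x)\<^sup>2)"
    by (rule Bochner_Integration.integrable_bound[OF s_int]) (use s in \<open>auto intro: order_trans[OF s] abs_ge_self\<close>)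
  have "(LINT x|lborel. (g x - h x)\<^sup>2) \<le> integral\<^sup>L lborel ?s"
    by (rule integral_mono[OF int s_int s])
  also have "\<dots> < e" using g_int k_int n_int gk k n by simp
  finally show thesis using that g(1) int by blast
qed

section \<open>Square integrable functions\<close>

text \<open>Fatou with an eventual bound, as it arises from Cauchy estimates that hold only for
  indices beyond j.\<close>

lemma nn_integral_Fatou_le:
  fixes f :: "nat \<Rightarrow> 'b \<Rightarrow> ennreal"
  assumes [measurable]: "\<And>i. f i \<in> borel_measurable M"
    and lim: "AE x in M. (\<lambda>i. f i x) \<longlonglongrightarrow> g x"
    and bnd: "\<forall>\<^sub>F i in sequentially. (\<integral>\<^sup>+x. f i x \<partial>M) \<le> c"
  shows "(\<integral>\<^sup>+x. g x \<partial>M) \<le> c"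
proof -
  have "(\<integral>\<^sup>+x. g x \<partial>M) \<le> (\<integral>\<^sup>+x. liminf (\<lambda>i. f i x) \<partial>M)"
    using lim by (intro nn_integral_mono_AE) (auto elim!: eventually_mono dest!: lim_imp_Liminf[OF sequentially_bot])
  also have "\<dots> \<le> liminf (\<lambda>i. \<integral>\<^sup>+x. f i x \<partial>M)"
    by (rule nn_integral_liminf) auto
  also have "\<dots> \<le> limsup (\<lambda>i. \<integral>\<^sup>+x. f i x \<partial>M)"
    by (rule Liminf_le_Limsup) auto
  also have "\<dots> \<le> c"
    by (rule Limsup_bounded[OF bnd])
  finally show ?thesis .
qed

lemma L2_measurable [measurable_dest]: "f \<in> L2 M \<Longrightarrow> f \<in> borel_measurable M"
  by (simp add: L2_def)

lemma L2_sq_integrable: "f \<in> L2 M \<Longrightarrow> integrable M (\<lambda>x. (f x)\<^sup>2)"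
  by (simp add: L2_def)

lemma L2_mult_integrable:
  assumes "f \<in> L2 M" "g \<in> L2 M"
  shows "integrable M (\<lambda>x. f x * g x)"
proof (rule Bochner_Integration.integrable_bound)
  show "integrable M (\<lambda>x. (f x)\<^sup>2 + (g x)\<^sup>2)"
    using assms by (simp add: L2_sq_integrable)
  show "AE x in M. norm (f x * g x) \<le> norm ((f x)\<^sup>2 + (g x)\<^sup>2)"
  proof (intro AE_I2)
    fix x
    have "0 \<le> (\<bar>f x\<bar> - \<bar>g x\<bar>)\<^sup>2" by simp
    then have "2 * (\<bar>f x\<bar> * \<bar>g x\<bar>) \<le> (f x)\<^sup>2 + (g x)\<^sup>2"
      by (simp add: power2_eq_square algebra_simps)
    moreover have "0 \<le> \<bar>f x\<bar> * \<bar>g x\<bar>" by simp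
    ultimately have "\<bar>f x\<bar> * \<bar>g x\<bar> \<le> (f x)\<^sup>2 + (g x)\<^sup>2" by linarith
    then show "norm (f x * g x) \<le> norm ((f x)\<^sup>2 + (g x)\<^sup>2)"
      by (simp add: abs_mult)
  qed
qed (use assms in auto)

lemma L2_add_cmult:
  assumes "f \<in> L2 M" "g \<in> L2 M"
  shows "(\<lambda>x. f x + c * g x) \<in> L2 M"
proof -
  have "integrable M (\<lambda>x. (f x)\<^sup>2 + (2 * c) * (f x * g x) + c\<^sup>2 * (g x)\<^sup>2)"
    using assms L2_mult_integrable[OF assms] by (simp add: L2_sq_integrable)
  moreover have "(\<lambda>x. (f x + c * g x)\<^sup>2) = (\<lambda>x. (f x)\<^sup>2 + (2 * c) * (f x * g x) + c\<^sup>2 * (g x)\<^sup>2)"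
    by (intro ext) algebra
  moreover have "(\<lambda>x. f x + c * g x) \<in> borel_measurable M" using assms by measurable
  ultimately show ?thesis unfolding L2_def by simp
qed

lemma L2_diff: "f \<in> L2 M \<Longrightarrow> g \<in> L2 M \<Longrightarrow> (\<lambda>x. f x - g x) \<in> L2 M"
  using L2_add_cmult[of f M g "-1"] by simp

lemma L2_iff_nn:
  "f \<in> L2 M \<longleftrightarrow> f \<in> borel_measurable M \<and> (\<integral>\<^sup>+x. ennreal ((f x)\<^sup>2) \<partial>M) < \<infinity>"
  by (auto simp: L2_def integrable_iff_bounded)

lemma L2_nn_eq: "f \<in> L2 M \<Longrightarrow> (\<integral>\<^sup>+x. ennreal ((f x)\<^sup>2) \<partial>M) = ennreal (L2_inner M f f)"
  unfolding L2_inner_def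
  by (subst nn_integral_eq_integral) (auto simp: L2_sq_integrable power2_eq_square[symmetric])

lemma L2_inner_commute: "L2_inner M f g = L2_inner M g f"
  by (simp add: L2_inner_def mult.commute)

lemma L2_inner_nonneg: "0 \<le> L2_inner M f f"
  by (simp add: L2_inner_def)

lemma L2_inner_add_cmult_right:
  assumes "f \<in> L2 M" "g \<in> L2 M" "h \<in> L2 M"
  shows "L2_inner M h (\<lambda>x. f x + c * g x) = L2_inner M h f + c * L2_inner M h g"
proof -
  have "L2_inner M h (\<lambda>x. f x + c * g x) = (LINT x|M. h x * f x + c * (h x * g x))"
    unfolding L2_inner_def by (intro Bochner_Integration.integral_cong) (auto simp: algebra_simps)
  then show ?thesis
    unfolding L2_inner_def using assms by (simp add: L2_mult_integrable)
qed

lemma L2_inner_quad: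
  assumes "f \<in> L2 M" "g \<in> L2 M"
  shows "L2_inner M (\<lambda>x. f x + c * g x) (\<lambda>x. f x + c * g x) =
    L2_inner M f f + 2 * c * L2_inner M f g + c\<^sup>2 * L2_inner M g g"
proof -
  have "L2_inner M (\<lambda>x. f x + c * g x) (\<lambda>x. f x + c * g x) =
    L2_inner M (\<lambda>x. f x + c * g x) f + c * L2_inner M (\<lambda>x. f x + c * g x) g"
    by (intro L2_inner_add_cmult_right L2_add_cmult assms)
  also have "\<dots> = L2_inner M f f + c * L2_inner M f g + c * (L2_inner M g f + c * L2_inner M g g)"
    using assms by (simp add: L2_inner_commute[of M "\<lambda>x. f x + c * g x"] L2_inner_add_cmult_right)
  finally show ?thesis
    by (simp add: L2_inner_commute[of M g f] power2_eq_square algebra_simps)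
qed

text \<open>Expand the norm of f + (s/t) g for s = 1 and s = -1. This weighted form plays the role
  of Cauchy-Schwarz for the L2 inner products: the parameter t absorbs a bound on one factor without
  square roots.\<close>

lemma L2_inner_AMGM:
  assumes "f \<in> L2 M" "g \<in> L2 M" "t > 0"
  shows "2 * \<bar>L2_inner M f g\<bar> \<le> t * L2_inner M f f + L2_inner M g g / t"
proof -
  have "0 \<le> t * L2_inner M f f + 2 * s * L2_inner M f g + L2_inner M g g / t" if "s\<^sup>2 = 1" for s
  proof -
    have "0 \<le> t * L2_inner M (\<lambda>x. f x + (s / t) * g x) (\<lambda>x. f x + (s / t) * g x)"
      using assms by (simp add: L2_inner_nonneg)
    also have "\<dots> = t * L2_inner M f f + 2 * s * L2_inner M f g + L2_inner M g g / t"
      unfolding L2_inner_quad[OF assms(1,2)] using assms(3) that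
      by (simp add: field_simps power2_eq_square)
    finally show ?thesis .
  qed
  from this[of 1] this[of "-1"] show ?thesis by (simp add: abs_if)
qed

lemma L2_inner_tendsto:
  assumes f: "f \<in> L2 M" and g: "g \<in> L2 M" and gn: "\<And>n. gn n \<in> L2 M"
    and lim: "(\<lambda>n::nat. L2_inner M (\<lambda>x. gn n x - g x) (\<lambda>x. gn n x - g x)) \<longlonglongrightarrow> 0"
  shows "(\<lambda>n. L2_inner M f (gn n)) \<longlonglongrightarrow> L2_inner M f g"
proof -
  let ?d = "\<lambda>n x. gn n x - g x"
  have d: "?d n \<in> L2 M" for n using L2_diff[OF gn g] .
  have "(\<lambda>n. L2_inner M f (?d n)) \<longlonglongrightarrow> 0"
  proof (rule LIMSEQ_I)
    fix e :: real assume "e > 0"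
    \<comment> \<open>With this t both terms of the weighted bound are at most e, and the factor 2
      on the left turns their sum into the required estimate; the added 1 avoids dividing by
      0.\<close>
    define t where "t = e / (1 + L2_inner M f f)"
    have t: "t > 0" using \<open>e > 0\<close> L2_inner_nonneg[of M f] by (simp add: t_def add_pos_nonneg)
    have "eventually (\<lambda>n. L2_inner M (?d n) (?d n) < t * e) sequentially"
      using lim t \<open>e > 0\<close> by (intro order_tendstoD) auto
    then obtain N where N: "\<And>n. n \<ge> N \<Longrightarrow> L2_inner M (?d n) (?d n) < t * e"
      by (auto simp: eventually_sequentially)
    have "norm (L2_inner M f (?d n) - 0) < e" if "n \<ge> N" for n
    proof -
      have "2 * \<bar>L2_inner M f (?d n)\<bar> \<le> t * L2_inner M f f + L2_inner M (?d n) (?d n) / t"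
        by (rule L2_inner_AMGM[OF f d t])
      moreover have "L2_inner M (?d n) (?d n) / t < e"
        using N[OF that] t by (simp add: field_simps)
      moreover have "t * L2_inner M f f \<le> e"
        using \<open>e > 0\<close> L2_inner_nonneg[of M f] by (simp add: t_def field_simps)
      ultimately show ?thesis by simp
    qed
    then show "\<exists>N. \<forall>n\<ge>N. norm (L2_inner M f (?d n) - 0) < e" by blast
  qed
  moreover have "L2_inner M f (?d n) = L2_inner M f (gn n) - L2_inner M f g" for n
    using L2_inner_add_cmult_right[OF gn g f, of n "-1"] by simp
  ultimately have "(\<lambda>n. L2_inner M f (gn n) - L2_inner M f g) \<longlonglongrightarrow> 0" by simp
  then show ?thesis by (rule LIM_zero_cancel)
qed

text \<open>A sequence that is Cauchy in \<open>L\<^sup>2\<close> at a geometric rate converges almost everywhere, since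
  \<open>\<Sum>j. 4\<^sup>j \<parallel>f (j+1) - f j\<parallel>\<^sup>2\<close> is finite.\<close>

lemma L2_fast_Cauchy_AE:
  fixes f :: "nat \<Rightarrow> 'b \<Rightarrow> real"
  assumes [measurable]: "\<And>j. f j \<in> borel_measurable M"
    and bnd: "\<And>j. (\<integral>\<^sup>+x. ennreal ((f (Suc j) x - f j x)\<^sup>2) \<partial>M) \<le> ennreal (C / 16 ^ j)"
  shows "AE x in M. convergent (\<lambda>j. f j x)"
proof -
  have "(\<integral>\<^sup>+x. (\<Sum>j. ennreal (4 ^ j * (f (Suc j) x - f j x)\<^sup>2)) \<partial>M) =
      (\<Sum>j. \<integral>\<^sup>+x. ennreal (4 ^ j * (f (Suc j) x - f j x)\<^sup>2) \<partial>M)"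
    by (intro nn_integral_suminf) auto
  also have "\<dots> = (\<Sum>j. ennreal (4 ^ j) * (\<integral>\<^sup>+x. ennreal ((f (Suc j) x - f j x)\<^sup>2) \<partial>M))"
    by (subst nn_integral_cmult[symmetric]) (auto simp: ennreal_mult)
  also have "\<dots> \<le> (\<Sum>j. ennreal (4 ^ j) * ennreal (\<bar>C\<bar> / 16 ^ j))"
    by (intro suminf_le mult_left_mono order_trans[OF bnd] ennreal_leI) (auto intro!: divide_right_mono)
  also have "\<dots> = (\<Sum>j. ennreal (\<bar>C\<bar> * (1 / 4) ^ j))"
  proof -
    have "ennreal (4 ^ j) * ennreal (\<bar>C\<bar> / 16 ^ j) = ennreal (\<bar>C\<bar> * (1 / 4) ^ j)" for j :: nat
    proof -
      have "(16::real) ^ j = 4 ^ j * 4 ^ j" by (subst power_mult_distrib[symmetric]) simp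
      then have "4 ^ j * (\<bar>C\<bar> / 16 ^ j) = \<bar>C\<bar> * (1 / 4) ^ j" by (simp add: power_one_over)
      then show ?thesis by (simp add: ennreal_mult[symmetric])
    qed
    then show ?thesis by simp
  qed
  also have "\<dots> < \<infinity>"
    by (subst suminf_ennreal2) (auto intro!: summable_mult summable_geometric)
  finally have "(\<integral>\<^sup>+x. (\<Sum>j. ennreal (4 ^ j * (f (Suc j) x - f j x)\<^sup>2)) \<partial>M) \<noteq> \<infinity>" by simp
  then have "AE x in M. (\<Sum>j. ennreal (4 ^ j * (f (Suc j) x - f j x)\<^sup>2)) \<noteq> \<infinity>"
    by (intro nn_integral_PInf_AE) auto
  then show ?thesis
  proof eventually_elim
    case (elim x)
    then have "(\<Sum>j. ennreal (4 ^ j * (f (Suc j) x - f j x)\<^sup>2)) \<noteq> top"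
      by (simp only: infinity_ennreal_def not_False_eq_True)
    then have "summable (\<lambda>j. 4 ^ j * (f (Suc j) x - f j x)\<^sup>2)"
      by (rule summable_suminf_not_top[rotated]) simp
    \<comment> \<open>The terms of a convergent series are bounded by some K^2, so the increments
      are at most K / 2^j and the telescoping series converges absolutely.\<close>
    then obtain K where K: "\<And>j. 4 ^ j * (f (Suc j) x - f j x)\<^sup>2 \<le> K\<^sup>2" "K \<ge> 0"
    proof -
      have "(\<lambda>j. 4 ^ j * (f (Suc j) x - f j x)\<^sup>2) \<longlonglongrightarrow> 0"
        by (rule summable_LIMSEQ_zero) fact
      then have "Bseq (\<lambda>j. 4 ^ j * (f (Suc j) x - f j x)\<^sup>2)"
        by (intro convergent_imp_Bseq convergentI)
      then obtain K where K: "\<And>j. norm (4 ^ j * (f (Suc j) x - f j x)\<^sup>2) \<le> K" "K > 0"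
        by (rule BseqE) blast
      show thesis
      proof (rule that[of "sqrt K"])
        show "4 ^ j * (f (Suc j) x - f j x)\<^sup>2 \<le> (sqrt K)\<^sup>2" for j
          using order_trans[OF abs_ge_self K(1)[of j, unfolded real_norm_def]] K(2)
          by (simp only: real_sqrt_pow2 less_imp_le)
        show "sqrt K \<ge> 0" using K(2) by (simp only: real_sqrt_ge_zero less_imp_le)
      qed
    qed
    have nb: "norm (f (Suc j) x - f j x) \<le> K * (1 / 2) ^ j" for j
    proof -
      have "(2 ^ j * \<bar>f (Suc j) x - f j x\<bar>)\<^sup>2 \<le> K\<^sup>2"
      proof -
        have "(2 ^ j)\<^sup>2 = ((2::real)\<^sup>2) ^ j" by (simp only: power_mult[symmetric] mult.commute)
        then have "(4::real) ^ j = (2 ^ j)\<^sup>2" by simp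
        then show ?thesis using K(1)[of j] by (simp only: power_mult_distrib power2_abs)
      qed
      then have "2 ^ j * \<bar>f (Suc j) x - f j x\<bar> \<le> K"
        using K(2) by (rule power2_le_imp_le)
      then show ?thesis by (simp add: power_one_over field_simps)
    qed
    have "summable (\<lambda>j. K * (1 / 2) ^ j)"
      by (intro summable_mult summable_geometric) simp
    from summable_comparison_test'[OF this, of 0, OF nb]
    have "summable (\<lambda>j. f (Suc j) x - f j x)" by simp
    then have "convergent (\<lambda>n. \<Sum>j<n. f (Suc j) x - f j x)"
      by (simp add: summable_iff_convergent)
    from convergent_add[OF this convergent_const[of "f 0 x"]]
    show ?case by (simp add: sum_lessThan_telescope[of "\<lambda>j. f j x"])
  qed
qed

text \<open>A \<open>C\<^sup>1\<close> substitute for the truncation at height \<open>M\<close>.\<close>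

definition tramp :: "real \<Rightarrow> real" where
  "tramp t = (if t \<le> 0 then 0 else t\<^sup>2 / (1 + t))"

definition tramp' :: "real \<Rightarrow> real" where
  "tramp' t = 1 - 1 / (1 + max 0 t)\<^sup>2"

text \<open>The identity on [-M, M]. Beyond it only t - t^2/(1 + t) = t/(1 + t) < 1 of the excess t
  survives, so the values stay within M + 1 while the slope remains between 0 and 1.\<close>

definition trunc :: "real \<Rightarrow> real \<Rightarrow> real" where
  "trunc M s = s - tramp (s - M) + tramp (- s - M)"

definition trunc' :: "real \<Rightarrow> real \<Rightarrow> real" where
  "trunc' M s = 1 - tramp' (s - M) - tramp' (- s - M)"

lemma tramp_deriv: "(tramp has_real_derivative tramp' t) (at t)"
proof -
  consider "t < 0" | "t = 0" | "t > 0" by linarith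
  then show ?thesis
  proof cases
    case 1
    then have "((\<lambda>_. 0) has_real_derivative tramp' t) (at t)" by (simp add: tramp'_def max_def)
    then show ?thesis
      by (rule DERIV_cong_ev[THEN iffD2, rotated 3, OF _ ])
        (use 1 in \<open>auto simp: tramp_def eventually_nhds intro!: exI[of _ "{..<0}"]\<close>)
  next
    case 3
    have "((\<lambda>t. t\<^sup>2 / (1 + t)) has_real_derivative tramp' t) (at t)"
    proof -
      have "((\<lambda>t. t\<^sup>2 / (1 + t)) has_real_derivative (2 * t * (1 + t) - t\<^sup>2) / (1 + t)\<^sup>2) (at t)"
        using 3 by (auto intro!: derivative_eq_intros simp: power2_eq_square)
      moreover have "(2 * t * (1 + t) - t\<^sup>2) / (1 + t)\<^sup>2 = ((1 + t)\<^sup>2 - 1) / (1 + t)\<^sup>2"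
        by (rule arg_cong[where f="\<lambda>x. x / (1 + t)\<^sup>2"]) algebra
      moreover have "\<dots> = tramp' t"
        using 3 by (simp add: tramp'_def max_def diff_divide_distrib)
      ultimately show ?thesis by simp
    qed
    then show ?thesis
      by (rule DERIV_cong_ev[THEN iffD2, rotated 3, OF _])
        (use 3 in \<open>auto simp: tramp_def eventually_nhds intro!: exI[of _ "{0<..}"]\<close>)
  next
    case 2
    \<comment> \<open>Quadratic behaviour at 0 makes the derivative vanish there, which is what
      keeps the truncation differentiable at height M.\<close>
    have "((\<lambda>h. tramp h / h) \<longlongrightarrow> 0) (at 0)"
    proof (rule Lim_null_comparison)
      show "((\<lambda>h::real. \<bar>h\<bar>) \<longlongrightarrow> 0) (at 0)" by (intro tendsto_eq_intros) auto
      show "\<forall>\<^sub>F h in at 0. norm (tramp h / h) \<le> \<bar>h\<bar>"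
      proof (intro always_eventually allI)
        fix h :: real
        have "h\<^sup>2 / (1 + h) / h = h / (1 + h)" "h / (1 + h) \<le> h" if "h > 0"
          using that by (auto simp: power2_eq_square divide_le_eq)
        then show "norm (tramp h / h) \<le> \<bar>h\<bar>" by (auto simp: tramp_def not_le)
      qed
    qed
    then show ?thesis using 2 by (simp add: DERIV_def tramp_def tramp'_def)
  qed
qed

lemma trunc_deriv: "(trunc M has_real_derivative trunc' M s) (at s)"
  unfolding trunc_def[abs_def] trunc'_def
  by (auto intro!: derivative_eq_intros DERIV_chain'[OF _ tramp_deriv])

lemma tramp'_bounds: "0 \<le> tramp' t" "tramp' t \<le> 1" "t \<le> 0 \<Longrightarrow> tramp' t = 0"
proof -
  have "1 \<le> (1 + max 0 t)\<^sup>2" by (rule one_le_power) simp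
  then show "0 \<le> tramp' t" "tramp' t \<le> 1" by (auto simp: tramp'_def)
qed (simp add: tramp'_def)

lemma trunc'_bounds: "0 \<le> M \<Longrightarrow> \<bar>trunc' M s\<bar> \<le> 1"
  using tramp'_bounds(1,2)[of "s - M"] tramp'_bounds(1,2)[of "- s - M"]
    tramp'_bounds(3)[of "s - M"] tramp'_bounds(3)[of "- s - M"]
  by (cases "s \<le> M"; cases "- s \<le> M") (auto simp: trunc'_def)

lemma trunc'_continuous: "continuous_on UNIV (trunc' M)"
proof -
  have "(1 + max 0 t)\<^sup>2 \<noteq> 0" for t :: real by (simp add: add_nonneg_eq_0_iff max_def)
  then show ?thesis unfolding trunc'_def[abs_def] tramp'_def by (intro continuous_intros) auto
qed

lemma trunc_lipschitz: "0 \<le> M \<Longrightarrow> \<bar>trunc M a - trunc M b\<bar> \<le> \<bar>a - b\<bar>"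
  using field_differentiable_bound[of UNIV "trunc M" "trunc' M" 1 a b] trunc_deriv trunc'_bounds
  by auto

lemma trunc_cases:
  assumes "0 \<le> M"
  shows "(\<bar>s\<bar> \<le> M \<and> trunc M s = s) \<or> (M < s \<and> M \<le> trunc M s \<and> trunc M s \<le> min s (M + 1)) \<or>
    (s < - M \<and> trunc M s \<le> - M \<and> max s (- M - 1) \<le> trunc M s)"
proof -
  have t: "0 \<le> t - t\<^sup>2 / (1 + t)" "t - t\<^sup>2 / (1 + t) \<le> 1" "0 \<le> t\<^sup>2 / (1 + t)" if "t > 0" for t :: real
    using that by (auto simp: field_simps power2_eq_square)
  consider "\<bar>s\<bar> \<le> M" | "M < s" | "s < - M" by linarith
  then show ?thesis
  proof cases
    case 1
    then show ?thesis by (auto simp: trunc_def tramp_def)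
  next
    case 2
    then have "trunc M s = M + ((s - M) - (s - M)\<^sup>2 / (1 + (s - M)))"
      using assms by (simp add: trunc_def tramp_def)
    with t[of "s - M"] 2 show ?thesis by auto
  next
    case 3
    then have "trunc M s = - M - ((- s - M) - (- s - M)\<^sup>2 / (1 + (- s - M)))"
      using assms by (simp add: trunc_def tramp_def)
    with t[of "- s - M"] 3 show ?thesis by auto
  qed
qed

text \<open>Values outside [-M, M] are pulled towards this interval and never past its nearer end,
  so the distance to any of its points does not increase.\<close>

lemma trunc_contract: "0 \<le> M \<Longrightarrow> \<bar>c\<bar> \<le> M \<Longrightarrow> \<bar>trunc M s - c\<bar> \<le> \<bar>s - c\<bar>"
  using trunc_cases[of M s] by auto

lemma trunc_bound: "0 \<le> M \<Longrightarrow> \<bar>trunc M s\<bar> \<le> M + 1"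
  using trunc_cases[of M s] by auto

text \<open>The domain is a closure of \<open>Cc_1\<close>, so truncated minimising sequences must
  remain continuously differentiable; the sharp clamp would leave the class.\<close>

lemma trunc_Cc_1:
  assumes "0 \<le> M" "\<phi> \<in> Cc_1"
  shows "(\<lambda>x. trunc M (\<phi> x)) \<in> Cc_1"
proof -
  have d: "((\<lambda>x. trunc M (\<phi> x)) has_derivative (\<lambda>v. frechet_derivative \<phi> (at x) v * trunc' M (\<phi> x))) (at x)" for x
    using has_derivative_compose[of \<phi> "frechet_derivative \<phi> (at x)" x UNIV "trunc M", OF _ trunc_deriv[unfolded has_field_derivative_def]]
      assms(2) by (auto simp: Cc_1_def frechet_derivative_works[symmetric] mult.commute)
  have "continuous_on UNIV (\<lambda>x. frechet_derivative \<phi> (at x) v * trunc' M (\<phi> x))" for v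
  proof -
    have "continuous_on UNIV (\<lambda>x. trunc' M (\<phi> x))"
      using Cc_1_sub_Cc[OF assms(2)]
      by (intro continuous_on_compose2[OF trunc'_continuous]) (auto simp: Cc_def)
    moreover have "continuous_on UNIV (\<lambda>x. frechet_derivative \<phi> (at x) v)"
      using frechet_derivative_Cc[OF assms(2)] by (auto simp: Cc_def)
    ultimately show ?thesis by (intro continuous_intros)
  qed
  then have "Ck 1 (\<lambda>x. trunc M (\<phi> x))"
    using d by (auto simp: frechet_derivative_eqI[OF d] differentiable_def)
  moreover have "trunc M 0 = 0" using trunc_cases[OF assms(1), of 0] assms(1) by auto
  then have "compact_support (\<lambda>x. trunc M (\<phi> x))"
    using assms(2) unfolding Cc_1_def compact_support_iff mem_Collect_eq by metis
  ultimately show ?thesis unfolding Cc_1_def by blast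
qed


section \<open>Symmetric jump forms\<close>

abbreviation lborel2 :: "('a::euclidean_space \<times> 'a) measure" where
  "lborel2 \<equiv> lborel \<Otimes>\<^sub>M lborel"

lemma AE_lborel2:
  fixes P :: "'a::euclidean_space \<Rightarrow> bool"
  assumes "AE x in lborel. P x"
  shows "AE p in lborel2. P (fst p) \<and> P (snd p)"
proof -
  obtain N where N: "N \<in> null_sets lborel" "{x. \<not> P x} \<subseteq> N"
    using assms unfolding eventually_ae_filter by auto
  have "N \<times> UNIV \<in> null_sets lborel2" "UNIV \<times> N \<in> null_sets lborel2"
    using N(1) lborel.emeasure_pair_measure_Times[of N lborel "UNIV :: 'a set"]
      lborel.emeasure_pair_measure_Times[of "UNIV :: 'a set" lborel N]
    by (auto simp: null_sets_def)
  from AE_not_in[OF this(1)] AE_not_in[OF this(2)] show ?thesis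
    by eventually_elim (use N(2) in \<open>auto simp: mem_Times_iff\<close>)
qed

lemma lborel2_Id: "- Id \<in> sets (borel \<Otimes>\<^sub>M borel :: ('a::euclidean_space \<times> 'a) measure)"
proof -
  have "closed (Id :: ('a \<times> 'a) set)"
  proof -
    have "Id = {p :: 'a \<times> 'a. fst p = snd p}" by auto
    also have "closed \<dots>" by (intro closed_Collect_eq continuous_intros)
    finally show ?thesis .
  qed
  then have "- Id \<in> sets (borel :: ('a \<times> 'a) measure)" by auto
  then show ?thesis by (subst borel_prod)
qed

definition dif :: "('a \<Rightarrow> real) \<Rightarrow> 'a \<times> 'a \<Rightarrow> real" where
  "dif f p = f (fst p) - f (snd p)"

text \<open>The factor 1/2, the kernel and the removal of the diagonal are put into the measure. The
  form then is the L2 inner product of increments, and Fatou, dominated convergence and the weighted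
  inequality apply to it as in any L2 space.\<close>

definition jm :: "('a::euclidean_space \<Rightarrow> 'a \<Rightarrow> real) \<Rightarrow> ('a \<times> 'a) measure" where
  "jm J = density lborel2 (\<lambda>p. ennreal (indicator (- Id) p * (1 / 2 * J (fst p) (snd p))))"

lemma dif_measurable [measurable]:
  assumes [measurable]: "f \<in> borel_measurable borel"
  shows "dif f \<in> borel_measurable (borel \<Otimes>\<^sub>M borel)"
  unfolding dif_def[abs_def] by measurable

lemma dif_add_cmult: "dif (\<lambda>x. f x + c * g x) = (\<lambda>p. dif f p + c * dif g p)"
  by (auto simp: dif_def algebra_simps)

lemma dif_diff: "dif (\<lambda>x. f x - g x) = (\<lambda>p. dif f p - dif g p)"
  by (auto simp: dif_def algebra_simps)

locale jump_kernel =
  fixes J :: "'a::euclidean_space \<Rightarrow> 'a \<Rightarrow> real"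
  assumes J_meas: "case_prod J \<in> borel_measurable (borel \<Otimes>\<^sub>M borel)"
    and J_nonneg: "0 \<le> J x y"
begin

lemma J_measurable [measurable]: "(\<lambda>p. J (fst p) (snd p)) \<in> borel_measurable (borel \<Otimes>\<^sub>M borel)"
  using J_meas by (simp add: case_prod_beta')

lemma Id_measurable [measurable]: "- Id \<in> sets (borel \<Otimes>\<^sub>M borel :: ('a \<times> 'a) measure)"
  by (rule lborel2_Id)

lemma sets_jm [measurable_cong]: "sets (jm J) = sets (borel \<Otimes>\<^sub>M borel)"
  unfolding jm_def by (simp cong: sets_pair_measure_cong)

lemma nn_integral_jm:
  assumes [measurable]: "h \<in> borel_measurable (borel \<Otimes>\<^sub>M borel)"
  shows "(\<integral>\<^sup>+p. ennreal (h p) \<partial>jm J) =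
    ennreal (1 / 2) * (\<integral>\<^sup>+p. ennreal (h p * J (fst p) (snd p)) * indicator (- Id) p \<partial>lborel2)"
proof -
  have "(\<integral>\<^sup>+p. ennreal (h p) \<partial>jm J) = (\<integral>\<^sup>+p. ennreal (indicator (- Id) p * (1 / 2 * J (fst p) (snd p))) * ennreal (h p) \<partial>lborel2)"
    unfolding jm_def by (intro nn_integral_density) measurable
  also have "\<dots> = (\<integral>\<^sup>+p. ennreal (1 / 2) * (ennreal (h p * J (fst p) (snd p)) * indicator (- Id) p) \<partial>lborel2)"
  proof (intro nn_integral_cong)
    fix p
    show "ennreal (indicator (- Id) p * (1 / 2 * J (fst p) (snd p))) * ennreal (h p) =
       ennreal (1 / 2) * (ennreal (h p * J (fst p) (snd p)) * indicator (- Id) p)"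
    proof (cases "p \<in> - Id")
      case True
      have "ennreal (1 / 2 * J (fst p) (snd p)) * ennreal (h p) = ennreal (1 / 2 * J (fst p) (snd p) * h p)"
        by (rule ennreal_mult'[symmetric]) (simp add: J_nonneg)
      also have "\<dots> = ennreal (1 / 2 * (h p * J (fst p) (snd p)))" by (simp add: mult_ac)
      also have "\<dots> = ennreal (1 / 2) * ennreal (h p * J (fst p) (snd p))"
        by (rule ennreal_mult') simp
      finally show ?thesis using True by simp
    qed simp
  qed
  also have "\<dots> = ennreal (1 / 2) * (\<integral>\<^sup>+p. ennreal (h p * J (fst p) (snd p)) * indicator (- Id) p \<partial>lborel2)"
    by (intro nn_integral_cmult) measurable
  finally show ?thesis .
qed

lemma jump_energy_jm:
  assumes [measurable]: "f \<in> borel_measurable borel"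
  shows "jump_energy J f = (\<integral>\<^sup>+p. ennreal ((dif f p)\<^sup>2) \<partial>jm J)"
  by (subst nn_integral_jm) (auto simp: jump_energy_def dif_def case_prod_beta')

lemma jump_form_jm:
  assumes [measurable]: "f \<in> borel_measurable borel" "g \<in> borel_measurable borel"
  shows "jump_form J f g = L2_inner (jm J) (dif f) (dif g)"
proof -
  have "L2_inner (jm J) (dif f) (dif g) =
     (LINT p|lborel2. (indicator (- Id) p * (1 / 2 * J (fst p) (snd p))) *\<^sub>R (dif f p * dif g p))"
    unfolding L2_inner_def jm_def
    by (intro integral_density) (auto simp: J_nonneg)
  also have "\<dots> = (LINT p|lborel2. 1 / 2 * (indicator (- Id) p *\<^sub>R (dif f p * dif g p * J (fst p) (snd p))))"
    by (intro Bochner_Integration.integral_cong) auto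
  also have "\<dots> = jump_form J f g"
    unfolding jump_form_def set_lebesgue_integral_def
    by (subst integral_mult_right_zero) (simp add: dif_def case_prod_beta')
  finally show ?thesis ..
qed

lemma AE_jm:
  assumes "AE x in lborel. P x"
  shows "AE p in jm J. P (fst p) \<and> P (snd p)"
  unfolding jm_def using AE_lborel2[OF assms] by (subst AE_density) auto

end

text \<open>Absolute continuity of Lebesgue measure with respect to m is demanded because
  convergence m-almost everywhere has to give convergence of increments \<open>jm J\<close>-almost
  everywhere.\<close>

locale jump_space = jump_kernel J for J :: "'a::euclidean_space \<Rightarrow> 'a \<Rightarrow> real" +
  fixes m :: "'a measure"
  assumes sets_m: "sets m = sets borel"
    and null_m: "N \<in> null_sets m \<Longrightarrow> N \<in> null_sets lborel"
    and Cc_1_L2: "\<phi> \<in> Cc_1 \<Longrightarrow> \<phi> \<in> L2 m"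
    and Cc_1_energy: "\<phi> \<in> Cc_1 \<Longrightarrow> jump_energy J \<phi> < \<infinity>"
begin

lemma sets_m' [measurable_cong]: "sets m = sets borel"
  by (rule sets_m)

lemma meas_m [simp]: "borel_measurable m = borel_measurable borel"
  by (rule measurable_cong_sets[OF sets_m refl])

lemma AE_m: "AE x in m. P x \<Longrightarrow> AE x in lborel. P x"
  using null_m unfolding eventually_ae_filter
  by (auto simp: sets_eq_imp_space_eq[OF sets_m])

text \<open>All square integrable functions of finite energy, possibly more than the closure of
  \<open>Cc_1\<close>; limits of bounded energy are first placed here.\<close>

definition V :: "('a \<Rightarrow> real) set" where
  "V = {f. f \<in> L2 m \<and> dif f \<in> L2 (jm J)}"

lemma V_measurable: "f \<in> V \<Longrightarrow> f \<in> borel_measurable borel"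
  unfolding V_def L2_def by simp

lemma V_iff: "f \<in> V \<longleftrightarrow> f \<in> L2 m \<and> jump_energy J f < \<infinity>"
proof -
  have "dif f \<in> L2 (jm J) \<longleftrightarrow> jump_energy J f < \<infinity>" if [measurable]: "f \<in> borel_measurable borel"
    by (simp add: L2_iff_nn jump_energy_jm)
  then show ?thesis unfolding V_def by (auto dest: L2_measurable)
qed

lemma V_add_cmult: "f \<in> V \<Longrightarrow> g \<in> V \<Longrightarrow> (\<lambda>x. f x + c * g x) \<in> V"
  unfolding V_def by (simp add: dif_add_cmult L2_add_cmult)

lemma V_diff: "f \<in> V \<Longrightarrow> g \<in> V \<Longrightarrow> (\<lambda>x. f x - g x) \<in> V"
  using V_add_cmult[of f g "-1"] by simp

lemma Cc_1_V: "\<phi> \<in> Cc_1 \<Longrightarrow> \<phi> \<in> V"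
  using Cc_1_energy by (auto simp: V_iff Cc_1_L2)

definition ip :: "real \<Rightarrow> ('a \<Rightarrow> real) \<Rightarrow> ('a \<Rightarrow> real) \<Rightarrow> real" where
  "ip l f g = L2_inner (jm J) (dif f) (dif g) + l * L2_inner m f g"

lemma ip_form: "f \<in> V \<Longrightarrow> g \<in> V \<Longrightarrow> jump_form J f g + l * L2_inner m f g = ip l f g"
  by (simp add: ip_def jump_form_jm V_measurable)

lemma ip_add_cmult_right:
  "f \<in> V \<Longrightarrow> g \<in> V \<Longrightarrow> h \<in> V \<Longrightarrow> ip l h (\<lambda>x. f x + c * g x) = ip l h f + c * ip l h g"
  unfolding ip_def V_def by (simp add: dif_add_cmult L2_inner_add_cmult_right algebra_simps)

lemma ip_commute: "ip l f g = ip l g f"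
  unfolding ip_def by (simp add: L2_inner_commute)

lemma ip_quad:
  "f \<in> V \<Longrightarrow> g \<in> V \<Longrightarrow> ip l (\<lambda>x. f x + c * g x) (\<lambda>x. f x + c * g x) =
    ip l f f + 2 * c * ip l f g + c\<^sup>2 * ip l g g"
  unfolding ip_def V_def by (simp add: dif_add_cmult L2_inner_quad algebra_simps)

lemma ip_nonneg: "0 \<le> l \<Longrightarrow> 0 \<le> ip l f f"
  unfolding ip_def by (simp add: L2_inner_nonneg)

lemma ip_tendsto:
  assumes f: "f \<in> V" and g: "g \<in> V" and gn: "\<And>n. gn n \<in> V"
    and lim: "(\<lambda>n::nat. ip 1 (\<lambda>x. gn n x - g x) (\<lambda>x. gn n x - g x)) \<longlonglongrightarrow> 0"
  shows "(\<lambda>n. ip l f (gn n)) \<longlonglongrightarrow> ip l f g"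
    and "h \<in> L2 m \<Longrightarrow> (\<lambda>n. L2_inner m h (gn n)) \<longlonglongrightarrow> L2_inner m h g"
proof -
  let ?d = "\<lambda>n x. gn n x - g x"
  have 1: "(\<lambda>n. L2_inner m (?d n) (?d n)) \<longlonglongrightarrow> 0"
    by (rule tendsto_sandwich[OF _ _ tendsto_const lim])
      (auto simp: ip_def L2_inner_nonneg)
  have 2: "(\<lambda>n. L2_inner (jm J) (dif (?d n)) (dif (?d n))) \<longlonglongrightarrow> 0"
    by (rule tendsto_sandwich[OF _ _ tendsto_const lim])
      (auto simp: ip_def L2_inner_nonneg)
  have f': "f \<in> L2 m" "dif f \<in> L2 (jm J)" and g': "g \<in> L2 m" "dif g \<in> L2 (jm J)"
    and gn': "\<And>n. gn n \<in> L2 m" "\<And>n. dif (gn n) \<in> L2 (jm J)"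
    using f g gn by (auto simp: V_def)
  show "(\<lambda>n. ip l f (gn n)) \<longlonglongrightarrow> ip l f g"
    unfolding ip_def
    by (intro tendsto_intros L2_inner_tendsto[OF f'(1) g'(1) gn'(1) 1]
        L2_inner_tendsto[OF f'(2) g'(2) gn'(2) 2[unfolded dif_diff]])
  show "h \<in> L2 m \<Longrightarrow> (\<lambda>n. L2_inner m h (gn n)) \<longlonglongrightarrow> L2_inner m h g"
    by (rule L2_inner_tendsto[OF _ g'(1) gn'(1) 1])
qed

lemma ip1_ennreal:
  assumes "f \<in> V"
  shows "jump_energy J f + (\<integral>\<^sup>+x. ennreal ((f x)\<^sup>2) \<partial>m) = ennreal (ip 1 f f)"
  using assms unfolding ip_def V_def
  by (simp add: jump_energy_jm[of f] L2_measurable[of f m, simplified] L2_nn_eq L2_inner_nonneg)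

lemma jump_energy_diff_V:
  assumes f: "f \<in> L2 m" and g: "g \<in> V" and fin: "jump_energy J (\<lambda>x. f x - g x) < \<infinity>"
  shows "f \<in> V"
proof -
  have "(\<lambda>x. f x - g x) \<in> V"
    using L2_diff[OF f] g fin by (simp add: V_iff)
  from V_add_cmult[OF g this, of 1] show ?thesis by simp
qed

lemma domain_iff:
  "f \<in> jump_domain m J \<longleftrightarrow> f \<in> V \<and> (\<exists>\<phi>. (\<forall>n::nat. \<phi> n \<in> Cc_1) \<and>
     (\<lambda>n. ip 1 (\<lambda>x. \<phi> n x - f x) (\<lambda>x. \<phi> n x - f x)) \<longlonglongrightarrow> 0)"
proof -
  have minus: "ip 1 (\<lambda>x. \<phi> x - f x) (\<lambda>x. \<phi> x - f x) = ip 1 (\<lambda>x. f x - \<phi> x) (\<lambda>x. f x - \<phi> x)" for \<phi>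
    unfolding ip_def L2_inner_def dif_def by (simp add: algebra_simps)
  show ?thesis
  proof
    assume "f \<in> jump_domain m J"
    then obtain \<phi> where f: "f \<in> L2 m" and \<phi>: "\<And>n::nat. \<phi> n \<in> Cc_1"
      and lim: "(\<lambda>n. jump_energy J (\<lambda>x. f x - \<phi> n x) + (\<integral>\<^sup>+x. ennreal ((f x - \<phi> n x)\<^sup>2) \<partial>m)) \<longlonglongrightarrow> 0"
      unfolding jump_domain_def by auto
    \<comment> \<open>The norms are extended reals; a single index at which the distance is finite
      already puts f into \<open>V\<close>.\<close>
    have "eventually (\<lambda>n. jump_energy J (\<lambda>x. f x - \<phi> n x) + (\<integral>\<^sup>+x. ennreal ((f x - \<phi> n x)\<^sup>2) \<partial>m) < \<infinity>) sequentially"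
      using lim by (rule order_tendstoD) simp
    then obtain n where "jump_energy J (\<lambda>x. f x - \<phi> n x) < \<infinity>"
      using eventually_happens' sequentially_bot by fastforce
    then have fV: "f \<in> V" using jump_energy_diff_V[OF f Cc_1_V[OF \<phi>]] by blast
    have "(\<lambda>n. ennreal (ip 1 (\<lambda>x. f x - \<phi> n x) (\<lambda>x. f x - \<phi> n x))) \<longlonglongrightarrow> ennreal 0"
      using lim ip1_ennreal[OF V_diff[OF fV Cc_1_V[OF \<phi>]]] by simp
    then have "(\<lambda>n. ip 1 (\<lambda>x. f x - \<phi> n x) (\<lambda>x. f x - \<phi> n x)) \<longlonglongrightarrow> 0"
      by (subst (asm) tendsto_ennreal_iff) (auto simp: ip_nonneg)
    with fV \<phi> show "f \<in> V \<and> (\<exists>\<phi>. (\<forall>n::nat. \<phi> n \<in> Cc_1) \<and>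
     (\<lambda>n. ip 1 (\<lambda>x. \<phi> n x - f x) (\<lambda>x. \<phi> n x - f x)) \<longlonglongrightarrow> 0)"
      unfolding minus by blast
  next
    assume "f \<in> V \<and> (\<exists>\<phi>. (\<forall>n::nat. \<phi> n \<in> Cc_1) \<and>
     (\<lambda>n. ip 1 (\<lambda>x. \<phi> n x - f x) (\<lambda>x. \<phi> n x - f x)) \<longlonglongrightarrow> 0)"
    then obtain \<phi> where fV: "f \<in> V" and \<phi>: "\<And>n::nat. \<phi> n \<in> Cc_1"
      and lim: "(\<lambda>n. ip 1 (\<lambda>x. f x - \<phi> n x) (\<lambda>x. f x - \<phi> n x)) \<longlonglongrightarrow> 0"
      unfolding minus by blast
    have "(\<lambda>n. jump_energy J (\<lambda>x. f x - \<phi> n x) + (\<integral>\<^sup>+x. ennreal ((f x - \<phi> n x)\<^sup>2) \<partial>m)) \<longlonglongrightarrow> 0"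
      using tendsto_ennrealI[OF lim] ip1_ennreal[OF V_diff[OF fV Cc_1_V[OF \<phi>]]] by simp
    then show "f \<in> jump_domain m J"
      using fV \<phi> unfolding jump_domain_def V_def by blast
  qed
qed

lemma domain_V: "f \<in> jump_domain m J \<Longrightarrow> f \<in> V"
  by (simp add: domain_iff)

lemma Cc_1_domain: "\<phi> \<in> Cc_1 \<Longrightarrow> \<phi> \<in> jump_domain m J"
  unfolding domain_iff using Cc_1_V
  by (auto intro!: exI[of _ "\<lambda>_. \<phi>"] simp: ip_def L2_inner_def dif_def)

lemma domain_add_cmult:
  assumes "f \<in> jump_domain m J" "g \<in> jump_domain m J"
  shows "(\<lambda>x. f x + c * g x) \<in> jump_domain m J"
proof -
  obtain \<phi> \<psi> where f: "f \<in> V" "\<And>n::nat. \<phi> n \<in> Cc_1"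
      "(\<lambda>n. ip 1 (\<lambda>x. \<phi> n x - f x) (\<lambda>x. \<phi> n x - f x)) \<longlonglongrightarrow> 0"
    and g: "g \<in> V" "\<And>n::nat. \<psi> n \<in> Cc_1"
      "(\<lambda>n. ip 1 (\<lambda>x. \<psi> n x - g x) (\<lambda>x. \<psi> n x - g x)) \<longlonglongrightarrow> 0"
    using assms unfolding domain_iff by blast
  \<comment> \<open>Nonnegativity of the form at a - c b is exactly this bound, the mixed terms
    cancelling against those at a + c b.\<close>
  have le: "ip 1 (\<lambda>x. a x + c * b x) (\<lambda>x. a x + c * b x) \<le> 2 * ip 1 a a + 2 * c\<^sup>2 * ip 1 b b"
    if "a \<in> V" "b \<in> V" for a b
  proof -
    have "0 \<le> ip 1 (\<lambda>x. a x + (- c) * b x) (\<lambda>x. a x + (- c) * b x)" by (rule ip_nonneg) simp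
    then show ?thesis using that by (simp only: ip_quad) simp
  qed
  let ?e = "\<lambda>n x. (\<phi> n x + c * \<psi> n x) - (f x + c * g x)"
  have eq: "?e n = (\<lambda>x. (\<phi> n x - f x) + c * (\<psi> n x - g x))" for n
    by (auto simp: algebra_simps)
  have "(\<lambda>n. ip 1 (?e n) (?e n)) \<longlonglongrightarrow> 0"
  proof (rule tendsto_sandwich[OF _ _ tendsto_const])
    show "\<forall>\<^sub>F n in sequentially. 0 \<le> ip 1 (?e n) (?e n)" by (simp add: ip_nonneg)
    show "\<forall>\<^sub>F n in sequentially. ip 1 (?e n) (?e n) \<le>
       2 * ip 1 (\<lambda>x. \<phi> n x - f x) (\<lambda>x. \<phi> n x - f x) + 2 * c\<^sup>2 * ip 1 (\<lambda>x. \<psi> n x - g x) (\<lambda>x. \<psi> n x - g x)"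
      unfolding eq
      by (intro always_eventually allI le V_diff[OF Cc_1_V[OF f(2)] f(1)] V_diff[OF Cc_1_V[OF g(2)] g(1)])
    show "(\<lambda>n. 2 * ip 1 (\<lambda>x. \<phi> n x - f x) (\<lambda>x. \<phi> n x - f x) + 2 * c\<^sup>2 * ip 1 (\<lambda>x. \<psi> n x - g x) (\<lambda>x. \<psi> n x - g x)) \<longlonglongrightarrow> 0"
      using tendsto_add[OF tendsto_mult_right_zero[OF f(3), of 2] tendsto_mult_right_zero[OF g(3), of "2 * c\<^sup>2"]]
      by simp
  qed
  moreover have "(\<lambda>x. \<phi> n x + c * \<psi> n x) \<in> Cc_1" for n
    by (intro Cc_1_add Cc_1_cmult f g)
  ultimately show ?thesis
    unfolding domain_iff using V_add_cmult[OF f(1) g(1)]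
    by (intro conjI exI[of _ "\<lambda>n x. \<phi> n x + c * \<psi> n x"]) auto
qed

lemma weak_eq_extend:
  assumes "u \<in> V" "r \<in> L2 m" "\<And>g. g \<in> Cc_1 \<Longrightarrow> ip l u g = L2_inner m r g"
    and g: "g \<in> jump_domain m J"
  shows "ip l u g = L2_inner m r g"
proof -
  obtain \<psi> where \<psi>: "\<And>n::nat. \<psi> n \<in> Cc_1"
      "(\<lambda>n. ip 1 (\<lambda>x. \<psi> n x - g x) (\<lambda>x. \<psi> n x - g x)) \<longlonglongrightarrow> 0"
    using g unfolding domain_iff by blast
  have "(\<lambda>n. ip l u (\<psi> n)) \<longlonglongrightarrow> ip l u g"
    by (rule ip_tendsto(1)[OF assms(1) domain_V[OF g] Cc_1_V[OF \<psi>(1)] \<psi>(2)])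
  moreover have "(\<lambda>n. L2_inner m r (\<psi> n)) \<longlonglongrightarrow> L2_inner m r g"
    by (rule ip_tendsto(2)[OF assms(1) domain_V[OF g] Cc_1_V[OF \<psi>(1)] \<psi>(2) assms(2)])
  ultimately show ?thesis
    using assms(3)[OF \<psi>(1)] LIMSEQ_unique by auto
qed


text \<open>Minimises \<open>\<E>(v, v) + l \<parallel>v\<parallel>\<^sup>2 - 2 \<langle>r, v\<rangle>\<close> over \<open>C\<^sup>1\<^sub>c\<close>. Truncating the
  members of a minimising sequence does not increase the functional.\<close>

lemma resolvent_exists:
  assumes r: "r \<in> L2 m" and l: "0 < l" and M: "0 \<le> M" "\<And>x. \<bar>r x\<bar> \<le> l * M"
  obtains u where "u \<in> jump_domain m J" "\<And>g. g \<in> jump_domain m J \<Longrightarrow> ip l u g = L2_inner m r g"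
    "\<And>x. \<bar>u x\<bar> \<le> M + 1"
proof -
  define Q where "Q v = ip l v v - 2 * L2_inner m r v" for v
  have Q_line: "Q (\<lambda>x. f x + c * g x) = Q f + 2 * c * (ip l f g - L2_inner m r g) + c\<^sup>2 * ip l g g"
    if "f \<in> V" "g \<in> V" for f g c
    using that r unfolding Q_def
    by (simp add: ip_quad V_def L2_inner_add_cmult_right algebra_simps)
  have Q_ge: "- L2_inner m r r / l \<le> Q v" if "v \<in> V" for v
  proof -
    have "2 * \<bar>L2_inner m v r\<bar> \<le> l * L2_inner m v v + L2_inner m r r / l"
      using that r l by (intro L2_inner_AMGM) (auto simp: V_def)
    moreover have "0 \<le> L2_inner (jm J) (dif v) (dif v)" by (rule L2_inner_nonneg)
    ultimately show ?thesis
      unfolding Q_def ip_def L2_inner_commute[of m r v] by linarith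
  qed
  define I where "I = Inf (Q ` Cc_1)"
  have bdd: "bdd_below (Q ` Cc_1)"
    using Q_ge Cc_1_V by (auto intro!: bdd_belowI)
  have I_le: "I \<le> Q v" if "v \<in> Cc_1" for v
    unfolding I_def using bdd that by (intro cInf_lower) auto
  \<comment> \<open>The rate 16^-j is the one that \<open>L2_fast_Cauchy_AE\<close> turns into
    almost everywhere convergence.\<close>
  have "\<exists>\<phi>\<in>Cc_1. Q \<phi> < I + 1 / 16 ^ j" for j :: nat
  proof -
    have "I < I + 1 / 16 ^ j" by simp
    moreover have "Q ` Cc_1 \<noteq> {}" using Cc_1_zero by auto
    ultimately have "\<exists>x\<in>Q ` Cc_1. x < I + 1 / 16 ^ j" unfolding I_def by (intro cInf_lessD)
    then show ?thesis by blast
  qed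
  then obtain \<psi> where \<psi>: "\<And>j::nat. \<psi> j \<in> Cc_1" "\<And>j. Q (\<psi> j) < I + 1 / 16 ^ j" by metis
  define \<phi> where "\<phi> j x = trunc M (\<psi> j x)" for j x
  have \<phi>C: "\<phi> j \<in> Cc_1" for j
    unfolding \<phi>_def[abs_def] by (rule trunc_Cc_1[OF M(1) \<psi>(1)])
  note \<phi>V = Cc_1_V[OF \<phi>C] and \<psi>V = Cc_1_V[OF \<psi>(1)]
  have [measurable]: "\<phi> j \<in> borel_measurable borel" for j by (rule V_measurable[OF \<phi>V])
  have [measurable]: "\<psi> j \<in> borel_measurable borel" for j by (rule V_measurable[OF \<psi>V])
  have "Q (\<phi> j) \<le> Q (\<psi> j)" for j
  proof -
    have "L2_inner (jm J) (dif (\<phi> j)) (dif (\<phi> j)) \<le> L2_inner (jm J) (dif (\<psi> j)) (dif (\<psi> j))"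
      unfolding L2_inner_def
    proof (rule integral_mono)
      show "dif (\<phi> j) p * dif (\<phi> j) p \<le> dif (\<psi> j) p * dif (\<psi> j) p" for p
        using trunc_lipschitz[OF M(1), of "\<psi> j (fst p)" "\<psi> j (snd p)"]
        by (simp add: dif_def \<phi>_def abs_le_square_iff power2_eq_square)
    qed (use \<phi>V[of j] \<psi>V[of j] in \<open>auto simp: V_def intro!: L2_mult_integrable\<close>)
    moreover have "l * L2_inner m (\<phi> j) (\<phi> j) - 2 * L2_inner m r (\<phi> j) \<le>
       l * L2_inner m (\<psi> j) (\<psi> j) - 2 * L2_inner m r (\<psi> j)"
    proof -
      have i: "integrable m (\<lambda>x. l * (\<phi> j x * \<phi> j x) - 2 * (r x * \<phi> j x))"
        "integrable m (\<lambda>x. l * (\<psi> j x * \<psi> j x) - 2 * (r x * \<psi> j x))"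
        using \<phi>V[of j] \<psi>V[of j] r by (auto simp: V_def intro!: L2_mult_integrable Bochner_Integration.integrable_diff integrable_mult_right)
      have "(LINT x|m. l * (\<phi> j x * \<phi> j x) - 2 * (r x * \<phi> j x)) \<le> (LINT x|m. l * (\<psi> j x * \<psi> j x) - 2 * (r x * \<psi> j x))"
      proof (rule integral_mono[OF i])
        fix x
        \<comment> \<open>Completing the square, l v^2 - 2 r v equals l (v - r/l)^2 up to a term
          free of v, and truncation does not increase the distance to r/l, whose modulus is at most
          M.\<close>
        have "\<bar>r x / l\<bar> \<le> M" using M(2)[of x] l by (simp add: field_simps)
        then have "(\<phi> j x - r x / l)\<^sup>2 \<le> (\<psi> j x - r x / l)\<^sup>2"
          unfolding abs_le_square_iff[symmetric] \<phi>_def by (rule trunc_contract[OF M(1)])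
        then have "l * (\<phi> j x - r x / l)\<^sup>2 \<le> l * (\<psi> j x - r x / l)\<^sup>2" using l by simp
        then show "l * (\<phi> j x * \<phi> j x) - 2 * (r x * \<phi> j x) \<le> l * (\<psi> j x * \<psi> j x) - 2 * (r x * \<psi> j x)"
          using l by (simp add: power2_eq_square algebra_simps)
      qed
      moreover have "integrable m (\<lambda>x. \<phi> j x * \<phi> j x)" "integrable m (\<lambda>x. \<psi> j x * \<psi> j x)"
         "integrable m (\<lambda>x. r x * \<phi> j x)" "integrable m (\<lambda>x. r x * \<psi> j x)"
        using \<phi>V[of j] \<psi>V[of j] r by (auto simp: V_def intro!: L2_mult_integrable)
      ultimately show ?thesis unfolding L2_inner_def by simp
    qed
    ultimately show ?thesis unfolding Q_def ip_def by simp
  qed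
  then have \<phi>I: "Q (\<phi> j) < I + 1 / 16 ^ j" for j
    using \<psi>(2)[of j] by (meson le_less_trans)
  have cauchy: "ip l (\<lambda>x. \<phi> i x - \<phi> j x) (\<lambda>x. \<phi> i x - \<phi> j x) \<le> 4 / 16 ^ j" if "j \<le> i" for i j
  proof -
    let ?d = "\<lambda>x. \<phi> i x - \<phi> j x"
    have d: "?d \<in> V" by (rule V_diff[OF \<phi>V \<phi>V])
    have 1: "Q (\<phi> i) = Q (\<phi> j) + 2 * (ip l (\<phi> j) ?d - L2_inner m r ?d) + ip l ?d ?d"
      using Q_line[OF \<phi>V[of j] d, of 1] by simp
    \<comment> \<open>The midpoint of two near minimisers is again admissible, so its value is at
      least I; this bounds the quadratic part of their difference.\<close>
    have "(\<lambda>x. \<phi> j x + 1 / 2 * ?d x) \<in> Cc_1"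
      using Cc_1_add[OF Cc_1_cmult[OF \<phi>C, of "1/2" i] Cc_1_cmult[OF \<phi>C, of "1/2" j]]
      by (simp add: field_simps)
    then have "I \<le> Q (\<lambda>x. \<phi> j x + 1 / 2 * ?d x)" by (rule I_le)
    also have "\<dots> = Q (\<phi> j) + (ip l (\<phi> j) ?d - L2_inner m r ?d) + ip l ?d ?d / 4"
      using Q_line[OF \<phi>V[of j] d, of "1/2"] by (simp add: power2_eq_square)
    finally have 2: "I \<le> Q (\<phi> j) + (ip l (\<phi> j) ?d - L2_inner m r ?d) + ip l ?d ?d / 4" .
    have arith: "d \<le> 2 * (q - i) + 2 * (p - i)" if "i \<le> p + b + d / 4" "q = p + 2 * b + d"
      for i p q b d :: real using that by (simp add: field_simps)
    have "ip l ?d ?d \<le> 2 * (Q (\<phi> i) - I) + 2 * (Q (\<phi> j) - I)"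
      by (rule arith[OF 2 1])
    moreover have "(1::real) / 16 ^ i \<le> 1 / 16 ^ j"
      using that by (intro divide_left_mono power_increasing) auto
    ultimately show ?thesis using \<phi>I[of i] \<phi>I[of j] by simp
  qed
  have c1: "L2_inner m (\<lambda>x. \<phi> i x - \<phi> j x) (\<lambda>x. \<phi> i x - \<phi> j x) \<le> (4 / l) / 16 ^ j" if "j \<le> i" for i j
  proof -
    have "l * L2_inner m (\<lambda>x. \<phi> i x - \<phi> j x) (\<lambda>x. \<phi> i x - \<phi> j x) \<le> 4 / 16 ^ j"
      using cauchy[OF that] L2_inner_nonneg[of "jm J" "dif (\<lambda>x. \<phi> i x - \<phi> j x)"] unfolding ip_def by linarith
    then show ?thesis using l by (simp add: field_simps)
  qed
  have c2: "L2_inner (jm J) (dif (\<lambda>x. \<phi> i x - \<phi> j x)) (dif (\<lambda>x. \<phi> i x - \<phi> j x)) \<le> 4 / 16 ^ j" if "j \<le> i" for i j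
  proof -
    have "0 \<le> l * L2_inner m (\<lambda>x. \<phi> i x - \<phi> j x) (\<lambda>x. \<phi> i x - \<phi> j x)"
      by (rule mult_nonneg_nonneg[OF less_imp_le[OF l] L2_inner_nonneg])
    then show ?thesis using cauchy[OF that] unfolding ip_def by linarith
  qed
  have "AE x in m. convergent (\<lambda>j. \<phi> j x)"
  proof (rule L2_fast_Cauchy_AE[where C="4 / l"])
    show "(\<integral>\<^sup>+x. ennreal ((\<phi> (Suc j) x - \<phi> j x)\<^sup>2) \<partial>m) \<le> ennreal (4 / l / 16 ^ j)" for j
      using V_diff[OF \<phi>V \<phi>V, of "Suc j" j] c1[of j "Suc j"]
      by (subst L2_nn_eq) (auto simp: V_def intro!: ennreal_leI)
  qed auto
  then have conv: "AE x in m. convergent (\<lambda>j. \<phi> j x)" .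
  \<comment> \<open>The default value 0 off the convergence set keeps the bound valid at every
    point.\<close>
  define u where "u x = (if convergent (\<lambda>j. \<phi> j x) then lim (\<lambda>j. \<phi> j x) else 0)" for x
  have u_lim: "(\<lambda>j. \<phi> j x) \<longlonglongrightarrow> u x" if "convergent (\<lambda>j. \<phi> j x)" for x
    using that convergent_LIMSEQ_iff[of "\<lambda>j. \<phi> j x"] by (simp add: u_def)
  have [measurable]: "Measurable.pred borel (\<lambda>x. convergent (\<lambda>j. \<phi> j x))"
    unfolding Cauchy_convergent_iff[symmetric] pred_def by (rule sets_Collect_Cauchy) auto
  have [measurable]: "u \<in> borel_measurable borel"
    unfolding u_def[abs_def] by measurable
  have u_bd: "\<bar>u x\<bar> \<le> M + 1" for x
  proof (cases "convergent (\<lambda>j. \<phi> j x)")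
    case True
    then show ?thesis
      using tendsto_rabs[OF u_lim[OF True]] trunc_bound[OF M(1)]
      by (intro LIMSEQ_le_const2) (auto simp: \<phi>_def)
  next
    case False
    then show ?thesis using M(1) by (simp add: u_def)
  qed
  have fat1: "(\<integral>\<^sup>+x. ennreal ((u x - \<phi> j x)\<^sup>2) \<partial>m) \<le> ennreal ((4 / l) / 16 ^ j)" for j
  proof (rule nn_integral_Fatou_le)
    show "AE x in m. (\<lambda>i. ennreal ((\<phi> i x - \<phi> j x)\<^sup>2)) \<longlonglongrightarrow> ennreal ((u x - \<phi> j x)\<^sup>2)"
      using conv by eventually_elim (intro tendsto_intros tendsto_ennrealI u_lim)
    show "\<forall>\<^sub>F i in sequentially. (\<integral>\<^sup>+x. ennreal ((\<phi> i x - \<phi> j x)\<^sup>2) \<partial>m) \<le> ennreal ((4 / l) / 16 ^ j)"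
      using eventually_ge_at_top[of j]
    proof eventually_elim
      case (elim i)
      then show ?case
        using V_diff[OF \<phi>V \<phi>V, of i j] c1[OF elim]
        by (subst L2_nn_eq) (auto simp: V_def intro!: ennreal_leI)
    qed
  qed auto
  \<comment> \<open>Convergence m-almost everywhere passes to Lebesgue measure and from there to
    pairs, so Fatou applies to the increments as well.\<close>
  have fat2: "(\<integral>\<^sup>+p. ennreal ((dif (\<lambda>x. u x - \<phi> j x) p)\<^sup>2) \<partial>jm J) \<le> ennreal (4 / 16 ^ j)" for j
  proof (rule nn_integral_Fatou_le)
    show "AE p in jm J. (\<lambda>i. ennreal ((dif (\<lambda>x. \<phi> i x - \<phi> j x) p)\<^sup>2)) \<longlonglongrightarrow> ennreal ((dif (\<lambda>x. u x - \<phi> j x) p)\<^sup>2)"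
      using AE_jm[OF AE_m[OF conv]] unfolding dif_def
      by eventually_elim (intro tendsto_intros tendsto_ennrealI u_lim, auto)
    show "\<forall>\<^sub>F i in sequentially. (\<integral>\<^sup>+p. ennreal ((dif (\<lambda>x. \<phi> i x - \<phi> j x) p)\<^sup>2) \<partial>jm J) \<le> ennreal (4 / 16 ^ j)"
      using eventually_ge_at_top[of j]
    proof eventually_elim
      case (elim i)
      then show ?case
        using V_diff[OF \<phi>V \<phi>V, of i j] c2[OF elim]
        by (subst L2_nn_eq) (auto simp: V_def intro!: ennreal_leI)
    qed
  qed measurable
  have dV: "(\<lambda>x. u x - \<phi> j x) \<in> V" for j
    using le_less_trans[OF fat1[of j] ennreal_less_top] le_less_trans[OF fat2[of j] ennreal_less_top]
    by (simp add: V_def L2_iff_nn)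
  have uV: "u \<in> V" using V_add_cmult[OF \<phi>V[of 0] dV[of 0], of 1] by simp
  have "ip 1 (\<lambda>x. \<phi> j x - u x) (\<lambda>x. \<phi> j x - u x) \<le> (4 / l + 4) / 16 ^ j" for j
  proof -
    have "ip 1 (\<lambda>x. \<phi> j x - u x) (\<lambda>x. \<phi> j x - u x) = ip 1 (\<lambda>x. u x - \<phi> j x) (\<lambda>x. u x - \<phi> j x)"
      unfolding ip_def L2_inner_def dif_def by (simp add: algebra_simps)
    also have "\<dots> \<le> 4 / 16 ^ j + (4 / l) / 16 ^ j"
      using fat1[of j] fat2[of j] dV[of j] l unfolding ip_def V_def
      by (intro add_mono) (auto simp: L2_nn_eq)
    finally show ?thesis by (simp add: add_divide_distrib)
  qed
  then have ev: "\<forall>\<^sub>F j in sequentially. ip 1 (\<lambda>x. \<phi> j x - u x) (\<lambda>x. \<phi> j x - u x) \<le> (4 / l + 4) / 16 ^ j"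
    by simp
  have "(\<lambda>j. (4 / l + 4) / 16 ^ j) \<longlonglongrightarrow> 0"
    using LIMSEQ_divide_realpow_zero[of 16] by simp
  from tendsto_sandwich[OF _ ev tendsto_const this]
  have lim: "(\<lambda>j. ip 1 (\<lambda>x. \<phi> j x - u x) (\<lambda>x. \<phi> j x - u x)) \<longlonglongrightarrow> 0"
    by (simp add: ip_nonneg)
  have uD: "u \<in> jump_domain m J"
    unfolding domain_iff using uV \<phi>C lim by blast
  have eq: "ip l u g = L2_inner m r g" if g: "g \<in> Cc_1" for g
  proof -
    note gV = Cc_1_V[OF g]
    let ?\<beta> = "ip l u g - L2_inner m r g"
    \<comment> \<open>First variation along the minimising sequence: moving \<open>\<phi> n\<close>
      by c g cannot lower the functional below I, hence not by more than 16^-n.\<close>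
    have nonneg: "0 \<le> 2 * c * ?\<beta> + c\<^sup>2 * ip l g g" for c
    proof (rule LIMSEQ_le)
      have "(\<lambda>j. ip l g (\<phi> j)) \<longlonglongrightarrow> ip l g u"
        by (rule ip_tendsto(1)[OF gV uV \<phi>V lim])
      then have "(\<lambda>j. ip l (\<phi> j) g) \<longlonglongrightarrow> ip l u g" by (simp add: ip_commute)
      then show "(\<lambda>j. 2 * c * (ip l (\<phi> j) g - L2_inner m r g) + c\<^sup>2 * ip l g g) \<longlonglongrightarrow> 2 * c * ?\<beta> + c\<^sup>2 * ip l g g"
        by (intro tendsto_intros)
      show "(\<lambda>j. - (1 / 16 ^ j) :: real) \<longlonglongrightarrow> 0"
        using tendsto_minus[OF LIMSEQ_divide_realpow_zero[of 16 1]] by simp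
      show "\<exists>N. \<forall>n\<ge>N. - (1 / 16 ^ n) \<le> 2 * c * (ip l (\<phi> n) g - L2_inner m r g) + c\<^sup>2 * ip l g g"
      proof (intro exI allI impI)
        fix n
        have "I \<le> Q (\<lambda>x. \<phi> n x + c * g x)"
          by (intro I_le Cc_1_add Cc_1_cmult \<phi>C g)
        then show "- (1 / 16 ^ n) \<le> 2 * c * (ip l (\<phi> n) g - L2_inner m r g) + c\<^sup>2 * ip l g g"
          using \<phi>I[of n] unfolding Q_line[OF \<phi>V gV] by linarith
      qed
    qed
    have s: "ip l g g \<ge> 0" using l by (intro ip_nonneg) simp
    \<comment> \<open>This choice makes the inequality read c^2 (2 + \<open>ip l g g\<close>) <= 0,
      which forces c = 0 and with it the equation.\<close>
    define c where "c = - ?\<beta> / (1 + ip l g g)"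
    have "c * (1 + ip l g g) = - ?\<beta>" using s by (simp add: c_def add_nonneg_eq_0_iff)
    then have \<beta>: "?\<beta> = - c * (1 + ip l g g)" by simp
    have "0 \<le> 2 * c * (- c * (1 + ip l g g)) + c\<^sup>2 * ip l g g" using nonneg[of c] unfolding \<beta> .
    then have "c\<^sup>2 * (2 + ip l g g) \<le> 0" by (simp add: power2_eq_square algebra_simps)
    then have "c = 0" using s by (simp add: mult_le_0_iff)
    then show ?thesis using \<beta> by simp
  qed
  show thesis
  proof (rule that[OF uD _ u_bd])
    show "ip l u g = L2_inner m r g" if "g \<in> jump_domain m J" for g
      by (rule weak_eq_extend[OF uV r eq that])
  qed
qed

lemma resolvent_unique:
  assumes "0 < l" "u \<in> jump_domain m J" "\<And>g. g \<in> jump_domain m J \<Longrightarrow> ip l u g = L2_inner m r g"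
    "v \<in> jump_domain m J" "\<And>g. g \<in> jump_domain m J \<Longrightarrow> ip l v g = L2_inner m r g"
  shows "AE x in m. u x = v x"
proof -
  let ?d = "\<lambda>x. u x - v x"
  have d: "?d \<in> jump_domain m J" using domain_add_cmult[OF assms(2,4), of "-1"] by simp
  have "ip l ?d ?d = ip l ?d u - ip l ?d v"
    using ip_add_cmult_right[OF domain_V[OF assms(2)] domain_V[OF assms(4)] domain_V[OF d], of l "-1"] by simp
  also have "\<dots> = 0" using assms(3)[OF d] assms(5)[OF d] by (simp add: ip_commute)
  finally have "l * L2_inner m ?d ?d = 0"
    using assms(1) L2_inner_nonneg[of "jm J" "dif ?d"] L2_inner_nonneg[of m ?d]
    unfolding ip_def by (smt (verit) mult_nonneg_nonneg)
  then have "(\<integral>\<^sup>+x. ennreal ((?d x)\<^sup>2) \<partial>m) = 0"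
    using assms(1) domain_V[OF d] by (subst L2_nn_eq) (auto simp: V_def)
  moreover have "?d \<in> borel_measurable m" using V_measurable[OF domain_V[OF d]] by simp
  ultimately have "AE x in m. ennreal ((?d x)\<^sup>2) = 0"
    by (subst (asm) nn_integral_0_iff_AE) auto
  then show ?thesis by eventually_elim simp
qed

text \<open>\<open>resolvent\<close> selects an arbitrary solution. It agrees almost everywhere with
  the bounded minimiser, so the sup bound survives only almost everywhere.\<close>

lemma resolvent_props:
  assumes r: "r \<in> L2 m" and l: "0 < l" and M: "0 \<le> M" "\<And>x. \<bar>r x\<bar> \<le> l * M"
  defines "u \<equiv> resolvent m (jump_form J) (jump_domain m J) l r"
  shows "u \<in> jump_domain m J" "g \<in> jump_domain m J \<Longrightarrow> ip l u g = L2_inner m r g"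
    "AE x in lborel. \<bar>u x\<bar> \<le> M + 1"
proof -
  obtain w where w: "w \<in> jump_domain m J" "\<And>g. g \<in> jump_domain m J \<Longrightarrow> ip l w g = L2_inner m r g"
    "\<And>x. \<bar>w x\<bar> \<le> M + 1"
    using resolvent_exists[OF r l M] by blast
  have "\<exists>u. u \<in> jump_domain m J \<and> (\<forall>g\<in>jump_domain m J. jump_form J u g + l * L2_inner m u g = L2_inner m r g)"
    using w ip_form[OF domain_V domain_V] by auto
  from someI_ex[OF this] have u: "u \<in> jump_domain m J"
    "\<And>g. g \<in> jump_domain m J \<Longrightarrow> ip l u g = L2_inner m r g"
    unfolding u_def resolvent_def using ip_form[OF domain_V domain_V] by auto
  then show "u \<in> jump_domain m J" "g \<in> jump_domain m J \<Longrightarrow> ip l u g = L2_inner m r g" by auto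
  have "AE x in lborel. u x = w x"
    by (intro AE_m resolvent_unique[OF l u w(1,2)])
  then show "AE x in lborel. \<bar>u x\<bar> \<le> M + 1"
    by eventually_elim (simp add: w(3))
qed

end

section \<open>The pointwise ergodic theorem\<close>

lemma cball_measurable [measurable]: "cball (c::'a::metric_space) r \<in> sets borel"
  by simp

lemma nn_integral_lborel_shift:
  fixes f :: "'a::euclidean_space \<Rightarrow> ennreal"
  assumes [measurable]: "f \<in> borel_measurable borel"
  shows "(\<integral>\<^sup>+x. f (x + z) \<partial>lborel) = (\<integral>\<^sup>+x. f x \<partial>lborel)"
proof -
  have "(\<integral>\<^sup>+x. f x \<partial>lborel) = (\<integral>\<^sup>+x. f x \<partial>distr lborel borel ((+) z))"
    by (simp add: lborel_distr_plus)
  also have "\<dots> = (\<integral>\<^sup>+x. f (x + z) \<partial>lborel)"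
    by (subst nn_integral_distr) (auto simp: add.commute)
  finally show ?thesis ..
qed

lemma AE_lborel_shift:
  fixes P :: "'a::euclidean_space \<Rightarrow> bool"
  assumes "AE x in lborel. P x"
  shows "AE x in lborel. P (x + z)"
proof -
  have "AE x in distr lborel borel ((+) z). P x" using assms by (subst lborel_distr_plus)
  then obtain N where N: "N \<in> null_sets (distr lborel borel ((+) z))" "{x. \<not> P x} \<subseteq> N"
    unfolding eventually_ae_filter by auto
  then have "(+) z -` N \<in> null_sets lborel" by (simp add: null_sets_distr_iff)
  from AE_not_in[OF this] show ?thesis
    by eventually_elim (use N(2) in \<open>auto simp: add.commute\<close>)
qed

lemma nn_integral_lborel_scale:
  fixes f :: "'a::euclidean_space \<Rightarrow> ennreal"
  assumes [measurable]: "f \<in> borel_measurable borel" and e: "0 < e"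
  shows "(\<integral>\<^sup>+x. f (x /\<^sub>R e) \<partial>lborel) = ennreal (e ^ DIM('a)) * (\<integral>\<^sup>+x. f x \<partial>lborel)"
proof -
  have "(\<integral>\<^sup>+x. f (x /\<^sub>R e) \<partial>lborel) = (\<integral>\<^sup>+x. f (x /\<^sub>R e)
      \<partial>density (distr lborel borel (\<lambda>x::'a. 0 + e *\<^sub>R x)) (\<lambda>_. ennreal (\<bar>e\<bar> ^ DIM('a))))"
    using e by (subst lborel_affine[of e 0]) auto
  also have "\<dots> = (\<integral>\<^sup>+x. ennreal (e ^ DIM('a)) * f x \<partial>lborel)"
    using e by (simp add: nn_integral_density nn_integral_distr)
  also have "\<dots> = ennreal (e ^ DIM('a)) * (\<integral>\<^sup>+x. f x \<partial>lborel)"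
    by (intro nn_integral_cmult) auto
  finally show ?thesis .
qed

lemma AE_lborel_scale:
  fixes P :: "'a::euclidean_space \<Rightarrow> bool"
  assumes "AE x in lborel. P x" "0 < e"
  shows "AE x in lborel. P (x /\<^sub>R e)"
proof -
  obtain N where N: "N \<in> sets borel" "emeasure lborel N = 0" "{x. \<not> P x} \<subseteq> N"
    using assms(1) unfolding eventually_ae_filter null_sets_def by auto
  have [measurable]: "N \<in> sets borel" by fact
  have "(\<integral>\<^sup>+x. indicator N (x /\<^sub>R e) \<partial>(lborel::'a measure)) = 0"
    using nn_integral_lborel_scale[of "indicator N" e] assms(2) N(2) by simp
  then have "AE x::'a in lborel. indicator N (x /\<^sub>R e) = (0::ennreal)"
    by (subst (asm) nn_integral_0_iff_AE) auto
  then show ?thesis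
    by eventually_elim (use N(3) in \<open>auto simp: indicator_def split: if_splits\<close>)
qed

lemma at_right_0_iff_sequentially:
  fixes f :: "real \<Rightarrow> 'b::topological_space"
  shows "(f \<longlongrightarrow> l) (at_right 0) \<longleftrightarrow>
    (\<forall>e. (\<forall>n::nat. 0 < e n) \<longrightarrow> e \<longlonglongrightarrow> 0 \<longrightarrow> (\<lambda>n. f (e n)) \<longlonglongrightarrow> l)"
  unfolding tendsto_at_iff_sequentially comp_def by (auto simp: less_imp_neq[symmetric])

context ergodic_environment
begin

lemma tau_measurable_pair [measurable]: "(\<lambda>p. \<tau> (fst p) (snd p)) \<in> borel \<Otimes>\<^sub>M M \<rightarrow>\<^sub>M M"
  using shift_measurable by (simp add: case_prod_beta')

lemma tau_comp [measurable (raw)]: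
  assumes "f \<in> N \<rightarrow>\<^sub>M borel" "g \<in> N \<rightarrow>\<^sub>M M"
  shows "(\<lambda>x. \<tau> (f x) (g x)) \<in> N \<rightarrow>\<^sub>M M"
  using measurable_compose[OF measurable_Pair[OF assms] tau_measurable_pair] by simp

lemma tau_cancel: "\<omega> \<in> space M \<Longrightarrow> \<tau> (- x) (\<tau> x \<omega>) = \<omega>"
  by (simp add: shift_add shift_zero)

lemma tau_image:
  assumes "A \<subseteq> space M"
  shows "\<tau> x ` A = \<tau> (- x) -` A \<inter> space M"
proof (intro equalityI subsetI)
  fix \<omega> assume "\<omega> \<in> \<tau> (- x) -` A \<inter> space M"
  then have "\<omega> = \<tau> x (\<tau> (- x) \<omega>)" "\<tau> (- x) \<omega> \<in> A" using tau_cancel[of \<omega> "- x"] by auto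
  then show "\<omega> \<in> \<tau> x ` A" by blast
next
  fix \<omega> assume "\<omega> \<in> \<tau> x ` A"
  then show "\<omega> \<in> \<tau> (- x) -` A \<inter> space M" using assms tau_cancel shift_space by auto
qed

text \<open>The group law turns images under \<open>\<tau> (- x)\<close> into preimages under
  \<open>\<tau> x\<close>, so invariance of the probabilities of images becomes invariance of the
  push-forward.\<close>

lemma distr_tau: "distr M M (\<tau> x) = M"
proof (rule measure_eqI)
  fix A assume "A \<in> sets (distr M M (\<tau> x))"
  then have A: "A \<in> sets M" by simp
  have "emeasure (distr M M (\<tau> x)) A = emeasure M (\<tau> x -` A \<inter> space M)"
    using A by (intro emeasure_distr) auto
  also have "\<tau> x -` A \<inter> space M = \<tau> (- x) ` A"
    using tau_image[OF sets.sets_into_space[OF A], of "- x"] by simp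
  also have "emeasure M (\<tau> (- x) ` A) = emeasure M A"
    using shift_invariant[OF A] by (simp add: emeasure_eq_measure)
  finally show "emeasure (distr M M (\<tau> x)) A = emeasure M A" .
qed simp

lemma nn_integral_tau:
  assumes "f \<in> borel_measurable M"
  shows "(\<integral>\<^sup>+\<omega>. f (\<tau> x \<omega>) \<partial>M) = (\<integral>\<^sup>+\<omega>. f \<omega> \<partial>M)"
  using nn_integral_distr[of "\<tau> x" M M f] assms by (simp add: distr_tau)

lemma integral_tau:
  fixes f :: "'w \<Rightarrow> real"
  assumes "f \<in> borel_measurable M"
  shows "(LINT \<omega>|M. f (\<tau> x \<omega>)) = (LINT \<omega>|M. f \<omega>)"
  using integral_distr[of "\<tau> x" M M f] assms by (simp add: distr_tau)

lemma AE_tau: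
  assumes "AE \<omega> in M. P \<omega>"
  shows "AE \<omega> in M. P (\<tau> x \<omega>)"
proof -
  obtain N where N: "N \<in> null_sets M" "{\<omega> \<in> space M. \<not> P \<omega>} \<subseteq> N"
    using assms unfolding eventually_ae_filter by auto
  then have "\<tau> x -` N \<inter> space M \<in> null_sets M"
    using null_sets_distr_iff[of "\<tau> x" M M N] by (auto simp: distr_tau)
  from AE_not_in[OF this] show ?thesis
    using AE_space by eventually_elim (use N(2) shift_space in auto)
qed

section \<open>Integration along orbits and the maximal inequality\<close>

sublocale lM: pair_sigma_finite lborel M
  by standard

text \<open>Fubini and stationarity. Through this identity, estimates for single paths integrate to
  estimates in the environment.\<close>

lemma nn_integral_path:
  fixes w :: "'a \<Rightarrow> ennreal"
  assumes [measurable]: "g \<in> borel_measurable M" "w \<in> borel_measurable borel"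
  shows "(\<integral>\<^sup>+\<omega>. \<integral>\<^sup>+x. w x * g (\<tau> x \<omega>) \<partial>lborel \<partial>M) = (\<integral>\<^sup>+x. w x \<partial>lborel) * (\<integral>\<^sup>+\<omega>. g \<omega> \<partial>M)"
proof -
  have "(\<integral>\<^sup>+\<omega>. \<integral>\<^sup>+x. w x * g (\<tau> x \<omega>) \<partial>lborel \<partial>M) = (\<integral>\<^sup>+x. \<integral>\<^sup>+\<omega>. w x * g (\<tau> x \<omega>) \<partial>M \<partial>lborel)"
    by (rule lM.Fubini') measurable
  also have "\<dots> = (\<integral>\<^sup>+x. w x * (\<integral>\<^sup>+\<omega>. g \<omega> \<partial>M) \<partial>lborel)"
    by (intro nn_integral_cong) (simp add: nn_integral_cmult nn_integral_tau)
  also have "\<dots> = (\<integral>\<^sup>+x. w x \<partial>lborel) * (\<integral>\<^sup>+\<omega>. g \<omega> \<partial>M)"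
    by (intro nn_integral_multc) auto
  finally show ?thesis .
qed

text \<open>Ball averages are not normalised by the volume of the unit ball.\<close>

definition ball_int :: "nat \<Rightarrow> ('w \<Rightarrow> ennreal) \<Rightarrow> 'w \<Rightarrow> ennreal" where
  "ball_int n g \<omega> = (\<integral>\<^sup>+y. indicator (cball 0 (2 ^ n)) y * g (\<tau> y \<omega>) \<partial>lborel)"

text \<open>Only dyadic radii up to 2^N occur: countability makes the set measurable, and the
  covering lemma asks for bounded radii. General radii are recovered later at the cost of a factor
  2.\<close>

definition exceed :: "real \<Rightarrow> ('w \<Rightarrow> ennreal) \<Rightarrow> nat \<Rightarrow> 'w set" where
  "exceed l g N = {\<omega> \<in> space M. \<exists>n\<le>N. ennreal (l * (2 ^ n) ^ DIM('a)) < ball_int n g \<omega>}"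

lemma ball_int_measurable [measurable]:
  assumes [measurable]: "g \<in> borel_measurable M"
  shows "ball_int n g \<in> borel_measurable M"
  unfolding ball_int_def[abs_def] by measurable

lemma exceed_sets [measurable]:
  assumes [measurable]: "g \<in> borel_measurable M"
  shows "exceed l g N \<in> sets M"
  unfolding exceed_def by measurable

lemma ball_int_shift:
  assumes [measurable]: "g \<in> borel_measurable M" and \<omega>: "\<omega> \<in> space M"
  shows "ball_int n g (\<tau> x \<omega>) = (\<integral>\<^sup>+z. indicator (cball x (2 ^ n)) z * g (\<tau> z \<omega>) \<partial>lborel)"
proof -
  have "ball_int n g (\<tau> x \<omega>) = (\<integral>\<^sup>+y. indicator (cball x (2 ^ n)) (y + x) * g (\<tau> (y + x) \<omega>) \<partial>lborel)"
    unfolding ball_int_def using \<omega>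
    by (intro nn_integral_cong) (auto simp: shift_add indicator_def dist_norm norm_minus_commute)
  also have "\<dots> = (\<integral>\<^sup>+z. indicator (cball x (2 ^ n)) z * g (\<tau> z \<omega>) \<partial>lborel)"
    using \<omega> by (intro nn_integral_lborel_shift) measurable
  finally show ?thesis .
qed

text \<open>Select disjoint balls whose fivefold enlargements cover S. Each enlargement has 5^d
  times the volume, and that volume is paid for by the mass of G in the original ball. Norms of
  centres and radii are at most 2^N, so all the mass used lies in the ball of radius 2 *
  2^N.\<close>

lemma vitali_bound:
  fixes G :: "'a \<Rightarrow> ennreal"
  assumes [measurable]: "G \<in> borel_measurable borel" "S \<in> sets borel" and l: "0 \<le> l"
    and S: "\<And>x. x \<in> S \<Longrightarrow> norm x \<le> 2 ^ N \<and>
      (\<exists>n\<le>N. ennreal (l * (2 ^ n) ^ DIM('a)) < (\<integral>\<^sup>+z. indicator (cball x (2 ^ n)) z * G z \<partial>lborel))"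
  shows "ennreal l * emeasure lborel S \<le> ennreal (unit_ball_vol DIM('a) * 5 ^ DIM('a)) *
    (\<integral>\<^sup>+z. indicator (cball 0 (2 * 2 ^ N)) z * G z \<partial>lborel)"
proof -
  obtain n where n: "\<And>x. x \<in> S \<Longrightarrow> n x \<le> N"
    "\<And>x. x \<in> S \<Longrightarrow> ennreal (l * (2 ^ n x) ^ DIM('a)) < (\<integral>\<^sup>+z. indicator (cball x (2 ^ n x)) z * G z \<partial>lborel)"
    using S by metis
  define r :: "'a \<Rightarrow> real" where "r x = 2 ^ n x" for x
  have "S \<subseteq> (\<Union>i\<in>S. cball i (r i))" by (auto simp: r_def intro!: bexI)
  moreover have "0 < r i \<and> r i \<le> 2 ^ N" if "i \<in> S" for i
    using n(1)[OF that] by (auto simp: r_def intro: power_increasing)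
  ultimately obtain C where C: "countable C" "C \<subseteq> S"
     "pairwise (\<lambda>i j. disjnt (cball i (r i)) (cball j (r j))) C"
     "S \<subseteq> (\<Union>i\<in>C. cball i (5 * r i))"
    by (rule Vitali_covering_lemma_cballs[where a="\<lambda>x. x"])
  define X where "X \<rho> i = (\<Union>x\<in>{x\<in>C. to_nat_on C x = i}. cball x (\<rho> * r x))" for \<rho> i
  have X: "X \<rho> i = cball x (\<rho> * r x)" if "x \<in> C" "to_nat_on C x = i" for \<rho> i x
  proof -
    have "{y \<in> C. to_nat_on C y = i} = {x}"
      using that inj_on_to_nat_on[OF C(1)] by (auto dest: inj_onD)
    then show ?thesis by (simp add: X_def)
  qed
  have X0: "X \<rho> i = {}" if "\<And>x. x \<in> C \<Longrightarrow> to_nat_on C x \<noteq> i" for \<rho> i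
    using that by (auto simp: X_def)
  have [measurable]: "X \<rho> i \<in> sets borel" for \<rho> i
    by (cases "\<exists>x\<in>C. to_nat_on C x = i") (use X X0 in \<open>auto\<close>)
  have UX: "(\<Union>i. X \<rho> i) = (\<Union>x\<in>C. cball x (\<rho> * r x))" for \<rho>
    by (auto simp: X_def)
  have dis: "disjoint_family (X 1)"
    unfolding disjoint_family_on_def
  proof (intro ballI impI)
    fix i j :: nat assume "i \<noteq> j"
    then show "X 1 i \<inter> X 1 j = {}"
      using C(3) by (fastforce simp: X_def pairwise_def disjnt_def)
  qed
  define c where "c = unit_ball_vol DIM('a) * 5 ^ DIM('a)"
  have c: "c \<ge> 0" by (simp add: c_def)
  have one: "ennreal l * emeasure lborel (X 5 i) \<le> ennreal c * emeasure (density lborel G) (X 1 i)" for i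
  proof (cases "\<exists>x\<in>C. to_nat_on C x = i")
    case True
    then obtain x where x: "x \<in> C" "to_nat_on C x = i" by auto
    have "ennreal l * emeasure lborel (X 5 i) = ennreal l * ennreal (unit_ball_vol DIM('a) * (5 * r x) ^ DIM('a))"
      unfolding X[OF x] by (subst emeasure_cball) (auto simp: r_def)
    also have "\<dots> = ennreal c * ennreal (l * (2 ^ n x) ^ DIM('a))"
      using l by (simp add: ennreal_mult[symmetric] c_def r_def power_mult_distrib mult_ac)
    also have "\<dots> \<le> ennreal c * (\<integral>\<^sup>+z. indicator (cball x (2 ^ n x)) z * G z \<partial>lborel)"
      using n(2)[of x] x C(2) by (intro mult_left_mono) auto
    also have "(\<integral>\<^sup>+z. indicator (cball x (2 ^ n x)) z * G z \<partial>lborel) = emeasure (density lborel G) (X 1 i)"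
      unfolding X[OF x] by (subst emeasure_density) (auto simp: r_def mult.commute)
    finally show ?thesis .
  next
    case False
    then show ?thesis using X0 by simp
  qed
  have "ennreal l * emeasure lborel S \<le> ennreal l * emeasure lborel (\<Union>i. X 5 i)"
    using C(4) by (intro mult_left_mono emeasure_mono) (auto simp: UX[symmetric])
  also have "\<dots> \<le> ennreal l * (\<Sum>i. emeasure lborel (X 5 i))"
    by (intro mult_left_mono emeasure_subadditive_countably) auto
  also have "\<dots> = (\<Sum>i. ennreal l * emeasure lborel (X 5 i))"
    by (rule ennreal_suminf_cmult[symmetric])
  also have "\<dots> \<le> (\<Sum>i. ennreal c * emeasure (density lborel G) (X 1 i))"
    by (intro suminf_le one) auto
  also have "\<dots> = ennreal c * (\<Sum>i. emeasure (density lborel G) (X 1 i))"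
    by (rule ennreal_suminf_cmult)
  also have "(\<Sum>i. emeasure (density lborel G) (X 1 i)) = emeasure (density lborel G) (\<Union>i. X 1 i)"
    by (intro suminf_emeasure dis) auto
  also have "\<dots> \<le> emeasure (density lborel G) (cball 0 (2 * 2 ^ N))"
  proof (intro emeasure_mono)
    show "(\<Union>i. X 1 i) \<subseteq> cball 0 (2 * 2 ^ N)"
    proof
      fix y assume "y \<in> (\<Union>i. X 1 i)"
      then obtain x where x: "x \<in> C" "dist x y \<le> r x" unfolding UX by auto
      have "norm x \<le> 2 ^ N" "r x \<le> 2 ^ N"
        using S[of x] n(1)[of x] x(1) C(2) by (auto simp: r_def intro: power_increasing)
      moreover have "norm y \<le> norm x + dist x y"
        by (metis dist_commute dist_norm norm_triangle_sub)
      ultimately show "y \<in> cball 0 (2 * 2 ^ N)" using x(2) by simp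
    qed
  qed auto
  also have "\<dots> = (\<integral>\<^sup>+z. indicator (cball 0 (2 * 2 ^ N)) z * G z \<partial>lborel)"
    by (subst emeasure_density) (auto simp: mult.commute)
  finally show ?thesis by (simp add: c_def mult_left_mono)
qed

text \<open>Transference: the Euclidean estimate is applied to each path on the ball of radius 2^N
  and integrated over the environment. Stationarity makes both sides multiples of the volume v of
  that ball; the doubled radius contributes 2^d, and 5^d 2^d is the constant 10^d.\<close>

lemma maximal_inequality_finite:
  assumes [measurable]: "g \<in> borel_measurable M" and l: "0 \<le> l"
  shows "ennreal l * emeasure M (exceed l g N) \<le> ennreal (unit_ball_vol DIM('a) * 10 ^ DIM('a)) * (\<integral>\<^sup>+\<omega>. g \<omega> \<partial>M)"
proof -
  define v where "v = emeasure lborel (cball (0::'a) (2 ^ N))"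
  have v: "v = ennreal (unit_ball_vol DIM('a) * (2 ^ N) ^ DIM('a))"
    unfolding v_def by (subst emeasure_cball) auto
  have v2: "emeasure lborel (cball (0::'a) (2 * 2 ^ N)) = ennreal (2 ^ DIM('a)) * v"
    unfolding v by (subst emeasure_cball) (auto simp: ennreal_mult[symmetric] power_mult_distrib mult_ac)
  let ?S = "\<lambda>\<omega>. {x \<in> cball 0 (2 ^ N). \<tau> x \<omega> \<in> exceed l g N}"
  have "ennreal l * (v * emeasure M (exceed l g N)) =
      ennreal l * (\<integral>\<^sup>+\<omega>. \<integral>\<^sup>+x. indicator (cball 0 (2 ^ N)) x * indicator (exceed l g N) (\<tau> x \<omega>) \<partial>lborel \<partial>M)"
    by (subst nn_integral_path) (auto simp: v_def)
  also have "\<dots> = (\<integral>\<^sup>+\<omega>. ennreal l * (\<integral>\<^sup>+x. indicator (cball 0 (2 ^ N)) x * indicator (exceed l g N) (\<tau> x \<omega>) \<partial>lborel) \<partial>M)"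
    by (rule nn_integral_cmult[symmetric]) measurable
  also have "\<dots> \<le> (\<integral>\<^sup>+\<omega>. ennreal (unit_ball_vol DIM('a) * 5 ^ DIM('a)) *
      (\<integral>\<^sup>+z. indicator (cball 0 (2 * 2 ^ N)) z * g (\<tau> z \<omega>) \<partial>lborel) \<partial>M)"
  proof (intro nn_integral_mono)
    fix \<omega> assume \<omega>: "\<omega> \<in> space M"
    have S_meas: "?S \<omega> \<in> sets borel"
    proof -
      have "(\<lambda>x. \<tau> x \<omega>) -` exceed l g N \<inter> space borel \<in> sets borel"
        using \<omega> by (intro measurable_sets[of _ borel M]) auto
      then have "cball 0 (2 ^ N) \<inter> ((\<lambda>x. \<tau> x \<omega>) -` exceed l g N \<inter> space borel) \<in> sets borel" by auto
      moreover have "?S \<omega> = cball 0 (2 ^ N) \<inter> ((\<lambda>x. \<tau> x \<omega>) -` exceed l g N \<inter> space borel)" by auto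
      ultimately show ?thesis by simp
    qed
    have "(\<integral>\<^sup>+x. indicator (cball 0 (2 ^ N)) x * indicator (exceed l g N) (\<tau> x \<omega>) \<partial>lborel) =
        (\<integral>\<^sup>+x. indicator (?S \<omega>) x \<partial>lborel)"
      by (intro nn_integral_cong) (auto simp: indicator_def)
    also have "\<dots> = emeasure lborel (?S \<omega>)"
      by (rule nn_integral_indicator) (use S_meas in simp)
    finally have "(\<integral>\<^sup>+x. indicator (cball 0 (2 ^ N)) x * indicator (exceed l g N) (\<tau> x \<omega>) \<partial>lborel) = emeasure lborel (?S \<omega>)" .
    moreover have "ennreal l * emeasure lborel (?S \<omega>) \<le> ennreal (unit_ball_vol DIM('a) * 5 ^ DIM('a)) *
      (\<integral>\<^sup>+z. indicator (cball 0 (2 * 2 ^ N)) z * g (\<tau> z \<omega>) \<partial>lborel)"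
    proof (rule vitali_bound[OF _ _ l])
      show "(\<lambda>z. g (\<tau> z \<omega>)) \<in> borel_measurable borel" using \<omega> by measurable
      show "norm x \<le> 2 ^ N \<and> (\<exists>n\<le>N. ennreal (l * (2 ^ n) ^ DIM('a)) < (\<integral>\<^sup>+z. indicator (cball x (2 ^ n)) z * g (\<tau> z \<omega>) \<partial>lborel))"
        if "x \<in> ?S \<omega>" for x
        using that ball_int_shift[OF assms(1) \<omega>, of _ x] by (auto simp: exceed_def)
    qed fact
    ultimately show "ennreal l * (\<integral>\<^sup>+x. indicator (cball 0 (2 ^ N)) x * indicator (exceed l g N) (\<tau> x \<omega>) \<partial>lborel) \<le>
      ennreal (unit_ball_vol DIM('a) * 5 ^ DIM('a)) * (\<integral>\<^sup>+z. indicator (cball 0 (2 * 2 ^ N)) z * g (\<tau> z \<omega>) \<partial>lborel)"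
      by simp
  qed
  also have "\<dots> = ennreal (unit_ball_vol DIM('a) * 5 ^ DIM('a)) * ((ennreal (2 ^ DIM('a)) * v) * (\<integral>\<^sup>+\<omega>. g \<omega> \<partial>M))"
    by (subst nn_integral_cmult) (measurable, subst nn_integral_path, auto simp: v2)
  also have "\<dots> = v * (ennreal (unit_ball_vol DIM('a) * 5 ^ DIM('a)) * ennreal (2 ^ DIM('a)) * (\<integral>\<^sup>+\<omega>. g \<omega> \<partial>M))"
    by (simp add: mult_ac)
  also have "ennreal (unit_ball_vol DIM('a) * 5 ^ DIM('a)) * ennreal (2 ^ DIM('a)) = ennreal (unit_ball_vol DIM('a) * 10 ^ DIM('a))"
    by (subst ennreal_mult[symmetric]) (auto simp: power_mult_distrib[symmetric] mult.assoc)
  finally have "v * (ennreal l * emeasure M (exceed l g N)) \<le> v * (ennreal (unit_ball_vol DIM('a) * 10 ^ DIM('a)) * (\<integral>\<^sup>+\<omega>. g \<omega> \<partial>M))"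
    by (simp add: mult_ac)
  moreover have "v \<noteq> 0" "v \<noteq> top"
    by (auto simp: v ennreal_eq_0_iff not_le intro!: mult_pos_pos)
  ultimately show ?thesis by (subst (asm) ennreal_mult_le_mult_iff) auto
qed

lemma maximal_inequality:
  assumes [measurable]: "g \<in> borel_measurable M" and l: "0 \<le> l"
  shows "ennreal l * emeasure M (\<Union>N. exceed l g N) \<le> ennreal (unit_ball_vol DIM('a) * 10 ^ DIM('a)) * (\<integral>\<^sup>+\<omega>. g \<omega> \<partial>M)"
proof -
  have "incseq (exceed l g)"
    by (auto simp: exceed_def incseq_def intro: order_trans)
  then have "emeasure M (\<Union>N. exceed l g N) = (SUP N. emeasure M (exceed l g N))"
    by (intro SUP_emeasure_incseq[symmetric]) auto
  then have "ennreal l * emeasure M (\<Union>N. exceed l g N) = (SUP N. ennreal l * emeasure M (exceed l g N))"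
    by (simp add: SUP_mult_left_ennreal)
  also have "\<dots> \<le> ennreal (unit_ball_vol DIM('a) * 10 ^ DIM('a)) * (\<integral>\<^sup>+\<omega>. g \<omega> \<partial>M)"
    by (intro SUP_least maximal_inequality_finite l assms)
  finally show ?thesis .
qed


section \<open>Orbit averages and their approximation in mean\<close>

definition orb :: "('a \<Rightarrow> real) \<Rightarrow> ('w \<Rightarrow> real) \<Rightarrow> real \<Rightarrow> 'w \<Rightarrow> real" where
  "orb \<phi> f e \<omega> = (LINT x|lborel. \<phi> x * f (\<tau> (x /\<^sub>R e) \<omega>))"

lemma orb_integrable:
  fixes \<phi> :: "'a \<Rightarrow> real" and f :: "'w \<Rightarrow> real"
  assumes "integrable lborel \<phi>" and [measurable]: "f \<in> borel_measurable M"
    and "\<And>\<omega>. \<omega> \<in> space M \<Longrightarrow> \<bar>f \<omega>\<bar> \<le> B" "\<omega> \<in> space M"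
  shows "integrable lborel (\<lambda>x. \<phi> x * f (\<tau> (x /\<^sub>R e) \<omega>))"
proof (rule integrable_mult_bounded[OF assms(1)])
  show "(\<lambda>x. f (\<tau> (x /\<^sub>R e) \<omega>)) \<in> borel_measurable lborel"
    using assms(4) by measurable
qed (use assms shift_space in auto)

text \<open>Shifting the environment by z amounts to shifting the weight by e z, and
  \<open>cont\<close> says that this changes the weight little in L1; boundedness of f does the
  rest.\<close>

lemma orb_shift_tendsto:
  fixes \<phi> :: "'a \<Rightarrow> real" and f :: "'w \<Rightarrow> real"
  assumes \<phi>: "integrable lborel \<phi>" and [measurable]: "f \<in> borel_measurable M"
    and B: "\<And>\<omega>. \<omega> \<in> space M \<Longrightarrow> \<bar>f \<omega>\<bar> \<le> B" and \<omega>: "\<omega> \<in> space M"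
    and cont: "((\<lambda>e. LINT x|lborel. \<bar>\<phi> (x - e *\<^sub>R z) - \<phi> x\<bar>) \<longlongrightarrow> 0) (at_right 0)"
  shows "((\<lambda>e. orb \<phi> (\<lambda>\<omega>. f (\<tau> z \<omega>)) e \<omega> - orb \<phi> f e \<omega>) \<longlongrightarrow> 0) (at_right 0)"
proof (rule Lim_null_comparison)
  have [measurable]: "\<phi> \<in> borel_measurable borel" using \<phi> by auto
  show "((\<lambda>e. B * (LINT x|lborel. \<bar>\<phi> (x - e *\<^sub>R z) - \<phi> x\<bar>)) \<longlongrightarrow> 0) (at_right 0)"
    using tendsto_mult_right_zero[OF cont] .
  have \<phi>s: "integrable lborel (\<lambda>x. \<phi> (x - y))" for y
    using \<phi> lborel_distr_plus[of "- y"]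
    by (subst (asm) lborel_distr_plus[of "- y", symmetric], subst (asm) integrable_distr_eq) auto
  have "norm (orb \<phi> (\<lambda>\<omega>. f (\<tau> z \<omega>)) e \<omega> - orb \<phi> f e \<omega>) \<le> B * (LINT x|lborel. \<bar>\<phi> (x - e *\<^sub>R z) - \<phi> x\<bar>)"
    if e: "0 < e" for e
  proof -
    let ?G = "\<lambda>x. f (\<tau> (x /\<^sub>R e) \<omega>)"
    have [measurable]: "?G \<in> borel_measurable borel" using \<omega> by measurable
    have GB: "\<bar>?G x\<bar> \<le> B" for x using B \<omega> shift_space by auto
    have i: "integrable lborel (\<lambda>x. \<phi> (x - e *\<^sub>R z) * ?G x)" "integrable lborel (\<lambda>x. \<phi> x * ?G x)"
      by (rule integrable_mult_bounded[OF \<phi>s _ GB] integrable_mult_bounded[OF \<phi> _ GB], measurable)+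
    have "orb \<phi> (\<lambda>\<omega>. f (\<tau> z \<omega>)) e \<omega> = (LINT x|lborel. \<phi> x * ?G (e *\<^sub>R z + x))"
      unfolding orb_def using \<omega> e
      by (intro Bochner_Integration.integral_cong) (auto simp: shift_add scaleR_add_right)
    also have "\<dots> = (LINT x|distr lborel borel ((+) (e *\<^sub>R z)). \<phi> (x - e *\<^sub>R z) * ?G x)"
      by (subst integral_distr) auto
    also have "\<dots> = (LINT x|lborel. \<phi> (x - e *\<^sub>R z) * ?G x)"
      by (simp only: lborel_distr_plus)
    finally have "orb \<phi> (\<lambda>\<omega>. f (\<tau> z \<omega>)) e \<omega> - orb \<phi> f e \<omega> = (LINT x|lborel. \<phi> (x - e *\<^sub>R z) * ?G x - \<phi> x * ?G x)"
      unfolding orb_def using i by simp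
    also have "norm \<dots> \<le> (LINT x|lborel. norm (\<phi> (x - e *\<^sub>R z) * ?G x - \<phi> x * ?G x))"
      by (rule integral_norm_bound)
    also have "\<dots> \<le> (LINT x|lborel. B * \<bar>\<phi> (x - e *\<^sub>R z) - \<phi> x\<bar>)"
    proof (rule integral_mono)
      fix x
      have "norm (\<phi> (x - e *\<^sub>R z) * ?G x - \<phi> x * ?G x) = \<bar>?G x\<bar> * \<bar>\<phi> (x - e *\<^sub>R z) - \<phi> x\<bar>"
        by (simp add: left_diff_distrib[symmetric] abs_mult)
      also have "\<dots> \<le> B * \<bar>\<phi> (x - e *\<^sub>R z) - \<phi> x\<bar>" by (intro mult_right_mono GB) auto
      finally show "norm (\<phi> (x - e *\<^sub>R z) * ?G x - \<phi> x * ?G x) \<le> B * \<bar>\<phi> (x - e *\<^sub>R z) - \<phi> x\<bar>" .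
    qed (use i \<phi>s \<phi> in auto)
    finally show ?thesis by simp
  qed
  then show "\<forall>\<^sub>F e in at_right 0. norm (orb \<phi> (\<lambda>\<omega>. f (\<tau> z \<omega>)) e \<omega> - orb \<phi> f e \<omega>) \<le> B * (LINT x|lborel. \<bar>\<phi> (x - e *\<^sub>R z) - \<phi> x\<bar>)"
    by (intro eventually_at_rightI[of 0 1]) auto
qed

text \<open>Ergodicity is stated for strictly invariant sets, while h is invariant only almost
  surely for each z. Level sets are therefore replaced by sets defined through almost all points of
  the orbit.\<close>

lemma invariant_AE_const:
  fixes h :: "'w \<Rightarrow> real"
  assumes [measurable]: "h \<in> borel_measurable M" and B: "\<And>\<omega>. \<omega> \<in> space M \<Longrightarrow> \<bar>h \<omega>\<bar> \<le> B"
    and inv: "\<And>z. AE \<omega> in M. h (\<tau> z \<omega>) = h \<omega>"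
  shows "AE \<omega> in M. h \<omega> = expectation h"
proof -
  have hi: "integrable M h" by (rule integrable_const_bound[of _ B]) (use B in auto)
  have "AE x in lborel. AE \<omega> in M. h (\<tau> x \<omega>) = h \<omega>" using inv by simp
  moreover have "{p \<in> space (lborel \<Otimes>\<^sub>M M). h (\<tau> (fst p) (snd p)) = h (snd p)} \<in> sets (lborel \<Otimes>\<^sub>M M)"
    by (rule borel_measurable_eq) measurable
  ultimately have orbit: "AE \<omega> in M. AE x in lborel. h (\<tau> x \<omega>) = h \<omega>"
    using lM.AE_commute[of "\<lambda>x \<omega>. h (\<tau> x \<omega>) = h \<omega>"] by blast
  have "prob {\<omega> \<in> space M. q < h \<omega>} = 0 \<or> prob {\<omega> \<in> space M. q < h \<omega>} = 1" for q
  proof -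
    \<comment> \<open>Whether almost all points of the orbit exceed q cannot change when the base
      point is translated.\<close>
    define A where "A = {\<omega> \<in> space M. AE x in lborel. q < h (\<tau> x \<omega>)}"
    \<comment> \<open>A vanishing integral in place of the almost everywhere condition makes the set
      measurable.\<close>
    have "A = {\<omega> \<in> space M. (\<integral>\<^sup>+x. indicator {r. r \<le> q} (h (\<tau> x \<omega>)) \<partial>lborel) = 0}"
    proof -
      have "(AE x in lborel. q < h (\<tau> x \<omega>)) \<longleftrightarrow> (\<integral>\<^sup>+x. indicator {r. r \<le> q} (h (\<tau> x \<omega>)) \<partial>lborel) = 0"
        if "\<omega> \<in> space M" for \<omega>
        using that by (subst nn_integral_0_iff_AE) (auto simp: indicator_eq_0_iff not_le)
      then show ?thesis unfolding A_def by blast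
    qed
    also have "\<dots> \<in> sets M" by measurable
    finally have A: "A \<in> sets M" .
    have "\<tau> z ` A = A" for z
    proof -
      have *: "\<tau> z \<omega> \<in> A" if "\<omega> \<in> A" for z \<omega>
      proof -
        have w: "\<omega> \<in> space M" and "AE x in lborel. q < h (\<tau> x \<omega>)" using that by (auto simp: A_def)
        from AE_lborel_shift[OF this(2), of z] show ?thesis
          using w by (simp add: A_def shift_space shift_add)
      qed
      have "\<omega> \<in> \<tau> z ` A" if "\<omega> \<in> A" for \<omega>
      proof -
        have "\<omega> = \<tau> z (\<tau> (- z) \<omega>)" using that tau_cancel[of \<omega> "- z"] by (simp add: A_def)
        then show ?thesis using *[OF that, of "- z"] by blast
      qed
      then show ?thesis using * by auto
    qed
    then have "prob A = 0 \<or> prob A = 1" by (rule shift_ergodic[OF A])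
    moreover have "prob A = prob {\<omega> \<in> space M. q < h \<omega>}"
    proof (rule finite_measure_eq_AE)
      show "AE \<omega> in M. \<omega> \<in> A \<longleftrightarrow> \<omega> \<in> {\<omega> \<in> space M. q < h \<omega>}"
        using orbit AE_space
      proof eventually_elim
        case (elim \<omega>)
        have nb: "ae_filter (lborel :: 'a measure) \<noteq> bot"
          by (simp add: ae_filter_eq_bot_iff)
        have "q < h \<omega>" if "AE x in lborel. q < h (\<tau> x \<omega>)"
        proof -
          have "AE x in (lborel :: 'a measure). q < h \<omega>"
            using that elim(1) by eventually_elim simp
          then show ?thesis using eventually_const[OF nb] by blast
        qed
        moreover have "AE x in lborel. q < h (\<tau> x \<omega>)" if "q < h \<omega>"
          using elim(1) by eventually_elim (use that in simp)
        ultimately show ?case using elim(2) by (auto simp: A_def)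
      qed
    qed (use A in auto)
    ultimately show ?thesis by simp
  qed
  note zo = this
  have lo: "AE \<omega> in M. q < h \<omega>" if "q < expectation h" for q
  proof (rule ccontr)
    assume "\<not> (AE \<omega> in M. q < h \<omega>)"
    then have "prob {\<omega> \<in> space M. q < h \<omega>} \<noteq> 1" by (subst prob_Collect_eq_1) auto
    then have "prob {\<omega> \<in> space M. q < h \<omega>} = 0" using zo by blast
    then have "AE \<omega> in M. \<not> q < h \<omega>" by (subst (asm) prob_Collect_eq_0) auto
    then have "AE \<omega> in M. h \<omega> \<le> q" by (simp add: not_less)
    then have "expectation h \<le> expectation (\<lambda>_. q)" by (intro integral_mono_AE hi) auto
    then show False using that by (simp add: prob_space)
  qed
  have hi': "AE \<omega> in M. h \<omega> \<le> q" if "expectation h < q" for q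
  proof (rule ccontr)
    assume "\<not> (AE \<omega> in M. h \<omega> \<le> q)"
    then have "\<not> (AE \<omega> in M. \<not> q < h \<omega>)" by (simp add: not_less)
    then have "prob {\<omega> \<in> space M. q < h \<omega>} \<noteq> 0" by (subst prob_Collect_eq_0) auto
    then have "prob {\<omega> \<in> space M. q < h \<omega>} = 1" using zo by blast
    then have "AE \<omega> in M. q < h \<omega>" by (subst (asm) prob_Collect_eq_1) auto
    then have "expectation (\<lambda>_. q) \<le> expectation h" by (intro integral_mono_AE hi) auto
    then show False using that by (simp add: prob_space)
  qed
  have "AE \<omega> in M. \<forall>n::nat. expectation h - 1 / Suc n < h \<omega> \<and> h \<omega> \<le> expectation h + 1 / Suc n"
    unfolding AE_all_countable using lo hi' by (auto simp: AE_conj_iff)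
  then show ?thesis
  proof eventually_elim
    case (elim \<omega>)
    have "\<bar>h \<omega> - expectation h\<bar> \<le> 1 / Suc n" for n using elim[rule_format, of n] by linarith
    then have "\<bar>h \<omega> - expectation h\<bar> \<le> 0"
      by (intro LIMSEQ_le_const[OF LIMSEQ_Suc[OF lim_1_over_n]]) auto
    then show ?case by simp
  qed
qed


text \<open>The class \<open>Cl\<close> of functions with the same orbit averages as \<open>f\<close> is convex and
  translation invariant, so its elements of almost minimal \<open>L\<^sup>2\<close> norm are almost invariant.\<close>

lemma mean_approx_bounded:
  fixes \<phi> :: "'a \<Rightarrow> real" and f :: "'w \<Rightarrow> real"
  assumes \<phi>: "integrable lborel \<phi>"
    and cont: "\<And>z. ((\<lambda>e. LINT x|lborel. \<bar>\<phi> (x - e *\<^sub>R z) - \<phi> x\<bar>) \<longlongrightarrow> 0) (at_right 0)"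
    and fm [measurable]: "f \<in> borel_measurable M" and fB: "\<And>\<omega>. \<omega> \<in> space M \<Longrightarrow> \<bar>f \<omega>\<bar> \<le> B"
    and \<eta>: "0 < \<eta>"
  obtains g where "g \<in> borel_measurable M" "\<And>\<omega>. \<omega> \<in> space M \<Longrightarrow> \<bar>g \<omega>\<bar> \<le> B"
    "\<And>\<omega>. \<omega> \<in> space M \<Longrightarrow> ((\<lambda>e. orb \<phi> g e \<omega> - orb \<phi> f e \<omega>) \<longlongrightarrow> 0) (at_right 0)"
    "expectation (\<lambda>\<omega>. \<bar>g \<omega> - expectation f\<bar>) < \<eta>"
proof -
  \<comment> \<open>The expectation is recorded in the class so that the invariant limit can be
    identified with the constant \<open>expectation f\<close>.\<close>
  define Cl where "Cl = {g. g \<in> borel_measurable M \<and> (\<forall>\<omega>\<in>space M. \<bar>g \<omega>\<bar> \<le> B) \<and>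
    expectation g = expectation f \<and>
    (\<forall>\<omega>\<in>space M. ((\<lambda>e. orb \<phi> g e \<omega> - orb \<phi> f e \<omega>) \<longlongrightarrow> 0) (at_right 0))}"
  define N where "N g = expectation (\<lambda>\<omega>. (g \<omega>)\<^sup>2)" for g :: "'w \<Rightarrow> real"
  have Cl_meas: "g \<in> borel_measurable M" if "g \<in> Cl" for g using that by (simp add: Cl_def)
  have Cl_B: "\<bar>g \<omega>\<bar> \<le> B" if "g \<in> Cl" "\<omega> \<in> space M" for g \<omega> using that by (simp add: Cl_def)
  have f_Cl: "f \<in> Cl" by (simp add: Cl_def fB)
  obtain \<omega>0 where "\<omega>0 \<in> space M" using not_empty by blast
  then have B0: "0 \<le> B" using fB[of \<omega>0] by linarith
  have bint: "integrable M g" if "g \<in> borel_measurable M" "\<And>\<omega>. \<omega> \<in> space M \<Longrightarrow> \<bar>g \<omega>\<bar> \<le> b" for g :: "'w \<Rightarrow> real" and b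
    by (rule integrable_const_bound[of _ b]) (use that in auto)
  have Cl_int: "integrable M g" if "g \<in> Cl" for g
    using bint[OF Cl_meas[OF that] Cl_B[OF that]] .
  have Cl_int2: "integrable M (\<lambda>\<omega>. g \<omega> * h \<omega>)" if "g \<in> Cl" "h \<in> Cl" for g h
    by (rule bint[of _ "B * B"])
      (use Cl_meas[OF that(1)] Cl_meas[OF that(2)] Cl_B[OF that(1)] Cl_B[OF that(2)] B0 in
        \<open>auto simp: abs_mult intro!: mult_mono\<close>)
  have mid: "(\<lambda>\<omega>. (g \<omega> + h \<omega>) / 2) \<in> Cl" if g: "g \<in> Cl" and h: "h \<in> Cl" for g h
  proof -
    have "((\<lambda>e. orb \<phi> (\<lambda>\<omega>. (g \<omega> + h \<omega>) / 2) e \<omega> - orb \<phi> f e \<omega>) \<longlongrightarrow> 0) (at_right 0)" if w: "\<omega> \<in> space M" for \<omega>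
    proof -
      have "orb \<phi> (\<lambda>\<omega>. (g \<omega> + h \<omega>) / 2) e \<omega> = (orb \<phi> g e \<omega> + orb \<phi> h e \<omega>) / 2" for e
      proof -
        have "orb \<phi> (\<lambda>\<omega>. (g \<omega> + h \<omega>) / 2) e \<omega> =
          (LINT x|lborel. (\<phi> x * g (\<tau> (x /\<^sub>R e) \<omega>) + \<phi> x * h (\<tau> (x /\<^sub>R e) \<omega>)) / 2)"
          unfolding orb_def by (intro Bochner_Integration.integral_cong) (auto simp: algebra_simps)
        also have "\<dots> = (orb \<phi> g e \<omega> + orb \<phi> h e \<omega>) / 2"
          unfolding orb_def
          using orb_integrable[OF \<phi> Cl_meas[OF g] Cl_B[OF g] w] orb_integrable[OF \<phi> Cl_meas[OF h] Cl_B[OF h] w]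
          by simp
        finally show ?thesis .
      qed
      then have "orb \<phi> (\<lambda>\<omega>. (g \<omega> + h \<omega>) / 2) e \<omega> - orb \<phi> f e \<omega> =
          ((orb \<phi> g e \<omega> - orb \<phi> f e \<omega>) + (orb \<phi> h e \<omega> - orb \<phi> f e \<omega>)) / 2" for e
        by (simp add: field_simps)
      note eq = this
      have "((\<lambda>e. ((orb \<phi> g e \<omega> - orb \<phi> f e \<omega>) + (orb \<phi> h e \<omega> - orb \<phi> f e \<omega>)) / 2) \<longlongrightarrow> (0 + 0) / 2) (at_right 0)"
        using g h w by (intro tendsto_intros) (auto simp: Cl_def)
      then show ?thesis unfolding eq by simp
    qed
    moreover have "expectation (\<lambda>\<omega>. (g \<omega> + h \<omega>) / 2) = expectation f"
      using Cl_int[OF g] Cl_int[OF h] g h by (simp add: Cl_def)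
    moreover have "\<bar>(g \<omega> + h \<omega>) / 2\<bar> \<le> B" if "\<omega> \<in> space M" for \<omega>
    proof -
      have "\<bar>g \<omega> + h \<omega>\<bar> \<le> 2 * B" using Cl_B[OF g that] Cl_B[OF h that] by linarith
      then show ?thesis by simp
    qed
    ultimately show ?thesis using Cl_meas[OF g] Cl_meas[OF h] by (simp add: Cl_def)
  qed
  have trans: "(\<lambda>\<omega>. g (\<tau> z \<omega>)) \<in> Cl" if g: "g \<in> Cl" for g z
  proof -
    note gm [measurable] = Cl_meas[OF g]
    have "((\<lambda>e. orb \<phi> (\<lambda>\<omega>. g (\<tau> z \<omega>)) e \<omega> - orb \<phi> f e \<omega>) \<longlongrightarrow> 0) (at_right 0)" if w: "\<omega> \<in> space M" for \<omega>
    proof -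
      have "((\<lambda>e. (orb \<phi> (\<lambda>\<omega>. g (\<tau> z \<omega>)) e \<omega> - orb \<phi> g e \<omega>) + (orb \<phi> g e \<omega> - orb \<phi> f e \<omega>)) \<longlongrightarrow> 0 + 0) (at_right 0)"
        using g w by (intro tendsto_add orb_shift_tendsto[OF \<phi> gm Cl_B[OF g] w cont]) (auto simp: Cl_def)
      then show ?thesis by simp
    qed
    moreover have "expectation (\<lambda>\<omega>. g (\<tau> z \<omega>)) = expectation f"
      using integral_tau[OF gm, of z] g by (simp add: Cl_def)
    ultimately show ?thesis using Cl_B[OF g] shift_space by (simp add: Cl_def)
  qed
  define a where "a = Inf (N ` Cl)"
  have bdd: "bdd_below (N ` Cl)"
    by (rule bdd_belowI[of _ 0]) (auto simp: N_def)
  have a_le: "a \<le> N g" if "g \<in> Cl" for g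
    unfolding a_def using bdd that by (intro cInf_lower) auto
  \<comment> \<open>Parallelogram identity: the midpoint lies in \<open>Cl\<close>, so its second
    moment is at least a, which makes two near minimisers close.\<close>
  have par: "expectation (\<lambda>\<omega>. (g \<omega> - h \<omega>)\<^sup>2) \<le> 2 * (N g - a) + 2 * (N h - a)" if g: "g \<in> Cl" and h: "h \<in> Cl" for g h
  proof -
    have i: "integrable M (\<lambda>\<omega>. (g \<omega>)\<^sup>2)" "integrable M (\<lambda>\<omega>. (h \<omega>)\<^sup>2)" "integrable M (\<lambda>\<omega>. g \<omega> * h \<omega>)"
      using Cl_int2[OF g g] Cl_int2[OF h h] Cl_int2[OF g h] by (auto simp: power2_eq_square)
    have "N (\<lambda>\<omega>. (g \<omega> + h \<omega>) / 2) = expectation (\<lambda>\<omega>. (g \<omega>)\<^sup>2 / 4 + (h \<omega>)\<^sup>2 / 4 + (g \<omega> * h \<omega>) / 2)"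
      unfolding N_def by (intro Bochner_Integration.integral_cong) (auto simp: power2_eq_square field_simps)
    also have "\<dots> = N g / 4 + N h / 4 + expectation (\<lambda>\<omega>. g \<omega> * h \<omega>) / 2"
      unfolding N_def using i by simp
    finally have m: "N (\<lambda>\<omega>. (g \<omega> + h \<omega>) / 2) = N g / 4 + N h / 4 + expectation (\<lambda>\<omega>. g \<omega> * h \<omega>) / 2" .
    have "expectation (\<lambda>\<omega>. (g \<omega> - h \<omega>)\<^sup>2) = expectation (\<lambda>\<omega>. (g \<omega>)\<^sup>2 + (h \<omega>)\<^sup>2 - 2 * (g \<omega> * h \<omega>))"
      by (intro Bochner_Integration.integral_cong) (auto simp: power2_eq_square algebra_simps)
    also have "\<dots> = N g + N h - 2 * expectation (\<lambda>\<omega>. g \<omega> * h \<omega>)"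
      unfolding N_def using i by simp
    finally show ?thesis using a_le[OF mid[OF g h]] m by simp
  qed
  have "\<exists>g\<in>Cl. N g < a + 1 / 16 ^ j" for j :: nat
  proof -
    have "\<exists>x\<in>N ` Cl. x < a + 1 / 16 ^ j" unfolding a_def
      by (rule cInf_lessD) (use f_Cl in auto)
    then show ?thesis by blast
  qed
  then obtain g where g: "\<And>j::nat. g j \<in> Cl" "\<And>j. N (g j) < a + 1 / 16 ^ j" by metis
  note gm [measurable] = Cl_meas[OF g(1)]
  have close: "(\<integral>\<^sup>+\<omega>. ennreal ((p \<omega> - q \<omega>)\<^sup>2) \<partial>M) \<le> ennreal (4 / 16 ^ j)"
    if "p \<in> Cl" "q \<in> Cl" "N p \<le> a + 1 / 16 ^ j" "N q \<le> a + 1 / 16 ^ j" for p q and j :: nat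
  proof -
    have "integrable M (\<lambda>\<omega>. (p \<omega> - q \<omega>)\<^sup>2)"
    proof (rule bint[of _ "(2 * B)\<^sup>2"])
      fix \<omega> assume "\<omega> \<in> space M"
      then have "\<bar>p \<omega> - q \<omega>\<bar> \<le> \<bar>2 * B\<bar>"
        using Cl_B[OF that(1), of \<omega>] Cl_B[OF that(2), of \<omega>] by linarith
      then show "\<bar>(p \<omega> - q \<omega>)\<^sup>2\<bar> \<le> (2 * B)\<^sup>2" by (simp only: abs_le_square_iff abs_power2)
    qed (use Cl_meas[OF that(1)] Cl_meas[OF that(2)] in measurable)
    then have "(\<integral>\<^sup>+\<omega>. ennreal ((p \<omega> - q \<omega>)\<^sup>2) \<partial>M) = ennreal (expectation (\<lambda>\<omega>. (p \<omega> - q \<omega>)\<^sup>2))"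
      by (intro nn_integral_eq_integral) auto
    also have "\<dots> \<le> ennreal (4 / 16 ^ j)"
    proof (rule ennreal_leI)
      have arith: "E \<le> 4 * t" if "E \<le> 2 * (n - c) + 2 * (m - c)" "n \<le> c + t" "m \<le> c + t"
        for E n m c t :: real using that by argo
      show "expectation (\<lambda>\<omega>. (p \<omega> - q \<omega>)\<^sup>2) \<le> 4 / 16 ^ j"
        using arith[OF par[OF that(1,2)] that(3,4)] by simp
    qed
    finally show ?thesis .
  qed
  have pw: "(1::real) / 16 ^ i \<le> 1 / 16 ^ j" if "j \<le> i" for i j :: nat
    using that by (intro divide_left_mono power_increasing) auto
  have "AE \<omega> in M. convergent (\<lambda>j. g j \<omega>)"
  proof (rule L2_fast_Cauchy_AE[where C=4])
    show "(\<integral>\<^sup>+\<omega>. ennreal ((g (Suc j) \<omega> - g j \<omega>)\<^sup>2) \<partial>M) \<le> ennreal (4 / 16 ^ j)" for j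
      using g(2)[of j] g(2)[of "Suc j"] pw[of j "Suc j"] by (intro close g(1)) auto
  qed auto
  then have conv: "AE \<omega> in M. convergent (\<lambda>j. g j \<omega>)" .
  define h where "h \<omega> = (if convergent (\<lambda>j. g j \<omega>) then lim (\<lambda>j. g j \<omega>) else 0)" for \<omega>
  have h_lim: "(\<lambda>j. g j \<omega>) \<longlonglongrightarrow> h \<omega>" if "convergent (\<lambda>j. g j \<omega>)" for \<omega>
    using that convergent_LIMSEQ_iff[of "\<lambda>j. g j \<omega>"] by (simp add: h_def)
  have [measurable]: "Measurable.pred M (\<lambda>\<omega>. convergent (\<lambda>j. g j \<omega>))"
    unfolding Cauchy_convergent_iff[symmetric] pred_def by (rule sets_Collect_Cauchy) auto
  have hm [measurable]: "h \<in> borel_measurable M" unfolding h_def[abs_def] by measurable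
  have h_B: "\<bar>h \<omega>\<bar> \<le> B" if "\<omega> \<in> space M" for \<omega>
  proof (cases "convergent (\<lambda>j. g j \<omega>)")
    case True
    show ?thesis
      by (rule LIMSEQ_le_const2[OF tendsto_rabs[OF h_lim[OF True]]]) (use Cl_B[OF g(1) that] in auto)
  qed (use B0 in \<open>simp add: h_def\<close>)
  have AElim: "AE \<omega> in M. (\<lambda>j. g j \<omega>) \<longlonglongrightarrow> h \<omega>"
    using conv by eventually_elim (rule h_lim)
  have Eh: "(\<lambda>j. expectation (\<lambda>\<omega>. g j \<omega>)) \<longlonglongrightarrow> expectation h"
    by (rule integral_dominated_convergence[where w="\<lambda>_. B"]) (use AElim Cl_B[OF g(1)] in auto)
  moreover have "expectation (\<lambda>\<omega>. g j \<omega>) = expectation f" for j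
    using g(1)[of j] by (simp add: Cl_def)
  ultimately have Ehf: "expectation h = expectation f"
    using LIMSEQ_unique[OF _ tendsto_const] by fastforce
  \<comment> \<open>The translate of a near minimiser is a near minimiser as well, hence close to
    it; the limit is therefore invariant.\<close>
  have inv: "AE \<omega> in M. h (\<tau> z \<omega>) = h \<omega>" for z
  proof -
    have le: "(\<integral>\<^sup>+\<omega>. ennreal ((h (\<tau> z \<omega>) - h \<omega>)\<^sup>2) \<partial>M) \<le> ennreal (4 / 16 ^ j)" for j :: nat
    proof (rule nn_integral_Fatou_le)
      show "AE \<omega> in M. (\<lambda>i. ennreal ((g i (\<tau> z \<omega>) - g i \<omega>)\<^sup>2)) \<longlonglongrightarrow> ennreal ((h (\<tau> z \<omega>) - h \<omega>)\<^sup>2)"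
        using AElim AE_tau[OF AElim, of z]
        by eventually_elim (intro tendsto_ennrealI tendsto_intros)
      have "(\<integral>\<^sup>+\<omega>. ennreal ((g i (\<tau> z \<omega>) - g i \<omega>)\<^sup>2) \<partial>M) \<le> ennreal (4 / 16 ^ j)" if "j \<le> i" for i
      proof (rule close[OF trans[OF g(1)] g(1)])
        have "N (\<lambda>\<omega>. g i (\<tau> z \<omega>)) = N (g i)"
          unfolding N_def by (rule integral_tau) measurable
        then show "N (\<lambda>\<omega>. g i (\<tau> z \<omega>)) \<le> a + 1 / 16 ^ j" "N (g i) \<le> a + 1 / 16 ^ j"
          using g(2)[of i] pw[OF that] by auto
      qed
      then show "\<forall>\<^sub>F i in sequentially. (\<integral>\<^sup>+\<omega>. ennreal ((g i (\<tau> z \<omega>) - g i \<omega>)\<^sup>2) \<partial>M) \<le> ennreal (4 / 16 ^ j)"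
        by (auto simp: eventually_sequentially)
    qed measurable
    have "(\<integral>\<^sup>+\<omega>. ennreal ((h (\<tau> z \<omega>) - h \<omega>)\<^sup>2) \<partial>M) \<le> ennreal 0"
    proof (rule LIMSEQ_le_const)
      show "(\<lambda>j. ennreal (4 / 16 ^ j)) \<longlonglongrightarrow> ennreal 0"
        by (intro tendsto_ennrealI LIMSEQ_divide_realpow_zero) simp
    qed (use le in auto)
    then have "AE \<omega> in M. ennreal ((h (\<tau> z \<omega>) - h \<omega>)\<^sup>2) = 0"
      by (subst nn_integral_0_iff_AE[symmetric]) auto
    then show ?thesis by eventually_elim simp
  qed
  have hc: "AE \<omega> in M. h \<omega> = expectation f"
    using invariant_AE_const[OF hm h_B inv] unfolding Ehf .
  have "(\<lambda>j. expectation (\<lambda>\<omega>. \<bar>g j \<omega> - expectation f\<bar>)) \<longlonglongrightarrow> expectation (\<lambda>_. 0)"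
  proof (rule integral_dominated_convergence[where w="\<lambda>_. B + \<bar>expectation f\<bar>"])
    show "AE \<omega> in M. (\<lambda>j. \<bar>g j \<omega> - expectation f\<bar>) \<longlonglongrightarrow> 0"
      using AElim hc
    proof eventually_elim
      case (elim \<omega>)
      have "(\<lambda>j. \<bar>g j \<omega> - expectation f\<bar>) \<longlonglongrightarrow> \<bar>h \<omega> - expectation f\<bar>"
        by (intro tendsto_intros elim)
      then show ?case using elim by simp
    qed
    have "norm \<bar>g j \<omega> - expectation f\<bar> \<le> B + \<bar>expectation f\<bar>" if "\<omega> \<in> space M" for j \<omega>
      using Cl_B[OF g(1) that, of j] by simp
    then show "\<And>j. AE \<omega> in M. norm \<bar>g j \<omega> - expectation f\<bar> \<le> B + \<bar>expectation f\<bar>" by auto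
  qed auto
  then have "eventually (\<lambda>j. expectation (\<lambda>\<omega>. \<bar>g j \<omega> - expectation f\<bar>) < \<eta>) sequentially"
    using \<eta> by (intro order_tendstoD) auto
  then obtain j where "expectation (\<lambda>\<omega>. \<bar>g j \<omega> - expectation f\<bar>) < \<eta>"
    using eventually_happens' sequentially_bot by blast
  then show thesis using that[of "g j"] g(1)[of j] by (auto simp: Cl_def)
qed

text \<open>Truncation makes f bounded; a nearly constant g with the same asymptotic orbit averages
  differs from the truncation by a p whose averages vanish in the limit at every point. What remains
  of f is small in mean, the norm that the maximal inequality controls.\<close>

lemma decomposition:
  fixes \<phi> :: "'a \<Rightarrow> real" and f :: "'w \<Rightarrow> real"
  assumes \<phi>: "integrable lborel \<phi>"
    and cont: "\<And>z. ((\<lambda>e. LINT x|lborel. \<bar>\<phi> (x - e *\<^sub>R z) - \<phi> x\<bar>) \<longlongrightarrow> 0) (at_right 0)"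
    and f: "integrable M f" and \<eta>: "0 < \<eta>"
  obtains p B where "p \<in> borel_measurable M" "\<And>\<omega>. \<omega> \<in> space M \<Longrightarrow> \<bar>p \<omega>\<bar> \<le> B"
    "\<And>\<omega>. \<omega> \<in> space M \<Longrightarrow> ((\<lambda>e. orb \<phi> p e \<omega>) \<longlongrightarrow> 0) (at_right 0)"
    "expectation (\<lambda>\<omega>. \<bar>f \<omega> - expectation f - p \<omega>\<bar>) < \<eta>"
proof -
  have fm [measurable]: "f \<in> borel_measurable M" using f by auto
  define t where "t k \<omega> = max (- real k) (min (real k) (f \<omega>))" for k :: nat and \<omega>
  have tm [measurable]: "t k \<in> borel_measurable M" for k unfolding t_def[abs_def] by measurable
  have tB: "\<bar>t k \<omega>\<bar> \<le> real k" for k \<omega> by (auto simp: t_def)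
  have ti: "integrable M (t k)" for k
    by (rule integrable_const_bound[of _ "real k"]) (use tB in auto)
  have "(\<lambda>k. expectation (\<lambda>\<omega>. \<bar>f \<omega> - t k \<omega>\<bar>)) \<longlonglongrightarrow> expectation (\<lambda>_. 0)"
  proof (rule integral_dominated_convergence[where w="\<lambda>\<omega>. \<bar>f \<omega>\<bar>"])
    show "AE \<omega> in M. (\<lambda>k. \<bar>f \<omega> - t k \<omega>\<bar>) \<longlonglongrightarrow> 0"
    proof (intro AE_I2 tendsto_eventually)
      fix \<omega>
      show "\<forall>\<^sub>F k in sequentially. \<bar>f \<omega> - t k \<omega>\<bar> = 0"
        using eventually_ge_at_top[of "nat \<lceil>\<bar>f \<omega>\<bar>\<rceil>"]
      proof eventually_elim
        case (elim k)
        then have "\<bar>f \<omega>\<bar> \<le> real k" by linarith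
        then show ?case by (auto simp: t_def)
      qed
    qed
  qed (use f in \<open>auto simp: t_def\<close>)
  \<comment> \<open>The truncation error enters twice, for f itself and for the expectation, with
    \<eta>/4 each; the remaining \<eta>/2 goes to the distance of g from a constant.\<close>
  then have "eventually (\<lambda>k. expectation (\<lambda>\<omega>. \<bar>f \<omega> - t k \<omega>\<bar>) < \<eta> / 4) sequentially"
    using \<eta> by (intro order_tendstoD) auto
  then obtain k where k: "expectation (\<lambda>\<omega>. \<bar>f \<omega> - t k \<omega>\<bar>) < \<eta> / 4"
    using eventually_happens' sequentially_bot by blast
  obtain g where g: "g \<in> borel_measurable M" "\<And>\<omega>. \<omega> \<in> space M \<Longrightarrow> \<bar>g \<omega>\<bar> \<le> real k"
    "\<And>\<omega>. \<omega> \<in> space M \<Longrightarrow> ((\<lambda>e. orb \<phi> g e \<omega> - orb \<phi> (t k) e \<omega>) \<longlongrightarrow> 0) (at_right 0)"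
    "expectation (\<lambda>\<omega>. \<bar>g \<omega> - expectation (t k)\<bar>) < \<eta> / 2"
    by (rule mean_approx_bounded[OF \<phi> cont tm, of k "real k" "\<eta> / 2"]) (use tB \<eta> in auto)
  note [measurable] = g(1)
  have gi: "integrable M g"
    by (rule integrable_const_bound[of _ "real k"]) (use g(2) in auto)
  show thesis
  proof (rule that[of "\<lambda>\<omega>. t k \<omega> - g \<omega>" "2 * real k"])
    show "\<bar>t k \<omega> - g \<omega>\<bar> \<le> 2 * real k" if "\<omega> \<in> space M" for \<omega>
      using g(2)[OF that] tB[of k \<omega>] by linarith
    show "((\<lambda>e. orb \<phi> (\<lambda>\<omega>. t k \<omega> - g \<omega>) e \<omega>) \<longlongrightarrow> 0) (at_right 0)" if w: "\<omega> \<in> space M" for \<omega>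
    proof -
      have "orb \<phi> (\<lambda>\<omega>. t k \<omega> - g \<omega>) e \<omega> = - (orb \<phi> g e \<omega> - orb \<phi> (t k) e \<omega>)" for e
        unfolding orb_def
        using orb_integrable[OF \<phi> tm tB w] orb_integrable[OF \<phi> g(1,2) w]
        by (simp add: right_diff_distrib)
      then show ?thesis using tendsto_minus[OF g(3)[OF w]] by simp
    qed
    have "\<bar>expectation (t k) - expectation f\<bar> = \<bar>expectation (\<lambda>\<omega>. f \<omega> - t k \<omega>)\<bar>"
      using f ti by simp
    also have "\<dots> \<le> expectation (\<lambda>\<omega>. \<bar>f \<omega> - t k \<omega>\<bar>)" by (rule integral_abs_bound)
    finally have c: "\<bar>expectation (t k) - expectation f\<bar> < \<eta> / 4" using k by linarith
    have "expectation (\<lambda>\<omega>. \<bar>f \<omega> - expectation f - (t k \<omega> - g \<omega>)\<bar>) \<le>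
       expectation (\<lambda>\<omega>. \<bar>f \<omega> - t k \<omega>\<bar> + \<bar>g \<omega> - expectation (t k)\<bar> + \<bar>expectation (t k) - expectation f\<bar>)"
      using f ti gi by (intro integral_mono) auto
    also have "\<dots> = expectation (\<lambda>\<omega>. \<bar>f \<omega> - t k \<omega>\<bar>) + expectation (\<lambda>\<omega>. \<bar>g \<omega> - expectation (t k)\<bar>) + \<bar>expectation (t k) - expectation f\<bar>"
      using f ti gi by (simp add: prob_space)
    also have "\<dots> < \<eta>" using k g(4) c by linarith
    finally show "expectation (\<lambda>\<omega>. \<bar>f \<omega> - expectation f - (t k \<omega> - g \<omega>)\<bar>) < \<eta>" .
  qed measurable
qed


end

section \<open>Almost sure convergence of orbit averages\<close>

lemma dyadic_scale:
  assumes "1 \<le> (x::real)"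
  obtains n :: nat where "x \<le> 2 ^ n" "2 ^ n \<le> 2 * x"
proof -
  obtain k where "x < 2 ^ k" using real_arch_pow[of 2 x] by auto
  then have ex: "\<exists>n. x \<le> 2 ^ n" by (auto intro: less_imp_le)
  define n where "n = (LEAST n. x \<le> 2 ^ n)"
  have n: "x \<le> 2 ^ n" unfolding n_def by (rule LeastI_ex[OF ex])
  have "2 ^ n \<le> 2 * x"
  proof (cases n)
    case (Suc k)
    then have "\<not> x \<le> 2 ^ k" unfolding n_def using not_less_Least[of k "\<lambda>n. x \<le> 2 ^ n"] by simp
    then show ?thesis using Suc by simp
  qed (use assms in simp)
  with n show thesis using that by blast
qed

context ergodic_environment
begin

text \<open>The support rescales to the ball of radius R/e, which a dyadic ball of radius at most 2
  R/e contains; the volume factor e^d then cancels and the bound is uniform in e.\<close>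

lemma orb_bound:
  fixes \<phi> :: "'a \<Rightarrow> real" and q :: "'w \<Rightarrow> real"
  assumes [measurable]: "\<phi> \<in> borel_measurable borel" "q \<in> borel_measurable M"
    and b: "\<And>x. \<bar>\<phi> x\<bar> \<le> b" "\<And>x. R < norm x \<Longrightarrow> \<phi> x = 0" and \<omega>: "\<omega> \<in> space M"
    and l: "0 \<le> l" "\<And>n. ball_int n (\<lambda>\<omega>. ennreal \<bar>q \<omega>\<bar>) \<omega> \<le> ennreal (l * (2 ^ n) ^ DIM('a))"
    and e: "0 < e" "e \<le> R"
  shows "(\<integral>\<^sup>+x. ennreal \<bar>\<phi> x * q (\<tau> (x /\<^sub>R e) \<omega>)\<bar> \<partial>lborel) \<le> ennreal (b * (2 * R) ^ DIM('a) * l)"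
proof -
  have b0: "0 \<le> b" using b(1)[of 0] by linarith
  have "1 \<le> R / e" using e by simp
  then obtain n :: nat where n: "R / e \<le> 2 ^ n" "2 ^ n \<le> 2 * (R / e)"
    by (rule dyadic_scale)
  let ?h = "\<lambda>y. indicator (cball 0 (2 ^ n)) y * ennreal \<bar>q (\<tau> y \<omega>)\<bar>"
  have "(\<integral>\<^sup>+x. ennreal \<bar>\<phi> x * q (\<tau> (x /\<^sub>R e) \<omega>)\<bar> \<partial>lborel) \<le> (\<integral>\<^sup>+x. ennreal b * ?h (x /\<^sub>R e) \<partial>lborel)"
  proof (intro nn_integral_mono)
    fix x :: 'a
    show "ennreal \<bar>\<phi> x * q (\<tau> (x /\<^sub>R e) \<omega>)\<bar> \<le> ennreal b * ?h (x /\<^sub>R e)"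
    proof (cases "norm x \<le> R")
      case True
      have "norm (x /\<^sub>R e) \<le> R / e" using True e by (simp add: field_simps)
      then have "x /\<^sub>R e \<in> cball 0 (2 ^ n)" using n(1) by simp
      then have "ennreal b * ?h (x /\<^sub>R e) = ennreal (b * \<bar>q (\<tau> (x /\<^sub>R e) \<omega>)\<bar>)"
        using b0 by (simp add: ennreal_mult)
      then show ?thesis using b(1)[of x] by (auto simp: abs_mult intro!: ennreal_leI mult_right_mono)
    qed (use b in simp)
  qed
  also have "\<dots> = ennreal b * (\<integral>\<^sup>+x. ?h (x /\<^sub>R e) \<partial>lborel)"
    using \<omega> by (intro nn_integral_cmult) measurable
  also have "(\<integral>\<^sup>+x. ?h (x /\<^sub>R e) \<partial>lborel) = ennreal (e ^ DIM('a)) * (\<integral>\<^sup>+x. ?h x \<partial>lborel)"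
    using \<omega> by (intro nn_integral_lborel_scale e) measurable
  also have "(\<integral>\<^sup>+x. ?h x \<partial>lborel) = ball_int n (\<lambda>\<omega>. ennreal \<bar>q \<omega>\<bar>) \<omega>"
    by (simp add: ball_int_def)
  also have "ennreal b * (ennreal (e ^ DIM('a)) * ball_int n (\<lambda>\<omega>. ennreal \<bar>q \<omega>\<bar>) \<omega>) \<le>
      ennreal b * (ennreal (e ^ DIM('a)) * ennreal (l * (2 ^ n) ^ DIM('a)))"
    by (intro mult_left_mono l) auto
  also have "\<dots> = ennreal (b * l * (e * 2 ^ n) ^ DIM('a))"
    using b0 l e by (simp add: ennreal_mult[symmetric] power_mult_distrib mult_ac)
  also have "\<dots> \<le> ennreal (b * l * (2 * R) ^ DIM('a))"
    using b0 l e n(2) by (intro ennreal_leI mult_left_mono power_mono) (auto simp: field_simps)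
  finally show ?thesis by (simp add: mult_ac)
qed

text \<open>Banach's principle: averages of the good part p tend to 0 everywhere, and off a set of
  small probability the maximal inequality bounds the averages of the remainder uniformly in small
  e.\<close>

theorem pointwise_ergodic:
  fixes \<phi> :: "'a \<Rightarrow> real" and f :: "'w \<Rightarrow> real"
  assumes \<phi>m [measurable]: "\<phi> \<in> borel_measurable borel"
    and b: "\<And>x. \<bar>\<phi> x\<bar> \<le> b" and R: "0 < R" "\<And>x. R < norm x \<Longrightarrow> \<phi> x = 0"
    and cont: "\<And>z. ((\<lambda>e. LINT x|lborel. \<bar>\<phi> (x - e *\<^sub>R z) - \<phi> x\<bar>) \<longlongrightarrow> 0) (at_right 0)"
    and f: "integrable M f"
  shows "AE \<omega> in M. ((\<lambda>e. orb \<phi> f e \<omega>) \<longlongrightarrow> expectation f * (LINT x|lborel. \<phi> x)) (at_right 0)"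
proof -
  have \<phi>: "integrable lborel \<phi>" by (rule bounded_support_integrable[OF \<phi>m b R(2)])
  have b0: "0 \<le> b" using b[of 0] by linarith
  have fm [measurable]: "f \<in> borel_measurable M" using f by auto
  \<comment> \<open>k stands for accuracy and i for confidence: a mean error of 1/((k + 1)(i + 1))
    and the threshold 1/(k + 1) leave an exceptional set of probability at most C/(i + 1).\<close>
  define P where "P k i p \<longleftrightarrow> p \<in> borel_measurable M \<and> (\<exists>B. \<forall>\<omega>\<in>space M. \<bar>p \<omega>\<bar> \<le> B) \<and>
     (\<forall>\<omega>\<in>space M. ((\<lambda>e. orb \<phi> p e \<omega>) \<longlongrightarrow> 0) (at_right 0)) \<and>
     expectation (\<lambda>\<omega>. \<bar>f \<omega> - expectation f - p \<omega>\<bar>) < 1 / (real (Suc k) * real (Suc i))" for k i p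
  have "\<exists>p. P k i p" for k i
  proof -
    have pos: "0 < 1 / (real (Suc k) * real (Suc i))" by simp
    obtain p B where "p \<in> borel_measurable M" "\<And>\<omega>. \<omega> \<in> space M \<Longrightarrow> \<bar>p \<omega>\<bar> \<le> B"
      "\<And>\<omega>. \<omega> \<in> space M \<Longrightarrow> ((\<lambda>e. orb \<phi> p e \<omega>) \<longlongrightarrow> 0) (at_right 0)"
      "expectation (\<lambda>\<omega>. \<bar>f \<omega> - expectation f - p \<omega>\<bar>) < 1 / (real (Suc k) * real (Suc i))"
      by (rule decomposition[OF \<phi> cont f pos]) (rule that; assumption)
    then have "P k i p" unfolding P_def by blast
    then show ?thesis by blast
  qed
  then obtain p where P: "\<And>k i. P k i (p k i)" by metis
  have pm [measurable]: "p k i \<in> borel_measurable M"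
    and pB: "\<exists>B. \<forall>\<omega>\<in>space M. \<bar>p k i \<omega>\<bar> \<le> B"
    and p0: "\<And>\<omega>. \<omega> \<in> space M \<Longrightarrow> ((\<lambda>e. orb \<phi> (p k i) e \<omega>) \<longlongrightarrow> 0) (at_right 0)"
    and pE: "expectation (\<lambda>\<omega>. \<bar>f \<omega> - expectation f - p k i \<omega>\<bar>) < 1 / (real (Suc k) * real (Suc i))"
    for k i using P[of k i] unfolding P_def by blast+
  define q where "q k i \<omega> = f \<omega> - expectation f - p k i \<omega>" for k i \<omega>
  have qm [measurable]: "q k i \<in> borel_measurable M" for k i unfolding q_def[abs_def] by measurable
  define C where "C = unit_ball_vol DIM('a) * 10 ^ DIM('a)"
  have C0: "C \<ge> 0" by (simp add: C_def)
  define Ex where "Ex k i = (\<Union>N. exceed (1 / Suc k) (\<lambda>\<omega>. ennreal \<bar>q k i \<omega>\<bar>) N)" for k i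
  have Ex_m [measurable]: "Ex k i \<in> sets M" for k i unfolding Ex_def by measurable
  have Ex_le: "emeasure M (Ex k i) \<le> ennreal (C / Suc i)" for k i
  proof -
    obtain B where B: "\<And>\<omega>. \<omega> \<in> space M \<Longrightarrow> \<bar>p k i \<omega>\<bar> \<le> B" using pB[of k i] by blast
    have pint: "integrable M (p k i)" by (rule integrable_const_bound[of _ B]) (use B in auto)
    have "ennreal (1 / Suc k) * emeasure M (Ex k i) \<le> ennreal C * (\<integral>\<^sup>+\<omega>. ennreal \<bar>q k i \<omega>\<bar> \<partial>M)"
      unfolding Ex_def C_def by (rule maximal_inequality) auto
    also have "(\<integral>\<^sup>+\<omega>. ennreal \<bar>q k i \<omega>\<bar> \<partial>M) = ennreal (expectation (\<lambda>\<omega>. \<bar>q k i \<omega>\<bar>))"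
      using f pint by (intro nn_integral_eq_integral) (auto simp: q_def)
    also have "ennreal C * ennreal (expectation (\<lambda>\<omega>. \<bar>q k i \<omega>\<bar>)) \<le> ennreal C * ennreal (1 / (real (Suc k) * real (Suc i)))"
      using pE[of k i] by (intro mult_left_mono ennreal_leI) (auto simp: q_def)
    also have "\<dots> = ennreal (1 / Suc k) * ennreal (C / Suc i)"
      using C0 by (simp add: ennreal_mult[symmetric])
    finally show ?thesis
      by (subst (asm) ennreal_mult_le_mult_iff) (auto simp: ennreal_eq_0_iff)
  qed
  \<comment> \<open>For each k the exceptional sets are intersected over i, which gives a null set;
    a path outside it is good for some i, and accuracy k asks for no more.\<close>
  have "AE \<omega> in M. \<forall>k. \<omega> \<notin> (\<Inter>i. Ex k i)"
    unfolding AE_all_countable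
  proof
    fix k
    have "emeasure M (\<Inter>i. Ex k i) \<le> ennreal 0"
    proof (rule LIMSEQ_le_const)
      have "(\<lambda>i. C * (1 / real (Suc i))) \<longlonglongrightarrow> C * 0"
        by (intro tendsto_intros LIMSEQ_Suc[OF lim_1_over_n])
      then show "(\<lambda>i. ennreal (C / Suc i)) \<longlonglongrightarrow> ennreal 0"
        by (intro tendsto_ennrealI) simp
      have "emeasure M (\<Inter>i. Ex k i) \<le> ennreal (C / Suc i)" for i
        by (rule order_trans[OF emeasure_mono Ex_le[of k i]]) auto
      then show "\<exists>N. \<forall>i\<ge>N. emeasure M (\<Inter>i. Ex k i) \<le> ennreal (C / Suc i)" by blast
    qed
    then have "(\<Inter>i. Ex k i) \<in> null_sets M" by (auto simp: null_sets_def)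
    from AE_not_in[OF this] show "AE \<omega> in M. \<omega> \<notin> (\<Inter>i. Ex k i)" .
  qed
  then show ?thesis
    using AE_space
  proof eventually_elim
    case (elim \<omega>)
    note w = elim(2)
    let ?D = "b * (2 * R) ^ DIM('a)"
    have D0: "0 \<le> ?D" using b0 R(1) by simp
    let ?c = "expectation f * (LINT x|lborel. \<phi> x)"
    have ev: "\<forall>\<^sub>F e in at_right 0. \<bar>orb \<phi> f e \<omega> - ?c\<bar> \<le> (?D + 1) / Suc k" for k
    proof -
      obtain i where i: "\<omega> \<notin> Ex k i" using elim(1) by blast
      obtain B where B: "\<And>\<omega>. \<omega> \<in> space M \<Longrightarrow> \<bar>p k i \<omega>\<bar> \<le> B" using pB[of k i] by blast
      have l: "ball_int n (\<lambda>\<omega>. ennreal \<bar>q k i \<omega>\<bar>) \<omega> \<le> ennreal (1 / Suc k * (2 ^ n) ^ DIM('a))" for n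
        using i w unfolding Ex_def exceed_def by (auto simp: not_less)
      have "\<forall>\<^sub>F e in at_right 0. \<bar>orb \<phi> (p k i) e \<omega>\<bar> < 1 / Suc k"
        using tendstoD[OF p0[OF w, of k i], of "1 / Suc k"] by (simp add: dist_real_def)
      moreover have "\<forall>\<^sub>F e in at_right 0. 0 < e \<and> e \<le> R"
        using R(1) by (intro eventually_at_rightI[of 0 R]) auto
      ultimately show ?thesis
      proof eventually_elim
        case (elim e)
        let ?q = "\<lambda>x. \<phi> x * q k i (\<tau> (x /\<^sub>R e) \<omega>)"
        have qb: "(\<integral>\<^sup>+x. ennreal \<bar>?q x\<bar> \<partial>lborel) \<le> ennreal (?D * (1 / Suc k))"
          using elim(2) by (intro orb_bound b R(2) w l) auto
        have [measurable]: "?q \<in> borel_measurable lborel" using w by measurable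
        have qi: "integrable lborel ?q"
          by (rule integrableI_bounded) (use le_less_trans[OF qb ennreal_less_top] in auto)
        have pi: "integrable lborel (\<lambda>x. \<phi> x * p k i (\<tau> (x /\<^sub>R e) \<omega>))"
          by (rule orb_integrable[OF \<phi> pm B w])
        have "orb \<phi> f e \<omega> = (LINT x|lborel. \<phi> x * expectation f + \<phi> x * p k i (\<tau> (x /\<^sub>R e) \<omega>) + ?q x)"
          unfolding orb_def q_def by (intro Bochner_Integration.integral_cong) (auto simp: algebra_simps)
        also have "\<dots> = ?c + orb \<phi> (p k i) e \<omega> + (LINT x|lborel. ?q x)"
          unfolding orb_def using \<phi> pi qi by simp
        finally have "orb \<phi> f e \<omega> - ?c = orb \<phi> (p k i) e \<omega> + (LINT x|lborel. ?q x)" by simp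
        moreover have "\<bar>LINT x|lborel. ?q x\<bar> \<le> ?D * (1 / Suc k)"
        proof -
          have "ennreal \<bar>LINT x|lborel. ?q x\<bar> \<le> (\<integral>\<^sup>+x. ennreal \<bar>?q x\<bar> \<partial>lborel)"
            using integral_norm_bound_ennreal[OF qi] by simp
          also note qb
          finally show ?thesis using D0 by (subst (asm) ennreal_le_iff) auto
        qed
        ultimately have "\<bar>orb \<phi> f e \<omega> - ?c\<bar> \<le> 1 / Suc k + ?D * (1 / Suc k)"
          using elim(1) by linarith
        also have "\<dots> = (?D + 1) / Suc k" by (simp add: add_divide_distrib)
        finally show ?case .
      qed
    qed
    show ?case
    proof (rule tendstoI)
      fix r :: real assume "0 < r"
      have "(\<lambda>k. (?D + 1) * (1 / real (Suc k))) \<longlonglongrightarrow> (?D + 1) * 0"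
        by (intro tendsto_intros LIMSEQ_Suc[OF lim_1_over_n])
      then have "\<forall>\<^sub>F k in sequentially. (?D + 1) * (1 / real (Suc k)) < r"
        using \<open>0 < r\<close> by (intro order_tendstoD) auto
      then obtain k where "(?D + 1) * (1 / real (Suc k)) < r"
        using eventually_happens' sequentially_bot by blast
      then show "\<forall>\<^sub>F e in at_right 0. dist (orb \<phi> f e \<omega>) ?c < r"
        using ev[of k] by (auto simp: dist_real_def elim!: eventually_mono)
    qed
  qed
qed

text \<open>The boundary of a box is null, and off it the indicator is locally constant; since the
  shifts are bounded, all differences are supported in one ball.\<close>

lemma box_translate:
  fixes z a b :: 'a
  shows "((\<lambda>e. LINT x|lborel. \<bar>indicator (box a b) (x - e *\<^sub>R z) - indicator (box a b) x :: real\<bar>) \<longlongrightarrow> 0) (at_right 0)"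
  unfolding at_right_0_iff_sequentially
proof (intro allI impI)
  fix e :: "nat \<Rightarrow> real" assume e: "\<forall>n. 0 < e n" "e \<longlonglongrightarrow> 0"
  let ?I = "indicator (box a b) :: 'a \<Rightarrow> real"
  obtain R where R: "\<And>x. x \<in> box a b \<Longrightarrow> norm x \<le> R" using bounded_box[of a b] unfolding bounded_iff by auto
  obtain E where E: "\<And>n. norm (e n) \<le> E"
    using convergent_imp_Bseq[OF convergentI[OF e(2)]] by (rule BseqE) blast
  let ?C = "cball (0::'a) (R + E * norm z)"
  have lim: "(\<lambda>n. x - e n *\<^sub>R z) \<longlonglongrightarrow> x" for x
    using tendsto_diff[OF tendsto_const tendsto_scaleR[OF e(2) tendsto_const]] by simp
  have "(\<lambda>n. LINT x|lborel. \<bar>?I (x - e n *\<^sub>R z) - ?I x\<bar>) \<longlonglongrightarrow> (LINT x|(lborel::'a measure). 0)"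
  proof (rule integral_dominated_convergence[where w="indicator ?C"])
    have "negligible (frontier (box a b))"
      by (rule negligible_convex_frontier) (rule convex_box)
    then obtain N where N: "N \<in> null_sets lborel" "frontier (box a b) \<subseteq> N"
      unfolding negligible_iff_null_sets null_sets_completion_iff2 by blast
    show "AE x in lborel. (\<lambda>n. \<bar>?I (x - e n *\<^sub>R z) - ?I x\<bar>) \<longlonglongrightarrow> 0"
      using AE_not_in[OF N(1)]
    proof eventually_elim
      case (elim x)
      then have "x \<in> box a b \<or> x \<in> - closure (box a b)"
        using N(2) by (auto simp: frontier_def interior_open[OF open_box])
      then have "\<forall>\<^sub>F n in sequentially. ?I (x - e n *\<^sub>R z) = ?I x"
      proof
        assume x: "x \<in> box a b"
        have "\<forall>\<^sub>F n in sequentially. x - e n *\<^sub>R z \<in> box a b"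
          by (rule topological_tendstoD[OF lim open_box x])
        then show ?thesis by eventually_elim (use x in simp)
      next
        assume x: "x \<in> - closure (box a b)"
        have "\<forall>\<^sub>F n in sequentially. x - e n *\<^sub>R z \<in> - closure (box a b)"
          by (rule topological_tendstoD[OF lim _ x]) auto
        then show ?thesis
          by eventually_elim (use x closure_subset[of "box a b"] in \<open>auto simp: indicator_def\<close>)
      qed
      then have "\<forall>\<^sub>F n in sequentially. \<bar>?I (x - e n *\<^sub>R z) - ?I x\<bar> = 0" by eventually_elim simp
      then show ?case by (rule tendsto_eventually)
    qed
    have "norm \<bar>?I (x - e n *\<^sub>R z) - ?I x\<bar> \<le> indicator ?C x" for n x
    proof -
      have ez: "norm (e n *\<^sub>R z) \<le> E * norm z" using E[of n] by (simp add: mult_right_mono)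
      have "norm x \<le> R + E * norm z" if "x - e n *\<^sub>R z \<in> box a b"
        using R[OF that] ez norm_triangle_ineq[of "x - e n *\<^sub>R z" "e n *\<^sub>R z"] by simp
      moreover have "norm x \<le> R + E * norm z" if "x \<in> box a b"
        using R[OF that] ez norm_ge_zero[of "e n *\<^sub>R z"] by linarith
      ultimately show ?thesis by (auto simp: indicator_def)
    qed
    then show "\<And>n. AE x in lborel. norm \<bar>?I (x - e n *\<^sub>R z) - ?I x\<bar> \<le> indicator ?C x" by simp
    show "integrable lborel (indicator ?C :: 'a \<Rightarrow> real)"
      using emeasure_lborel_cball_finite[of "0::'a"] by (intro integrable_real_indicator) auto
  qed auto
  then show "(\<lambda>n. LINT x|lborel. \<bar>?I (x - e n *\<^sub>R z) - ?I x\<bar>) \<longlonglongrightarrow> 0" by simp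
qed

end

section \<open>Weak convergence of densities\<close>

text \<open>\<open>rho_ui\<close> is uniform integrability on balls, expressed by the excess over a
  level N. It is required for small e only, since it will come from an ergodic limit.\<close>

locale ui_density =
  fixes \<rho> :: "real \<Rightarrow> 'a::euclidean_space \<Rightarrow> real"
  assumes rho_measurable [measurable]: "\<And>e. \<rho> e \<in> borel_measurable borel"
    and rho_nonneg: "\<And>e x. 0 \<le> \<rho> e x"
    and rho_fin: "\<And>e R. 0 < e \<Longrightarrow> (\<integral>\<^sup>+x. indicator (cball 0 R) x * ennreal (\<rho> e x) \<partial>lborel) < \<infinity>"
    and rho_ui: "\<And>R \<delta>. 0 < \<delta> \<Longrightarrow> \<exists>N::nat. \<forall>\<^sub>F e in at_right 0.
      (\<integral>\<^sup>+x. indicator (cball 0 R) x * ennreal (max 0 (\<rho> e x - real N)) \<partial>lborel) \<le> ennreal \<delta>"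
begin

lemma mult_rho_integrable:
  assumes [measurable]: "u \<in> borel_measurable borel" and B: "AE x in lborel. \<bar>u x\<bar> \<le> B"
    and R: "\<And>x. R < norm x \<Longrightarrow> u x = 0" and e: "0 < e"
  shows "integrable lborel (\<lambda>x. u x * \<rho> e x)"
proof -
  have "integrable lborel (\<lambda>x. indicator (cball 0 R) x * \<rho> e x :: real)"
  proof (rule integrableI_nonneg)
    have "(\<integral>\<^sup>+x. ennreal (indicator (cball 0 R) x * \<rho> e x) \<partial>lborel) =
      (\<integral>\<^sup>+x. indicator (cball 0 R) x * ennreal (\<rho> e x) \<partial>lborel)"
      by (intro nn_integral_cong) (auto simp: indicator_def)
    then show "(\<integral>\<^sup>+x. ennreal (indicator (cball 0 R) x * \<rho> e x) \<partial>lborel) < \<infinity>"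
      using rho_fin[OF e, of R] by simp
  qed (auto simp: rho_nonneg)
  then have *: "integrable lborel (\<lambda>x. B * (indicator (cball 0 R) x * \<rho> e x))"
    by (rule integrable_mult_right)
  show ?thesis
  proof (rule Bochner_Integration.integrable_bound[OF *])
    show "AE x in lborel. norm (u x * \<rho> e x) \<le> norm (B * (indicator (cball 0 R) x * \<rho> e x))"
      using B
    proof eventually_elim
      case (elim x)
      then show ?case
        using R[of x] rho_nonneg[of e x]
        by (cases "norm x \<le> R") (auto simp: abs_mult intro!: mult_right_mono)
    qed
  qed auto
qed

text \<open>Split \<rho> at level N: |u| \<rho> is at most N |u| + B max 0 (\<rho> - N). Smallness
  of u in L1 handles the first part, uniform integrability the second.\<close>

lemma mult_rho_small:
  assumes [measurable]: "u \<in> borel_measurable borel" and B: "AE x in lborel. \<bar>u x\<bar> \<le> B" "0 \<le> B"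
    and R: "\<And>x. R < norm x \<Longrightarrow> u x = 0"
    and N: "(\<integral>\<^sup>+x. indicator (cball 0 R) x * ennreal (max 0 (\<rho> e x - real N)) \<partial>lborel) \<le> ennreal \<delta>"
    and ui: "integrable lborel u" and e: "0 < e" "0 < \<delta>"
  shows "(LINT x|lborel. \<bar>u x * \<rho> e x\<bar>) \<le> real N * (LINT x|lborel. \<bar>u x\<bar>) + B * \<delta>"
proof -
  have i: "integrable lborel (\<lambda>x. u x * \<rho> e x)"
    by (rule mult_rho_integrable[OF _ B(1) R e(1)]) auto
  have le: "AE x in lborel. ennreal \<bar>u x * \<rho> e x\<bar> \<le>
      ennreal (real N) * ennreal \<bar>u x\<bar> + ennreal B * (indicator (cball 0 R) x * ennreal (max 0 (\<rho> e x - real N)))"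
    using B(1)
  proof eventually_elim
    case (elim x)
    show ?case
    proof (cases "norm x \<le> R")
      case True
      have "\<bar>u x\<bar> * \<rho> e x \<le> \<bar>u x\<bar> * (real N + max 0 (\<rho> e x - real N))"
        by (intro mult_left_mono) auto
      also have "\<dots> \<le> real N * \<bar>u x\<bar> + B * max 0 (\<rho> e x - real N)"
        using elim mult_right_mono[OF elim, of "max 0 (\<rho> e x - real N)"] by (simp add: algebra_simps)
      finally have "ennreal (\<bar>u x\<bar> * \<rho> e x) \<le> ennreal (real N * \<bar>u x\<bar> + B * max 0 (\<rho> e x - real N))"
        by (rule ennreal_leI)
      also have "\<dots> = ennreal (real N) * ennreal \<bar>u x\<bar> + ennreal B * ennreal (max 0 (\<rho> e x - real N))"
        using B(2) by (simp add: ennreal_mult)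
      finally show ?thesis using True rho_nonneg[of e x] by (simp add: abs_mult)
    qed (simp add: R)
  qed
  have "ennreal (LINT x|lborel. \<bar>u x * \<rho> e x\<bar>) = (\<integral>\<^sup>+x. ennreal \<bar>u x * \<rho> e x\<bar> \<partial>lborel)"
    using i by (intro nn_integral_eq_integral[symmetric]) auto
  also have "\<dots> \<le> (\<integral>\<^sup>+x. ennreal (real N) * ennreal \<bar>u x\<bar> + ennreal B * (indicator (cball 0 R) x * ennreal (max 0 (\<rho> e x - real N))) \<partial>lborel)"
    by (rule nn_integral_mono_AE[OF le])
  also have "\<dots> = ennreal (real N) * (\<integral>\<^sup>+x. ennreal \<bar>u x\<bar> \<partial>lborel) +
      ennreal B * (\<integral>\<^sup>+x. indicator (cball 0 R) x * ennreal (max 0 (\<rho> e x - real N)) \<partial>lborel)"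
    by (subst nn_integral_add, measurable, subst nn_integral_cmult, measurable, subst nn_integral_cmult, measurable)
  also have "\<dots> \<le> ennreal (real N) * ennreal (LINT x|lborel. \<bar>u x\<bar>) + ennreal B * ennreal \<delta>"
  proof -
    have "(\<integral>\<^sup>+x. ennreal \<bar>u x\<bar> \<partial>lborel) = ennreal (LINT x|lborel. \<bar>u x\<bar>)"
      using ui by (intro nn_integral_eq_integral) auto
    then show ?thesis
      using add_left_mono[OF mult_left_mono[OF N, of "ennreal B"], of "ennreal (real N) * ennreal (LINT x|lborel. \<bar>u x\<bar>)"]
      by simp
  qed
  also have "\<dots> = ennreal (real N * (LINT x|lborel. \<bar>u x\<bar>) + B * \<delta>)"
    using B(2) e(2) by (simp add: ennreal_mult)
  finally show ?thesis
    using B(2) e(2) by (subst (asm) ennreal_le_iff) (auto intro!: add_nonneg_nonneg mult_nonneg_nonneg)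
qed

text \<open>Although the weight varies with n, uniform integrability fixes N before the L1 norms
  tend to 0.\<close>

lemma mult_rho_tendsto_0:
  fixes u :: "nat \<Rightarrow> 'a \<Rightarrow> real" and e :: "nat \<Rightarrow> real"
  assumes um [measurable]: "\<And>n. u n \<in> borel_measurable borel" and B: "\<And>n. AE x in lborel. \<bar>u n x\<bar> \<le> B" "0 \<le> B"
    and R: "\<And>n x. R < norm x \<Longrightarrow> u n x = 0" and ui: "\<And>n. integrable lborel (u n)"
    and lim: "(\<lambda>n. LINT x|lborel. \<bar>u n x\<bar>) \<longlonglongrightarrow> 0"
    and e: "\<And>n. 0 < e n" "e \<longlonglongrightarrow> 0"
  shows "(\<lambda>n. LINT x|lborel. \<bar>u n x * \<rho> (e n) x\<bar>) \<longlonglongrightarrow> 0"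
proof (rule tendstoI)
  fix r :: real assume r: "0 < r"
  \<comment> \<open>The tail part then costs less than r/2; B + 1 avoids dividing by 0.\<close>
  define \<delta> where "\<delta> = r / (2 * (B + 1))"
  have \<delta>: "0 < \<delta>" using r B(2) by (simp add: \<delta>_def)
  have B\<delta>: "B * \<delta> < r / 2" using r B(2) by (simp add: \<delta>_def field_simps)
  obtain N :: nat where N: "\<forall>\<^sub>F s in at_right 0.
      (\<integral>\<^sup>+x. indicator (cball 0 R) x * ennreal (max 0 (\<rho> s x - real N)) \<partial>lborel) \<le> ennreal \<delta>"
    using rho_ui[OF \<delta>] by blast
  have "filterlim e (at_right 0) sequentially"
    using e(2) less_imp_neq[OF e(1), symmetric] by (simp add: filterlim_at e(1))
  from eventually_compose_filterlim[OF N this]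
  have ev: "\<forall>\<^sub>F n in sequentially. (\<integral>\<^sup>+x. indicator (cball 0 R) x * ennreal (max 0 (\<rho> (e n) x - real N)) \<partial>lborel) \<le> ennreal \<delta>" .
  have "(\<lambda>n. real N * (LINT x|lborel. \<bar>u n x\<bar>)) \<longlonglongrightarrow> 0"
    by (rule tendsto_mult_right_zero[OF lim])
  then have "\<forall>\<^sub>F n in sequentially. real N * (LINT x|lborel. \<bar>u n x\<bar>) < r / 2"
    using r by (intro order_tendstoD) auto
  with ev show "\<forall>\<^sub>F n in sequentially. dist (LINT x|lborel. \<bar>u n x * \<rho> (e n) x\<bar>) 0 < r"
  proof eventually_elim
    case (elim n)
    have "(LINT x|lborel. \<bar>u n x * \<rho> (e n) x\<bar>) \<le> real N * (LINT x|lborel. \<bar>u n x\<bar>) + B * \<delta>"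
      by (rule mult_rho_small[OF um B R elim(1) ui e(1) \<delta>])
    moreover have "0 \<le> (LINT x|lborel. \<bar>u n x * \<rho> (e n) x\<bar>)" by simp
    ultimately show ?case using elim(2) B\<delta> by (simp add: dist_real_def)
  qed
qed

text \<open>Weak convergence of the densities to the constant c, tested against u.\<close>

definition wl :: "real \<Rightarrow> ('a \<Rightarrow> real) \<Rightarrow> bool" where
  "wl c u \<longleftrightarrow> ((\<lambda>e. LINT x|lborel. u x * \<rho> e x) \<longlongrightarrow> c * (LINT x|lborel. u x)) (at_right 0)"

text \<open>For bounded functions with a common support, uniform integrability makes the pairing
  with \<rho> continuous in L1 uniformly for small e, so the two limits can be interchanged.\<close>

lemma wl_approx:
  fixes u :: "nat \<Rightarrow> 'a \<Rightarrow> real"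
  assumes um [measurable]: "\<And>n. u n \<in> borel_measurable borel" and B: "\<And>n x. \<bar>u n x\<bar> \<le> B"
    and R: "\<And>n x. R < norm x \<Longrightarrow> u n x = 0"
    and vm [measurable]: "v \<in> borel_measurable borel"
    and lim: "\<And>x. (\<lambda>n. u n x) \<longlonglongrightarrow> v x" and wl: "\<And>n. wl c (u n)"
  shows "wl c v"
proof -
  have B0: "0 \<le> B" using B[of 0 0] by linarith
  have vB: "\<bar>v x\<bar> \<le> B" for x
    by (rule LIMSEQ_le_const2[OF tendsto_rabs[OF lim]]) (use B in auto)
  have vR: "v x = 0" if "R < norm x" for x
    using lim[of x] R[OF that] LIMSEQ_unique[OF _ tendsto_const] by fastforce
  have ui: "integrable lborel (u n)" for n by (rule bounded_support_integrable[OF um B R])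
  have vi: "integrable lborel v" by (rule bounded_support_integrable[OF vm vB vR])
  have L1: "(\<lambda>n. LINT x|lborel. \<bar>u n x - v x\<bar>) \<longlonglongrightarrow> (LINT x|(lborel::'a measure). 0)"
  proof (rule integral_dominated_convergence[where w="\<lambda>x. 2 * B * indicator (cball 0 R) x"])
    show "AE x in lborel. (\<lambda>n. \<bar>u n x - v x\<bar>) \<longlonglongrightarrow> 0"
    proof (intro AE_I2)
      fix x
      have "(\<lambda>n. \<bar>u n x - v x\<bar>) \<longlonglongrightarrow> \<bar>v x - v x\<bar>" by (intro tendsto_intros lim)
      then show "(\<lambda>n. \<bar>u n x - v x\<bar>) \<longlonglongrightarrow> 0" by simp
    qed
    have "norm \<bar>u n x - v x\<bar> \<le> 2 * B * indicator (cball 0 R) x" for n x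
      using B[of n x] vB[of x] R[of x n] vR[of x] by (cases "norm x \<le> R") (auto simp: indicator_def)
    then show "\<And>n. AE x in lborel. norm \<bar>u n x - v x\<bar> \<le> 2 * B * indicator (cball 0 R) x" by simp
    show "integrable lborel (\<lambda>x::'a. 2 * B * indicator (cball 0 R) x)"
      using emeasure_lborel_cball_finite[of "0::'a" R]
      by (intro integrable_mult_right integrable_real_indicator) auto
  qed auto
  show ?thesis unfolding wl_def
  proof (rule tendstoI)
    fix r :: real assume r: "0 < r"
    \<comment> \<open>The difference of two functions bounded by B is bounded by 2 B, hence the 8
      for a share of r/4.\<close>
    define \<delta> where "\<delta> = r / (8 * (B + 1))"
    have \<delta>: "0 < \<delta>" using r B0 by (simp add: \<delta>_def)
    have B\<delta>: "2 * B * \<delta> < r / 4"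
    proof -
      have "B * r < (B + 1) * r" using r by simp
      then show ?thesis using B0 by (simp add: \<delta>_def field_simps)
    qed
    obtain N :: nat where N: "\<forall>\<^sub>F s in at_right 0.
        (\<integral>\<^sup>+x. indicator (cball 0 R) x * ennreal (max 0 (\<rho> s x - real N)) \<partial>lborel) \<le> ennreal \<delta>"
      using rho_ui[OF \<delta>] by blast
    have "(\<lambda>n. (real N + \<bar>c\<bar>) * (LINT x|lborel. \<bar>u n x - v x\<bar>)) \<longlonglongrightarrow> 0"
      using tendsto_mult_right_zero[OF L1[simplified]] .
    then have "\<forall>\<^sub>F n in sequentially. (real N + \<bar>c\<bar>) * (LINT x|lborel. \<bar>u n x - v x\<bar>) < r / 4"
      using r by (intro order_tendstoD) auto
    then obtain n where n: "(real N + \<bar>c\<bar>) * (LINT x|lborel. \<bar>u n x - v x\<bar>) < r / 4"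
      using eventually_happens' sequentially_bot by blast
    have "\<forall>\<^sub>F e in at_right 0. dist (LINT x|lborel. u n x * \<rho> e x) (c * (LINT x|lborel. u n x)) < r / 4"
      using wl[of n] r unfolding wl_def by (intro tendstoD) auto
    moreover have "\<forall>\<^sub>F e::real in at_right 0. 0 < e" by (intro eventually_at_rightI[of 0 1]) auto
    ultimately show "\<forall>\<^sub>F e in at_right 0. dist (LINT x|lborel. v x * \<rho> e x) (c * (LINT x|lborel. v x)) < r"
      using N
    proof eventually_elim
      case (elim e)
      have d: "(LINT x|lborel. \<bar>(u n x - v x) * \<rho> e x\<bar>) \<le> real N * (LINT x|lborel. \<bar>u n x - v x\<bar>) + (2 * B) * \<delta>"
      proof (rule mult_rho_small[OF _ _ _ _ elim(3) _ elim(2) \<delta>])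
        show "AE x in lborel. \<bar>u n x - v x\<bar> \<le> 2 * B"
        proof (intro AE_I2)
          show "\<bar>u n x - v x\<bar> \<le> 2 * B" for x using B[of n x] vB[of x] by linarith
        qed
      qed (use ui vi R vR B0 in auto)
      have iu: "integrable lborel (\<lambda>x. u n x * \<rho> e x)"
        by (rule mult_rho_integrable[OF um _ R elim(2)]) (use B in auto)
      have iv: "integrable lborel (\<lambda>x. v x * \<rho> e x)"
        by (rule mult_rho_integrable[OF vm _ vR elim(2)]) (use vB in auto)
      have "\<bar>(LINT x|lborel. u n x * \<rho> e x) - (LINT x|lborel. v x * \<rho> e x)\<bar> =
          \<bar>LINT x|lborel. (u n x - v x) * \<rho> e x\<bar>"
        using iu iv by (simp add: left_diff_distrib)
      also have "\<dots> \<le> (LINT x|lborel. \<bar>(u n x - v x) * \<rho> e x\<bar>)" by (rule integral_abs_bound)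
      finally have 1: "\<bar>(LINT x|lborel. u n x * \<rho> e x) - (LINT x|lborel. v x * \<rho> e x)\<bar> \<le>
          real N * (LINT x|lborel. \<bar>u n x - v x\<bar>) + (2 * B) * \<delta>" using d by linarith
      have "\<bar>c * (LINT x|lborel. u n x) - c * (LINT x|lborel. v x)\<bar> = \<bar>c\<bar> * \<bar>LINT x|lborel. u n x - v x\<bar>"
        using ui vi by (simp add: right_diff_distrib[symmetric] abs_mult)
      also have "\<dots> \<le> \<bar>c\<bar> * (LINT x|lborel. \<bar>u n x - v x\<bar>)"
        by (intro mult_left_mono integral_abs_bound) auto
      finally have 2: "\<bar>c * (LINT x|lborel. u n x) - c * (LINT x|lborel. v x)\<bar> \<le> \<bar>c\<bar> * (LINT x|lborel. \<bar>u n x - v x\<bar>)" .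
      have 3: "real N * (LINT x|lborel. \<bar>u n x - v x\<bar>) + \<bar>c\<bar> * (LINT x|lborel. \<bar>u n x - v x\<bar>) < r / 4"
        using n by (simp add: distrib_right)
      show ?case using elim(1) 1 2 3 B\<delta> r unfolding dist_real_def by argo
    qed
  qed
qed

lemma wl_add_cmult:
  assumes um: "u \<in> borel_measurable borel" "\<And>x. \<bar>u x\<bar> \<le> B" "\<And>x. R < norm x \<Longrightarrow> u x = 0"
    and vm: "v \<in> borel_measurable borel" "\<And>x. \<bar>v x\<bar> \<le> B'" "\<And>x. R < norm x \<Longrightarrow> v x = 0"
    and "wl c u" "wl c v"
  shows "wl c (\<lambda>x. u x + a * v x)"
proof -
  have i: "integrable lborel u" "integrable lborel v"
    using bounded_support_integrable[OF um] bounded_support_integrable[OF vm] by blast+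
  have "((\<lambda>e. (LINT x|lborel. u x * \<rho> e x) + a * (LINT x|lborel. v x * \<rho> e x)) \<longlongrightarrow>
     c * (LINT x|lborel. u x) + a * (c * (LINT x|lborel. v x))) (at_right 0)"
    using assms(7,8) unfolding wl_def by (intro tendsto_intros)
  moreover have "\<forall>\<^sub>F e in at_right 0. (LINT x|lborel. u x * \<rho> e x) + a * (LINT x|lborel. v x * \<rho> e x) =
      (LINT x|lborel. (u x + a * v x) * \<rho> e x)"
  proof (rule eventually_at_rightI[of 0 1])
    fix e :: real assume "e \<in> {0<..<1}"
    then have e: "0 < e" by simp
    have "AE x in lborel. \<bar>u x\<bar> \<le> B" "AE x in lborel. \<bar>v x\<bar> \<le> B'" using um(2) vm(2) by auto
    from mult_rho_integrable[OF um(1) this(1) um(3) e] mult_rho_integrable[OF vm(1) this(2) vm(3) e]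
    show "(LINT x|lborel. u x * \<rho> e x) + a * (LINT x|lborel. v x * \<rho> e x) =
      (LINT x|lborel. (u x + a * v x) * \<rho> e x)"
      by (simp add: distrib_right mult.assoc)
  qed simp
  ultimately have "((\<lambda>e. LINT x|lborel. (u x + a * v x) * \<rho> e x) \<longlongrightarrow> c * (LINT x|lborel. u x) + a * (c * (LINT x|lborel. v x))) (at_right 0)"
    by (rule Lim_transform_eventually)
  then show ?thesis unfolding wl_def using i by (simp add: distrib_left mult_ac)
qed

lemma wl_zero: "wl c (\<lambda>x. 0)"
  by (simp add: wl_def)

text \<open>Monotone class argument: from a generating family closed under intersection to Borel
  sets, then to bounded functions. Everything is localised to \<open>W k\<close>, since complements
  need a set of finite measure and functions a bounded support.\<close>

lemma wl_all:
  assumes G: "borel = sigma UNIV G" "Int_stable G"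
    and W: "\<And>k. W k \<in> G" "\<And>k::nat. cball 0 (real k) \<subseteq> W k" "\<And>k. bounded (W k)"
    and box: "\<And>D k. D \<in> G \<Longrightarrow> wl c (indicator (D \<inter> W k))"
    and um: "u \<in> borel_measurable borel" "\<And>x. \<bar>u x\<bar> \<le> B" "\<And>x. R < norm x \<Longrightarrow> u x = 0"
  shows "wl c u"
proof -
  define k where "k = nat \<lceil>R\<rceil>"
  obtain S where S: "\<And>x. x \<in> W k \<Longrightarrow> norm x \<le> S" using W(3)[of k] unfolding bounded_iff by auto
  have Wm [measurable]: "W k \<in> sets borel"
    using W(1)[of k] unfolding G(1) by simp
  have WU: "wl c (indicator (W k))" using box[OF W(1)[of k], of k] by simp
  have sup: "\<bar>indicator (D \<inter> W k) x :: real\<bar> \<le> 1" "S < norm x \<Longrightarrow> indicator (D \<inter> W k) x = (0::real)" for D x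
    using S[of x] by (auto simp: indicator_def)
  have sets: "wl c (indicator (D \<inter> W k))" if "D \<in> sets borel" for D
  proof -
    have D: "D \<in> sigma_sets UNIV G" using that unfolding G(1) by simp
    have sub: "G \<subseteq> Pow UNIV" by simp
    from G(2) sub D show ?thesis
    proof (induction rule: sigma_sets_induct_disjoint)
      case (basic A) then show ?case by (rule box)
    next
      case empty then show ?case using wl_zero by simp
    next
      case (compl A)
      then have [measurable]: "A \<in> sets borel" unfolding G(1) by simp
      have "wl c (\<lambda>x. indicator (W k) x + (-1) * indicator (A \<inter> W k) x)"
        by (rule wl_add_cmult[OF _ _ _ _ sup[where D=A] WU compl.IH, of 1])
          (use sup[where D=UNIV] in auto)
      moreover have "indicator ((UNIV - A) \<inter> W k) = (\<lambda>x. indicator (W k) x + (-1) * indicator (A \<inter> W k) x :: real)"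
        by (auto simp: indicator_def)
      ultimately show ?case by simp
    next
      case (union A)
      then have [measurable]: "A i \<in> sets borel" for i unfolding G(1) by auto
      have fin: "wl c (indicator ((\<Union>i<n. A i) \<inter> W k))" for n :: nat
      proof (induction n)
        case 0 then show ?case using wl_zero by simp
      next
        case (Suc n)
        have "wl c (\<lambda>x. indicator ((\<Union>i<n. A i) \<inter> W k) x + 1 * indicator (A n \<inter> W k) x)"
          by (rule wl_add_cmult[OF _ sup _ sup Suc union.IH]) auto
        moreover have "indicator ((\<Union>i<Suc n. A i) \<inter> W k) = (\<lambda>x. indicator ((\<Union>i<n. A i) \<inter> W k) x + 1 * indicator (A n \<inter> W k) x :: real)"
        proof
          fix x
          have "x \<notin> (\<Union>i<n. A i)" if "x \<in> A n"
          proof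
            assume "x \<in> (\<Union>i<n. A i)"
            then obtain i where i: "i < n" "x \<in> A i" by auto
            have "A i \<inter> A n = {}"
              using union.hyps(1) i(1) by (intro disjoint_family_onD[of A UNIV]) auto
            then show False using i(2) that by auto
          qed
          then show "indicator ((\<Union>i<Suc n. A i) \<inter> W k) x = (indicator ((\<Union>i<n. A i) \<inter> W k) x + 1 * indicator (A n \<inter> W k) x :: real)"
            by (auto simp: indicator_def less_Suc_eq)
        qed
        ultimately show ?case by simp
      qed
      show ?case
      proof (rule wl_approx[where B=1 and R=S, OF _ sup _ _ fin])
        fix x
        show "(\<lambda>n. indicator ((\<Union>i<n. A i) \<inter> W k) x :: real) \<longlonglongrightarrow> indicator (\<Union> (range A) \<inter> W k) x"
        proof (cases "x \<in> \<Union> (range A) \<inter> W k")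
          case True
          then obtain i where i: "x \<in> A i" by auto
          have "\<forall>\<^sub>F n in sequentially. indicator ((\<Union>i<n. A i) \<inter> W k) x = (1::real)"
            using eventually_gt_at_top[of i] by eventually_elim (use True i in \<open>auto simp: indicator_def\<close>)
          then show ?thesis using True by (auto intro: tendsto_eventually)
        next
          case False
          then have "\<And>n. indicator ((\<Union>i<n. A i) \<inter> W k) x = (0::real)" by (auto simp: indicator_def)
          then show ?thesis using False by simp
        qed
      qed auto
    qed
  qed
  \<comment> \<open>The induction rule for measurable functions does not carry a bound along, so
    boundedness is a premise inside the induction predicate.\<close>
  define P where "P v \<longleftrightarrow> ((\<exists>B. \<forall>x. v x \<le> B) \<longrightarrow> wl c (\<lambda>x. indicator (W k) x * v x))" for v :: "'a \<Rightarrow> real"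
  have P: "P v" if "v \<in> borel_measurable borel" "\<And>x. 0 \<le> v x" for v
    using that
  proof (induction rule: borel_measurable_induct_real)
    case (set A)
    then show ?case using sets[of A] unfolding P_def
      by (simp add: indicator_inter_arith[symmetric] Int_commute)
  next
    case (mult v a)
    show ?case unfolding P_def
    proof
      assume "\<exists>B. \<forall>x. a * v x \<le> B"
      then obtain B where B: "\<And>x. a * v x \<le> B" by blast
      show "wl c (\<lambda>x. indicator (W k) x * (a * v x))"
      proof (cases "a = 0")
        case False
        then have vB: "v x \<le> B / a" for x using B[of x] mult.hyps(1) by (simp add: field_simps)
        then have w: "wl c (\<lambda>x. indicator (W k) x * v x)" using mult.IH unfolding P_def by blast
        have vB0: "0 \<le> B / a" using vB[of 0] mult.hyps(3)[of 0] by linarith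
        have "wl c (\<lambda>x. 0 + a * (indicator (W k) x * v x))"
        proof (rule wl_add_cmult[where B=0 and B'="B / a" and R=S, OF _ _ _ _ _ _ wl_zero w])
          show "\<bar>indicator (W k) x * v x\<bar> \<le> B / a" for x
            using vB[of x] mult.hyps(3)[of x] vB0 by (simp add: indicator_def)
          show "S < norm x \<Longrightarrow> indicator (W k) x * v x = 0" for x using S[of x] by (auto simp: indicator_def)
        qed (use mult.hyps in auto)
        then show ?thesis by (simp add: mult_ac)
      qed (simp add: wl_zero)
    qed
  next
    case (add u v)
    show ?case unfolding P_def
    proof
      assume "\<exists>B. \<forall>x. v x + u x \<le> B"
      then obtain B where B: "\<And>x. v x + u x \<le> B" by blast
      have uB: "u x \<le> B" and vB: "v x \<le> B" for x
        using B[of x] add.hyps(2)[of x] add.hyps(4)[of x] by linarith+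
      then have w: "wl c (\<lambda>x. indicator (W k) x * u x)" "wl c (\<lambda>x. indicator (W k) x * v x)"
        using add.IH unfolding P_def by blast+
      have "wl c (\<lambda>x. indicator (W k) x * u x + 1 * (indicator (W k) x * v x))"
      proof (rule wl_add_cmult[where B=B and B'=B and R=S, OF _ _ _ _ _ _ w])
        have "0 \<le> B" using uB[of 0] add.hyps(2)[of 0] by linarith
        then show "\<bar>indicator (W k) x * u x\<bar> \<le> B" "\<bar>indicator (W k) x * v x\<bar> \<le> B" for x
          using uB[of x] vB[of x] add.hyps(2)[of x] add.hyps(4)[of x] by (auto simp: indicator_def)
        show "S < norm x \<Longrightarrow> indicator (W k) x * u x = 0" "S < norm x \<Longrightarrow> indicator (W k) x * v x = 0" for x
          using S[of x] by (auto simp: indicator_def)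
      qed (use add.hyps in auto)
      then show "wl c (\<lambda>x. indicator (W k) x * (v x + u x))" by (simp add: algebra_simps)
    qed
  next
    case (seq U)
    show ?case unfolding P_def
    proof
      assume "\<exists>B. \<forall>x. v x \<le> B"
      then obtain B where B: "\<And>x. v x \<le> B" by blast
      have UB: "U i x \<le> B" for i x
      proof -
        have "U i x \<le> v x"
          by (rule incseq_le[OF _ seq.hyps(4)]) (use seq.hyps(3) in \<open>auto simp: incseq_def le_fun_def\<close>)
        then show ?thesis using B[of x] by linarith
      qed
      show "wl c (\<lambda>x. indicator (W k) x * v x)"
      proof (rule wl_approx[where u="\<lambda>i x. indicator (W k) x * U i x" and B=B and R=S])
        have "0 \<le> B" using UB[of 0 0] seq.hyps(2)[of 0 0] by linarith
        then show "\<bar>indicator (W k) x * U i x\<bar> \<le> B" for i x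
          using UB[of i x] seq.hyps(2)[of i x] by (auto simp: indicator_def)
        show "(\<lambda>i. indicator (W k) x * U i x) \<longlonglongrightarrow> indicator (W k) x * v x" for x
          using seq.hyps(4)[of x] by (intro tendsto_intros) simp
        show "wl c (\<lambda>x. indicator (W k) x * U i x)" for i
          using seq.IH[of i] UB unfolding P_def by blast
        show "S < norm x \<Longrightarrow> indicator (W k) x * U i x = 0" for i x
          using S[of x] by (auto simp: indicator_def)
        show "(\<lambda>x. indicator (W k) x * v x) \<in> borel_measurable borel"
          using borel_measurable_LIMSEQ_real[of borel U v] seq.hyps by (intro borel_measurable_times) auto
      qed (use seq.hyps in auto)
    qed
  qed
  have [measurable]: "u \<in> borel_measurable borel" by (rule um(1))
  have Bnn: "0 \<le> B" using um(2)[of 0] by linarith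
  have Bp: "u x \<le> B" "- u x \<le> B" for x using um(2)[of x] by linarith+
  have p: "wl c (\<lambda>x. indicator (W k) x * max 0 (u x))" "wl c (\<lambda>x. indicator (W k) x * max 0 (- u x))"
  proof -
    have "P (\<lambda>x. max 0 (u x))" "P (\<lambda>x. max 0 (- u x))" by (rule P; simp)+
    moreover have "\<forall>x. max 0 (u x) \<le> B" "\<forall>x. max 0 (- u x) \<le> B" using Bp Bnn by auto
    ultimately show "wl c (\<lambda>x. indicator (W k) x * max 0 (u x))" "wl c (\<lambda>x. indicator (W k) x * max 0 (- u x))"
      unfolding P_def by blast+
  qed
  have "wl c (\<lambda>x. indicator (W k) x * max 0 (u x) + (-1) * (indicator (W k) x * max 0 (- u x)))"
  proof (rule wl_add_cmult[where B=B and B'=B and R=S, OF _ _ _ _ _ _ p])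
    show "\<bar>indicator (W k) x * max 0 (u x)\<bar> \<le> B" "\<bar>indicator (W k) x * max 0 (- u x)\<bar> \<le> B" for x
      using Bp[of x] Bnn by (auto simp: indicator_def)
    show "S < norm x \<Longrightarrow> indicator (W k) x * max 0 (u x) = 0"
      "S < norm x \<Longrightarrow> indicator (W k) x * max 0 (- u x) = 0" for x
      using S[of x] by (auto simp: indicator_def)
  qed auto
  moreover have "(\<lambda>x. indicator (W k) x * max 0 (u x) + (-1) * (indicator (W k) x * max 0 (- u x))) = u"
  proof
    fix x
    have "x \<in> W k" if "norm x \<le> R"
    proof -
      have "norm x \<le> real k" using that unfolding k_def by linarith
      then show ?thesis using W(2)[of k] by auto
    qed
    then show "indicator (W k) x * max 0 (u x) + (-1) * (indicator (W k) x * max 0 (- u x)) = u x"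
      using um(3)[of x] by (cases "norm x \<le> R") (auto simp: max_def)
  qed
  ultimately show ?thesis by simp
qed

end

section \<open>A countable generator: boxes with rational corners\<close>

definition rbox :: "('a::euclidean_space \<Rightarrow> real \<times> real) \<Rightarrow> 'a set" where
  "rbox f = box (\<Sum>i\<in>Basis. fst (f i) *\<^sub>R i) (\<Sum>i\<in>Basis. snd (f i) *\<^sub>R i)"

definition rboxes :: "'a::euclidean_space set set" where
  "rboxes = rbox ` (Basis \<rightarrow>\<^sub>E \<rat> \<times> \<rat>)"

lemma mem_rbox: "x \<in> rbox f \<longleftrightarrow> (\<forall>i\<in>Basis. fst (f i) < x \<bullet> i \<and> x \<bullet> i < snd (f i))"
  by (simp add: rbox_def mem_box)

lemma rboxes_countable: "countable (rboxes :: 'a::euclidean_space set set)"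
  unfolding rboxes_def by (intro countable_image countable_PiE) (auto simp: countable_rat)

lemma rboxes_Int_stable: "Int_stable (rboxes :: 'a::euclidean_space set set)"
proof (rule Int_stableI)
  fix A B :: "'a set" assume "A \<in> rboxes" "B \<in> rboxes"
  then obtain f g where fg: "f \<in> Basis \<rightarrow>\<^sub>E \<rat> \<times> \<rat>" "A = rbox f" "g \<in> Basis \<rightarrow>\<^sub>E \<rat> \<times> \<rat>" "B = rbox g"
    unfolding rboxes_def by auto
  define h where "h = (\<lambda>i\<in>Basis. (max (fst (f i)) (fst (g i)), min (snd (f i)) (snd (g i))))"
  have "h i \<in> \<rat> \<times> \<rat>" if "i \<in> Basis" for i
    using PiE_mem[OF fg(1) that] PiE_mem[OF fg(3) that] that
    by (auto simp: h_def max_def min_def mem_Times_iff)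
  then have "h \<in> Basis \<rightarrow>\<^sub>E \<rat> \<times> \<rat>" by (auto simp: h_def)
  moreover have "A \<inter> B = rbox h"
    unfolding fg by (auto simp: mem_rbox h_def)
  ultimately show "A \<inter> B \<in> rboxes" unfolding rboxes_def by blast
qed

lemma borel_rboxes: "(borel :: 'a::euclidean_space measure) = sigma UNIV rboxes"
  unfolding rboxes_def
proof (rule borel_eq_sigmaI1[OF borel_def])
  fix S :: "'a set" assume "S \<in> {S. open S}"
  then have "S = (\<Union>f\<in>{f \<in> Basis \<rightarrow>\<^sub>E \<rat> \<times> \<rat>. rbox f \<subseteq> S}. rbox f)"
    using open_UNION_box[of S] by (simp add: rbox_def)
  also have "\<dots> \<in> sets (sigma UNIV (rbox ` (Basis \<rightarrow>\<^sub>E \<rat> \<times> \<rat>)))"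
  proof (rule sets.countable_UN')
    have "countable (Basis \<rightarrow>\<^sub>E (\<rat> \<times> \<rat> :: (real \<times> real) set) :: ('a \<Rightarrow> real \<times> real) set)"
      by (intro countable_PiE) (auto simp: countable_rat)
    then show "countable {f \<in> Basis \<rightarrow>\<^sub>E \<rat> \<times> \<rat>. rbox f \<subseteq> S}"
      by (rule countable_subset[rotated]) auto
  qed auto
  finally show "S \<in> sets (sigma UNIV (rbox ` (Basis \<rightarrow>\<^sub>E \<rat> \<times> \<rat>)))" .
qed (auto simp: rbox_def)

definition wbox :: "nat \<Rightarrow> 'a::euclidean_space set" where
  "wbox k = rbox (\<lambda>i\<in>Basis. (- (real k + 1), real k + 1))"

lemma mem_wbox: "x \<in> wbox k \<longleftrightarrow> (\<forall>i\<in>Basis. - (real k + 1) < x \<bullet> i \<and> x \<bullet> i < real k + 1)"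
  by (simp add: wbox_def mem_rbox)

lemma wbox_rboxes: "wbox k \<in> rboxes"
  unfolding wbox_def rboxes_def by (rule imageI) auto

lemma cball_wbox: "cball (0::'a::euclidean_space) (real k) \<subseteq> wbox k"
proof
  fix x :: 'a assume "x \<in> cball 0 (real k)"
  then have "\<bar>x \<bullet> i\<bar> \<le> real k" if "i \<in> Basis" for i
    using Basis_le_norm[OF that, of x] by simp
  then show "x \<in> wbox k" by (force simp: mem_wbox)
qed

lemma rboxes_bounded: "D \<in> rboxes \<Longrightarrow> bounded D"
  by (auto simp: rboxes_def rbox_def)

lemma rboxes_box: "D \<in> rboxes \<Longrightarrow> \<exists>a b. D = box a b"
  by (auto simp: rboxes_def rbox_def)

section \<open>Rescaled densities along almost every path\<close>

context ergodic_environment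
begin

lemma pointwise_ergodic_rboxes:
  fixes f :: "'w \<Rightarrow> real"
  assumes f: "integrable M f"
  shows "AE \<omega> in M. \<forall>D\<in>rboxes. ((\<lambda>e. orb (indicator D) f e \<omega>) \<longlongrightarrow> expectation f * (LINT x|lborel. indicator D x)) (at_right 0)"
proof (rule AE_ball_countable[THEN iffD2, OF rboxes_countable], rule ballI)
  fix D :: "'a set" assume D: "D \<in> rboxes"
  then obtain a b where ab: "D = box a b" using rboxes_box by blast
  obtain R where R: "\<And>x. x \<in> D \<Longrightarrow> norm x \<le> R" using rboxes_bounded[OF D] unfolding bounded_iff by auto
  show "AE \<omega> in M. ((\<lambda>e. orb (indicator D) f e \<omega>) \<longlongrightarrow> expectation f * (LINT x|lborel. indicator D x)) (at_right 0)"
  proof (rule pointwise_ergodic[where b=1 and R="max 1 R"])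
    show "indicator D x = (0::real)" if "max 1 R < norm x" for x
      using R[of x] that by (auto simp: indicator_def)
  qed (use f ab box_translate[of a b] in \<open>auto simp: indicator_def[abs_def]\<close>)
qed

lemma ball_int_finite:
  assumes "integrable M f"
  shows "AE \<omega> in M. \<forall>n. ball_int n (\<lambda>\<omega>. ennreal \<bar>f \<omega>\<bar>) \<omega> < \<infinity>"
  unfolding AE_all_countable
proof
  fix n
  have [measurable]: "f \<in> borel_measurable M" using assms by auto
  have "(\<integral>\<^sup>+\<omega>. ball_int n (\<lambda>\<omega>. ennreal \<bar>f \<omega>\<bar>) \<omega> \<partial>M) = emeasure lborel (cball (0::'a) (2 ^ n)) * (\<integral>\<^sup>+\<omega>. ennreal \<bar>f \<omega>\<bar> \<partial>M)"
    unfolding ball_int_def by (subst nn_integral_path) auto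
  also have "\<dots> < \<infinity>"
    using assms emeasure_lborel_cball_finite[of "0::'a" "2 ^ n"]
    by (auto simp: integrable_iff_bounded ennreal_mult_less_top)
  finally have "(\<integral>\<^sup>+\<omega>. ball_int n (\<lambda>\<omega>. ennreal \<bar>f \<omega>\<bar>) \<omega> \<partial>M) \<noteq> \<infinity>" by simp
  then have "AE \<omega> in M. ball_int n (\<lambda>\<omega>. ennreal \<bar>f \<omega>\<bar>) \<omega> \<noteq> \<infinity>"
    by (intro nn_integral_PInf_AE) auto
  then show "AE \<omega> in M. ball_int n (\<lambda>\<omega>. ennreal \<bar>f \<omega>\<bar>) \<omega> < \<infinity>"
    by eventually_elim (simp add: less_top)
qed

text \<open>The ergodic theorem is applied to f and to its excess over each natural N, on countably
  many boxes. The expected excess tends to 0 as N grows, so the limits of the excess integrals are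
  small, which is uniform integrability; convergence on boxes then determines the weak
  limit.\<close>

theorem ergodic_density:
  fixes f :: "'w \<Rightarrow> real"
  assumes f: "integrable M f" and nn: "\<And>\<omega>. \<omega> \<in> space M \<Longrightarrow> 0 \<le> f \<omega>"
  shows "AE \<omega> in M. ui_density (\<lambda>e x. f (\<tau> (x /\<^sub>R e) \<omega>)) \<and>
    (\<forall>u B R. u \<in> borel_measurable borel \<longrightarrow> (\<forall>x. \<bar>u x\<bar> \<le> B) \<longrightarrow> (\<forall>x. R < norm x \<longrightarrow> u x = 0) \<longrightarrow>
      ui_density.wl (\<lambda>e x. f (\<tau> (x /\<^sub>R e) \<omega>)) (expectation f) u)"
proof -
  have fm [measurable]: "f \<in> borel_measurable M" using f by auto
  define g where "g N \<omega> = max 0 (f \<omega> - real N)" for N \<omega>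
  have gi: "integrable M (g N)" for N
    unfolding g_def[abs_def] using f by (intro integrable_max) auto
  have gE: "(\<lambda>N. expectation (g N)) \<longlonglongrightarrow> expectation (\<lambda>_. 0)"
  proof (rule integral_dominated_convergence[where w="\<lambda>\<omega>. \<bar>f \<omega>\<bar>"])
    show "AE \<omega> in M. (\<lambda>N. g N \<omega>) \<longlonglongrightarrow> 0"
    proof (intro AE_I2 tendsto_eventually)
      fix \<omega>
      show "\<forall>\<^sub>F N in sequentially. g N \<omega> = 0"
        using eventually_ge_at_top[of "nat \<lceil>f \<omega>\<rceil>"]
      proof eventually_elim
        case (elim N)
        then have "f \<omega> \<le> real N" by linarith
        then show ?case by (simp add: g_def)
      qed
    qed
  qed (use f gi in \<open>auto simp: g_def[abs_def]\<close>)
  have "AE \<omega> in M. \<forall>N. \<forall>D\<in>rboxes. ((\<lambda>e. orb (indicator D) (g N) e \<omega>) \<longlongrightarrow> expectation (g N) * (LINT x|lborel. indicator D x)) (at_right 0)"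
    unfolding AE_all_countable using pointwise_ergodic_rboxes[OF gi] by blast
  with pointwise_ergodic_rboxes[OF f] ball_int_finite[OF f] AE_space show ?thesis
  proof eventually_elim
    case (elim \<omega>)
    note w = elim(3)
    let ?\<rho> = "\<lambda>e x. f (\<tau> (x /\<^sub>R e) \<omega>)"
    have \<rho>m [measurable]: "?\<rho> e \<in> borel_measurable borel" for e using w by measurable
    have \<rho>nn: "0 \<le> ?\<rho> e x" for e x using w by (intro nn shift_space)
    \<comment> \<open>This is required for every e > 0 and not only for small e, so it rests on
      finiteness of the path integrals over all dyadic balls and not on a limit.\<close>
    have fin: "(\<integral>\<^sup>+x. indicator (cball 0 R) x * ennreal (?\<rho> e x) \<partial>lborel) < \<infinity>" if e: "0 < e" for e R
    proof -
      have "1 \<le> max 1 (R / e)" by simp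
      then obtain n :: nat where n: "max 1 (R / e) \<le> 2 ^ n" by (rule dyadic_scale)
      let ?h = "\<lambda>y. indicator (cball 0 (2 ^ n)) y * ennreal \<bar>f (\<tau> y \<omega>)\<bar>"
      have "(\<integral>\<^sup>+x. indicator (cball 0 R) x * ennreal (?\<rho> e x) \<partial>lborel) \<le> (\<integral>\<^sup>+x. ?h (x /\<^sub>R e) \<partial>lborel)"
      proof (intro nn_integral_mono mult_mono)
        fix x :: 'a
        show "indicator (cball 0 R) x \<le> (indicator (cball 0 (2 ^ n)) (x /\<^sub>R e) :: ennreal)"
          using n e by (auto simp: indicator_def field_simps)
      qed (auto intro: ennreal_leI)
      also have "\<dots> = ennreal (e ^ DIM('a)) * ball_int n (\<lambda>\<omega>. ennreal \<bar>f \<omega>\<bar>) \<omega>"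
        unfolding ball_int_def using w by (intro nn_integral_lborel_scale e) measurable
      also have "\<dots> < \<infinity>" using elim(2) by (simp add: ennreal_mult_less_top)
      finally show ?thesis .
    qed
    have ui: "\<exists>N::nat. \<forall>\<^sub>F e in at_right 0.
      (\<integral>\<^sup>+x. indicator (cball 0 R) x * ennreal (max 0 (?\<rho> e x - real N)) \<partial>lborel) \<le> ennreal \<delta>" if \<delta>: "0 < \<delta>" for R \<delta>
    proof -
      define k where "k = nat \<lceil>R\<rceil>"
      have kR: "cball (0::'a) R \<subseteq> wbox k"
      proof -
        have "R \<le> real k" unfolding k_def by linarith
        then have "cball (0::'a) R \<subseteq> cball 0 (real k)" by auto
        then show ?thesis using cball_wbox by blast
      qed
      define v where "v = (LINT x|lborel. indicator (wbox k :: 'a set) x :: real)"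
      have "(\<lambda>N. expectation (g N) * v) \<longlonglongrightarrow> 0"
        using tendsto_mult_left_zero[OF gE[simplified]] .
      then have "\<forall>\<^sub>F N in sequentially. expectation (g N) * v < \<delta>" using \<delta> by (intro order_tendstoD) auto
      then obtain N where N: "expectation (g N) * v < \<delta>"
        using eventually_happens' sequentially_bot by blast
      have "((\<lambda>e. orb (indicator (wbox k)) (g N) e \<omega>) \<longlongrightarrow> expectation (g N) * v) (at_right 0)"
        using elim(4) wbox_rboxes unfolding v_def by blast
      then have "\<forall>\<^sub>F e in at_right 0. orb (indicator (wbox k)) (g N) e \<omega> < \<delta>"
        using N by (intro order_tendstoD) auto
      moreover have "\<forall>\<^sub>F e::real in at_right 0. 0 < e" by (intro eventually_at_rightI[of 0 1]) auto
      ultimately have "\<forall>\<^sub>F e in at_right 0.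
        (\<integral>\<^sup>+x. indicator (cball 0 R) x * ennreal (max 0 (?\<rho> e x - real N)) \<partial>lborel) \<le> ennreal \<delta>"
      proof eventually_elim
        case (elim e)
        obtain S where S: "\<And>x. x \<in> (wbox k :: 'a set) \<Longrightarrow> norm x \<le> S"
          using rboxes_bounded[of "wbox k :: 'a set"] wbox_rboxes unfolding bounded_iff by blast
        obtain a b where "(wbox k :: 'a set) = box a b"
          using rboxes_box[OF wbox_rboxes] by blast
        then have [measurable]: "(wbox k :: 'a set) \<in> sets borel" by simp
        let ?i = "\<lambda>x. indicator (wbox k) x * g N (\<tau> (x /\<^sub>R e) \<omega>)"
        have [measurable]: "(\<lambda>x. g N (\<tau> (x /\<^sub>R e) \<omega>)) \<in> borel_measurable borel"
          unfolding g_def using w by measurable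
        have bd: "ennreal (?i x) \<le> indicator (cball 0 S) x * ennreal (?\<rho> e x)" for x
          using S[of x] \<rho>nn[of e x] by (auto simp: indicator_def g_def intro!: ennreal_leI)
        have int: "integrable lborel ?i"
        proof (rule integrableI_nonneg)
          have "(\<integral>\<^sup>+x. ennreal (?i x) \<partial>lborel) \<le> (\<integral>\<^sup>+x. indicator (cball 0 S) x * ennreal (?\<rho> e x) \<partial>lborel)"
            by (rule nn_integral_mono[OF bd])
          also have "\<dots> < \<infinity>" by (rule fin[OF elim(2)])
          finally show "(\<integral>\<^sup>+x. ennreal (?i x) \<partial>lborel) < \<infinity>" .
        qed (auto simp: g_def)
        have "(\<integral>\<^sup>+x. indicator (cball 0 R) x * ennreal (max 0 (?\<rho> e x - real N)) \<partial>lborel) \<le> (\<integral>\<^sup>+x. ennreal (?i x) \<partial>lborel)"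
          using kR by (intro nn_integral_mono) (auto simp: g_def indicator_def)
        also have "\<dots> = ennreal (orb (indicator (wbox k)) (g N) e \<omega>)"
          unfolding orb_def by (rule nn_integral_eq_integral[OF int]) (auto simp: g_def)
        also have "\<dots> \<le> ennreal \<delta>" using elim(1) by (intro ennreal_leI) simp
        finally show ?case .
      qed
      then show ?thesis by blast
    qed
    have uid: "ui_density ?\<rho>"
      by standard (use \<rho>m \<rho>nn fin ui in auto)
    interpret ui_density ?\<rho> by (rule uid)
    have "wl (expectation f) u" if "u \<in> borel_measurable borel" "\<And>x. \<bar>u x\<bar> \<le> B" "\<And>x. R < norm x \<Longrightarrow> u x = 0" for u B R
    proof (rule wl_all[OF borel_rboxes rboxes_Int_stable wbox_rboxes cball_wbox rboxes_bounded[OF wbox_rboxes] _ that])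
      fix D :: "'a set" and k assume "D \<in> rboxes"
      then have "D \<inter> wbox k \<in> rboxes" using rboxes_Int_stable wbox_rboxes by (auto simp: Int_stable_def)
      then show "wl (expectation f) (indicator (D \<inter> wbox k))"
        using elim(1) unfolding wl_def orb_def by blast
    qed
    with uid show ?case by blast
  qed
qed

end

section \<open>Uniqueness for translation invariant forms\<close>

lemma nn_integral_lborel2_swap:
  fixes f :: "'a::euclidean_space \<times> 'a \<Rightarrow> ennreal"
  assumes [measurable]: "f \<in> borel_measurable (borel \<Otimes>\<^sub>M borel)"
  shows "(\<integral>\<^sup>+p. f (snd p, fst p) \<partial>lborel2) = (\<integral>\<^sup>+p. f p \<partial>lborel2)"
proof -
  have "(\<integral>\<^sup>+p. f p \<partial>lborel2) = (\<integral>\<^sup>+p. f p \<partial>distr lborel2 lborel2 (\<lambda>(x, y). (y, x)))"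
    by (simp only: lborel_pair.distr_pair_swap[symmetric])
  also have "\<dots> = (\<integral>\<^sup>+p. f (snd p, fst p) \<partial>lborel2)"
    by (subst nn_integral_distr) (auto simp: case_prod_beta')
  finally show ?thesis ..
qed

lemma nn_integral_lborel2_fst:
  fixes f :: "'a::euclidean_space \<times> 'a \<Rightarrow> ennreal"
  assumes [measurable]: "f \<in> borel_measurable (borel \<Otimes>\<^sub>M borel)"
  shows "(\<integral>\<^sup>+p. f p \<partial>lborel2) = (\<integral>\<^sup>+x. \<integral>\<^sup>+y. f (x, y) \<partial>lborel \<partial>lborel)"
  by (rule lborel.nn_integral_fst[symmetric]) simp

text \<open>The weight dominating the squared increments of a Lipschitz function supported in
  \<open>cball 0 R\<close>.\<close>

definition wgt :: "real \<Rightarrow> 'a::euclidean_space \<times> 'a \<Rightarrow> real" where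
  "wgt R p = min 1 ((dist (fst p) (snd p))\<^sup>2) * (indicator (cball 0 R) (fst p) + indicator (cball 0 R) (snd p))"

lemma wgt_measurable [measurable]: "wgt R \<in> borel_measurable (borel \<Otimes>\<^sub>M borel)"
  unfolding wgt_def[abs_def] by measurable

lemma wgt_nonneg: "0 \<le> wgt R p"
  by (simp add: wgt_def)

text \<open>The increment is at most L times the distance and at most 2 B; L^2 + 4 B^2 covers both
  branches of the minimum in the weight.\<close>

lemma lipc_dif_le:
  assumes "lipc L B R g"
  shows "(dif g p)\<^sup>2 \<le> (L\<^sup>2 + 4 * B\<^sup>2) * wgt R p"
proof (cases "norm (fst p) \<le> R \<or> norm (snd p) \<le> R")
  case True
  let ?d = "dist (fst p) (snd p)"
  have g: "\<bar>dif g p\<bar> \<le> L * ?d" "\<bar>g (fst p)\<bar> \<le> B" "\<bar>g (snd p)\<bar> \<le> B" "0 \<le> L" "0 \<le> B"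
    using assms unfolding lipc_def dif_def by auto
  have "\<bar>dif g p\<bar> \<le> 2 * B" using g(2,3) unfolding dif_def by linarith
  then have 1: "(dif g p)\<^sup>2 \<le> (2 * B)\<^sup>2" using g(5) by (intro abs_le_square_iff[THEN iffD1]) simp
  have 2: "(dif g p)\<^sup>2 \<le> (L * ?d)\<^sup>2" using g(1,4) by (intro abs_le_square_iff[THEN iffD1]) simp
  have "(dif g p)\<^sup>2 \<le> (L\<^sup>2 + 4 * B\<^sup>2) * min 1 (?d\<^sup>2)"
  proof (cases "?d\<^sup>2 \<le> 1")
    case True
    then have "(L\<^sup>2 + 4 * B\<^sup>2) * min 1 (?d\<^sup>2) = L\<^sup>2 * ?d\<^sup>2 + 4 * B\<^sup>2 * ?d\<^sup>2" by (simp add: min_def algebra_simps)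
    moreover have "0 \<le> 4 * B\<^sup>2 * ?d\<^sup>2" by simp
    ultimately show ?thesis using 2 unfolding power_mult_distrib by linarith
  next
    case False
    then show ?thesis using 1 by (simp add: min_def power_mult_distrib add_increasing)
  qed
  also have "\<dots> \<le> (L\<^sup>2 + 4 * B\<^sup>2) * wgt R p"
    unfolding wgt_def using True
    by (intro mult_left_mono) (auto simp: indicator_def)
  finally show ?thesis .
next
  case False
  then have "dif g p = 0" using assms unfolding lipc_def dif_def by auto
  then show ?thesis by (simp add: wgt_nonneg)
qed

section \<open>Symmetric kernels and the energy of Lipschitz functions\<close>

context jump_kernel
begin

lemma J_section [measurable]: "J x \<in> borel_measurable borel"
  using measurable_compose[OF measurable_Pair1'[of x borel borel] J_measurable] by simp

end

text \<open>\<open>J_loc\<close> is the Levy-type condition integrated over bounded sets of base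
  points; it gives compactly supported Lipschitz functions finite energy.\<close>

locale sym_kernel = jump_kernel J for J :: "'a::euclidean_space \<Rightarrow> 'a \<Rightarrow> real" +
  assumes J_sym: "J x y = J y x"
    and J_loc: "(\<integral>\<^sup>+x. indicator (cball 0 R) x * (\<integral>\<^sup>+y. ennreal (min 1 ((dist x y)\<^sup>2) * J x y) \<partial>lborel) \<partial>lborel) < \<infinity>"
begin

text \<open>By symmetry of J the part of the weight that sits on the second point equals the part on
  the first, and the latter is the integral in \<open>J_loc\<close>.\<close>

lemma wgt_finite: "(\<integral>\<^sup>+p. ennreal (wgt R p) \<partial>jm J) < \<infinity>"
proof -
  let ?f = "\<lambda>p. indicator (cball 0 R) (fst p) * ennreal (min 1 ((dist (fst p) (snd p))\<^sup>2) * J (fst p) (snd p))"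
  have "(\<integral>\<^sup>+p. ennreal (wgt R p) \<partial>jm J) \<le> ennreal (1 / 2) * (\<integral>\<^sup>+p. ?f p + ?f (snd p, fst p) \<partial>lborel2)"
  proof (subst nn_integral_jm, measurable, intro mult_left_mono nn_integral_mono)
    fix p :: "'a \<times> 'a"
    have "ennreal (wgt R p * J (fst p) (snd p)) = ?f p + ?f (snd p, fst p)"
      using J_nonneg J_sym[of "snd p" "fst p"]
      by (auto simp: wgt_def indicator_def dist_commute algebra_simps ennreal_plus[symmetric] simp del: ennreal_plus)
    then show "ennreal (wgt R p * J (fst p) (snd p)) * indicator (- Id) p \<le> ?f p + ?f (snd p, fst p)"
      by (auto simp: indicator_def)
  qed auto
  also have "(\<integral>\<^sup>+p. ?f p + ?f (snd p, fst p) \<partial>lborel2) = 2 * (\<integral>\<^sup>+p. ?f p \<partial>lborel2)"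
    by (subst nn_integral_add, measurable, subst nn_integral_lborel2_swap, measurable) (simp add: mult_2)
  also have "(\<integral>\<^sup>+p. ?f p \<partial>lborel2) = (\<integral>\<^sup>+x. indicator (cball 0 R) x * (\<integral>\<^sup>+y. ennreal (min 1 ((dist x y)\<^sup>2) * J x y) \<partial>lborel) \<partial>lborel)"
    by (subst nn_integral_lborel2_fst, measurable, subst nn_integral_cmult[symmetric], measurable)
  finally have le: "(\<integral>\<^sup>+p. ennreal (wgt R p) \<partial>jm J) \<le> ennreal (1 / 2) *
      (2 * (\<integral>\<^sup>+x. indicator (cball 0 R) x * (\<integral>\<^sup>+y. ennreal (min 1 ((dist x y)\<^sup>2) * J x y) \<partial>lborel) \<partial>lborel))" .
  have "2 * (\<integral>\<^sup>+x. indicator (cball 0 R) x * (\<integral>\<^sup>+y. ennreal (min 1 ((dist x y)\<^sup>2) * J x y) \<partial>lborel) \<partial>lborel) < top"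
    using J_loc[of R] by (simp add: ennreal_mult_less_top)
  then have "ennreal (1 / 2) *
      (2 * (\<integral>\<^sup>+x. indicator (cball 0 R) x * (\<integral>\<^sup>+y. ennreal (min 1 ((dist x y)\<^sup>2) * J x y) \<partial>lborel) \<partial>lborel)) < top"
    using ennreal_mult_less_top[of "ennreal (1 / 2)"] ennreal_less_top[of "1 / 2"] by blast
  from le_less_trans[OF le this] show ?thesis unfolding infinity_ennreal_def .
qed

lemma lipc_energy:
  assumes "lipc L B R g"
  shows "jump_energy J g < \<infinity>"
proof -
  have [measurable]: "g \<in> borel_measurable borel"
    using Cc_measurable[OF lipc_Cc[OF assms]] .
  have "jump_energy J g \<le> (\<integral>\<^sup>+p. ennreal (L\<^sup>2 + 4 * B\<^sup>2) * ennreal (wgt R p) \<partial>jm J)"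
  proof (subst jump_energy_jm, measurable, intro nn_integral_mono)
    show "ennreal ((dif g p)\<^sup>2) \<le> ennreal (L\<^sup>2 + 4 * B\<^sup>2) * ennreal (wgt R p)" for p
      using ennreal_leI[OF lipc_dif_le[OF assms, of p]] ennreal_mult'[of "L\<^sup>2 + 4 * B\<^sup>2" "wgt R p"]
      by (simp del: ennreal_plus)
  qed
  also have "\<dots> = ennreal (L\<^sup>2 + 4 * B\<^sup>2) * (\<integral>\<^sup>+p. ennreal (wgt R p) \<partial>jm J)"
    by (rule nn_integral_cmult) measurable
  also have "\<dots> < \<infinity>" using wgt_finite[of R] by (simp add: ennreal_mult_less_top)
  finally show ?thesis .
qed

end

locale sym_space = sym_kernel J for J :: "'a::euclidean_space \<Rightarrow> 'a \<Rightarrow> real" +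
  fixes m :: "'a measure"
  assumes m_sets: "sets m = sets borel"
    and m_null: "N \<in> null_sets m \<Longrightarrow> N \<in> null_sets lborel"
    and m_cball: "emeasure m (cball 0 R) < \<infinity>"
begin

lemma bounded_support_L2:
  assumes [measurable]: "f \<in> borel_measurable borel" and B: "\<And>x. \<bar>f x\<bar> \<le> B" and R: "\<And>x. R < norm x \<Longrightarrow> f x = 0"
  shows "f \<in> L2 m"
  unfolding L2_iff_nn
proof
  show "f \<in> borel_measurable m" using measurable_cong_sets[OF m_sets refl] assms by blast
  have "(\<integral>\<^sup>+x. ennreal ((f x)\<^sup>2) \<partial>m) \<le> (\<integral>\<^sup>+x. ennreal (B\<^sup>2) * indicator (cball 0 R) x \<partial>m)"
  proof (intro nn_integral_mono)
    show "ennreal ((f x)\<^sup>2) \<le> ennreal (B\<^sup>2) * indicator (cball 0 R) x" for x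
      using B[of x] R[of x] by (cases "norm x \<le> R") (auto intro!: ennreal_leI simp: abs_le_square_iff[symmetric])
  qed
  also have "\<dots> = ennreal (B\<^sup>2) * emeasure m (cball 0 R)"
    by (rule nn_integral_cmult_indicator) (simp add: m_sets)
  also have "\<dots> < \<infinity>" using m_cball by (simp add: ennreal_mult_less_top)
  finally show "(\<integral>\<^sup>+x. ennreal ((f x)\<^sup>2) \<partial>m) < \<infinity>" .
qed

lemma lipc_L2: assumes "lipc L B R g" shows "g \<in> L2 m"
  by (rule bounded_support_L2[of g B R])
    (use assms Cc_measurable[OF lipc_Cc[OF assms]] in \<open>auto simp: lipc_def\<close>)

sublocale jump_space J m
proof
  show "\<phi> \<in> L2 m" if "\<phi> \<in> Cc_1" for \<phi> using Cc_1_lipc[OF that] lipc_L2 by metis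
  show "jump_energy J \<phi> < \<infinity>" if "\<phi> \<in> Cc_1" for \<phi> using Cc_1_lipc[OF that] lipc_energy by metis
qed (use m_sets m_null in auto)

lemma lipc_V: "lipc L B R g \<Longrightarrow> g \<in> V"
  using lipc_L2 lipc_energy by (simp add: V_iff)

end

context jump_space
begin

lemma ip_dominated:
  assumes gm: "\<And>n::nat. g n \<in> borel_measurable borel"
    and w: "integrable (jm J) w" "\<And>n p. (dif (g n) p)\<^sup>2 \<le> w p"
    and w': "integrable m w'" "\<And>n x. (g n x)\<^sup>2 \<le> w' x"
    and lim: "\<And>x. (\<lambda>n. g n x) \<longlonglongrightarrow> 0"
  shows "(\<lambda>n. ip 1 (g n) (g n)) \<longlonglongrightarrow> 0"
proof -
  note [measurable] = gm
  have "(\<lambda>n. LINT p|jm J. dif (g n) p * dif (g n) p) \<longlonglongrightarrow> (LINT p|jm J. 0)"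
  proof (rule integral_dominated_convergence[where w=w])
    show "AE p in jm J. (\<lambda>n. dif (g n) p * dif (g n) p) \<longlonglongrightarrow> 0"
    proof (intro AE_I2)
      fix p
      have "(\<lambda>n. dif (g n) p * dif (g n) p) \<longlonglongrightarrow> (0 - 0) * (0 - 0)"
        unfolding dif_def by (intro tendsto_intros lim)
      then show "(\<lambda>n. dif (g n) p * dif (g n) p) \<longlonglongrightarrow> 0" by simp
    qed
  qed (use w in \<open>auto simp: power2_eq_square\<close>)
  moreover have "(\<lambda>n. LINT x|m. g n x * g n x) \<longlonglongrightarrow> (LINT x|m. 0)"
  proof (rule integral_dominated_convergence[where w=w'])
    show "AE x in m. (\<lambda>n. g n x * g n x) \<longlonglongrightarrow> 0"
      using tendsto_mult[OF lim lim] by simp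
  qed (use w' in \<open>auto simp: power2_eq_square\<close>)
  ultimately have "(\<lambda>n. (LINT p|jm J. dif (g n) p * dif (g n) p) + 1 * (LINT x|m. g n x * g n x)) \<longlonglongrightarrow> (LINT p|jm J. 0) + 1 * (LINT x|m. 0)"
    by (intro tendsto_intros)
  then show ?thesis unfolding ip_def L2_inner_def by simp
qed

end

context sym_space
begin

lemma wgt_integrable: "integrable (jm J) (wgt R)"
  by (rule integrableI_nonneg) (use wgt_finite in \<open>auto simp: wgt_nonneg\<close>)

lemma cball_integrable: "integrable m (\<lambda>x. c * indicator (cball 0 R) x :: real)"
  using m_cball by (intro integrable_mult_right integrable_real_indicator) (auto simp: m_sets)

lemma lipc_tendsto:
  assumes h: "\<And>n::nat. lipc L B R (h n)" and lim: "\<And>x. (\<lambda>n. h n x) \<longlonglongrightarrow> g x"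
    and g: "lipc L B R g"
  shows "(\<lambda>n. ip 1 (\<lambda>x. h n x - g x) (\<lambda>x. h n x - g x)) \<longlonglongrightarrow> 0"
proof (rule ip_dominated)
  \<comment> \<open>Here 4 = 2 + 2: both functions have the same Lipschitz data, and (a - b)^2 <= 2
    a^2 + 2 b^2.\<close>
  let ?w = "\<lambda>p. (4 * (L\<^sup>2 + 4 * B\<^sup>2)) * wgt R p"
  have sq: "(a - b)\<^sup>2 \<le> 2 * a\<^sup>2 + 2 * b\<^sup>2" for a b :: real
    using zero_le_power2[of "a + b"] by (simp add: power2_eq_square algebra_simps)
  show "(dif (\<lambda>x. h n x - g x) p)\<^sup>2 \<le> ?w p" for n p
  proof -
    have "(dif (\<lambda>x. h n x - g x) p)\<^sup>2 \<le> 2 * (dif (h n) p)\<^sup>2 + 2 * (dif g p)\<^sup>2"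
      unfolding dif_diff by (rule sq)
    then show ?thesis using lipc_dif_le[OF h, of n p] lipc_dif_le[OF g, of p] by argo
  qed
  show "integrable (jm J) ?w" by (intro integrable_mult_right wgt_integrable)
  show "(h n x - g x)\<^sup>2 \<le> (2 * B)\<^sup>2 * indicator (cball 0 R) x" for n x
  proof (cases "norm x \<le> R")
    case True
    have "\<bar>h n x\<bar> \<le> B" "\<bar>g x\<bar> \<le> B" using h[of n] g unfolding lipc_def by blast+
    then have "\<bar>h n x - g x\<bar> \<le> \<bar>2 * B\<bar>" by linarith
    then show ?thesis using True unfolding abs_le_square_iff by simp
  next
    case False
    then show ?thesis using h[of n] g unfolding lipc_def by simp
  qed
  show "integrable m (\<lambda>x. (2 * B)\<^sup>2 * indicator (cball 0 R) x)" by (rule cball_integrable)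
  show "(\<lambda>n. h n x - g x) \<longlonglongrightarrow> 0" for x using tendsto_diff[OF lim[of x] tendsto_const[of "g x"]] by simp
  have "h n \<in> borel_measurable borel" "g \<in> borel_measurable borel" for n
    using Cc_measurable[OF lipc_Cc] h g by blast+
  then show "(\<lambda>x. h n x - g x) \<in> borel_measurable borel" for n by measurable
qed

lemma lipc_mono: "lipc L B R g \<Longrightarrow> R \<le> R' \<Longrightarrow> lipc L B R' g"
  unfolding lipc_def by auto

text \<open>Smooth approximants with common Lipschitz data converge in the energy norm by
  domination, so an equation tested with smooth functions extends to compactly supported Lipschitz
  ones.\<close>

lemma lipc_weak_eq:
  assumes u: "u \<in> V" and r: "r \<in> L2 m" and eq: "\<And>g. g \<in> Cc_infinity \<Longrightarrow> ip l u g = L2_inner m r g"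
    and g: "lipc L B R g"
  shows "g \<in> jump_domain m J" "ip l u g = L2_inner m r g"
proof -
  obtain h where h: "\<And>n::nat. h n \<in> Cc_infinity" "\<And>n. lipc L B (R + 1) (h n)" "\<And>x. (\<lambda>n. h n x) \<longlonglongrightarrow> g x"
    using lipc_approx[OF g] by metis
  have lim: "(\<lambda>n. ip 1 (\<lambda>x. h n x - g x) (\<lambda>x. h n x - g x)) \<longlonglongrightarrow> 0"
    by (rule lipc_tendsto[OF h(2,3) lipc_mono[OF g]]) simp
  have hC: "h n \<in> Cc_1" for n using h(1) Cc_infinity_sub_Cc_1 by blast
  show "g \<in> jump_domain m J" unfolding domain_iff using lipc_V[OF g] hC lim by blast
  have "(\<lambda>n. ip l u (h n)) \<longlonglongrightarrow> ip l u g"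
    by (rule ip_tendsto(1)[OF u lipc_V[OF g] Cc_1_V[OF hC] lim])
  moreover have "(\<lambda>n. L2_inner m r (h n)) \<longlonglongrightarrow> L2_inner m r g"
    by (rule ip_tendsto(2)[OF u lipc_V[OF g] Cc_1_V[OF hC] lim r])
  ultimately show "ip l u g = L2_inner m r g"
    using eq[OF h(1)] LIMSEQ_unique by auto
qed

end


section \<open>Averaging along a measure preserving action\<close>

locale shift_average =
  fixes N :: "'p measure" and \<theta> :: "'a::euclidean_space \<Rightarrow> 'p \<Rightarrow> 'p" and \<sigma> :: "'a \<Rightarrow> real"
  assumes sf: "sigma_finite_measure N"
    and theta_meas: "(\<lambda>q. \<theta> (fst q) (snd q)) \<in> borel \<Otimes>\<^sub>M N \<rightarrow>\<^sub>M N"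
    and theta_pres: "distr N N (\<theta> y) = N"
    and theta_inv: "p \<in> space N \<Longrightarrow> \<theta> y (\<theta> (- y) p) = p"
    and sigma_meas [measurable]: "\<sigma> \<in> borel_measurable borel"
    and sigma_nonneg: "0 \<le> \<sigma> y" and sigma_even: "\<sigma> (- y) = \<sigma> y"
    and sigma_int: "integrable lborel \<sigma>" and sigma_pos: "0 < (LINT y|lborel. \<sigma> y)"
begin

sublocale N: sigma_finite_measure N by (rule sf)

sublocale NL: pair_sigma_finite N lborel by standard

lemma theta_comp [measurable (raw)]:
  assumes "f \<in> K \<rightarrow>\<^sub>M borel" "g \<in> K \<rightarrow>\<^sub>M N"
  shows "(\<lambda>x. \<theta> (f x) (g x)) \<in> K \<rightarrow>\<^sub>M N"
  using measurable_compose[OF measurable_Pair[OF assms] theta_meas] by simp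

lemma nn_theta:
  assumes [measurable]: "f \<in> borel_measurable N"
  shows "(\<integral>\<^sup>+p. f (\<theta> y p) \<partial>N) = (\<integral>\<^sup>+p. f p \<partial>N)"
  using nn_integral_distr[of "\<theta> y" N N f] by (simp add: theta_pres)

text \<open>The setting is abstract because the average is taken twice: of functions of a point,
  with Lebesgue measure, and of functions of a pair, with the jump measure and the diagonal shift.
  Symmetry of averaging then is one lemma serving both terms of the form.\<close>

definition avg :: "('p \<Rightarrow> real) \<Rightarrow> 'p \<Rightarrow> real" where
  "avg F p = (LINT y|lborel. \<sigma> y * F (\<theta> y p))"

lemma avg_measurable [measurable]:
  assumes [measurable]: "F \<in> borel_measurable N"
  shows "avg F \<in> borel_measurable N"
  unfolding avg_def[abs_def] by measurable

lemma avg_square_le: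
  assumes [measurable]: "F \<in> borel_measurable N" and p: "p \<in> space N"
  shows "ennreal ((avg F p)\<^sup>2) \<le> ennreal (LINT y|lborel. \<sigma> y) * (\<integral>\<^sup>+y. ennreal (\<sigma> y * (F (\<theta> y p))\<^sup>2) \<partial>lborel)"
proof (cases "(\<integral>\<^sup>+y. ennreal (\<sigma> y * (F (\<theta> y p))\<^sup>2) \<partial>lborel) = \<infinity>")
  case True
  then show ?thesis using sigma_pos by (simp add: ennreal_mult_top)
next
  case False
  let ?s = "LINT y|lborel. \<sigma> y"
  let ?f = "\<lambda>y. F (\<theta> y p)"
  have [measurable]: "?f \<in> borel_measurable borel" using p by measurable
  have i2: "integrable lborel (\<lambda>y. \<sigma> y * (?f y)\<^sup>2)"
    by (rule integrableI_nonneg) (use False in \<open>auto simp: sigma_nonneg less_top\<close>)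
  have i1: "integrable lborel (\<lambda>y. \<sigma> y * ?f y)"
  proof (rule Bochner_Integration.integrable_bound[OF Bochner_Integration.integrable_add[OF sigma_int i2]])
    show "AE y in lborel. norm (\<sigma> y * ?f y) \<le> norm (\<sigma> y + \<sigma> y * (?f y)\<^sup>2)"
    proof (intro AE_I2)
      fix y
      have "2 * \<bar>?f y\<bar> \<le> 1 + (?f y)\<^sup>2"
        using zero_le_power2[of "\<bar>?f y\<bar> - 1"] by (simp add: power2_eq_square algebra_simps)
      then have "\<bar>?f y\<bar> \<le> 1 + (?f y)\<^sup>2" by linarith
      then have "\<sigma> y * \<bar>?f y\<bar> \<le> \<sigma> y * (1 + (?f y)\<^sup>2)" by (intro mult_left_mono sigma_nonneg)
      then show "norm (\<sigma> y * ?f y) \<le> norm (\<sigma> y + \<sigma> y * (?f y)\<^sup>2)"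
        using sigma_nonneg[of y] by (simp add: abs_mult distrib_left)
    qed
  qed auto
  \<comment> \<open>The weighted mean of F along the orbit; nonnegativity of the weighted variance
    is the Cauchy-Schwarz inequality.\<close>
  define c where "c = avg F p / ?s"
  have cs: "c * ?s = avg F p" using sigma_pos by (simp add: c_def)
  have "0 \<le> (LINT y|lborel. \<sigma> y * (?f y - c)\<^sup>2)"
    by (intro integral_nonneg_AE) (simp add: sigma_nonneg)
  also have "\<dots> = (LINT y|lborel. \<sigma> y * (?f y)\<^sup>2 - (2 * c) * (\<sigma> y * ?f y) + c\<^sup>2 * \<sigma> y)"
    by (intro Bochner_Integration.integral_cong) (auto simp: power2_eq_square algebra_simps)
  also have "\<dots> = (LINT y|lborel. \<sigma> y * (?f y)\<^sup>2) - (2 * c) * avg F p + c\<^sup>2 * ?s"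
    unfolding avg_def using i1 i2 sigma_int by simp
  finally have "0 \<le> ?s * ((LINT y|lborel. \<sigma> y * (?f y)\<^sup>2) - (2 * c) * avg F p + c\<^sup>2 * ?s)"
    using sigma_pos by simp
  also have "\<dots> = ?s * (LINT y|lborel. \<sigma> y * (?f y)\<^sup>2) - (avg F p)\<^sup>2"
    unfolding cs[symmetric] by (simp add: power2_eq_square algebra_simps)
  finally have "(avg F p)\<^sup>2 \<le> ?s * (LINT y|lborel. \<sigma> y * (?f y)\<^sup>2)" by simp
  then have "ennreal ((avg F p)\<^sup>2) \<le> ennreal (?s * (LINT y|lborel. \<sigma> y * (?f y)\<^sup>2))" by (rule ennreal_leI)
  also have "\<dots> = ennreal ?s * ennreal (LINT y|lborel. \<sigma> y * (?f y)\<^sup>2)"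
    using sigma_pos by (intro ennreal_mult') simp
  also have "ennreal (LINT y|lborel. \<sigma> y * (?f y)\<^sup>2) = (\<integral>\<^sup>+y. ennreal (\<sigma> y * (?f y)\<^sup>2) \<partial>lborel)"
    by (rule nn_integral_eq_integral[symmetric, OF i2]) (simp add: sigma_nonneg)
  finally show ?thesis .
qed

lemma nn_sigma_theta:
  assumes [measurable]: "F \<in> borel_measurable N"
  shows "(\<integral>\<^sup>+p. \<integral>\<^sup>+y. ennreal (\<sigma> y * (F (\<theta> y p))\<^sup>2) \<partial>lborel \<partial>N) = ennreal (LINT y|lborel. \<sigma> y) * (\<integral>\<^sup>+p. ennreal ((F p)\<^sup>2) \<partial>N)"
proof -
  have "(\<integral>\<^sup>+p. \<integral>\<^sup>+y. ennreal (\<sigma> y * (F (\<theta> y p))\<^sup>2) \<partial>lborel \<partial>N) = (\<integral>\<^sup>+y. \<integral>\<^sup>+p. ennreal (\<sigma> y * (F (\<theta> y p))\<^sup>2) \<partial>N \<partial>lborel)"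
    by (rule NL.Fubini'[symmetric]) measurable
  also have "\<dots> = (\<integral>\<^sup>+y. ennreal (\<sigma> y) * (\<integral>\<^sup>+p. ennreal ((F p)\<^sup>2) \<partial>N) \<partial>lborel)"
  proof (intro nn_integral_cong)
    fix y
    have "(\<integral>\<^sup>+p. ennreal (\<sigma> y * (F (\<theta> y p))\<^sup>2) \<partial>N) = (\<integral>\<^sup>+p. ennreal (\<sigma> y) * ennreal ((F (\<theta> y p))\<^sup>2) \<partial>N)"
      using sigma_nonneg by (intro nn_integral_cong ennreal_mult) auto
    also have "\<dots> = ennreal (\<sigma> y) * (\<integral>\<^sup>+p. ennreal ((F p)\<^sup>2) \<partial>N)"
      by (subst nn_integral_cmult, measurable, subst nn_theta[of "\<lambda>p. ennreal ((F p)\<^sup>2)"], measurable)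
    finally show "(\<integral>\<^sup>+p. ennreal (\<sigma> y * (F (\<theta> y p))\<^sup>2) \<partial>N) = ennreal (\<sigma> y) * (\<integral>\<^sup>+p. ennreal ((F p)\<^sup>2) \<partial>N)" .
  qed
  also have "\<dots> = (\<integral>\<^sup>+y. ennreal (\<sigma> y) \<partial>lborel) * (\<integral>\<^sup>+p. ennreal ((F p)\<^sup>2) \<partial>N)"
    by (rule nn_integral_multc) measurable
  also have "(\<integral>\<^sup>+y. ennreal (\<sigma> y) \<partial>lborel) = ennreal (LINT y|lborel. \<sigma> y)"
    by (rule nn_integral_eq_integral[OF sigma_int]) (simp add: sigma_nonneg)
  finally show ?thesis .
qed

lemma avg_L2:
  assumes "F \<in> L2 N" shows "avg F \<in> L2 N"
proof -
  have [measurable]: "F \<in> borel_measurable N" using assms by (rule L2_measurable)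
  have "(\<integral>\<^sup>+p. ennreal ((avg F p)\<^sup>2) \<partial>N) \<le>
     (\<integral>\<^sup>+p. ennreal (LINT y|lborel. \<sigma> y) * (\<integral>\<^sup>+y. ennreal (\<sigma> y * (F (\<theta> y p))\<^sup>2) \<partial>lborel) \<partial>N)"
    by (intro nn_integral_mono avg_square_le) auto
  also have "\<dots> = ennreal (LINT y|lborel. \<sigma> y) * (ennreal (LINT y|lborel. \<sigma> y) * (\<integral>\<^sup>+p. ennreal ((F p)\<^sup>2) \<partial>N))"
    by (subst nn_integral_cmult, measurable, subst nn_sigma_theta, measurable)
  also have "\<dots> < \<infinity>" using assms by (simp add: L2_iff_nn ennreal_mult_less_top)
  finally show ?thesis unfolding L2_iff_nn by simp
qed

lemma avg_prod_integrable:
  assumes F: "F \<in> L2 N" and G: "G \<in> L2 N"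
  shows "integrable (N \<Otimes>\<^sub>M lborel) (\<lambda>(p, y). \<sigma> y * (F p * G (\<theta> y p)))"
proof -
  have [measurable]: "F \<in> borel_measurable N" "G \<in> borel_measurable N" using assms L2_measurable by auto
  have le: "ennreal (norm (\<sigma> y * (F p * G (\<theta> y p)))) \<le> ennreal (\<sigma> y) * ennreal ((F p)\<^sup>2) + ennreal (\<sigma> y * (G (\<theta> y p))\<^sup>2)" for p y
  proof -
    have "0 \<le> (\<bar>F p\<bar> - \<bar>G (\<theta> y p)\<bar>)\<^sup>2" by simp
    then have "2 * (\<bar>F p\<bar> * \<bar>G (\<theta> y p)\<bar>) \<le> (F p)\<^sup>2 + (G (\<theta> y p))\<^sup>2"
      by (simp add: power2_eq_square algebra_simps)
    moreover have "0 \<le> \<bar>F p\<bar> * \<bar>G (\<theta> y p)\<bar>" by simp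
    ultimately have "\<bar>F p\<bar> * \<bar>G (\<theta> y p)\<bar> \<le> (F p)\<^sup>2 + (G (\<theta> y p))\<^sup>2" by linarith
    then have "\<sigma> y * (\<bar>F p\<bar> * \<bar>G (\<theta> y p)\<bar>) \<le> \<sigma> y * ((F p)\<^sup>2 + (G (\<theta> y p))\<^sup>2)"
      by (intro mult_left_mono sigma_nonneg)
    then have "norm (\<sigma> y * (F p * G (\<theta> y p))) \<le> \<sigma> y * (F p)\<^sup>2 + \<sigma> y * (G (\<theta> y p))\<^sup>2"
      using sigma_nonneg[of y] by (simp add: abs_mult distrib_left)
    then have "ennreal (norm (\<sigma> y * (F p * G (\<theta> y p)))) \<le> ennreal (\<sigma> y * (F p)\<^sup>2 + \<sigma> y * (G (\<theta> y p))\<^sup>2)"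
      by (rule ennreal_leI)
    then show ?thesis using sigma_nonneg[of y] by (simp add: ennreal_mult)
  qed
  have "(\<integral>\<^sup>+q. ennreal (norm (case q of (p, y) \<Rightarrow> \<sigma> y * (F p * G (\<theta> y p)))) \<partial>(N \<Otimes>\<^sub>M lborel)) =
    (\<integral>\<^sup>+p. \<integral>\<^sup>+y. ennreal (norm (\<sigma> y * (F p * G (\<theta> y p)))) \<partial>lborel \<partial>N)"
    by (subst lborel.nn_integral_fst[symmetric]) (auto simp: case_prod_beta')
  also have "\<dots> \<le> (\<integral>\<^sup>+p. \<integral>\<^sup>+y. ennreal (\<sigma> y) * ennreal ((F p)\<^sup>2) + ennreal (\<sigma> y * (G (\<theta> y p))\<^sup>2) \<partial>lborel \<partial>N)"
    by (intro nn_integral_mono le)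
  also have "\<dots> = (\<integral>\<^sup>+p. (\<integral>\<^sup>+y. ennreal (\<sigma> y) \<partial>lborel) * ennreal ((F p)\<^sup>2) + (\<integral>\<^sup>+y. ennreal (\<sigma> y * (G (\<theta> y p))\<^sup>2) \<partial>lborel) \<partial>N)"
  proof (intro nn_integral_cong)
    fix p assume "p \<in> space N"
    then show "(\<integral>\<^sup>+y. ennreal (\<sigma> y) * ennreal ((F p)\<^sup>2) + ennreal (\<sigma> y * (G (\<theta> y p))\<^sup>2) \<partial>lborel) =
      (\<integral>\<^sup>+y. ennreal (\<sigma> y) \<partial>lborel) * ennreal ((F p)\<^sup>2) + (\<integral>\<^sup>+y. ennreal (\<sigma> y * (G (\<theta> y p))\<^sup>2) \<partial>lborel)"
      by (subst nn_integral_add, measurable, subst nn_integral_multc, measurable)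
  qed
  also have "\<dots> = (\<integral>\<^sup>+y. ennreal (\<sigma> y) \<partial>lborel) * (\<integral>\<^sup>+p. ennreal ((F p)\<^sup>2) \<partial>N) + ennreal (LINT y|lborel. \<sigma> y) * (\<integral>\<^sup>+p. ennreal ((G p)\<^sup>2) \<partial>N)"
    by (subst nn_integral_add, measurable, subst nn_integral_cmult, measurable, subst nn_sigma_theta, measurable)
  also have "(\<integral>\<^sup>+y. ennreal (\<sigma> y) \<partial>lborel) = ennreal (LINT y|lborel. \<sigma> y)"
    by (rule nn_integral_eq_integral[OF sigma_int]) (simp add: sigma_nonneg)
  also have "ennreal (LINT y|lborel. \<sigma> y) * (\<integral>\<^sup>+p. ennreal ((F p)\<^sup>2) \<partial>N) + ennreal (LINT y|lborel. \<sigma> y) * (\<integral>\<^sup>+p. ennreal ((G p)\<^sup>2) \<partial>N) < \<infinity>"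
    using F G by (simp add: L2_iff_nn ennreal_mult_less_top)
  finally show ?thesis
    by (intro integrableI_bounded) (auto simp: case_prod_beta')
qed

text \<open>Since N is invariant, the adjoint of composition with \<open>\<theta> y\<close> is
  composition with \<open>\<theta> (- y)\<close>, and \<sigma> is even; Fubini exchanges the average
  with the inner product.\<close>

lemma avg_selfadjoint:
  assumes F: "F \<in> L2 N" and G: "G \<in> L2 N"
  shows "L2_inner N F (avg G) = L2_inner N (avg F) G"
proof -
  have Fm [measurable]: "F \<in> borel_measurable N" "G \<in> borel_measurable N" using assms L2_measurable by auto
  have half: "L2_inner N F (avg G) = (LINT y|lborel. \<sigma> y * (LINT p|N. F p * G (\<theta> y p)))" if F: "F \<in> L2 N" and G: "G \<in> L2 N" for F G
  proof -
    have "L2_inner N F (avg G) = (LINT p|N. LINT y|lborel. \<sigma> y * (F p * G (\<theta> y p)))"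
      unfolding L2_inner_def avg_def
      by (subst Bochner_Integration.integral_mult_right_zero[symmetric]) (simp add: mult_ac)
    also have "\<dots> = (LINT y|lborel. LINT p|N. \<sigma> y * (F p * G (\<theta> y p)))"
      by (rule NL.Fubini_integral[symmetric, OF avg_prod_integrable[OF F G]])
    finally show ?thesis by simp
  qed
  have flip: "(LINT p|N. F p * G (\<theta> y p)) = (LINT p|N. G p * F (\<theta> (- y) p))" for y
  proof -
    have "(LINT p|N. F p * G (\<theta> y p)) = (LINT p|distr N N (\<theta> (- y)). F p * G (\<theta> y p))"
      by (simp only: theta_pres)
    also have "\<dots> = (LINT p|N. F (\<theta> (- y) p) * G (\<theta> y (\<theta> (- y) p)))"
      by (rule integral_distr) measurable
    also have "\<dots> = (LINT p|N. G p * F (\<theta> (- y) p))"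
      by (intro Bochner_Integration.integral_cong) (auto simp: theta_inv mult.commute)
    finally show ?thesis .
  qed
  have "L2_inner N F (avg G) = (LINT y|lborel. \<sigma> y * (LINT p|N. G p * F (\<theta> (- y) p)))"
    unfolding half[OF F G] flip ..
  also have "\<dots> = (LINT y|lborel. \<sigma> y * (LINT p|N. G p * F (\<theta> y p)))"
  proof -
    have m: "(\<lambda>y. \<sigma> y * (LINT p|N. G p * F (\<theta> y p))) \<in> borel_measurable borel" by measurable
    show ?thesis using lborel_integral_reflect[OF m, of 0] by (simp add: sigma_even)
  qed
  also have "\<dots> = L2_inner N (avg F) G"
    unfolding half[OF G F, symmetric] by (rule L2_inner_commute)
  finally show ?thesis .
qed

end

section \<open>Vanishing box integrals and Lipschitz approximations of boxes\<close>

lemma nn_integral_lborel_reflect: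
  fixes f :: "'a::euclidean_space \<Rightarrow> ennreal"
  assumes [measurable]: "f \<in> borel_measurable borel"
  shows "(\<integral>\<^sup>+y. f (x - y) \<partial>lborel) = (\<integral>\<^sup>+y. f y \<partial>lborel)"
proof -
  have "(\<integral>\<^sup>+y. f y \<partial>lborel) = (\<integral>\<^sup>+y. f y \<partial>density (distr lborel borel (\<lambda>y::'a. x + (-1) *\<^sub>R y)) (\<lambda>_. \<bar>-1::real\<bar>^DIM('a)))"
    by (subst lborel_affine[of "-1" x]) auto
  also have "\<dots> = (\<integral>\<^sup>+y. f (x - y) \<partial>lborel)"
    by (simp add: density_1 nn_integral_distr)
  finally show ?thesis ..
qed

text \<open>Adding B makes v a density; two densities whose measures agree on a generating family of
  boxes agree almost everywhere.\<close>

lemma AE_zero_boxes: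
  fixes v :: "'a::euclidean_space \<Rightarrow> real"
  assumes [measurable]: "v \<in> borel_measurable borel" and B: "\<And>x. \<bar>v x\<bar> \<le> B"
    and box: "\<And>a b. (LINT x|lborel. indicator (box a b) x * v x) = 0"
  shows "AE x in lborel. v x = 0"
proof -
  have B0: "0 \<le> B" using B[of 0] by linarith
  have vB: "0 \<le> v x + B" for x using B[of x] by linarith
  have eq: "emeasure (density lborel (\<lambda>x. ennreal (v x + B))) (box a b) = emeasure (density lborel (\<lambda>x. ennreal B)) (box a b)" for a b
  proof -
    have i1: "integrable lborel (indicator (box a b) :: 'a \<Rightarrow> real)"
      by (intro integrable_real_indicator) (auto simp: emeasure_lborel_box_eq)
    have i2: "integrable lborel (\<lambda>x. indicator (box a b) x * v x)"
      by (rule integrable_mult_bounded[OF i1 _ B]) auto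
    have "emeasure (density lborel (\<lambda>x. ennreal (v x + B))) (box a b) = (\<integral>\<^sup>+x. ennreal (indicator (box a b) x * v x + B * indicator (box a b) x) \<partial>lborel)"
      by (subst emeasure_density) (auto intro!: nn_integral_cong simp: indicator_def)
    also have "\<dots> = ennreal (LINT x|lborel. indicator (box a b) x * v x + B * indicator (box a b) x)"
      using vB by (intro nn_integral_eq_integral Bochner_Integration.integrable_add i2 integrable_mult_right i1)
        (auto simp: indicator_def)
    also have "\<dots> = ennreal (LINT x|lborel. B * indicator (box a b) x)"
      using i1 i2 box by (subst Bochner_Integration.integral_add) auto
    also have "\<dots> = (\<integral>\<^sup>+x. ennreal (B * indicator (box a b) x) \<partial>lborel)"
      using i1 B0 by (intro nn_integral_eq_integral[symmetric]) auto
    also have "\<dots> = emeasure (density lborel (\<lambda>x. ennreal B)) (box a b)"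
      by (subst emeasure_density) (auto intro!: nn_integral_cong simp: indicator_def)
    finally show ?thesis .
  qed
  have "density lborel (\<lambda>x. ennreal (v x + B)) = density lborel (\<lambda>x::'a. ennreal B)"
  proof (rule measure_eqI_generator_eq[where E=rboxes and \<Omega>=UNIV and A="wbox :: nat \<Rightarrow> 'a set"])
    show "emeasure (density lborel (\<lambda>x. ennreal (v x + B))) D = emeasure (density lborel (\<lambda>x. ennreal B)) D" if "D \<in> rboxes" for D
      using rboxes_box[OF that] eq by auto
    show "sets (density lborel (\<lambda>x. ennreal (v x + B))) = sigma_sets UNIV rboxes"
      "sets (density lborel (\<lambda>x::'a. ennreal B)) = sigma_sets UNIV rboxes"
      using arg_cong[OF borel_rboxes, of sets] by auto
    show "range (wbox :: nat \<Rightarrow> 'a set) \<subseteq> rboxes" using wbox_rboxes by auto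
    show "(\<Union>i. wbox i) = (UNIV :: 'a set)"
    proof (intro equalityI subsetI UNIV_I)
      fix x :: 'a
      have "x \<in> cball 0 (real (nat \<lceil>norm x\<rceil>))" by (simp; linarith)
      then show "x \<in> (\<Union>i. wbox i)" using cball_wbox by blast
    qed
    show "emeasure (density lborel (\<lambda>x. ennreal (v x + B))) (wbox i) \<noteq> \<infinity>" for i
    proof -
      obtain a b where ab: "(wbox i :: 'a set) = box a b" using rboxes_box[OF wbox_rboxes] by blast
      have "emeasure (density lborel (\<lambda>x. ennreal (v x + B))) (wbox i) = ennreal B * emeasure lborel (box a b)"
        unfolding ab eq by (subst emeasure_density) (auto simp: nn_integral_cmult_indicator)
      then show ?thesis by (simp add: emeasure_lborel_box_eq ennreal_mult_eq_top_iff)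
    qed
  qed (auto simp: rboxes_Int_stable)
  then have "AE x in lborel. ennreal (v x + B) = ennreal B"
    by (subst (asm) sigma_finite_measure.density_unique_iff[OF lborel.sigma_finite_measure_axioms]) auto
  then show ?thesis
  proof eventually_elim
    case (elim x)
    then show ?case using vB[of x] B0 by (subst (asm) ennreal_inj) auto
  qed
qed

text \<open>Lipschitz functions that increase with n to the indicator of an open box. The box is
  centred at 0 to make them even, as an averaging weight has to be.\<close>

definition tent :: "'a::euclidean_space \<Rightarrow> nat \<Rightarrow> 'a \<Rightarrow> real" where
  "tent a n y = min 1 (real n * infdist y (- box (- a) a))"

lemma tent_even: "tent a n (- y) = tent a n y"
proof -
  have "uminus ` (- box (- a) a) = - box (- a) a"
  proof -
    have "x \<in> box (- a) a \<longleftrightarrow> - x \<in> box (- a) a" for x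
      by (auto simp: mem_box)
    moreover have "x \<in> uminus ` (- box (- a) a) \<longleftrightarrow> - x \<in> - box (- a) a" for x
      by (metis (no_types) image_iff minus_minus)
    ultimately show ?thesis by blast
  qed
  then have "(INF b\<in>- box (- a) a. dist (- y) b) = (INF b\<in>- box (- a) a. dist y b)"
    using image_image[of "dist (- y)" uminus "- box (- a) a"]
    by (metis (no_types, lifting) image_cong dist_minus)
  then show ?thesis by (simp add: tent_def infdist_def)
qed

lemma compl_box_nonempty: "- box (- a) a \<noteq> ({} :: 'a::euclidean_space set)"
  using not_bounded_UNIV bounded_box[of "- a" a] by (metis Compl_UNIV_eq double_complement)

lemma tent_zero: "y \<notin> box (- a) a \<Longrightarrow> tent a n y = 0"
  by (simp add: tent_def)

lemma tent_pos: "y \<in> box (- a) a \<Longrightarrow> 0 < infdist y (- box (- a) a)"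
  using in_closed_iff_infdist_zero[OF _ compl_box_nonempty, of a y] infdist_nonneg[of y "- box (- a) a"]
  by (auto simp: closed_def less_le)

lemma tent_tendsto: "(\<lambda>n. tent a n y) \<longlonglongrightarrow> indicator (box (- a) a) y"
proof (cases "y \<in> box (- a) a")
  case True
  let ?d = "infdist y (- box (- a) a)"
  have d: "0 < ?d" by (rule tent_pos[OF True])
  have "\<forall>\<^sub>F n in sequentially. tent a n y = 1"
    using eventually_ge_at_top[of "nat \<lceil>1 / ?d\<rceil>"]
  proof eventually_elim
    case (elim n)
    then have "1 / ?d \<le> real n" by linarith
    then have "1 \<le> real n * ?d" using d by (simp add: field_simps)
    then show ?case by (simp add: tent_def)
  qed
  then show ?thesis using True by (auto intro: tendsto_eventually)
next
  case False
  then show ?thesis by (simp add: tent_zero)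
qed

lemma tent_lipc:
  fixes a :: "'a::euclidean_space"
  obtains R where "\<And>n. lipc (real n) 1 R (tent a n)"
proof -
  obtain R where R: "\<And>x. x \<in> box (- a) a \<Longrightarrow> norm x \<le> R" using bounded_box[of "- a" a] unfolding bounded_iff by auto
  have "lipc (real n) 1 (max R 1) (tent a n)" for n
    unfolding lipc_def
  proof (intro conjI allI impI)
    show "\<bar>tent a n x - tent a n y\<bar> \<le> real n * dist x y" for x y
    proof -
      have "\<bar>tent a n x - tent a n y\<bar> \<le> \<bar>real n * infdist x (- box (- a) a) - real n * infdist y (- box (- a) a)\<bar>"
        by (auto simp: tent_def)
      also have "\<dots> = real n * \<bar>infdist x (- box (- a) a) - infdist y (- box (- a) a)\<bar>"
        by (simp add: right_diff_distrib[symmetric] abs_mult)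
      also have "\<dots> \<le> real n * dist x y"
        by (intro mult_left_mono infdist_triangle_abs) auto
      finally show ?thesis .
    qed
    show "\<bar>tent a n x\<bar> \<le> 1" for x by (auto simp: tent_def infdist_nonneg)
    show "tent a n x = 0" if "max R 1 < norm x" for x
      using R[of x] that by (intro tent_zero) auto
  qed auto
  then show thesis by (rule that)
qed

section \<open>Translation invariant forms\<close>

locale lim_kernel =
  fixes k :: "'a::euclidean_space \<Rightarrow> real"
  assumes k_meas [measurable]: "k \<in> borel_measurable borel"
    and k_nonneg: "0 \<le> k z" and k_even: "k (- z) = k z"
    and k_int: "(\<integral>\<^sup>+z. ennreal (min 1 ((norm z)\<^sup>2) * k z) \<partial>lborel) < \<infinity>"
begin

lemma k_int_shift: "(\<integral>\<^sup>+y. ennreal (min 1 ((dist x y)\<^sup>2) * k (x - y)) \<partial>lborel) = (\<integral>\<^sup>+z. ennreal (min 1 ((norm z)\<^sup>2) * k z) \<partial>lborel)"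
  using nn_integral_lborel_reflect[of "\<lambda>z. ennreal (min 1 ((norm z)\<^sup>2) * k z)" x] by (simp add: dist_norm)

sublocale sym_space "\<lambda>x y. k (x - y)" lborel
proof
  show "(\<lambda>(x, y). k (x - y)) \<in> borel_measurable (borel \<Otimes>\<^sub>M borel)" by measurable
  show "k (x - y) = k (y - x)" for x y using k_even[of "x - y"] by simp
  show "emeasure lborel (cball (0::'a) R) < \<infinity>" for R by (rule emeasure_lborel_cball_finite)
  show "(\<integral>\<^sup>+x. indicator (cball 0 R) x * (\<integral>\<^sup>+y. ennreal (min 1 ((dist x y)\<^sup>2) * k (x - y)) \<partial>lborel) \<partial>lborel) < \<infinity>" for R
    unfolding k_int_shift using k_int emeasure_lborel_cball_finite[of "0::'a" R]
    by (subst nn_integral_multc) (auto simp: ennreal_mult_less_top)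
qed (auto simp: k_nonneg)

abbreviation "JJ \<equiv> jm (\<lambda>x y. k (x - y))"

text \<open>Both points of a pair are moved by the same vector, so their difference, and with it the
  density, is unchanged; Lebesgue measure on pairs is invariant.\<close>

lemma JJ_shift: "distr JJ JJ (\<lambda>p. (fst p - y, snd p - y)) = JJ"
proof (rule measure_eqI)
  fix A assume "A \<in> sets (distr JJ JJ (\<lambda>p. (fst p - y, snd p - y)))"
  then have A [measurable]: "A \<in> sets (borel \<Otimes>\<^sub>M borel)" by (simp add: sets_jm)
  let ?w = "\<lambda>p. ennreal (indicator (- Id) p * (1 / 2 * k (fst p - snd p))) * indicator A p"
  have "emeasure (distr JJ JJ (\<lambda>p. (fst p - y, snd p - y))) A =
     emeasure JJ ((\<lambda>p. (fst p - y, snd p - y)) -` A \<inter> space JJ)"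
    by (rule emeasure_distr) measurable
  also have "\<dots> = (\<integral>\<^sup>+p. indicator ((\<lambda>p. (fst p - y, snd p - y)) -` A \<inter> space JJ) p \<partial>JJ)"
    by (rule nn_integral_indicator[symmetric]) measurable
  also have "\<dots> = (\<integral>\<^sup>+p. indicator A (fst p - y, snd p - y) \<partial>JJ)"
    by (intro nn_integral_cong) (auto simp: indicator_def)
  also have "\<dots> = (\<integral>\<^sup>+p. ennreal (indicator (- Id) p * (1 / 2 * k (fst p - snd p))) * indicator A (fst p - y, snd p - y) \<partial>lborel2)"
    unfolding jm_def by (subst nn_integral_density) auto
  also have "\<dots> = (\<integral>\<^sup>+p. ?w (p + (- y, - y)) \<partial>lborel2)"
    by (intro nn_integral_cong) (auto simp: indicator_def)
  also have "\<dots> = (\<integral>\<^sup>+p. ?w p \<partial>lborel2)"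
    unfolding lborel_prod by (rule nn_integral_lborel_shift) (simp add: borel_prod[symmetric])
  also have "\<dots> = emeasure JJ A"
    unfolding jm_def by (subst emeasure_density) auto
  finally show "emeasure (distr JJ JJ (\<lambda>p. (fst p - y, snd p - y))) A = emeasure JJ A" .
qed simp

lemma lborel_shift: "distr lborel lborel (\<lambda>x. x - y) = (lborel :: 'a measure)"
  using lborel_distr_plus[of "- y"] by (simp cong: distr_cong)

lemma JJ_sigma_finite: "sigma_finite_measure JJ"
  unfolding jm_def lborel_prod by (subst sigma_finite_measure.sigma_finite_iff_density_finite[OF lborel.sigma_finite_measure_axioms]) (auto simp: borel_prod[symmetric])


text \<open>Hence bounded Lipschitz functions of finite energy belong to the domain.\<close>

lemma lipschitz_cutoff:
  assumes w: "w \<in> V" and L: "\<And>x y. \<bar>w x - w y\<bar> \<le> L * dist x y" and B: "\<And>x. \<bar>w x\<bar> \<le> B" and L0: "0 \<le> L"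
  shows "lipc (L + B) B (real n + 1) (\<lambda>x. cutoff n x * w x)"
    and "(\<lambda>n. ip 1 (\<lambda>x. cutoff n x * w x - w x) (\<lambda>x. cutoff n x * w x - w x)) \<longlonglongrightarrow> 0"
proof -
  have B0: "0 \<le> B" using B[of 0] by linarith
  have [measurable]: "w \<in> borel_measurable borel" by (rule V_measurable[OF w])
  have cl: "\<bar>cutoff n x - cutoff n y\<bar> \<le> dist x y" for n and x y :: 'a
  proof -
    have "\<bar>cutoff n x - cutoff n y\<bar> \<le> 1 * dist x y" using cutoff_lipc[of n] unfolding lipc_def by blast
    then show ?thesis by simp
  qed
  show "lipc (L + B) B (real n + 1) (\<lambda>x. cutoff n x * w x)" unfolding lipc_def
  proof (intro conjI allI impI)
    fix x y :: 'a
    have "\<bar>cutoff n x * w x - cutoff n y * w y\<bar> = \<bar>cutoff n x * (w x - w y) + (cutoff n x - cutoff n y) * w y\<bar>"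
      by (simp add: algebra_simps)
    also have "\<dots> \<le> \<bar>cutoff n x\<bar> * \<bar>w x - w y\<bar> + \<bar>cutoff n x - cutoff n y\<bar> * \<bar>w y\<bar>"
      by (metis abs_mult abs_triangle_ineq)
    also have "\<dots> \<le> 1 * (L * dist x y) + dist x y * B"
      using cutoff_bounds[of n x] L0 by (intro add_mono mult_mono L B cl) auto
    finally show "\<bar>cutoff n x * w x - cutoff n y * w y\<bar> \<le> (L + B) * dist x y" by (simp add: algebra_simps)
  next
    fix x :: 'a
    have "\<bar>cutoff n x\<bar> * \<bar>w x\<bar> \<le> 1 * B" using cutoff_bounds[of n x] by (intro mult_mono B) auto
    then show "\<bar>cutoff n x * w x\<bar> \<le> B" by (simp add: abs_mult)
  qed (use B0 L0 in \<open>auto simp: cutoff_def\<close>)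
  \<comment> \<open>This bounds the second term of the product rule, increments of the cutoff times
    a value of w. It is integrable because translation invariance makes the kernel integral
    independent of the base point.\<close>
  let ?w2 = "\<lambda>p. min 1 ((dist (fst p) (snd p))\<^sup>2) * (w (snd p))\<^sup>2"
  show "(\<lambda>n. ip 1 (\<lambda>x. cutoff n x * w x - w x) (\<lambda>x. cutoff n x * w x - w x)) \<longlonglongrightarrow> 0"
  proof (rule ip_dominated)
    show "(\<lambda>n. cutoff n x * w x - w x) \<longlonglongrightarrow> 0" for x
      using tendsto_diff[OF tendsto_mult[OF cutoff_tendsto[of x] tendsto_const[of "w x"]] tendsto_const[of "w x"]] by simp
    show "(dif (\<lambda>x. cutoff n x * w x - w x) p)\<^sup>2 \<le> 2 * (dif w p)\<^sup>2 + 2 * ?w2 p" for n p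
    proof -
      let ?a = "\<lambda>x. cutoff n x - 1" and ?x = "fst p" and ?y = "snd p"
      have e: "dif (\<lambda>x. cutoff n x * w x - w x) p = ?a ?x * dif w p + (cutoff n ?x - cutoff n ?y) * w ?y"
        by (simp add: dif_def algebra_simps)
      have sq: "(a + b)\<^sup>2 \<le> 2 * a\<^sup>2 + 2 * b\<^sup>2" for a b :: real
        using zero_le_power2[of "a - b"] by (simp add: power2_eq_square algebra_simps)
      have "\<bar>?a ?x\<bar> \<le> \<bar>1\<bar>" using cutoff_bounds[of n ?x] by auto
      then have "(?a ?x)\<^sup>2 \<le> 1" unfolding abs_le_square_iff by simp
      then have 1: "(?a ?x * dif w p)\<^sup>2 \<le> (dif w p)\<^sup>2"
        using mult_right_mono[of "(?a ?x)\<^sup>2" 1 "(dif w p)\<^sup>2"] by (simp add: power_mult_distrib)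
      have "\<bar>cutoff n ?x - cutoff n ?y\<bar> \<le> \<bar>dist ?x ?y\<bar>" "\<bar>cutoff n ?x - cutoff n ?y\<bar> \<le> \<bar>1\<bar>"
        using cl[of n ?x ?y] cutoff_bounds[of n ?x] cutoff_bounds[of n ?y] by auto
      then have "(cutoff n ?x - cutoff n ?y)\<^sup>2 \<le> min 1 ((dist ?x ?y)\<^sup>2)" unfolding abs_le_square_iff by simp
      then have 2: "((cutoff n ?x - cutoff n ?y) * w ?y)\<^sup>2 \<le> ?w2 p"
        unfolding power_mult_distrib by (intro mult_right_mono) auto
      show ?thesis using sq[of "?a ?x * dif w p" "(cutoff n ?x - cutoff n ?y) * w ?y"] 1 2 unfolding e by linarith
    qed
    have "integrable JJ ?w2"
    proof (rule integrableI_nonneg)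
      have "(\<integral>\<^sup>+p. ennreal (?w2 p) \<partial>JJ) \<le> ennreal (1 / 2) * (\<integral>\<^sup>+p. ennreal (?w2 p * k (fst p - snd p)) \<partial>lborel2)"
        by (subst nn_integral_jm, measurable, intro mult_left_mono nn_integral_mono) (auto simp: indicator_def)
      also have "(\<integral>\<^sup>+p. ennreal (?w2 p * k (fst p - snd p)) \<partial>lborel2) = (\<integral>\<^sup>+p. ennreal ((w (fst p))\<^sup>2) * ennreal (min 1 ((dist (fst p) (snd p))\<^sup>2) * k (fst p - snd p)) \<partial>lborel2)"
      proof -
        have "(\<integral>\<^sup>+p. ennreal (?w2 p * k (fst p - snd p)) \<partial>lborel2) = (\<integral>\<^sup>+p. ennreal (?w2 (snd p, fst p) * k (snd p - fst p)) \<partial>lborel2)"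
          by (subst nn_integral_lborel2_swap[symmetric]) auto
        also have "\<dots> = (\<integral>\<^sup>+p. ennreal ((w (fst p))\<^sup>2) * ennreal (min 1 ((dist (fst p) (snd p))\<^sup>2) * k (fst p - snd p)) \<partial>lborel2)"
        proof (intro nn_integral_cong)
          fix p :: "'a \<times> 'a"
          have "k (snd p - fst p) = k (fst p - snd p)" using k_even[of "fst p - snd p"] by simp
          then show "ennreal (?w2 (snd p, fst p) * k (snd p - fst p)) = ennreal ((w (fst p))\<^sup>2) * ennreal (min 1 ((dist (fst p) (snd p))\<^sup>2) * k (fst p - snd p))"
            using k_nonneg by (simp add: ennreal_mult[symmetric] dist_commute mult_ac)
        qed
        finally show ?thesis .
      qed
      also have "\<dots> = (\<integral>\<^sup>+x. ennreal ((w x)\<^sup>2) * (\<integral>\<^sup>+z. ennreal (min 1 ((norm z)\<^sup>2) * k z) \<partial>lborel) \<partial>lborel)"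
        by (subst nn_integral_lborel2_fst, measurable, intro nn_integral_cong, simp only: fst_conv snd_conv,
            subst nn_integral_cmult, measurable, simp only: k_int_shift)
      also have "\<dots> = (\<integral>\<^sup>+x. ennreal ((w x)\<^sup>2) \<partial>lborel) * (\<integral>\<^sup>+z. ennreal (min 1 ((norm z)\<^sup>2) * k z) \<partial>lborel)"
        by (rule nn_integral_multc) measurable
      finally have le: "(\<integral>\<^sup>+p. ennreal (?w2 p) \<partial>JJ) \<le> ennreal (1 / 2) * ((\<integral>\<^sup>+x. ennreal ((w x)\<^sup>2) \<partial>lborel) * (\<integral>\<^sup>+z. ennreal (min 1 ((norm z)\<^sup>2) * k z) \<partial>lborel))" .
      have "(\<integral>\<^sup>+x. ennreal ((w x)\<^sup>2) \<partial>lborel) * (\<integral>\<^sup>+z. ennreal (min 1 ((norm z)\<^sup>2) * k z) \<partial>lborel) < top"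
        using w k_int by (simp add: V_def L2_iff_nn ennreal_mult_less_top)
      then have "ennreal (1 / 2) * ((\<integral>\<^sup>+x. ennreal ((w x)\<^sup>2) \<partial>lborel) * (\<integral>\<^sup>+z. ennreal (min 1 ((norm z)\<^sup>2) * k z) \<partial>lborel)) < top"
        using ennreal_mult_less_top[of "ennreal (1 / 2)"] ennreal_less_top[of "1 / 2"] by blast
      from le_less_trans[OF le this] show "(\<integral>\<^sup>+p. ennreal (?w2 p) \<partial>JJ) < \<infinity>" unfolding infinity_ennreal_def .
    qed auto
    then show "integrable JJ (\<lambda>p. 2 * (dif w p)\<^sup>2 + 2 * ?w2 p)"
      using w by (auto simp: V_def L2_def)
    show "(cutoff n x * w x - w x)\<^sup>2 \<le> (w x)\<^sup>2" for n x
    proof -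
      have "(cutoff n x * w x - w x)\<^sup>2 = (1 - cutoff n x)\<^sup>2 * (w x)\<^sup>2" by algebra
      also have "\<dots> \<le> 1 * (w x)\<^sup>2"
        using cutoff_bounds[of n x] by (intro mult_right_mono) (auto simp: power_le_one)
      finally show ?thesis by simp
    qed
    show "integrable lborel (\<lambda>x. (w x)\<^sup>2)" using w by (simp add: V_def L2_def)
  qed measurable
qed

text \<open>Averages of \<open>v\<close> over translations with an even weight are Lipschitz, hence admissible test
  functions, and averaging is symmetric for the translation invariant form. Testing with the average
  of the average of \<open>v\<close> shows that the average of \<open>v\<close> vanishes.\<close>

lemma uniqueness:
  assumes v: "v \<in> V" and B: "\<And>x. \<bar>v x\<bar> \<le> B" and l: "0 < l"
    and eq: "\<And>g. g \<in> Cc_infinity \<Longrightarrow> ip l v g = 0"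
  shows "AE x in lborel. v x = 0"
proof -
  have [measurable]: "v \<in> borel_measurable borel" by (rule V_measurable[OF v])
  have B0: "0 \<le> B" using B[of 0] by linarith
  have zero: "(\<lambda>_. 0) \<in> L2 lborel" by (simp add: L2_def)
  have eq': "g \<in> jump_domain lborel (\<lambda>x y. k (x - y)) \<and> ip l v g = 0" if "lipc L b R g" for L b R g
    using lipc_weak_eq[OF v zero _ that, of l] eq by (simp add: L2_inner_def)
  \<comment> \<open>Averages of v need not have compact support; cutoffs admit them as test
    functions.\<close>
  have eq2: "ip l v w = 0" if w: "w \<in> V" and Lb: "\<And>x y. \<bar>w x - w y\<bar> \<le> L * dist x y" "\<And>x. \<bar>w x\<bar> \<le> b" "0 \<le> L" for w L b
  proof -
    note c = lipschitz_cutoff[OF w Lb]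
    have "(\<lambda>n. ip l v (\<lambda>x. cutoff n x * w x)) \<longlonglongrightarrow> ip l v w"
      by (rule ip_tendsto(1)[OF v w lipc_V[OF c(1)] c(2)])
    moreover have "ip l v (\<lambda>x. cutoff n x * w x) = 0" for n using eq'[OF c(1)] by blast
    ultimately show ?thesis using LIMSEQ_unique[OF _ tendsto_const] by fastforce
  qed
  have main: "(LINT y|lborel. tent a n y * v (x - y)) = 0" if pos: "0 < (LINT y|lborel. tent a n y)" for a x :: 'a and n
  proof -
    let ?\<sigma> = "tent a n"
    obtain R where R: "lipc (real n) 1 R ?\<sigma>" using tent_lipc[of a] by metis
    have sm [measurable]: "?\<sigma> \<in> borel_measurable borel" using Cc_measurable[OF lipc_Cc[OF R]] .
    have si: "integrable lborel ?\<sigma>" by (rule Cc_integrable[OF lipc_Cc[OF R]])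
    have sn: "0 \<le> ?\<sigma> y" for y by (simp add: tent_def infdist_nonneg)
    interpret A: shift_average lborel "\<lambda>y x. x - y" ?\<sigma>
      by standard (auto simp: lborel_shift sn tent_even si pos)
    interpret P: shift_average JJ "\<lambda>y p. (fst p - y, snd p - y)" ?\<sigma>
    proof
      show "\<exists>A. countable A \<and> A \<subseteq> sets JJ \<and> \<Union> A = space JJ \<and> (\<forall>a\<in>A. emeasure JJ a \<noteq> \<infinity>)"
        using JJ_sigma_finite unfolding sigma_finite_measure_def .
      show "(\<lambda>q. (fst (snd q) - fst q, snd (snd q) - fst q)) \<in> borel \<Otimes>\<^sub>M JJ \<rightarrow>\<^sub>M JJ"
        by measurable
    qed (auto simp: JJ_shift sn tent_even si pos)
    let ?S = "A.avg"
    have Vavg: "?S w \<in> V" "\<And>f. f \<in> V \<Longrightarrow> ip l f (?S w) = L2_inner JJ (dif f) (P.avg (dif w)) + l * L2_inner lborel f (?S w)"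
      "dif (?S w) = P.avg (dif w)"
      "\<And>x. \<bar>?S w x\<bar> \<le> b * (LINT y|lborel. ?\<sigma> y)" "continuous_on UNIV (?S w)"
      "\<exists>L\<ge>0. \<forall>x y. \<bar>?S w x - ?S w y\<bar> \<le> L * dist x y"
      if w: "w \<in> V" and b: "\<And>x. \<bar>w x\<bar> \<le> b" for w b
    proof -
      have wm [measurable]: "w \<in> borel_measurable borel" by (rule V_measurable[OF w])
      have b0: "0 \<le> b" using b[of 0] by linarith
      have int: "integrable lborel (\<lambda>y. ?\<sigma> y * w (x - y))" for x
        by (rule integrable_mult_bounded[OF si _ b]) measurable
      show d: "dif (?S w) = P.avg (dif w)"
      proof
        fix p
        show "dif (?S w) p = P.avg (dif w) p"
          unfolding dif_def A.avg_def P.avg_def using int by (simp add: right_diff_distrib)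
      qed
      show "?S w \<in> V"
        using w unfolding V_def by (simp add: d A.avg_L2 P.avg_L2)
      show "ip l f (?S w) = L2_inner JJ (dif f) (P.avg (dif w)) + l * L2_inner lborel f (?S w)" if "f \<in> V" for f
        unfolding ip_def d ..
      show "\<bar>?S w x\<bar> \<le> b * (LINT y|lborel. ?\<sigma> y)" for x
      proof -
        have "\<bar>?S w x\<bar> \<le> (LINT y|lborel. \<bar>?\<sigma> y * w (x - y)\<bar>)"
          unfolding A.avg_def by (rule integral_abs_bound)
        also have "\<dots> \<le> (LINT y|lborel. b * ?\<sigma> y)"
        proof (rule integral_mono)
          show "\<bar>?\<sigma> y * w (x - y)\<bar> \<le> b * ?\<sigma> y" for y
            using mult_left_mono[OF b[of "x - y"] sn[of y]] sn[of y] by (simp add: abs_mult mult.commute)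
        qed (use int si in auto)
        finally show ?thesis by simp
      qed
      \<comment> \<open>Written as a convolution, the average inherits a Lipschitz bound from the
        weight although w is only bounded and measurable.\<close>
      have cnv: "?S w x = (LINT z|lborel. w z * ?\<sigma> (x - z))" for x
        unfolding A.avg_def
        by (subst lborel_integral_reflect[of "\<lambda>y. ?\<sigma> y * w (x - y)" x, symmetric]) (auto simp: mult.commute)
      have int': "integrable lborel (\<lambda>z. w z * ?\<sigma> (x - z))" for x
      proof -
        have "integrable lborel (\<lambda>z. ?\<sigma> (x - z))"
        proof (rule bounded_support_integrable[where B=1 and R="norm x + R"])
          show "?\<sigma> (x - z) = 0" if "norm x + R < norm z" for z
          proof -
            have "R < norm (x - z)" using that norm_triangle_ineq2[of z x] by (simp add: norm_minus_commute)
            then show ?thesis using R unfolding lipc_def by blast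
          qed
          show "\<bar>?\<sigma> (x - z)\<bar> \<le> 1" for z using R unfolding lipc_def by blast
        qed measurable
        then have "integrable lborel (\<lambda>z. ?\<sigma> (x - z) * w z)"
          by (rule integrable_mult_bounded[OF _ _ b]) measurable
        then show ?thesis by (simp add: mult.commute)
      qed
      define c where "c = measure lborel (cball (0::'a) R)"
      let ?i = "\<lambda>x z. indicator (cball x R) z :: real"
      have ci: "integrable lborel (?i x)" "(LINT z|lborel. ?i x z) = c" for x :: 'a
        using emeasure_lborel_cball_finite[of x R] R
        by (auto simp: c_def lipc_def measure_def emeasure_cball)
      have lip: "\<bar>?S w x - ?S w y\<bar> \<le> (2 * b * real n * c) * dist x y" for x y
      proof -
        have "\<bar>?S w x - ?S w y\<bar> = \<bar>LINT z|lborel. w z * ?\<sigma> (x - z) - w z * ?\<sigma> (y - z)\<bar>"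
          unfolding cnv using int' by simp
        also have "\<dots> \<le> (LINT z|lborel. \<bar>w z * ?\<sigma> (x - z) - w z * ?\<sigma> (y - z)\<bar>)" by (rule integral_abs_bound)
        also have "\<dots> \<le> (LINT z|lborel. (b * (real n * dist x y)) * (?i x z + ?i y z))"
        proof (rule integral_mono)
          fix z
          have s0: "?\<sigma> u = 0" if "R < norm u" for u using R that unfolding lipc_def by blast
          have sl: "\<bar>?\<sigma> (x - z) - ?\<sigma> (y - z)\<bar> \<le> real n * dist (x - z) (y - z)"
            using R unfolding lipc_def by blast
          have "\<bar>?\<sigma> (x - z) - ?\<sigma> (y - z)\<bar> \<le> (real n * dist x y) * (?i x z + ?i y z)"
          proof (cases "norm (x - z) \<le> R \<or> norm (y - z) \<le> R")
            case True
            then have "1 \<le> ?i x z + ?i y z" by (auto simp: indicator_def dist_norm)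
            then have "(real n * dist x y) * 1 \<le> (real n * dist x y) * (?i x z + ?i y z)"
              by (intro mult_left_mono) auto
            then show ?thesis using sl by (simp add: dist_norm)
          qed (auto simp: s0)
          then have "\<bar>w z\<bar> * \<bar>?\<sigma> (x - z) - ?\<sigma> (y - z)\<bar> \<le> b * ((real n * dist x y) * (?i x z + ?i y z))"
            using b0 by (intro mult_mono b) auto
          then show "\<bar>w z * ?\<sigma> (x - z) - w z * ?\<sigma> (y - z)\<bar> \<le> (b * (real n * dist x y)) * (?i x z + ?i y z)"
            by (simp add: right_diff_distrib[symmetric] abs_mult mult.assoc)
        qed (use int' ci in auto)
        also have "\<dots> = (2 * b * real n * c) * dist x y"
          using ci by (simp add: algebra_simps)
        finally show ?thesis .
      qed
      have "0 \<le> 2 * b * real n * c" using b0 by (simp add: c_def)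
      then show ex: "\<exists>L\<ge>0. \<forall>x y. \<bar>?S w x - ?S w y\<bar> \<le> L * dist x y" using lip by blast
      show "continuous_on UNIV (?S w)"
      proof (rule lipschitz_on_continuous_on)
        show "(2 * b * real n * c)-lipschitz_on UNIV (?S w)"
          using lip \<open>0 \<le> 2 * b * real n * c\<close> by (intro lipschitz_onI) (auto simp: dist_real_def)
      qed
    qed
    note S1 = Vavg[OF v B] and S2 = Vavg[OF Vavg(1)[OF v B] Vavg(4)[OF v B]]
    \<comment> \<open>The twofold average is an admissible test function; moving one averaging
      operator across the form leaves the form of \<open>?S v\<close> with itself.\<close>
    have "ip l v (?S (?S v)) = 0"
    proof -
      obtain L where "0 \<le> L" "\<And>x y. \<bar>?S (?S v) x - ?S (?S v) y\<bar> \<le> L * dist x y" using S2(6) by blast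
      then show ?thesis using eq2[OF S2(1) _ S2(4)] by blast
    qed
    then have "0 = L2_inner JJ (dif v) (P.avg (dif (?S v))) + l * L2_inner lborel v (?S (?S v))"
      using S2(2)[OF v] by simp
    also have "\<dots> = L2_inner JJ (dif (?S v)) (dif (?S v)) + l * L2_inner lborel (?S v) (?S v)"
      using v S1(1) by (subst P.avg_selfadjoint, simp_all add: V_def, subst A.avg_selfadjoint, simp_all add: S1(3))
    finally have "l * L2_inner lborel (?S v) (?S v) = 0"
      using l L2_inner_nonneg[of JJ "dif (?S v)"] L2_inner_nonneg[of lborel "?S v"]
        mult_nonneg_nonneg[of l "L2_inner lborel (?S v) (?S v)"] by linarith
    then have "(\<integral>\<^sup>+x. ennreal ((?S v x)\<^sup>2) \<partial>lborel) = 0"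
      using l S1(1) by (subst L2_nn_eq) (auto simp: V_def)
    moreover have [measurable]: "?S v \<in> borel_measurable borel" by (rule V_measurable[OF S1(1)])
    ultimately have "AE x in lborel. ennreal ((?S v x)\<^sup>2) = 0" by (subst (asm) nn_integral_0_iff_AE) auto
    then have ae: "AE x in lborel. x \<notin> {x. ?S v x \<noteq> 0}" by eventually_elim simp
    \<comment> \<open>Continuity upgrades vanishing almost everywhere to vanishing at every x. This
      matters because x will stay fixed while the weight varies, and the exceptional null set could
      depend on the weight.\<close>
    have op: "open {x. ?S v x \<noteq> 0}"
      by (intro open_Collect_neq S1(5) continuous_intros)
    have "{x. ?S v x \<noteq> 0} = {}"
    proof (rule ccontr)
      assume "{x. ?S v x \<noteq> 0} \<noteq> {}"
      then obtain x e where xe: "0 < e" "ball x e \<subseteq> {x. ?S v x \<noteq> 0}"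
        using op unfolding open_contains_ball by blast
      have "AE y in lborel. y \<notin> ball x e" using ae by eventually_elim (use xe(2) in blast)
      then have "emeasure lborel (ball x e) = 0"
        by (subst (asm) AE_iff_measurable[OF _ refl]) (auto simp: ball_def)
      then show False
        using xe(1) emeasure_ball[of e x] unit_ball_vol_pos[of "real DIM('a)"]
        by (simp add: mult_le_0_iff not_le)
    qed
    then have "?S v x = 0" by blast
    then show ?thesis unfolding A.avg_def .
  qed
  have box0: "(LINT y|lborel. indicator (box (- a) a) y * v (x - y)) = 0" for a x :: 'a
  proof (rule LIMSEQ_unique)
    obtain R where R: "\<And>n. lipc (real n) 1 R (tent a n)" using tent_lipc[of a] by metis
    have tm [measurable]: "tent a n \<in> borel_measurable borel" for n using Cc_measurable[OF lipc_Cc[OF R]] .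
    show "(\<lambda>n. LINT y|lborel. tent a n y * v (x - y)) \<longlonglongrightarrow> (LINT y|lborel. indicator (box (- a) a) y * v (x - y))"
    proof (rule integral_dominated_convergence[where w="\<lambda>y. B * indicator (cball 0 R) y"])
      show "AE y in lborel. (\<lambda>n. tent a n y * v (x - y)) \<longlonglongrightarrow> indicator (box (- a) a) y * v (x - y)"
        by (intro AE_I2 tendsto_intros tent_tendsto)
      have "norm (tent a n y * v (x - y)) \<le> B * indicator (cball 0 R) y" for n y
      proof (cases "norm y \<le> R")
        case True
        have "\<bar>tent a n y\<bar> \<le> 1" using R[of n] unfolding lipc_def by blast
        then have "\<bar>tent a n y\<bar> * \<bar>v (x - y)\<bar> \<le> 1 * B" by (intro mult_mono B) auto
        then show ?thesis using True by (simp add: abs_mult)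
      next
        case False
        then have "tent a n y = 0" using R[of n] unfolding lipc_def by auto
        then show ?thesis using B0 by simp
      qed
      then show "\<And>n. AE y in lborel. norm (tent a n y * v (x - y)) \<le> B * indicator (cball 0 R) y" by simp
    qed (use cball_integrable in auto)
    \<comment> \<open>A tent may vanish identically, for n = 0 or an empty box, whereas averaging
      asks for a weight of positive mass.\<close>
    have "(LINT y|lborel. tent a n y * v (x - y)) = 0" for n
    proof (cases "0 < (LINT y|lborel. tent a n y)")
      case True then show ?thesis by (rule main)
    next
      case False
      have nn: "0 \<le> tent a n y" for y by (simp add: tent_def infdist_nonneg)
      have i: "integrable lborel (tent a n)" by (rule Cc_integrable[OF lipc_Cc[OF R]])
      have "0 \<le> (LINT y|lborel. tent a n y)" using nn by simp
      then have "(LINT y|lborel. tent a n y) = 0" using False by linarith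
      then have "AE y in lborel. tent a n y = 0" using integral_nonneg_eq_0_iff_AE[OF i] nn by auto
      then have "AE y in lborel. tent a n y * v (x - y) = 0" by eventually_elim simp
      then show ?thesis by (intro integral_eq_zero_AE)
    qed
    then show "(\<lambda>n. LINT y|lborel. tent a n y * v (x - y)) \<longlonglongrightarrow> 0" by simp
  qed
  show ?thesis
  proof (rule AE_zero_boxes[OF _ B])
    fix p q :: 'a
    \<comment> \<open>Midpoint and half diagonal: reflection at the midpoint carries an arbitrary
      box to a centred one.\<close>
    let ?x = "(p + q) /\<^sub>R 2" and ?a = "(q - p) /\<^sub>R 2"
    have "(LINT z|lborel. indicator (box p q) z * v z) = (LINT y|lborel. indicator (box p q) (?x - y) * v (?x - y))"
      by (rule lborel_integral_reflect[symmetric]) measurable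
    also have "\<dots> = (LINT y|lborel. indicator (box (- ?a) ?a) y * v (?x - y))"
    proof (intro Bochner_Integration.integral_cong refl arg_cong2[where f="(*)"])
      fix y
      have "?x - y \<in> box p q \<longleftrightarrow> y \<in> box (- ?a) ?a"
        unfolding mem_box by (intro ball_cong refl) (auto simp: inner_simps field_simps)
      then show "indicator (box p q) (?x - y) = (indicator (box (- ?a) ?a) y :: real)" by (simp add: indicator_def)
    qed
    also have "\<dots> = 0" by (rule box0)
    finally show "(LINT z|lborel. indicator (box p q) z * v z) = 0" .
  qed measurable
qed

end

section \<open>Passage to the limit\<close>

definition restr :: "('a::euclidean_space \<Rightarrow> 'a \<Rightarrow> real) \<Rightarrow> 'a set \<Rightarrow> 'a \<Rightarrow> 'a \<Rightarrow> real" where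
  "restr J A x y = J x y * indicator A (x - y)"

definition band :: "real \<Rightarrow> 'a::euclidean_space set" where
  "band \<eta> = {z. \<eta> < norm z \<and> norm z < 1 / \<eta>}"

lemma band_sets [measurable]: "band \<eta> \<in> sets borel"
  unfolding band_def by measurable

context jump_kernel
begin

lemma restr_kernel:
  assumes [measurable]: "A \<in> sets borel"
  shows "jump_kernel (restr J A)"
  by standard (auto simp: restr_def J_nonneg case_prod_beta')

lemma jm_restr:
  assumes [measurable]: "A \<in> sets borel"
  shows "jm (restr J A) = density (jm J) (\<lambda>p. indicator A (fst p - snd p))"
proof -
  have "(\<lambda>p. ennreal (indicator (- Id) p * (1 / 2 * restr J A (fst p) (snd p)))) =
     (\<lambda>p. ennreal (indicator (- Id) p * (1 / 2 * J (fst p) (snd p))) * indicator A (fst p - snd p))"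
    by (auto simp: restr_def indicator_def)
  then show ?thesis unfolding jm_def by (subst density_density_eq) auto
qed

lemma nn_integral_restr:
  assumes [measurable]: "A \<in> sets borel" "h \<in> borel_measurable (borel \<Otimes>\<^sub>M borel)"
  shows "(\<integral>\<^sup>+p. h p \<partial>jm (restr J A)) = (\<integral>\<^sup>+p. indicator A (fst p - snd p) * h p \<partial>jm J)"
  unfolding jm_restr[OF assms(1)] by (rule nn_integral_density) measurable

lemma integral_restr:
  assumes [measurable]: "A \<in> sets borel" "h \<in> borel_measurable (borel \<Otimes>\<^sub>M borel)"
  shows "(LINT p|jm (restr J A). h p) = (LINT p|jm J. indicator A (fst p - snd p) * h p :: real)"
proof -
  have "(\<lambda>p. indicator A (fst p - snd p) :: ennreal) = (\<lambda>p. ennreal (indicator A (fst p - snd p)))"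
    by (auto simp: indicator_def)
  then show ?thesis
    unfolding jm_restr[OF assms(1)] by (simp add: integral_density)
qed

lemma L2_restr:
  assumes [measurable]: "A \<in> sets borel" and F: "F \<in> L2 (jm J)"
  shows "F \<in> L2 (jm (restr J A))" "L2_inner (jm (restr J A)) F F \<le> L2_inner (jm J) F F"
proof -
  have Fm: "F \<in> borel_measurable (jm J)" using F by (rule L2_measurable)
  then have [measurable]: "F \<in> borel_measurable (borel \<Otimes>\<^sub>M borel)"
    using measurable_cong_sets[OF sets_jm refl] by blast
  interpret R: jump_kernel "restr J A" by (rule restr_kernel) measurable
  have le: "(\<integral>\<^sup>+p. ennreal ((F p)\<^sup>2) \<partial>jm (restr J A)) \<le> (\<integral>\<^sup>+p. ennreal ((F p)\<^sup>2) \<partial>jm J)"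
    by (subst nn_integral_restr, measurable, intro nn_integral_mono) (auto simp: indicator_def)
  have "F \<in> borel_measurable (jm (restr J A))" by measurable
  moreover have "(\<integral>\<^sup>+p. ennreal ((F p)\<^sup>2) \<partial>jm (restr J A)) < \<infinity>"
    using F by (intro le_less_trans[OF le]) (simp add: L2_iff_nn)
  ultimately show FL: "F \<in> L2 (jm (restr J A))" unfolding L2_iff_nn by blast
  show "L2_inner (jm (restr J A)) F F \<le> L2_inner (jm J) F F"
    using le unfolding L2_nn_eq[OF F] L2_nn_eq[OF FL] by (simp add: L2_inner_nonneg)
qed

lemma L2_inner_split:
  assumes A [measurable]: "A \<in> sets borel" and F: "F \<in> L2 (jm J)" and G: "G \<in> L2 (jm J)"
  shows "L2_inner (jm J) F G = L2_inner (jm (restr J A)) F G + L2_inner (jm (restr J (- A))) F G"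
proof -
  have [measurable]: "F \<in> borel_measurable (borel \<Otimes>\<^sub>M borel)" "G \<in> borel_measurable (borel \<Otimes>\<^sub>M borel)"
    using L2_measurable[OF F] L2_measurable[OF G] measurable_cong_sets[OF sets_jm refl] by blast+
  have i: "integrable (jm J) (\<lambda>p. F p * G p)" by (rule L2_mult_integrable[OF F G])
  have i': "integrable (jm J) (\<lambda>p. indicator S (fst p - snd p) * (F p * G p))" if [measurable]: "S \<in> sets borel" for S
    by (rule Bochner_Integration.integrable_bound[OF i]) (auto simp: indicator_def)
  have "L2_inner (jm (restr J A)) F G + L2_inner (jm (restr J (- A))) F G =
     (LINT p|jm J. indicator A (fst p - snd p) * (F p * G p) + indicator (- A) (fst p - snd p) * (F p * G p))"
    unfolding L2_inner_def using i'[of A] i'[of "- A"] by (simp add: integral_restr)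
  also have "\<dots> = L2_inner (jm J) F G"
    unfolding L2_inner_def by (intro Bochner_Integration.integral_cong) (auto simp: indicator_def)
  finally show ?thesis ..
qed

lemma AE_jm_off_diagonal: "AE p in jm J. fst p \<noteq> snd p"
  unfolding jm_def by (subst AE_density, measurable) (auto simp: indicator_def)

end

context sym_kernel
begin

text \<open>On the band the weight is at least min 1 (\<eta>^2) wherever g contributes, so
  boundedness of h is enough.\<close>

lemma band_dif_integrable:
  assumes [measurable]: "h \<in> borel_measurable borel" and B: "\<And>x. \<bar>h x\<bar> \<le> B" and g: "lipc L G R g" and \<eta>: "0 < \<eta>"
  shows "integrable (jm (restr J (band \<eta>))) (\<lambda>p. dif h p * dif g p)"
proof -
  interpret R: jump_kernel "restr J (band \<eta>)" by (rule restr_kernel) measurable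
  have [measurable]: "g \<in> borel_measurable borel" using Cc_measurable[OF lipc_Cc[OF g]] .
  have B0: "0 \<le> B" using B[of 0] by linarith
  define c where "c = 2 * B * (2 * G) / min 1 (\<eta>\<^sup>2)"
  have m: "0 < min 1 (\<eta>\<^sup>2)" using \<eta> by simp
  have c0: "0 \<le> c" using m B0 g by (simp add: c_def lipc_def)
  have le: "indicator (band \<eta>) (fst p - snd p) * \<bar>dif h p * dif g p\<bar> \<le> c * wgt R p" for p
  proof (cases "fst p - snd p \<in> band \<eta> \<and> (norm (fst p) \<le> R \<or> norm (snd p) \<le> R)")
    case True
    have h: "\<bar>dif h p\<bar> \<le> 2 * B" unfolding dif_def using B[of "fst p"] B[of "snd p"] by linarith
    have "\<bar>g (fst p)\<bar> \<le> G" "\<bar>g (snd p)\<bar> \<le> G" using g unfolding lipc_def by blast+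
    then have g': "\<bar>dif g p\<bar> \<le> 2 * G" unfolding dif_def by linarith
    have "\<eta>\<^sup>2 \<le> (dist (fst p) (snd p))\<^sup>2" using True \<eta> by (intro power_mono) (auto simp: band_def dist_norm)
    then have "min 1 (\<eta>\<^sup>2) \<le> min 1 ((dist (fst p) (snd p))\<^sup>2)" by auto
    also have "\<dots> \<le> wgt R p" using True by (auto simp: wgt_def indicator_def)
    finally have w: "min 1 (\<eta>\<^sup>2) \<le> wgt R p" .
    have "\<bar>dif h p * dif g p\<bar> \<le> 2 * B * (2 * G)" unfolding abs_mult using h g' by (intro mult_mono) auto
    also have "\<dots> = c * min 1 (\<eta>\<^sup>2)" using less_imp_neq[OF m, symmetric] unfolding c_def by (subst nonzero_divide_eq_eq[symmetric]) auto
    also have "\<dots> \<le> c * wgt R p" by (intro mult_left_mono w c0)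
    finally show ?thesis using True by simp
  next
    case False
    have "dif g p = 0" if "\<not> (norm (fst p) \<le> R \<or> norm (snd p) \<le> R)"
      using that g unfolding lipc_def dif_def by auto
    then have "indicator (band \<eta>) (fst p - snd p) * \<bar>dif h p * dif g p\<bar> = 0"
      using False by (auto simp: indicator_def)
    moreover have "0 \<le> c * wgt R p" using c0 wgt_nonneg[of R p] by (rule mult_nonneg_nonneg)
    ultimately show ?thesis by linarith
  qed
  show ?thesis
  proof (rule integrableI_bounded)
    have "(\<integral>\<^sup>+p. ennreal (norm (dif h p * dif g p)) \<partial>jm (restr J (band \<eta>))) =
      (\<integral>\<^sup>+p. indicator (band \<eta>) (fst p - snd p) * ennreal (norm (dif h p * dif g p)) \<partial>jm J)"
      by (rule nn_integral_restr) measurable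
    also have "\<dots> \<le> (\<integral>\<^sup>+p. ennreal c * ennreal (wgt R p) \<partial>jm J)"
    proof (intro nn_integral_mono)
      fix p
      have "indicator (band \<eta>) (fst p - snd p) * ennreal (norm (dif h p * dif g p)) = ennreal (indicator (band \<eta>) (fst p - snd p) * \<bar>dif h p * dif g p\<bar>)"
        by (auto simp: indicator_def)
      also have "\<dots> \<le> ennreal (c * wgt R p)" by (rule ennreal_leI[OF le])
      also have "\<dots> = ennreal c * ennreal (wgt R p)" by (rule ennreal_mult'[OF c0])
      finally show "indicator (band \<eta>) (fst p - snd p) * ennreal (norm (dif h p * dif g p)) \<le> ennreal c * ennreal (wgt R p)" .
    qed
    also have "\<dots> = ennreal c * (\<integral>\<^sup>+p. ennreal (wgt R p) \<partial>jm J)" by (rule nn_integral_cmult) measurable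
    also have "\<dots> < \<infinity>" using wgt_finite[of R] by (simp add: ennreal_mult_less_top)
    finally show "(\<integral>\<^sup>+p. ennreal (norm (dif h p * dif g p)) \<partial>jm (restr J (band \<eta>))) < \<infinity>" .
  qed measurable
qed

end

context lim_kernel
begin

text \<open>Restricted to a band the kernel is integrable in x - y, so the restricted form is
  bounded on L2. There h can be replaced by a smooth function through L2 approximation
  alone.\<close>

lemma band_bounded:
  assumes \<eta>: "0 < \<eta>"
  obtains c where "0 \<le> c" "\<And>a. a \<in> L2 lborel \<Longrightarrow> dif a \<in> L2 (jm (restr (\<lambda>x y. k (x - y)) (band \<eta>)))"
    "\<And>a. a \<in> L2 lborel \<Longrightarrow> L2_inner (jm (restr (\<lambda>x y. k (x - y)) (band \<eta>))) (dif a) (dif a) \<le> c * L2_inner lborel a a"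
proof -
  interpret R: jump_kernel "restr (\<lambda>x y. k (x - y)) (band \<eta>)" by (rule restr_kernel) measurable
  let ?kb = "\<lambda>z. k z * indicator (band \<eta>) z"
  have m: "0 < min 1 (\<eta>\<^sup>2)" using \<eta> by simp
  have "(\<integral>\<^sup>+z. ennreal (?kb z) \<partial>lborel) \<le> (\<integral>\<^sup>+z. ennreal (1 / min 1 (\<eta>\<^sup>2)) * ennreal (min 1 ((norm z)\<^sup>2) * k z) \<partial>lborel)"
  proof (intro nn_integral_mono)
    fix z
    show "ennreal (?kb z) \<le> ennreal (1 / min 1 (\<eta>\<^sup>2)) * ennreal (min 1 ((norm z)\<^sup>2) * k z)"
    proof (cases "z \<in> band \<eta>")
      case True
      have "\<eta>\<^sup>2 \<le> (norm z)\<^sup>2" using True \<eta> by (intro power_mono) (auto simp: band_def)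
      then have "min 1 (\<eta>\<^sup>2) \<le> min 1 ((norm z)\<^sup>2)" by auto
      then have "1 \<le> 1 / min 1 (\<eta>\<^sup>2) * min 1 ((norm z)\<^sup>2)" using m by (simp add: field_simps)
      then have "1 * k z \<le> 1 / min 1 (\<eta>\<^sup>2) * min 1 ((norm z)\<^sup>2) * k z" by (intro mult_right_mono k_nonneg)
      then have "ennreal (?kb z) \<le> ennreal (1 / min 1 (\<eta>\<^sup>2) * (min 1 ((norm z)\<^sup>2) * k z))"
        using True by (intro ennreal_leI) (simp add: mult.assoc)
      also have "\<dots> = ennreal (1 / min 1 (\<eta>\<^sup>2)) * ennreal (min 1 ((norm z)\<^sup>2) * k z)"
        using m by (intro ennreal_mult') simp
      finally show ?thesis .
    qed simp
  qed
  also have "\<dots> = ennreal (1 / min 1 (\<eta>\<^sup>2)) * (\<integral>\<^sup>+z. ennreal (min 1 ((norm z)\<^sup>2) * k z) \<partial>lborel)"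
    by (rule nn_integral_cmult) measurable
  also have "\<dots> < \<infinity>" using k_int ennreal_mult_less_top ennreal_less_top[of "1 / min 1 (\<eta>\<^sup>2)"] unfolding infinity_ennreal_def by blast
  finally have fin: "(\<integral>\<^sup>+z. ennreal (?kb z) \<partial>lborel) < top" by simp
  define c where "c = enn2real (\<integral>\<^sup>+z. ennreal (?kb z) \<partial>lborel)"
  have c: "(\<integral>\<^sup>+z. ennreal (?kb z) \<partial>lborel) = ennreal c" using fin by (simp add: c_def)
  have kbe: "?kb (- z) = ?kb z" for z by (simp add: k_even band_def indicator_def)
  have main: "(\<integral>\<^sup>+p. ennreal ((dif a p)\<^sup>2) \<partial>jm (restr (\<lambda>x y. k (x - y)) (band \<eta>))) \<le> ennreal (2 * c) * (\<integral>\<^sup>+x. ennreal ((a x)\<^sup>2) \<partial>lborel)"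
    if [measurable]: "a \<in> borel_measurable borel" for a
  proof -
    let ?f = "\<lambda>p. ennreal ((a (fst p))\<^sup>2) * ennreal (?kb (fst p - snd p))"
    have "(\<integral>\<^sup>+p. ennreal ((dif a p)\<^sup>2) \<partial>jm (restr (\<lambda>x y. k (x - y)) (band \<eta>))) =
       ennreal (1 / 2) * (\<integral>\<^sup>+p. ennreal ((dif a p)\<^sup>2 * restr (\<lambda>x y. k (x - y)) (band \<eta>) (fst p) (snd p)) * indicator (- Id) p \<partial>lborel2)"
      by (rule R.nn_integral_jm) measurable
    also have "\<dots> \<le> ennreal (1 / 2) * (\<integral>\<^sup>+p. 2 * (?f p + ?f (snd p, fst p)) \<partial>lborel2)"
    proof (intro mult_left_mono nn_integral_mono)
      fix p :: "'a \<times> 'a"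
      let ?x = "fst p" and ?y = "snd p"
      have "(dif a p)\<^sup>2 \<le> 2 * ((a ?x)\<^sup>2 + (a ?y)\<^sup>2)"
        using zero_le_power2[of "a ?x + a ?y"] by (simp add: dif_def power2_eq_square algebra_simps)
      then have "(dif a p)\<^sup>2 * ?kb (?x - ?y) \<le> 2 * ((a ?x)\<^sup>2 + (a ?y)\<^sup>2) * ?kb (?x - ?y)"
        by (intro mult_right_mono) (auto simp: k_nonneg)
      then have "ennreal ((dif a p)\<^sup>2 * ?kb (?x - ?y)) \<le> ennreal (2 * ((a ?x)\<^sup>2 * ?kb (?x - ?y) + (a ?y)\<^sup>2 * ?kb (?x - ?y)))"
        by (intro ennreal_leI) (simp add: algebra_simps)
      also have "\<dots> = 2 * (?f p + ennreal ((a ?y)\<^sup>2) * ennreal (?kb (?x - ?y)))"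
        by (simp add: ennreal_mult k_nonneg)
      also have "ennreal ((a ?y)\<^sup>2) * ennreal (?kb (?x - ?y)) = ?f (?y, ?x)"
      proof -
        have "?kb (?x - ?y) = ?kb (?y - ?x)" using kbe[of "?x - ?y"] by simp
        then show ?thesis by (simp only: fst_conv snd_conv)
      qed
      finally have 1: "ennreal ((dif a p)\<^sup>2 * ?kb (?x - ?y)) \<le> 2 * (?f p + ?f (?y, ?x))" .
      have "ennreal ((dif a p)\<^sup>2 * restr (\<lambda>x y. k (x - y)) (band \<eta>) ?x ?y) * indicator (- Id) p \<le> ennreal ((dif a p)\<^sup>2 * ?kb (?x - ?y))"
        by (auto simp: restr_def indicator_def)
      with 1 show "ennreal ((dif a p)\<^sup>2 * restr (\<lambda>x y. k (x - y)) (band \<eta>) ?x ?y) * indicator (- Id) p \<le> 2 * (?f p + ?f (snd p, fst p))"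
        by (rule order_trans[rotated])
    qed simp
    also have "(\<integral>\<^sup>+p. 2 * (?f p + ?f (snd p, fst p)) \<partial>lborel2) = 2 * ((\<integral>\<^sup>+p. ?f p \<partial>lborel2) + (\<integral>\<^sup>+p. ?f p \<partial>lborel2))"
      by (subst nn_integral_cmult, measurable, subst nn_integral_add, measurable, subst nn_integral_lborel2_swap[of ?f], measurable)
    also have "(\<integral>\<^sup>+p. ?f p \<partial>lborel2) = (\<integral>\<^sup>+x. ennreal ((a x)\<^sup>2) \<partial>lborel) * ennreal c"
    proof -
      have "(\<integral>\<^sup>+p. ?f p \<partial>lborel2) = (\<integral>\<^sup>+x. ennreal ((a x)\<^sup>2) * ennreal c \<partial>lborel)"
      proof (subst nn_integral_lborel2_fst, measurable, intro nn_integral_cong, simp only: fst_conv snd_conv)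
        fix x
        have "(\<integral>\<^sup>+y. ennreal ((a x)\<^sup>2) * ennreal (?kb (x - y)) \<partial>lborel) = ennreal ((a x)\<^sup>2) * (\<integral>\<^sup>+y. ennreal (?kb (x - y)) \<partial>lborel)"
          by (rule nn_integral_cmult) measurable
        also have "(\<integral>\<^sup>+y. ennreal (?kb (x - y)) \<partial>lborel) = ennreal c"
          using nn_integral_lborel_reflect[of "\<lambda>z. ennreal (?kb z)" x] c by simp
        finally show "(\<integral>\<^sup>+y. ennreal ((a x)\<^sup>2) * ennreal (?kb (x - y)) \<partial>lborel) = ennreal ((a x)\<^sup>2) * ennreal c" .
      qed
      then show ?thesis by (simp add: nn_integral_multc)
    qed
    also have "ennreal (1 / 2) * (2 * ((\<integral>\<^sup>+x. ennreal ((a x)\<^sup>2) \<partial>lborel) * ennreal c + (\<integral>\<^sup>+x. ennreal ((a x)\<^sup>2) \<partial>lborel) * ennreal c)) =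
       ennreal (2 * c) * (\<integral>\<^sup>+x. ennreal ((a x)\<^sup>2) \<partial>lborel)"
    proof -
      have "ennreal (1 / 2) * ennreal 2 = ennreal 1" by (subst ennreal_mult[symmetric]) auto
      then have "ennreal (1 / 2) * 2 * X = X" for X :: ennreal by (simp only: ennreal_numeral ennreal_1 mult_1_left)
      then have half: "ennreal (1 / 2) * (2 * X) = X" for X :: ennreal by (simp only: mult.assoc)
      have "0 \<le> c" by (simp add: c_def)
      then have "ennreal (2 * c) = ennreal c + ennreal c" by (simp only: mult_2 ennreal_plus)
      then show ?thesis unfolding half by (simp only: distrib_right mult.commute)
    qed
    finally show ?thesis .
  qed
  have L: "dif a \<in> L2 (jm (restr (\<lambda>x y. k (x - y)) (band \<eta>)))" if a: "a \<in> L2 lborel" for a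
  proof -
    have [measurable]: "a \<in> borel_measurable borel" using L2_measurable[OF a] by simp
    have "ennreal (2 * c) * (\<integral>\<^sup>+x. ennreal ((a x)\<^sup>2) \<partial>lborel) < \<infinity>"
      using a by (simp add: L2_iff_nn ennreal_mult_less_top)
    then have "(\<integral>\<^sup>+p. ennreal ((dif a p)\<^sup>2) \<partial>jm (restr (\<lambda>x y. k (x - y)) (band \<eta>))) < \<infinity>"
      by (rule le_less_trans[OF main[of a], rotated]) measurable
    moreover have "dif a \<in> borel_measurable (jm (restr (\<lambda>x y. k (x - y)) (band \<eta>)))" by measurable
    ultimately show ?thesis unfolding L2_iff_nn by blast
  qed
  show thesis
  proof (rule that[of "2 * c"])
    show "L2_inner (jm (restr (\<lambda>x y. k (x - y)) (band \<eta>))) (dif a) (dif a) \<le> 2 * c * L2_inner lborel a a" if a: "a \<in> L2 lborel" for a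
    proof -
      have "ennreal (L2_inner (jm (restr (\<lambda>x y. k (x - y)) (band \<eta>))) (dif a) (dif a)) \<le> ennreal (2 * c) * ennreal (L2_inner lborel a a)"
      proof -
        have "a \<in> borel_measurable borel" using L2_measurable[OF a] by simp
        from main[OF this] show ?thesis unfolding L2_nn_eq[OF a] L2_nn_eq[OF L[OF a]] .
      qed
      also have "\<dots> = ennreal (2 * c * L2_inner lborel a a)" by (rule ennreal_mult'[symmetric]) (simp add: c_def)
      finally have "ennreal (L2_inner (jm (restr (\<lambda>x y. k (x - y)) (band \<eta>))) (dif a) (dif a)) \<le> ennreal (2 * c * L2_inner lborel a a)" .
      moreover have "0 \<le> 2 * c * L2_inner lborel a a" by (simp add: c_def L2_inner_nonneg)
      ultimately show ?thesis by (subst (asm) ennreal_le_iff)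
    qed
    show "0 \<le> 2 * c" by (simp add: c_def)
  qed (rule L)
qed

end

section \<open>One realisation: estimates on bands\<close>

lemma ball_measurable [measurable]: "ball (c::'a::metric_space) r \<in> sets borel"
  by simp

text \<open>If convergence failed, some sequence tending to 0 would keep the values at distance d
  from L, and no subsequence could converge to L. The sequences are kept in (0, 1], the range of the
  compactness hypothesis.\<close>

lemma tendsto_at_right_0_subseq:
  fixes F :: "real \<Rightarrow> real"
  assumes "\<And>e. (\<And>n::nat. 0 < e n \<and> e n \<le> 1) \<Longrightarrow> e \<longlonglongrightarrow> 0 \<Longrightarrow>
    \<exists>r. strict_mono (r :: nat \<Rightarrow> nat) \<and> (\<lambda>n. F (e (r n))) \<longlonglongrightarrow> L"
  shows "(F \<longlongrightarrow> L) (at_right 0)"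
proof (rule ccontr)
  assume "\<not> (F \<longlongrightarrow> L) (at_right 0)"
  then obtain d where d: "0 < d" "\<not> (\<forall>\<^sub>F e in at_right 0. dist (F e) L < d)"
    unfolding tendsto_iff by blast
  have "\<exists>e. 0 < e \<and> e \<le> 1 / real (Suc n) \<and> d \<le> dist (F e) L" for n
  proof (rule ccontr)
    assume "\<not> ?thesis"
    then have "dist (F e) L < d" if "0 < e" "e \<le> 1 / real (Suc n)" for e using that by (meson not_le)
    then have "\<forall>\<^sub>F e in at_right 0. dist (F e) L < d"
      by (intro eventually_at_rightI[of 0 "1 / real (Suc n)"]) auto
    then show False using d(2) by blast
  qed
  then obtain e where e: "\<And>n. 0 < e n" "\<And>n. e n \<le> 1 / real (Suc n)" "\<And>n. d \<le> dist (F (e n)) L" by metis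
  have e1: "0 < e n \<and> e n \<le> 1" for n
    using e(1)[of n] e(2)[of n] by (auto intro: order_trans)
  have "e \<longlonglongrightarrow> 0"
    by (rule tendsto_sandwich[OF always_eventually always_eventually tendsto_const LIMSEQ_Suc[OF lim_1_over_n]])
      (use e(2) less_imp_le[OF e(1)] in auto)
  from assms[OF e1 this] obtain r :: "nat \<Rightarrow> nat" where "(\<lambda>n. F (e (r n))) \<longlonglongrightarrow> L" by blast
  then have "\<forall>\<^sub>F n in sequentially. dist (F (e (r n))) L < d" using d(1) by (rule tendstoD)
  then obtain n where "dist (F (e (r n))) L < d" using eventually_happens' sequentially_bot by blast
  then show False using e(3)[of "r n"] by linarith
qed

lemma filterlim_at_right_0: "(\<And>n. 0 < e n) \<Longrightarrow> e \<longlonglongrightarrow> (0::real) \<Longrightarrow> filterlim e (at_right 0) sequentially"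
  using less_imp_neq[of 0 "e _", symmetric] by (simp add: filterlim_at)

text \<open>One realisation of the environment: \<open>\<rho> e\<close> and \<open>\<kappa> e\<close> are the rescaled coefficients and
  \<open>J e\<close> is the resulting jump kernel.\<close>

locale hom_path = lim_kernel k + ui_density \<rho>
  for k :: "'a::euclidean_space \<Rightarrow> real" and \<rho> :: "real \<Rightarrow> 'a \<Rightarrow> real" +
  fixes J :: "real \<Rightarrow> 'a \<Rightarrow> 'a \<Rightarrow> real" and \<kappa> :: "real \<Rightarrow> 'a \<Rightarrow> 'a \<Rightarrow> real" and q :: "real \<Rightarrow> real"
  assumes J_space: "0 < e \<Longrightarrow> sym_space (J e) (density lborel (\<lambda>x. ennreal (\<rho> e x)))"
    and wl_rho: "u \<in> borel_measurable borel \<Longrightarrow> (\<And>x. \<bar>u x\<bar> \<le> B) \<Longrightarrow> (\<And>x. R < norm x \<Longrightarrow> u x = 0) \<Longrightarrow> wl 1 u"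
    and kappa_measurable: "(\<lambda>p. \<kappa> e (fst p) (snd p)) \<in> borel_measurable (borel \<Otimes>\<^sub>M borel)"
    and kappa_nonneg: "0 \<le> \<kappa> e x y" and kappa_sym: "\<kappa> e x y = \<kappa> e y x"
    and J_kappa: "0 < \<eta> \<Longrightarrow> \<eta> < norm (x - y) \<Longrightarrow> J e x y \<le> q \<eta> * \<kappa> e x y" and q_nonneg: "0 \<le> q \<eta>"
    and compactness: "\<And>f e. (\<And>\<epsilon>. \<epsilon> \<in> {0<..1} \<Longrightarrow> f \<epsilon> \<in> jump_domain (density lborel (\<lambda>x. ennreal (\<rho> \<epsilon> x))) (J \<epsilon>)) \<Longrightarrow>
        Limsup (at_right 0) (\<lambda>\<epsilon>. esssup lborel (\<lambda>x. ennreal \<bar>f \<epsilon> x\<bar>) + jump_energy (J \<epsilon>) (f \<epsilon>)) < \<infinity> \<Longrightarrow>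
        (\<And>n. e n \<in> {0<..1}) \<Longrightarrow> e \<longlonglongrightarrow> 0 \<Longrightarrow>
        \<exists>r h. strict_mono (r :: nat \<Rightarrow> nat) \<and> h \<in> L1_loc \<and>
          (\<forall>s>1. tendsto_L1 (ball 0 s) (\<lambda>n. f (e (r n))) h sequentially)"
    and off_band: "g \<in> Cc_infinity \<Longrightarrow> 0 < \<delta> \<Longrightarrow> \<forall>\<^sub>F \<eta> in at_right 0. \<forall>\<^sub>F e in at_right 0.
        (\<integral>\<^sup>+p. ennreal ((dif g p)\<^sup>2) \<partial>jm (restr (J e) (- band \<eta>))) \<le> ennreal \<delta>"
    and kappa_power: "\<exists>p>1. \<forall>R\<ge>1. \<exists>C. \<forall>\<^sub>F e in at_right 0.
        (\<integral>\<^sup>+x\<in>ball 0 R. ennreal_powr (\<integral>\<^sup>+y\<in>ball 0 R. ennreal (\<kappa> e x y) \<partial>lborel) p \<partial>lborel) \<le> ennreal C"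
    and band_limit: "0 < \<eta> \<Longrightarrow> f \<in> borel_measurable borel \<Longrightarrow> bounded (range f) \<Longrightarrow> g \<in> Cc_infinity \<Longrightarrow>
        ((\<lambda>e. L2_inner (jm (restr (J e) (band \<eta>))) (dif f) (dif g)) \<longlongrightarrow>
          L2_inner (jm (restr (\<lambda>x y. k (x - y)) (band \<eta>))) (dif f) (dif g)) (at_right 0)"
begin

abbreviation m :: "real \<Rightarrow> 'a measure" where
  "m e \<equiv> density lborel (\<lambda>x. ennreal (\<rho> e x))"

lemma m_inner:
  assumes [measurable]: "f \<in> borel_measurable borel" "g \<in> borel_measurable borel"
  shows "L2_inner (m e) f g = (LINT x|lborel. f x * g x * \<rho> e x)"
  unfolding L2_inner_def by (subst integral_density) (auto simp: rho_nonneg mult.commute)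

lemma kappa_section [measurable]: "\<kappa> e x \<in> borel_measurable borel"
  using measurable_compose[OF measurable_Pair1'[of x borel borel] kappa_measurable] by simp

lemma kappa_comp [measurable (raw)]:
  assumes "f \<in> K \<rightarrow>\<^sub>M borel" "g \<in> K \<rightarrow>\<^sub>M borel"
  shows "(\<lambda>x. \<kappa> e (f x) (g x)) \<in> borel_measurable K"
  using measurable_compose[OF measurable_Pair[OF assms] kappa_measurable] by simp

text \<open>As g vanishes off the ball of radius R and points of the band are less than 1/\<eta>
  apart, both points lie in the ball of radius R'. The factor 2 G bounds the increment of g, and
  symmetry of \<kappa> merges the two halves of the increment of v.\<close>

lemma band_dif_bound:
  assumes [measurable]: "v \<in> borel_measurable borel" and g: "lipc L G R g" and \<eta>: "0 < \<eta>" and e: "0 < e"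
    and R': "R + 1 / \<eta> < R'"
  shows "(\<integral>\<^sup>+p. ennreal \<bar>dif v p * dif g p\<bar> \<partial>jm (restr (J e) (band \<eta>))) \<le>
    ennreal (2 * G * q \<eta>) * (\<integral>\<^sup>+x\<in>ball 0 R'. ennreal \<bar>v x\<bar> * (\<integral>\<^sup>+y\<in>ball 0 R'. ennreal (\<kappa> e x y) \<partial>lborel) \<partial>lborel)"
proof -
  interpret S: sym_space "J e" "m e" by (rule J_space[OF e])
  interpret R: jump_kernel "restr (J e) (band \<eta>)" by (rule S.restr_kernel) measurable
  have [measurable]: "g \<in> borel_measurable borel" using Cc_measurable[OF lipc_Cc[OF g]] .
  have G0: "0 \<le> G" using g by (simp add: lipc_def)
  let ?I = "indicator (ball 0 R') :: 'a \<Rightarrow> ennreal"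
  let ?f = "\<lambda>p. ennreal \<bar>v (fst p)\<bar> * (?I (fst p) * (ennreal (\<kappa> e (fst p) (snd p)) * ?I (snd p)))"
  have pw: "ennreal (\<bar>dif v p * dif g p\<bar> * restr (J e) (band \<eta>) (fst p) (snd p)) \<le> ennreal (2 * G * q \<eta>) * (?f p + ?f (snd p, fst p))" for p
  proof (cases "fst p - snd p \<in> band \<eta> \<and> (norm (fst p) \<le> R \<or> norm (snd p) \<le> R)")
    case True
    let ?x = "fst p" and ?y = "snd p"
    have d: "norm (?x - ?y) < 1 / \<eta>" "\<eta> < norm (?x - ?y)" using True by (auto simp: band_def)
    have "norm ?x < R'" "norm ?y < R'"
      using True d(1) R' norm_triangle_ineq2[of ?x ?y] norm_triangle_ineq2[of ?y ?x] norm_minus_commute[of ?x ?y] \<eta>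
      by (auto; linarith)+
    then have I: "?I ?x = 1" "?I ?y = 1" by auto
    have "\<bar>g ?x\<bar> \<le> G" "\<bar>g ?y\<bar> \<le> G" using g unfolding lipc_def by blast+
    then have gd: "\<bar>dif g p\<bar> \<le> 2 * G" unfolding dif_def by linarith
    have vd: "\<bar>dif v p\<bar> \<le> \<bar>v ?x\<bar> + \<bar>v ?y\<bar>" unfolding dif_def by linarith
    have "\<bar>dif v p * dif g p\<bar> * J e ?x ?y \<le> ((\<bar>v ?x\<bar> + \<bar>v ?y\<bar>) * (2 * G)) * (q \<eta> * \<kappa> e ?x ?y)"
      unfolding abs_mult using G0 S.J_nonneg by (intro mult_mono gd vd J_kappa \<eta> d) auto
    then have "ennreal (\<bar>dif v p * dif g p\<bar> * J e ?x ?y) \<le> ennreal ((2 * G * q \<eta>) * (\<bar>v ?x\<bar> * \<kappa> e ?x ?y + \<bar>v ?y\<bar> * \<kappa> e ?x ?y))"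
      by (intro ennreal_leI) (simp add: algebra_simps)
    also have "\<dots> = ennreal (2 * G * q \<eta>) * (ennreal \<bar>v ?x\<bar> * ennreal (\<kappa> e ?x ?y) + ennreal \<bar>v ?y\<bar> * ennreal (\<kappa> e ?x ?y))"
      using G0 q_nonneg[of \<eta>] kappa_nonneg[of e ?x ?y] by (simp add: ennreal_mult)
    also have "\<dots> = ennreal (2 * G * q \<eta>) * (?f p + ?f (?y, ?x))"
      using I by (simp add: kappa_sym[of e ?y ?x])
    finally show ?thesis using True by (simp add: restr_def)
  next
    case False
    have "dif g p = 0" if "\<not> (norm (fst p) \<le> R \<or> norm (snd p) \<le> R)"
      using that g unfolding lipc_def dif_def by auto
    then have "\<bar>dif v p * dif g p\<bar> * restr (J e) (band \<eta>) (fst p) (snd p) = 0"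
      using False by (auto simp: restr_def indicator_def)
    then show ?thesis by (simp only: ennreal_0 zero_le)
  qed
  have "(\<integral>\<^sup>+p. ennreal \<bar>dif v p * dif g p\<bar> \<partial>jm (restr (J e) (band \<eta>))) =
      ennreal (1 / 2) * (\<integral>\<^sup>+p. ennreal (\<bar>dif v p * dif g p\<bar> * restr (J e) (band \<eta>) (fst p) (snd p)) * indicator (- Id) p \<partial>lborel2)"
    by (rule R.nn_integral_jm) measurable
  also have "\<dots> \<le> ennreal (1 / 2) * (\<integral>\<^sup>+p. ennreal (2 * G * q \<eta>) * (?f p + ?f (snd p, fst p)) \<partial>lborel2)"
  proof (intro mult_left_mono nn_integral_mono)
    fix p :: "'a \<times> 'a"
    have "ennreal (\<bar>dif v p * dif g p\<bar> * restr (J e) (band \<eta>) (fst p) (snd p)) * indicator (- Id) p \<le>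
       ennreal (\<bar>dif v p * dif g p\<bar> * restr (J e) (band \<eta>) (fst p) (snd p)) * 1"
      by (intro mult_left_mono) (auto simp: indicator_def)
    with pw[of p] show "ennreal (\<bar>dif v p * dif g p\<bar> * restr (J e) (band \<eta>) (fst p) (snd p)) * indicator (- Id) p \<le>
      ennreal (2 * G * q \<eta>) * (?f p + ?f (snd p, fst p))" by simp
  qed simp
  also have "(\<integral>\<^sup>+p. ennreal (2 * G * q \<eta>) * (?f p + ?f (snd p, fst p)) \<partial>lborel2) =
      ennreal (2 * G * q \<eta>) * ((\<integral>\<^sup>+p. ?f p \<partial>lborel2) + (\<integral>\<^sup>+p. ?f p \<partial>lborel2))"
    by (subst nn_integral_cmult, measurable, subst nn_integral_add, measurable, subst nn_integral_lborel2_swap[of ?f], measurable)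
  also have "(\<integral>\<^sup>+p. ?f p \<partial>lborel2) = (\<integral>\<^sup>+x\<in>ball 0 R'. ennreal \<bar>v x\<bar> * (\<integral>\<^sup>+y\<in>ball 0 R'. ennreal (\<kappa> e x y) \<partial>lborel) \<partial>lborel)"
  proof (subst nn_integral_lborel2_fst, measurable, intro nn_integral_cong, simp only: fst_conv snd_conv)
    fix x
    have "(\<integral>\<^sup>+y. ennreal \<bar>v x\<bar> * (?I x * (ennreal (\<kappa> e x y) * ?I y)) \<partial>lborel) = ennreal \<bar>v x\<bar> * (?I x * (\<integral>\<^sup>+y\<in>ball 0 R'. ennreal (\<kappa> e x y) \<partial>lborel))"
      by (subst nn_integral_cmult, measurable, subst nn_integral_cmult, measurable)
    then show "(\<integral>\<^sup>+y. ennreal \<bar>v x\<bar> * (?I x * (ennreal (\<kappa> e x y) * ?I y)) \<partial>lborel) = ennreal \<bar>v x\<bar> * (\<integral>\<^sup>+y\<in>ball 0 R'. ennreal (\<kappa> e x y) \<partial>lborel) * ?I x"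
      by (simp add: mult_ac)
  qed
  also have "ennreal (1 / 2) * (ennreal (2 * G * q \<eta>) * (X + X)) = ennreal (2 * G * q \<eta>) * X" for X
  proof -
    have "ennreal (1 / 2) * ennreal 2 = ennreal 1" by (subst ennreal_mult[symmetric]) auto
    then have h: "ennreal (1 / 2) * 2 = 1" by (simp only: ennreal_numeral ennreal_1)
    have "ennreal (1 / 2) * (ennreal (2 * G * q \<eta>) * (X + X)) = (ennreal (1 / 2) * 2) * (ennreal (2 * G * q \<eta>) * X)"
      by (simp only: mult_2[symmetric] mult.assoc mult.left_commute)
    then show ?thesis unfolding h by simp
  qed
  finally show ?thesis .
qed

text \<open>A substitute for Hoelder: above the level N, t = t^(1-p) t^p is at most N^(1-p) t^p
  because 1 - p < 0. The bound B on a is spent in that range; below N the factor a is kept, since it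
  is what becomes small.\<close>

lemma powr_split:
  assumes "1 < p" "0 < N" "0 < B" "0 \<le> a" "a \<le> B"
  shows "ennreal a * F \<le> ennreal (N * a) + ennreal (B * N powr (1 - p)) * ennreal_powr F p"
proof (cases "F = \<infinity>")
  case True
  have "0 < B * N powr (1 - p)" using assms by simp
  then have "ennreal (B * N powr (1 - p)) * ennreal_powr F p = \<infinity>"
    using True assms by (simp add: ennreal_powr_def ennreal_mult_top)
  then show ?thesis by simp
next
  case False
  then obtain t where t: "F = ennreal t" "0 \<le> t" by (cases F) auto
  have "a * t \<le> N * a + (B * N powr (1 - p)) * t powr p"
  proof (cases "t \<le> N")
    case True
    then have "a * t \<le> a * N" using assms by (intro mult_left_mono)
    moreover have "0 \<le> (B * N powr (1 - p)) * t powr p" using assms by simp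
    ultimately show ?thesis by (simp add: mult.commute)
  next
    case False
    have "t = t powr (1 - p) * t powr p" using False assms by (simp add: powr_add[symmetric])
    also have "\<dots> \<le> N powr (1 - p) * t powr p"
      using False assms by (intro mult_right_mono powr_mono2') auto
    finally have "a * t \<le> B * (N powr (1 - p) * t powr p)"
      using assms t by (intro mult_mono) auto
    moreover have "0 \<le> N * a" using assms by simp
    ultimately show ?thesis by (simp add: mult.assoc)
  qed
  then have "ennreal (a * t) \<le> ennreal (N * a + (B * N powr (1 - p)) * t powr p)" by (rule ennreal_leI)
  also have "\<dots> = ennreal (N * a) + ennreal (B * N powr (1 - p)) * ennreal (t powr p)"
    using assms by (simp add: ennreal_mult)
  finally show ?thesis using t assms by (simp add: ennreal_powr_def ennreal_mult)
qed


text \<open>The integrated coefficients are bounded only in L^p, so the splitting level N is chosen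
  first and makes the high part small uniformly in n; L1 convergence then disposes of the low
  part.\<close>

lemma band_dif_tendsto_0:
  fixes v :: "nat \<Rightarrow> 'a \<Rightarrow> real"
  assumes vm: "\<And>n. v n \<in> borel_measurable borel" and vB: "\<And>n. AE x in lborel. \<bar>v n x\<bar> \<le> B" and B: "0 < B"
    and lim: "\<And>r. 1 < r \<Longrightarrow> (\<lambda>n. LINT x:ball 0 r|lborel. \<bar>v n x\<bar>) \<longlonglongrightarrow> 0"
    and g: "lipc L G R g" and \<eta>: "0 < \<eta>" and e: "\<And>n. 0 < e n" "e \<longlonglongrightarrow> 0"
  shows "(\<lambda>n. L2_inner (jm (restr (J (e n)) (band \<eta>))) (dif (v n)) (dif g)) \<longlonglongrightarrow> 0"
proof (rule tendstoI)
  fix d :: real assume d: "0 < d"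
  note [measurable] = vm
  have [measurable]: "g \<in> borel_measurable borel" using Cc_measurable[OF lipc_Cc[OF g]] .
  have G0: "0 \<le> G" and R0: "0 < R" using g by (auto simp: lipc_def)
  \<comment> \<open>Beyond R + 1/\<eta> for the support argument; the extra 2 also puts the radius
    above 1, the range of the convergence and moment assumptions.\<close>
  define R' where "R' = R + 1 / \<eta> + 2"
  have R': "R + 1 / \<eta> < R'" "1 < R'" "1 \<le> R'" using R0 \<eta> by (auto simp: R'_def add_pos_pos)
  obtain p where p: "1 < p" and "\<forall>R\<ge>1. \<exists>C. \<forall>\<^sub>F e in at_right 0.
        (\<integral>\<^sup>+x\<in>ball 0 R. ennreal_powr (\<integral>\<^sup>+y\<in>ball 0 R. ennreal (\<kappa> e x y) \<partial>lborel) p \<partial>lborel) \<le> ennreal C"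
    using kappa_power by blast
  then obtain C where "\<forall>\<^sub>F e in at_right 0.
        (\<integral>\<^sup>+x\<in>ball 0 R'. ennreal_powr (\<integral>\<^sup>+y\<in>ball 0 R'. ennreal (\<kappa> e x y) \<partial>lborel) p \<partial>lborel) \<le> ennreal C"
    using R'(3) by blast
  from eventually_compose_filterlim[OF this filterlim_at_right_0[OF e]]
  have C: "\<forall>\<^sub>F n in sequentially. (\<integral>\<^sup>+x\<in>ball 0 R'. ennreal_powr (\<integral>\<^sup>+y\<in>ball 0 R'. ennreal (\<kappa> (e n) x y) \<partial>lborel) p \<partial>lborel) \<le> ennreal \<bar>C\<bar>"
    by eventually_elim (erule order_trans, rule ennreal_leI, simp)
  define c where "c = 2 * G * q \<eta>"
  have c0: "0 \<le> c" using G0 q_nonneg by (simp add: c_def)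
  have "((\<lambda>N::real. c * (B * \<bar>C\<bar>) * N powr (1 - p)) \<longlongrightarrow> c * (B * \<bar>C\<bar>) * 0) at_top"
    using p by (intro tendsto_intros tendsto_neg_powr filterlim_ident) auto
  then have "\<forall>\<^sub>F N::real in at_top. c * (B * \<bar>C\<bar>) * N powr (1 - p) < d / 2"
    using d by (intro order_tendstoD) auto
  then have "\<forall>\<^sub>F N::real in at_top. c * (B * \<bar>C\<bar>) * N powr (1 - p) < d / 2 \<and> 0 < N"
    using eventually_gt_at_top[of 0] by eventually_elim simp
  then obtain N :: real where N: "c * (B * \<bar>C\<bar>) * N powr (1 - p) < d / 2" "0 < N"
    using eventually_happens'[OF trivial_limit_at_top_linorder] by blast
  have "(\<lambda>n. c * N * (LINT x:ball 0 R'|lborel. \<bar>v n x\<bar>)) \<longlonglongrightarrow> 0"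
    by (rule tendsto_mult_right_zero[OF lim[OF R'(2)]])
  then have "\<forall>\<^sub>F n in sequentially. c * N * (LINT x:ball 0 R'|lborel. \<bar>v n x\<bar>) < d / 2"
    using d by (intro order_tendstoD) auto
  with C show "\<forall>\<^sub>F n in sequentially. dist (L2_inner (jm (restr (J (e n)) (band \<eta>))) (dif (v n)) (dif g)) 0 < d"
  proof eventually_elim
    case (elim n)
    interpret S: sym_space "J (e n)" "m (e n)" by (rule J_space[OF e(1)])
    interpret R: jump_kernel "restr (J (e n)) (band \<eta>)" by (rule S.restr_kernel) measurable
    let ?F = "\<lambda>x. \<integral>\<^sup>+y\<in>ball 0 R'. ennreal (\<kappa> (e n) x y) \<partial>lborel"
    let ?a = "LINT x:ball 0 R'|lborel. \<bar>v n x\<bar>"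
    let ?b = "B * N powr (1 - p)"
    have pm: "(\<lambda>x. ennreal_powr (?F x) p) \<in> borel_measurable borel"
      unfolding ennreal_powr_def by measurable
    have ae: "AE x in lborel. ennreal \<bar>v n x\<bar> * ?F x * indicator (ball 0 R') x \<le>
       ennreal N * (ennreal \<bar>v n x\<bar> * indicator (ball 0 R') x) + ennreal ?b * (ennreal_powr (?F x) p * indicator (ball 0 R') x)"
      using vB[of n]
    proof eventually_elim
      case (elim x)
      have "ennreal \<bar>v n x\<bar> * ?F x \<le> ennreal (N * \<bar>v n x\<bar>) + ennreal ?b * ennreal_powr (?F x) p"
        using p N(2) B elim by (intro powr_split) auto
      then show ?case using N(2) by (auto simp: indicator_def ennreal_mult)
    qed
    have vi: "integrable lborel (\<lambda>x. indicator (ball 0 R') x * \<bar>v n x\<bar> :: real)"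
    proof (rule Bochner_Integration.integrable_bound[OF cball_integrable[of B R']])
      show "AE x in lborel. norm (indicator (ball 0 R') x * \<bar>v n x\<bar>) \<le> norm (B * indicator (cball 0 R') x)"
        using vB[of n] by eventually_elim (auto simp: indicator_def)
    qed measurable
    have va: "(\<integral>\<^sup>+x. ennreal \<bar>v n x\<bar> * indicator (ball 0 R') x \<partial>lborel) = ennreal ?a"
      unfolding set_lebesgue_integral_def
      by (subst nn_integral_eq_integral[symmetric]) (use vi in \<open>auto intro!: nn_integral_cong simp: indicator_def\<close>)
    have "(\<integral>\<^sup>+x\<in>ball 0 R'. ennreal \<bar>v n x\<bar> * ?F x \<partial>lborel) \<le>
       (\<integral>\<^sup>+x. ennreal N * (ennreal \<bar>v n x\<bar> * indicator (ball 0 R') x) + ennreal ?b * (ennreal_powr (?F x) p * indicator (ball 0 R') x) \<partial>lborel)"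
      by (rule nn_integral_mono_AE[OF ae])
    also have "\<dots> = ennreal N * ennreal ?a + ennreal ?b * (\<integral>\<^sup>+x\<in>ball 0 R'. ennreal_powr (?F x) p \<partial>lborel)"
      using pm by (subst nn_integral_add, measurable, subst nn_integral_cmult, measurable, subst nn_integral_cmult, measurable, simp only: va)
    also have "\<dots> \<le> ennreal N * ennreal ?a + ennreal ?b * ennreal \<bar>C\<bar>"
      by (intro add_left_mono mult_left_mono elim(1)) simp
    also have "\<dots> = ennreal (N * ?a + ?b * \<bar>C\<bar>)"
      using N(2) B by (simp add: ennreal_mult set_lebesgue_integral_def)
    finally have main: "(\<integral>\<^sup>+x\<in>ball 0 R'. ennreal \<bar>v n x\<bar> * ?F x \<partial>lborel) \<le> ennreal (N * ?a + ?b * \<bar>C\<bar>)" .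
    have a0: "0 \<le> ?a" by (simp add: set_lebesgue_integral_def)
    then have s0: "0 \<le> N * ?a + ?b * \<bar>C\<bar>" using N(2) B by simp
    have "ennreal \<bar>L2_inner (jm (restr (J (e n)) (band \<eta>))) (dif (v n)) (dif g)\<bar> \<le> (\<integral>\<^sup>+p. ennreal \<bar>dif (v n) p * dif g p\<bar> \<partial>jm (restr (J (e n)) (band \<eta>)))"
    proof (cases "integrable (jm (restr (J (e n)) (band \<eta>))) (\<lambda>p. dif (v n) p * dif g p)")
      case True
      then show ?thesis using integral_norm_bound_ennreal[OF True] by (simp add: L2_inner_def)
    next
      case False
      then show ?thesis by (simp add: L2_inner_def not_integrable_integral_eq)
    qed
    also have "\<dots> \<le> ennreal c * (\<integral>\<^sup>+x\<in>ball 0 R'. ennreal \<bar>v n x\<bar> * ?F x \<partial>lborel)"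
      unfolding c_def by (rule band_dif_bound[OF vm g \<eta> e(1) R'(1)])
    also have "\<dots> \<le> ennreal c * ennreal (N * ?a + ?b * \<bar>C\<bar>)" by (intro mult_left_mono main) simp
    also have "\<dots> = ennreal (c * (N * ?a + ?b * \<bar>C\<bar>))" using c0 by (rule ennreal_mult'[symmetric])
    finally have "\<bar>L2_inner (jm (restr (J (e n)) (band \<eta>))) (dif (v n)) (dif g)\<bar> \<le> c * (N * ?a + ?b * \<bar>C\<bar>)"
      using c0 s0 by (subst (asm) ennreal_le_iff) auto
    also have "\<dots> = c * N * ?a + c * (B * \<bar>C\<bar>) * N powr (1 - p)" by (simp add: algebra_simps)
    also have "\<dots> < d" using elim(2) N(1) by linarith
    finally show ?case by (simp add: dist_real_def)
  qed
qed

text \<open>Write u n = h + (u n - h): uniform integrability removes the difference against the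
  varying weight, and for the fixed h the weak convergence of the weight suffices.\<close>

lemma weighted_tendsto:
  fixes u :: "nat \<Rightarrow> 'a \<Rightarrow> real"
  assumes um: "\<And>n. u n \<in> borel_measurable borel" and uB: "\<And>n. AE x in lborel. \<bar>u n x\<bar> \<le> B"
    and hm: "h \<in> borel_measurable borel" and hB: "\<And>x. \<bar>h x\<bar> \<le> B"
    and lim: "\<And>r. 1 < r \<Longrightarrow> (\<lambda>n. LINT x:ball 0 r|lborel. \<bar>u n x - h x\<bar>) \<longlonglongrightarrow> 0"
    and gm: "g \<in> borel_measurable borel" and gB: "\<And>x. \<bar>g x\<bar> \<le> G" and gR: "\<And>x. R < norm x \<Longrightarrow> g x = 0"
    and e: "\<And>n. 0 < e n" "e \<longlonglongrightarrow> 0"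
  shows "(\<lambda>n. L2_inner (m (e n)) (u n) g) \<longlonglongrightarrow> L2_inner lborel h g"
proof -
  note [measurable] = um hm gm
  have B0: "0 \<le> B" using hB[of 0] by linarith
  have G0: "0 \<le> G" using gB[of 0] by linarith
  define r where "r = max R 1 + 1"
  have r: "1 < r" "R < r" by (auto simp: r_def)
  let ?w = "\<lambda>n x. (u n x - h x) * g x"
  have uhB: "AE x in lborel. \<bar>u n x - h x\<bar> \<le> 2 * B" for n
    using uB[of n]
  proof eventually_elim
    case (elim x)
    then show ?case using hB[of x] by linarith
  qed
  have wB: "AE x in lborel. \<bar>?w n x\<bar> \<le> 2 * B * G" for n
    using uhB[of n]
  proof eventually_elim
    case (elim x)
    then show ?case unfolding abs_mult using B0 by (intro mult_mono gB) auto
  qed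
  have uhi: "integrable lborel (\<lambda>x. indicator (ball 0 r) x * \<bar>u n x - h x\<bar> :: real)" for n
  proof (rule Bochner_Integration.integrable_bound[OF cball_integrable[of "2 * B" r]])
    show "AE x in lborel. norm (indicator (ball 0 r) x * \<bar>u n x - h x\<bar>) \<le> norm (2 * B * indicator (cball 0 r) x)"
      using uhB[of n] by eventually_elim (auto simp: indicator_def)
  qed measurable
  have wi: "integrable lborel (?w n)" for n
  proof (rule Bochner_Integration.integrable_bound[OF cball_integrable[of "2 * B * G" R]])
    show "AE x in lborel. norm (?w n x) \<le> norm (2 * B * G * indicator (cball 0 R) x)"
      using wB[of n]
    proof eventually_elim
      case (elim x)
      then show ?case using gR[of x] by (cases "norm x \<le> R") auto
    qed
  qed measurable
  have wl1: "(\<lambda>n. LINT x|lborel. \<bar>?w n x\<bar>) \<longlonglongrightarrow> 0"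
  proof (rule tendsto_sandwich[OF _ _ tendsto_const])
    show "\<forall>\<^sub>F n in sequentially. 0 \<le> (LINT x|lborel. \<bar>?w n x\<bar>)" by simp
    have "(LINT x|lborel. \<bar>?w n x\<bar>) \<le> G * (LINT x:ball 0 r|lborel. \<bar>u n x - h x\<bar>)" for n
    proof -
      have "(LINT x|lborel. \<bar>?w n x\<bar>) \<le> (LINT x|lborel. G * (indicator (ball 0 r) x * \<bar>u n x - h x\<bar>))"
      proof (rule integral_mono)
        show "\<bar>?w n x\<bar> \<le> G * (indicator (ball 0 r) x * \<bar>u n x - h x\<bar>)" for x
          using gR[of x] r(2) mult_left_mono[OF gB[of x], of "\<bar>u n x - h x\<bar>"]
          by (cases "norm x \<le> R") (auto simp: abs_mult mult.commute indicator_def)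
      qed (use wi uhi in auto)
      then show ?thesis by (simp add: set_lebesgue_integral_def)
    qed
    then show "\<forall>\<^sub>F n in sequentially. (LINT x|lborel. \<bar>?w n x\<bar>) \<le> G * (LINT x:ball 0 r|lborel. \<bar>u n x - h x\<bar>)" by simp
    show "(\<lambda>n. G * (LINT x:ball 0 r|lborel. \<bar>u n x - h x\<bar>)) \<longlonglongrightarrow> 0"
      by (rule tendsto_mult_right_zero[OF lim[OF r(1)]])
  qed
  have 1: "(\<lambda>n. LINT x|lborel. \<bar>?w n x * \<rho> (e n) x\<bar>) \<longlonglongrightarrow> 0"
    by (rule mult_rho_tendsto_0[where B="2 * B * G" and R=R, OF _ wB _ _ wi wl1 e]) (use B0 G0 gR in auto)
  have "(\<lambda>n. LINT x|lborel. ?w n x * \<rho> (e n) x) \<longlonglongrightarrow> 0"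
    by (rule Lim_null_comparison[OF _ 1]) (auto intro!: always_eventually integral_abs_bound)
  moreover have "(\<lambda>n. LINT x|lborel. (h x * g x) * \<rho> (e n) x) \<longlonglongrightarrow> (LINT x|lborel. h x * g x)"
  proof -
    have "wl 1 (\<lambda>x. h x * g x)"
    proof (rule wl_rho[of _ "B * G" R])
      show "\<bar>h x * g x\<bar> \<le> B * G" for x unfolding abs_mult using B0 by (intro mult_mono hB gB) auto
    qed (use gR in auto)
    then show ?thesis unfolding wl_def using filterlim_compose[OF _ filterlim_at_right_0[OF e]] by fastforce
  qed
  ultimately have "(\<lambda>n. (LINT x|lborel. ?w n x * \<rho> (e n) x) + (LINT x|lborel. (h x * g x) * \<rho> (e n) x)) \<longlonglongrightarrow> 0 + (LINT x|lborel. h x * g x)"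
    by (rule tendsto_add)
  moreover have "(LINT x|lborel. ?w n x * \<rho> (e n) x) + (LINT x|lborel. (h x * g x) * \<rho> (e n) x) = L2_inner (m (e n)) (u n) g" for n
  proof -
    have i1: "integrable lborel (\<lambda>x. ?w n x * \<rho> (e n) x)"
      by (rule mult_rho_integrable[OF _ wB _ e(1)]) (use gR in auto)
    have "AE x in lborel. \<bar>h x * g x\<bar> \<le> B * G"
    proof (intro AE_I2)
      show "\<bar>h x * g x\<bar> \<le> B * G" for x unfolding abs_mult using B0 by (intro mult_mono hB gB) auto
    qed
    then have i2: "integrable lborel (\<lambda>x. (h x * g x) * \<rho> (e n) x)"
      by (rule mult_rho_integrable[OF _ _ _ e(1), rotated]) (use gR in auto)
    show ?thesis
      unfolding m_inner[OF um gm] using Bochner_Integration.integral_add[OF i1 i2] by (simp add: algebra_simps)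
  qed
  ultimately show ?thesis by (simp add: L2_inner_def)
qed


text \<open>\<open>h0\<close> comes from compactness along one sequence; identifying it with the
  fixed U makes the limit independent of the sequence.\<close>

lemma limit_identified:
  fixes u :: "real \<Rightarrow> 'a \<Rightarrow> real" and e :: "nat \<Rightarrow> real"
  assumes l: "0 < l" and f: "f \<in> Cc" and M: "0 \<le> M" "\<And>x. \<bar>f x\<bar> \<le> l * M"
    and u: "\<And>s. 0 < s \<Longrightarrow> u s \<in> jump_domain (m s) (J s)"
    and ueq: "\<And>s g. 0 < s \<Longrightarrow> g \<in> jump_domain (m s) (J s) \<Longrightarrow> jump_space.ip (J s) (m s) l (u s) g = L2_inner (m s) f g"
    and uB: "\<And>s. 0 < s \<Longrightarrow> AE x in lborel. \<bar>u s x\<bar> \<le> M + 1"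
    and U: "U \<in> jump_domain lborel (\<lambda>x y. k (x - y))"
      "\<And>g. g \<in> jump_domain lborel (\<lambda>x y. k (x - y)) \<Longrightarrow> ip l U g = L2_inner lborel f g"
      "\<And>x. \<bar>U x\<bar> \<le> M + 1"
    and e: "\<And>n. 0 < e n" "e \<longlonglongrightarrow> 0"
    and hm0: "h0 \<in> borel_measurable borel"
    and lim0: "\<And>r. 1 < r \<Longrightarrow> tendsto_L1 (ball 0 r) (\<lambda>n. u (e n)) h0 sequentially"
  shows "AE x in lborel. h0 x = U x"
proof -
  define B where "B = M + 1"
  have B: "0 < B" "0 \<le> B" using M(1) by (auto simp: B_def)
  note [measurable] = hm0
  have fm [measurable]: "f \<in> borel_measurable borel" by (rule Cc_measurable[OF f])
  have um [measurable]: "u (e n) \<in> borel_measurable borel" for n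
  proof -
    interpret S: sym_space "J (e n)" "m (e n)" by (rule J_space[OF e(1)])
    show ?thesis by (rule S.V_measurable[OF S.domain_V[OF u[OF e(1)[of n]]]])
  qed
  have uB': "AE x in lborel. \<bar>u (e n) x\<bar> \<le> B" for n using uB[OF e(1)] by (simp add: B_def)
  \<comment> \<open>Both \<open>band_limit\<close> and \<open>uniqueness\<close> ask for functions
    bounded at every point, whereas \<open>h0\<close> inherits the bound only almost everywhere;
    hence a clamped version.\<close>
  define h where "h x = max (- B) (min B (h0 x))" for x
  have hm [measurable]: "h \<in> borel_measurable borel" unfolding h_def[abs_def] by measurable
  have hB: "\<bar>h x\<bar> \<le> B" for x using B by (auto simp: h_def)
  \<comment> \<open>Clamping moves \<open>h0\<close> no further than its distance from any value in
    [-B, B], so the L1 distance to \<open>u (e i)\<close> controls the change.\<close>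
  have clamp: "\<bar>h0 x - h x\<bar> \<le> \<bar>y - h0 x\<bar>" if "\<bar>y\<bar> \<le> B" for x y
    using that by (auto simp: h_def)
  have hh0: "AE x in lborel. h0 x = h x"
  proof -
    have "AE x in lborel. indicator (ball 0 (real n + 2)) x * \<bar>h0 x - h x\<bar> = (0::real)" for n :: nat
    proof -
      let ?b = "ball (0::'a) (real n + 2)"
      have t: "set_integrable lborel ?b h0" "\<forall>\<^sub>F i in sequentially. set_integrable lborel ?b (u (e i))"
        "(\<lambda>i. LINT x:?b|lborel. \<bar>u (e i) x - h0 x\<bar>) \<longlonglongrightarrow> 0"
        using lim0[of "real n + 2"] unfolding tendsto_L1_def by auto
      have hi: "set_integrable lborel ?b h"
        unfolding set_integrable_def
      proof (rule Bochner_Integration.integrable_bound[OF cball_integrable[of B "real n + 2"]])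
        show "AE x in lborel. norm (indicator ?b x *\<^sub>R h x) \<le> norm (B * indicator (cball 0 (real n + 2)) x :: real)"
        proof (rule AE_I2)
          fix x show "norm (indicator ?b x *\<^sub>R h x) \<le> norm (B * indicator (cball 0 (real n + 2)) x :: real)"
            using hB[of x] B by (simp add: indicator_def)
        qed
      qed measurable
      have di: "set_integrable lborel ?b (\<lambda>x. \<bar>h0 x - h x\<bar>)"
        by (intro set_integrable_abs set_integral_diff(1) t hi)
      have "(LINT x:?b|lborel. \<bar>h0 x - h x\<bar>) \<le> 0"
      proof (rule tendsto_lowerbound[OF t(3)])
        show "\<forall>\<^sub>F i in sequentially. (LINT x:?b|lborel. \<bar>h0 x - h x\<bar>) \<le> (LINT x:?b|lborel. \<bar>u (e i) x - h0 x\<bar>)"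
          using t(2)
        proof eventually_elim
          case (elim i)
          have "set_integrable lborel ?b (\<lambda>x. \<bar>u (e i) x - h0 x\<bar>)"
            by (intro set_integrable_abs set_integral_diff(1) t elim)
          then show ?case
            unfolding set_lebesgue_integral_def using di unfolding set_integrable_def
          proof (intro integral_mono_AE)
            show "AE x in lborel. indicator ?b x *\<^sub>R \<bar>h0 x - h x\<bar> \<le> indicator ?b x *\<^sub>R \<bar>u (e i) x - h0 x\<bar>"
              using uB'[of i] by eventually_elim (auto simp: indicator_def clamp)
          qed auto
        qed
      qed simp
      moreover have "0 \<le> (LINT x|lborel. indicator ?b x * \<bar>h0 x - h x\<bar>)"
        by (intro Bochner_Integration.integral_nonneg) (simp add: indicator_def)
      ultimately have "(LINT x|lborel. indicator ?b x * \<bar>h0 x - h x\<bar>) = 0" by (simp add: set_lebesgue_integral_def)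
      then show ?thesis
        using di unfolding set_integrable_def by (subst (asm) integral_nonneg_eq_0_iff_AE) auto
    qed
    then have "AE x in lborel. \<forall>n::nat. indicator (ball 0 (real n + 2)) x * \<bar>h0 x - h x\<bar> = (0::real)"
      unfolding AE_all_countable by blast
    then show ?thesis
    proof eventually_elim
      case (elim x)
      have "x \<in> ball 0 (real (nat \<lceil>norm x\<rceil>) + 2)" by (simp; linarith)
      then show ?case using elim[rule_format, of "nat \<lceil>norm x\<rceil>"] by simp
    qed
  qed
  have lim: "(\<lambda>n. LINT x:ball 0 r|lborel. \<bar>u (e n) x - h x\<bar>) \<longlonglongrightarrow> 0" if "1 < r" for r
  proof -
    have "(LINT x:ball 0 r|lborel. \<bar>u (e n) x - h x\<bar>) = (LINT x:ball 0 r|lborel. \<bar>u (e n) x - h0 x\<bar>)" for n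
      unfolding set_lebesgue_integral_def
    proof (rule integral_cong_AE)
      show "AE x in lborel. indicator (ball 0 r) x *\<^sub>R \<bar>u (e n) x - h x\<bar> = indicator (ball 0 r) x *\<^sub>R \<bar>u (e n) x - h0 x\<bar>"
        using hh0 by eventually_elim simp
    qed measurable
    then show ?thesis using lim0[OF that] unfolding tendsto_L1_def by simp
  qed
  have vB: "AE x in lborel. \<bar>u (e n) x - h x\<bar> \<le> 2 * B" for n
    using uB'[of n]
  proof eventually_elim
    case (elim x)
    then show ?case using hB[of x] by linarith
  qed
  have conv: "(\<lambda>n. L2_inner (m (e n)) (u (e n)) g) \<longlonglongrightarrow> L2_inner lborel h g"
    if "g \<in> borel_measurable borel" "\<And>x. \<bar>g x\<bar> \<le> G" "\<And>x. R < norm x \<Longrightarrow> g x = 0" for g G R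
    by (rule weighted_tendsto[OF um uB' hm hB lim that e])
  have conv': "(\<lambda>n. L2_inner (m (e n)) a g) \<longlonglongrightarrow> L2_inner lborel a g"
    if "a \<in> borel_measurable borel" "\<And>x. \<bar>a x\<bar> \<le> A" "g \<in> borel_measurable borel" "\<And>x. \<bar>g x\<bar> \<le> G" "\<And>x. R < norm x \<Longrightarrow> g x = 0" for a A g G R
  proof -
    have "(\<lambda>n::nat. LINT x:ball 0 r|lborel. \<bar>a x - a x\<bar>) \<longlonglongrightarrow> 0" for r
      by (simp add: set_lebesgue_integral_def)
    from weighted_tendsto[of "\<lambda>_. a", OF that(1) _ that(1,2) this that(3,4,5) e] that(2) show ?thesis by auto
  qed
  obtain Rf where Rf: "0 < Rf" "\<And>x. Rf < norm x \<Longrightarrow> f x = 0"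
    using f compact_support_pos unfolding Cc_def by blast
  \<comment> \<open>From E + l |u|^2 = <f,u> and 2 <f,u> <= l |u|^2 + |f|^2 / l one gets 2 E + l
    |u|^2 <= |f|^2 / l; the added 1 leaves room for the convergence of the weighted norms of
    f.\<close>
  define C where "C = (L2_inner lborel f f + 1) / l"
  have "(\<lambda>n. L2_inner (m (e n)) f f) \<longlonglongrightarrow> L2_inner lborel f f"
    by (rule conv'[OF fm M(2) fm M(2) Rf(2)])
  then have "\<forall>\<^sub>F n in sequentially. L2_inner (m (e n)) f f < L2_inner lborel f f + 1"
    by (rule order_tendstoD) simp
  then have bnd: "\<forall>\<^sub>F n in sequentially. 2 * L2_inner (jm (J (e n))) (dif (u (e n))) (dif (u (e n))) \<le> C \<and>
      l * L2_inner (m (e n)) (u (e n)) (u (e n)) \<le> C"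
  proof eventually_elim
    case (elim n)
    interpret S: sym_space "J (e n)" "m (e n)" by (rule J_space[OF e(1)])
    have uV: "u (e n) \<in> S.V" by (rule S.domain_V[OF u[OF e(1)[of n]]])
    have fL: "f \<in> L2 (m (e n))" by (rule S.bounded_support_L2[OF fm M(2) Rf(2)])
    let ?E = "L2_inner (jm (J (e n))) (dif (u (e n))) (dif (u (e n)))" and ?W = "L2_inner (m (e n)) (u (e n)) (u (e n))"
    have "?E + l * ?W = L2_inner (m (e n)) f (u (e n))"
      using ueq[OF e(1)[of n] u[OF e(1)]] unfolding S.ip_def .
    moreover have "2 * \<bar>L2_inner (m (e n)) (u (e n)) f\<bar> \<le> l * ?W + L2_inner (m (e n)) f f / l"
      using uV fL l by (intro L2_inner_AMGM) (auto simp: S.V_def)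
    moreover have "L2_inner (m (e n)) f f / l \<le> C" unfolding C_def using elim l by (intro divide_right_mono) auto
    moreover have "0 \<le> ?E" "0 \<le> l * ?W" using l L2_inner_nonneg by (auto simp: L2_inner_nonneg)
    ultimately show ?case unfolding L2_inner_commute[of "m (e n)" "u (e n)" f] by linarith
  qed
  have C0: "0 \<le> C" using l by (simp add: C_def L2_inner_nonneg)
  have hL2: "h \<in> L2 lborel"
  proof -
    have le: "(\<integral>\<^sup>+x. ennreal ((indicator (cball 0 (real N)) x * h x)\<^sup>2) \<partial>lborel) \<le> ennreal (C / l)" for N :: nat
    proof -
      \<comment> \<open>The limit is paired with its own restriction to a ball: 2 <u,g> - <g,g> <=
        <u,u> holds in each weighted space, and every term on the left converges.\<close>
      let ?g = "\<lambda>x. indicator (cball 0 (real N)) x * h x"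
      have gm: "?g \<in> borel_measurable borel" by measurable
      have gB: "\<bar>?g x\<bar> \<le> B" for x using hB[of x] B by (auto simp: indicator_def)
      have gR: "?g x = 0" if "real N < norm x" for x using that by simp
      have hg: "L2_inner lborel h ?g = L2_inner lborel ?g ?g"
        unfolding L2_inner_def by (intro Bochner_Integration.integral_cong) (auto simp: indicator_def)
      have "(\<lambda>n. 2 * L2_inner (m (e n)) (u (e n)) ?g - L2_inner (m (e n)) ?g ?g) \<longlonglongrightarrow> 2 * L2_inner lborel h ?g - L2_inner lborel ?g ?g"
        by (intro tendsto_intros conv[OF gm gB gR] conv'[OF gm gB gm gB gR])
      then have "2 * L2_inner lborel h ?g - L2_inner lborel ?g ?g \<le> C / l"
      proof (rule tendsto_upperbound)
        show "\<forall>\<^sub>F n in sequentially. 2 * L2_inner (m (e n)) (u (e n)) ?g - L2_inner (m (e n)) ?g ?g \<le> C / l"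
          using bnd
        proof eventually_elim
          case (elim n)
          interpret S: sym_space "J (e n)" "m (e n)" by (rule J_space[OF e(1)])
          have uL: "u (e n) \<in> L2 (m (e n))" using S.domain_V[OF u[OF e(1)[of n]]] by (simp add: S.V_def)
          have gL: "?g \<in> L2 (m (e n))" by (rule S.bounded_support_L2[OF gm gB gR])
          have "0 \<le> L2_inner (m (e n)) (\<lambda>x. u (e n) x + (-1) * ?g x) (\<lambda>x. u (e n) x + (-1) * ?g x)" by (rule L2_inner_nonneg)
          moreover have "L2_inner (m (e n)) (u (e n)) (u (e n)) \<le> C / l" using elim l by (simp add: field_simps)
          ultimately show ?case unfolding L2_inner_quad[OF uL gL] by simp
        qed
      qed simp
      then have "L2_inner lborel ?g ?g \<le> C / l" unfolding hg by simp
      moreover have "?g \<in> L2 lborel" by (rule bounded_support_L2[OF gm gB gR])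
      ultimately show ?thesis by (subst L2_nn_eq) (auto intro: ennreal_leI)
    qed
    have "(\<integral>\<^sup>+x. ennreal ((h x)\<^sup>2) \<partial>lborel) \<le> ennreal (C / l)"
    proof (rule nn_integral_Fatou_le)
      show "AE x in lborel. (\<lambda>N. ennreal ((indicator (cball 0 (real N)) x * h x)\<^sup>2)) \<longlonglongrightarrow> ennreal ((h x)\<^sup>2)"
      proof (intro AE_I2 tendsto_eventually)
        fix x :: 'a
        show "\<forall>\<^sub>F N in sequentially. ennreal ((indicator (cball 0 (real N)) x * h x)\<^sup>2) = ennreal ((h x)\<^sup>2)"
          using eventually_ge_at_top[of "nat \<lceil>norm x\<rceil>"]
        proof eventually_elim
          case (elim N)
          then have "norm x \<le> real N" by linarith
          then show ?case by simp
        qed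
      qed
    qed (use le in auto)
    then show ?thesis unfolding L2_iff_nn using le_less_trans ennreal_less_top by fastforce
  qed
  let ?Kb = "\<lambda>\<eta>. jm (restr (\<lambda>x y. k (x - y)) (band \<eta>))"
  let ?Jb = "\<lambda>n \<eta>. jm (restr (J (e n)) (band \<eta>))"
  have hbd: "bounded (range h)" using hB by (auto simp: bounded_iff)
  have band_conv: "(\<lambda>n. L2_inner (?Jb n \<eta>) (dif (u (e n))) (dif g)) \<longlonglongrightarrow> L2_inner (?Kb \<eta>) (dif h) (dif g)"
    if \<eta>: "0 < \<eta>" and g: "g \<in> Cc_infinity" for \<eta> g
  proof -
    obtain L G R where gl: "lipc L G R g" using Cc_1_lipc[OF Cc_infinity_sub_Cc_1[OF g]] by metis
    \<comment> \<open>The moment bound \<open>kappa_power\<close> handles the difference u - h;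
      \<open>band_limit\<close> treats the fixed bounded function h.\<close>
    have 1: "(\<lambda>n. L2_inner (?Jb n \<eta>) (dif (\<lambda>x. u (e n) x - h x)) (dif g)) \<longlonglongrightarrow> 0"
      by (rule band_dif_tendsto_0[OF _ vB _ lim gl \<eta> e]) (use B in auto)
    have 2: "(\<lambda>n. L2_inner (?Jb n \<eta>) (dif h) (dif g)) \<longlonglongrightarrow> L2_inner (?Kb \<eta>) (dif h) (dif g)"
      by (rule filterlim_compose[OF band_limit[OF \<eta> hm hbd g] filterlim_at_right_0[OF e]])
    have "L2_inner (?Jb n \<eta>) (dif (u (e n))) (dif g) = L2_inner (?Jb n \<eta>) (dif (\<lambda>x. u (e n) x - h x)) (dif g) + L2_inner (?Jb n \<eta>) (dif h) (dif g)" for n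
    proof -
      interpret S: sym_space "J (e n)" "m (e n)" by (rule J_space[OF e(1)])
      have "dif (u (e n)) \<in> L2 (jm (J (e n)))" "dif g \<in> L2 (jm (J (e n)))"
        using S.domain_V[OF u[OF e(1)[of n]]] S.lipc_V[OF gl] by (auto simp: S.V_def)
      then have i1: "integrable (?Jb n \<eta>) (\<lambda>p. dif (u (e n)) p * dif g p)"
        by (intro L2_mult_integrable S.L2_restr) auto
      have i2: "integrable (?Jb n \<eta>) (\<lambda>p. dif h p * dif g p)"
        by (rule S.band_dif_integrable[OF hm hB gl \<eta>])
      show ?thesis unfolding L2_inner_def dif_diff left_diff_distrib using i1 i2 by simp
    qed
    then show ?thesis using tendsto_add[OF 1 2] by simp
  qed
  \<comment> \<open>Again by duality, 2 B(u,g) - B(g,g) <= B(u,u), now for the form B on the band.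
    As \<open>band_limit\<close> asks for a smooth second argument, g is an L2 approximation of h
    and not h itself.\<close>
  have hb_le: "2 * L2_inner (?Kb \<eta>) (dif h) (dif h) \<le> C" if \<eta>: "0 < \<eta>" for \<eta>
  proof (rule field_le_epsilon)
    fix d :: real assume d: "0 < d"
    obtain c where c: "0 \<le> c" "\<And>a. a \<in> L2 lborel \<Longrightarrow> dif a \<in> L2 (?Kb \<eta>)"
      "\<And>a. a \<in> L2 lborel \<Longrightarrow> L2_inner (?Kb \<eta>) (dif a) (dif a) \<le> c * L2_inner lborel a a"
      using band_bounded[OF \<eta>] by metis
    \<comment> \<open>With c the L2 bound of the form on the band, c d' is at most d/2; c + 1 avoids
      dividing by 0.\<close>
    define d' where "d' = d / (2 * (c + 1))"
    have d': "0 < d'" using d c(1) by (simp add: d'_def)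
    obtain g where g: "g \<in> Cc_infinity" "integrable lborel (\<lambda>x. (g x - h x)\<^sup>2)" "(LINT x|lborel. (g x - h x)\<^sup>2) < d'"
      using Cc_infinity_dense_L2[OF hm hB _ d'] hL2 unfolding L2_def by blast
    obtain L G R where gl: "lipc L G R g" using Cc_1_lipc[OF Cc_infinity_sub_Cc_1[OF g(1)]] by metis
    have gm: "g \<in> borel_measurable borel" by (rule Cc_measurable[OF lipc_Cc[OF gl]])
    have gL: "g \<in> L2 lborel" by (rule lipc_L2[OF gl])
    have gbd: "bounded (range g)" using gl unfolding lipc_def bounded_iff by auto
    have "(\<lambda>n. 2 * L2_inner (?Jb n \<eta>) (dif (u (e n))) (dif g) - L2_inner (?Jb n \<eta>) (dif g) (dif g)) \<longlonglongrightarrow>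
        2 * L2_inner (?Kb \<eta>) (dif h) (dif g) - L2_inner (?Kb \<eta>) (dif g) (dif g)"
      by (intro tendsto_intros band_conv[OF \<eta> g(1)] filterlim_compose[OF band_limit[OF \<eta> gm gbd g(1)] filterlim_at_right_0[OF e]])
    then have 1: "2 * L2_inner (?Kb \<eta>) (dif h) (dif g) - L2_inner (?Kb \<eta>) (dif g) (dif g) \<le> C / 2"
    proof (rule tendsto_upperbound)
      show "\<forall>\<^sub>F n in sequentially. 2 * L2_inner (?Jb n \<eta>) (dif (u (e n))) (dif g) - L2_inner (?Jb n \<eta>) (dif g) (dif g) \<le> C / 2"
        using bnd
      proof eventually_elim
        case (elim n)
        interpret S: sym_space "J (e n)" "m (e n)" by (rule J_space[OF e(1)])
        have uL: "dif (u (e n)) \<in> L2 (jm (J (e n)))" and gL': "dif g \<in> L2 (jm (J (e n)))"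
          using S.domain_V[OF u[OF e(1)[of n]]] S.lipc_V[OF gl] by (auto simp: S.V_def)
        note uL2 = S.L2_restr[OF band_sets uL, of \<eta>] and gL2 = S.L2_restr(1)[OF band_sets gL', of \<eta>]
        have "0 \<le> L2_inner (?Jb n \<eta>) (\<lambda>p. dif (u (e n)) p + (-1) * dif g p) (\<lambda>p. dif (u (e n)) p + (-1) * dif g p)"
          by (rule L2_inner_nonneg)
        then show ?case using uL2(2) elim unfolding L2_inner_quad[OF uL2(1) gL2] by simp
      qed
    qed simp
    have hgL: "(\<lambda>x. g x - h x) \<in> L2 lborel" by (rule L2_diff[OF gL hL2])
    have "L2_inner (?Kb \<eta>) (\<lambda>p. dif h p + (-1) * dif g p) (\<lambda>p. dif h p + (-1) * dif g p) = L2_inner (?Kb \<eta>) (dif (\<lambda>x. g x - h x)) (dif (\<lambda>x. g x - h x))"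
      unfolding L2_inner_def dif_def by (simp add: algebra_simps)
    also have "\<dots> \<le> c * L2_inner lborel (\<lambda>x. g x - h x) (\<lambda>x. g x - h x)" by (rule c(3)[OF hgL])
    also have "\<dots> \<le> c * d'" using g(3) c(1) by (intro mult_left_mono) (auto simp: L2_inner_def power2_eq_square)
    also have "c * d' \<le> d / 2"
    proof -
      have "c * d' \<le> (c + 1) * d'" using d' by (intro mult_right_mono) auto
      also have "\<dots> = d / 2" using c(1) by (simp add: d'_def field_simps)
      finally show ?thesis .
    qed
    finally have 2: "L2_inner (?Kb \<eta>) (dif h) (dif h) - 2 * L2_inner (?Kb \<eta>) (dif h) (dif g) + L2_inner (?Kb \<eta>) (dif g) (dif g) \<le> d / 2"
      unfolding L2_inner_quad[OF c(2)[OF hL2] c(2)[OF gL]] by simp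
    show "2 * L2_inner (?Kb \<eta>) (dif h) (dif h) \<le> C + d" using 1 2 by argo
  qed
  \<comment> \<open>These bands increase to the complement of 0; n + 2 puts the outer radius
    strictly above n.\<close>
  define \<eta> where "\<eta> n = 1 / real (n + 2)" for n :: nat
  have \<eta>: "0 < \<eta> n" for n by (simp add: \<eta>_def)
  have \<eta>0: "\<eta> \<longlonglongrightarrow> 0" unfolding \<eta>_def using LIMSEQ_ignore_initial_segment[OF lim_1_over_n, of 2] by simp
  have band_ind: "(\<lambda>n. indicator (band (\<eta> n)) z :: real) \<longlonglongrightarrow> 1" if "z \<noteq> 0" for z :: 'a
  proof -
    have "\<forall>\<^sub>F n in sequentially. \<eta> n < norm z" using \<eta>0 that by (intro order_tendstoD) auto
    moreover have "\<forall>\<^sub>F n in sequentially. norm z < 1 / \<eta> n"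
      using eventually_ge_at_top[of "nat \<lceil>norm z\<rceil>"]
    proof eventually_elim
      case (elim n)
      then have "norm z \<le> real n" by linarith
      then show ?case by (simp add: \<eta>_def)
    qed
    ultimately have "\<forall>\<^sub>F n in sequentially. indicator (band (\<eta> n)) z = (1::real)"
      by eventually_elim (simp add: band_def)
    then show ?thesis by (rule tendsto_eventually)
  qed
  \<comment> \<open>Off the diagonal the bands exhaust all pairs, and the band energies of h share
    the bound C/2, so Fatou gives finite energy.\<close>
  have hV: "h \<in> V"
  proof -
    have "(\<integral>\<^sup>+p. ennreal ((dif h p)\<^sup>2) \<partial>JJ) \<le> ennreal (C / 2)"
    proof (rule nn_integral_Fatou_le[where f="\<lambda>n p. indicator (band (\<eta> n)) (fst p - snd p) * ennreal ((dif h p)\<^sup>2)"])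
      show "AE p in JJ. (\<lambda>n. indicator (band (\<eta> n)) (fst p - snd p) * ennreal ((dif h p)\<^sup>2)) \<longlonglongrightarrow> ennreal ((dif h p)\<^sup>2)"
        using AE_jm_off_diagonal
      proof eventually_elim
        case (elim p)
        have "(\<lambda>n. ennreal (indicator (band (\<eta> n)) (fst p - snd p) * (dif h p)\<^sup>2)) \<longlonglongrightarrow> ennreal (1 * (dif h p)\<^sup>2)"
          using elim by (intro tendsto_ennrealI tendsto_intros band_ind) simp
        moreover have "ennreal (indicator (band (\<eta> n)) (fst p - snd p) * (dif h p)\<^sup>2) = indicator (band (\<eta> n)) (fst p - snd p) * ennreal ((dif h p)\<^sup>2)" for n
          by (auto simp: indicator_def)
        ultimately show ?case by simp
      qed
      have "(\<integral>\<^sup>+p. indicator (band (\<eta> n)) (fst p - snd p) * ennreal ((dif h p)\<^sup>2) \<partial>JJ) \<le> ennreal (C / 2)" for n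
      proof -
        have hL: "dif h \<in> L2 (?Kb (\<eta> n))" using band_bounded[OF \<eta>] hL2 by metis
        have "(\<integral>\<^sup>+p. indicator (band (\<eta> n)) (fst p - snd p) * ennreal ((dif h p)\<^sup>2) \<partial>JJ) = (\<integral>\<^sup>+p. ennreal ((dif h p)\<^sup>2) \<partial>?Kb (\<eta> n))"
          by (rule nn_integral_restr[symmetric]) measurable
        also have "\<dots> = ennreal (L2_inner (?Kb (\<eta> n)) (dif h) (dif h))" by (rule L2_nn_eq[OF hL])
        also have "\<dots> \<le> ennreal (C / 2)" using hb_le[OF \<eta>, of n] by (intro ennreal_leI) simp
        finally show ?thesis .
      qed
      then show "\<forall>\<^sub>F n in sequentially. (\<integral>\<^sup>+p. indicator (band (\<eta> n)) (fst p - snd p) * ennreal ((dif h p)\<^sup>2) \<partial>JJ) \<le> ennreal (C / 2)" by simp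
    qed measurable
    then have "(\<integral>\<^sup>+p. ennreal ((dif h p)\<^sup>2) \<partial>JJ) < \<infinity>" using le_less_trans ennreal_less_top unfolding infinity_ennreal_def by blast
    moreover have "dif h \<in> borel_measurable JJ" by measurable
    ultimately have "dif h \<in> L2 JJ" unfolding L2_iff_nn by blast
    then show ?thesis using hL2 by (simp add: V_def)
  qed
  have eq: "ip l h g = L2_inner lborel f g" if g: "g \<in> Cc_infinity" for g
  proof -
    obtain L G R where gl: "lipc L G R g" using Cc_1_lipc[OF Cc_infinity_sub_Cc_1[OF g]] by metis
    have gm: "g \<in> borel_measurable borel" by (rule Cc_measurable[OF lipc_Cc[OF gl]])
    have gB: "\<bar>g x\<bar> \<le> G" and gR: "R < norm x \<Longrightarrow> g x = 0" for x using gl unfolding lipc_def by auto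
    have gV: "g \<in> V" by (rule lipc_V[OF gl])
    \<comment> \<open>The value that the resolvent equations of u force on the limit of the full
      forms \<open>?A\<close>. The band forms \<open>?b\<close> converge to the form of h, and the
      two limits are compared through the part off the band.\<close>
    let ?L = "L2_inner lborel f g - l * L2_inner lborel h g"
    let ?b = "\<lambda>n. L2_inner (?Kb (\<eta> n)) (dif h) (dif g)"
    let ?A = "\<lambda>n. L2_inner (jm (J (e n))) (dif (u (e n))) (dif g)"
    have A: "?A \<longlonglongrightarrow> ?L"
    proof -
      have "?A n = L2_inner (m (e n)) f g - l * L2_inner (m (e n)) (u (e n)) g" for n
      proof -
        interpret S: sym_space "J (e n)" "m (e n)" by (rule J_space[OF e(1)])
        show ?thesis using ueq[OF e(1)[of n] S.Cc_1_domain[OF Cc_infinity_sub_Cc_1[OF g]]] unfolding S.ip_def by simp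
      qed
      moreover have "(\<lambda>n. L2_inner (m (e n)) f g - l * L2_inner (m (e n)) (u (e n)) g) \<longlonglongrightarrow> ?L"
        by (intro tendsto_intros conv'[OF fm M(2) gm gB gR] conv[OF gm gB gR])
      ultimately show ?thesis by simp
    qed
    have b: "?b \<longlonglongrightarrow> L2_inner JJ (dif h) (dif g)"
    proof -
      have i: "integrable JJ (\<lambda>p. dif h p * dif g p)" using hV gV by (intro L2_mult_integrable) (auto simp: V_def)
      have "(\<lambda>n. LINT p|JJ. indicator (band (\<eta> n)) (fst p - snd p) * (dif h p * dif g p)) \<longlonglongrightarrow> (LINT p|JJ. dif h p * dif g p)"
      proof (rule integral_dominated_convergence[where w="\<lambda>p. \<bar>dif h p * dif g p\<bar>"])
        show "AE p in JJ. (\<lambda>n. indicator (band (\<eta> n)) (fst p - snd p) * (dif h p * dif g p)) \<longlonglongrightarrow> dif h p * dif g p"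
          using AE_jm_off_diagonal
        proof eventually_elim
          case (elim p)
          have "(\<lambda>n. indicator (band (\<eta> n)) (fst p - snd p) * (dif h p * dif g p)) \<longlonglongrightarrow> 1 * (dif h p * dif g p)"
            using elim by (intro tendsto_intros band_ind) simp
          then show ?case by simp
        qed
        show "(\<lambda>p. indicator (band (\<eta> n)) (fst p - snd p) * (dif h p * dif g p)) \<in> borel_measurable JJ" for n
          using gm by measurable
      qed (use i in \<open>auto simp: indicator_def\<close>)
      moreover have "?b n = (LINT p|JJ. indicator (band (\<eta> n)) (fst p - snd p) * (dif h p * dif g p))" for n
        unfolding L2_inner_def using gm by (intro integral_restr) measurable
      ultimately show ?thesis unfolding L2_inner_def by simp
    qed
    \<comment> \<open>Weighted inequality off the band: the energy of u contributes at most t C and,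
      once the energy of g there is at most t^2, g contributes at most t. First n tends to infinity,
      then the band index i.\<close>
    have bound: "2 * \<bar>?L - L2_inner JJ (dif h) (dif g)\<bar> \<le> t * (C + 1)" if t: "0 < t" for t
    proof -
      have "\<forall>\<^sub>F s in at_right 0. \<forall>\<^sub>F r in at_right 0.
        (\<integral>\<^sup>+p. ennreal ((dif g p)\<^sup>2) \<partial>jm (restr (J r) (- band s))) \<le> ennreal (t\<^sup>2)"
        using t by (intro off_band g) simp
      from eventually_compose_filterlim[OF this filterlim_at_right_0[OF \<eta> \<eta>0]]
      have ev: "\<forall>\<^sub>F i in sequentially. \<forall>\<^sub>F r in at_right 0.
        (\<integral>\<^sup>+p. ennreal ((dif g p)\<^sup>2) \<partial>jm (restr (J r) (- band (\<eta> i)))) \<le> ennreal (t\<^sup>2)" .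
      have "\<forall>\<^sub>F i in sequentially. 2 * \<bar>?L - ?b i\<bar> \<le> t * (C + 1)"
        using ev
      proof eventually_elim
        case (elim i)
        from eventually_compose_filterlim[OF elim filterlim_at_right_0[OF e]]
        have ev2: "\<forall>\<^sub>F n in sequentially. (\<integral>\<^sup>+p. ennreal ((dif g p)\<^sup>2) \<partial>jm (restr (J (e n)) (- band (\<eta> i)))) \<le> ennreal (t\<^sup>2)" .
        have "(\<lambda>n. 2 * \<bar>?A n - L2_inner (?Jb n (\<eta> i)) (dif (u (e n))) (dif g)\<bar>) \<longlonglongrightarrow> 2 * \<bar>?L - ?b i\<bar>"
          by (intro tendsto_intros A band_conv[OF \<eta> g])
        then show ?case
        proof (rule tendsto_upperbound)
          show "\<forall>\<^sub>F n in sequentially. 2 * \<bar>?A n - L2_inner (?Jb n (\<eta> i)) (dif (u (e n))) (dif g)\<bar> \<le> t * (C + 1)"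
            using ev2 bnd
          proof eventually_elim
            case (elim n)
            interpret S: sym_space "J (e n)" "m (e n)" by (rule J_space[OF e(1)])
            have uL: "dif (u (e n)) \<in> L2 (jm (J (e n)))" and gL: "dif g \<in> L2 (jm (J (e n)))"
              using S.domain_V[OF u[OF e(1)[of n]]] S.lipc_V[OF gl] by (auto simp: S.V_def)
            have cs: "- band (\<eta> i) \<in> sets (borel :: 'a measure)" by measurable
            note uL2 = S.L2_restr[OF cs uL] and gL2 = S.L2_restr(1)[OF cs gL]
            let ?R = "jm (restr (J (e n)) (- band (\<eta> i)))"
            have "2 * \<bar>L2_inner ?R (dif (u (e n))) (dif g)\<bar> \<le> t * L2_inner ?R (dif (u (e n))) (dif (u (e n))) + L2_inner ?R (dif g) (dif g) / t"
              by (rule L2_inner_AMGM[OF uL2(1) gL2 t])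
            moreover have "t * L2_inner ?R (dif (u (e n))) (dif (u (e n))) \<le> t * C"
            proof (rule mult_left_mono)
              have "0 \<le> L2_inner (jm (J (e n))) (dif (u (e n))) (dif (u (e n)))" by (rule L2_inner_nonneg)
              then show "L2_inner ?R (dif (u (e n))) (dif (u (e n))) \<le> C" using uL2(2) elim(2) by linarith
            qed (use t in simp)
            moreover have "L2_inner ?R (dif g) (dif g) / t \<le> t"
            proof -
              have "L2_inner ?R (dif g) (dif g) \<le> t\<^sup>2"
                using elim(1) t unfolding L2_nn_eq[OF gL2] by (subst (asm) ennreal_le_iff) auto
              then show ?thesis using t by (simp add: field_simps power2_eq_square)
            qed
            moreover have "?A n - L2_inner (?Jb n (\<eta> i)) (dif (u (e n))) (dif g) = L2_inner ?R (dif (u (e n))) (dif g)"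
              using S.L2_inner_split[OF band_sets uL gL, of "\<eta> i"] by simp
            ultimately have "2 * \<bar>?A n - L2_inner (?Jb n (\<eta> i)) (dif (u (e n))) (dif g)\<bar> \<le> t * C + t" by simp
            then show ?case by (simp add: distrib_left)
          qed
        qed simp
      qed
      moreover have "(\<lambda>i. 2 * \<bar>?L - ?b i\<bar>) \<longlonglongrightarrow> 2 * \<bar>?L - L2_inner JJ (dif h) (dif g)\<bar>"
        by (intro tendsto_intros b)
      ultimately show ?thesis by (intro tendsto_upperbound) auto
    qed
    have "2 * \<bar>?L - L2_inner JJ (dif h) (dif g)\<bar> \<le> 0"
    proof (rule field_le_epsilon)
      fix d :: real assume "0 < d"
      then have "2 * \<bar>?L - L2_inner JJ (dif h) (dif g)\<bar> \<le> (d / (C + 1)) * (C + 1)" using C0 by (intro bound) simp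
      also have "\<dots> = d" using C0 by simp
      finally show "2 * \<bar>?L - L2_inner JJ (dif h) (dif g)\<bar> \<le> 0 + d" by simp
    qed
    then have "?L = L2_inner JJ (dif h) (dif g)" by simp
    then show ?thesis unfolding ip_def by simp
  qed
  have UV: "U \<in> V" by (rule domain_V[OF U(1)])
  \<comment> \<open>So far h is known only to lie in \<open>V\<close>, hence uniqueness is used
    among bounded functions of finite energy and not just within the form domain.\<close>
  have "AE x in lborel. h x - U x = 0"
  proof (rule uniqueness[where B="2 * B", OF V_diff[OF hV UV] _ l])
    show "\<bar>h x - U x\<bar> \<le> 2 * B" for x using hB[of x] U(3)[of x, folded B_def] by linarith
    show "ip l (\<lambda>x. h x - U x) g = 0" if g: "g \<in> Cc_infinity" for g
    proof -
      have gC: "g \<in> Cc_1" by (rule Cc_infinity_sub_Cc_1[OF g])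
      have "ip l g (\<lambda>x. h x + (-1) * U x) = ip l g h + (-1) * ip l g U"
        by (rule ip_add_cmult_right[OF hV UV Cc_1_V[OF gC]])
      then show ?thesis using eq[OF g] U(2)[OF Cc_1_domain[OF gC]] by (simp add: ip_commute[of l _ g])
    qed
  qed
  with hh0 show ?thesis by eventually_elim simp
qed


text \<open>Every sequence tending to 0 has a subsequence with the same limit, which yields
  convergence along \<epsilon> itself.\<close>

theorem resolvent_convergence:
  fixes l :: real and f :: "'a \<Rightarrow> real"
  assumes l: "0 < l" and f: "f \<in> Cc"
  defines "u \<equiv> \<lambda>e. resolvent (m e) (jump_form (J e)) (jump_domain (m e) (J e)) l f"
    and "W \<equiv> resolvent lborel (jump_form (\<lambda>x y. k (x - y))) (jump_domain lborel (\<lambda>x y. k (x - y))) l f"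
  shows "1 < s \<Longrightarrow> tendsto_L1 (ball 0 s) u W (at_right 0)"
    and "g \<in> Cc \<Longrightarrow> ((\<lambda>e. L2_inner (m e) (u e) g) \<longlongrightarrow> L2_inner lborel W g) (at_right 0)"
    and "g \<in> Cc_infinity \<Longrightarrow>
      ((\<lambda>e. jump_form (J e) (u e) g) \<longlongrightarrow> jump_form (\<lambda>x y. k (x - y)) W g) (at_right 0)"
proof -
  have fm: "f \<in> borel_measurable borel" by (rule Cc_measurable[OF f])
  obtain Rf where Rf: "0 < Rf" "\<And>x. Rf < norm x \<Longrightarrow> f x = 0"
    using f compact_support_pos unfolding Cc_def by blast
  obtain F where F: "0 \<le> F" "\<And>x. \<bar>f x\<bar> \<le> F" using Cc_bounded[OF f] by metis
  define M where "M = F / l"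
  have M: "0 \<le> M" "\<And>x. \<bar>f x\<bar> \<le> l * M" using F l by (auto simp: M_def)
  have fW: "f \<in> L2 lborel" by (rule bounded_support_L2[OF fm F(2) Rf(2)])
  have u: "u s \<in> jump_domain (m s) (J s)" "AE x in lborel. \<bar>u s x\<bar> \<le> M + 1" "u s \<in> borel_measurable borel"
    and ueq: "g \<in> jump_domain (m s) (J s) \<Longrightarrow> jump_space.ip (J s) (m s) l (u s) g = L2_inner (m s) f g"
    if s: "0 < s" for s g
  proof -
    interpret S: sym_space "J s" "m s" by (rule J_space[OF s])
    have fL: "f \<in> L2 (m s)" by (rule S.bounded_support_L2[OF fm F(2) Rf(2)])
    note * = S.resolvent_props[OF fL l M]
    show "u s \<in> jump_domain (m s) (J s)" "AE x in lborel. \<bar>u s x\<bar> \<le> M + 1"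
      "g \<in> jump_domain (m s) (J s) \<Longrightarrow> S.ip l (u s) g = L2_inner (m s) f g"
      unfolding u_def by (fact *(1) *(3) *(2))+
    then show "u s \<in> borel_measurable borel" using S.V_measurable[OF S.domain_V] by blast
  qed
  note W = resolvent_props[OF fW l M, folded W_def]
  have Wm: "W \<in> borel_measurable borel" by (rule V_measurable[OF domain_V[OF W(1)]])
  \<comment> \<open>W is a selected solution and bounded only almost everywhere; U is a solution
    bounded at every point and stands in for it.\<close>
  obtain U where U: "U \<in> jump_domain lborel (\<lambda>x y. k (x - y))"
    "\<And>g. g \<in> jump_domain lborel (\<lambda>x y. k (x - y)) \<Longrightarrow> ip l U g = L2_inner lborel f g"
    "\<And>x. \<bar>U x\<bar> \<le> M + 1"
    using resolvent_exists[OF fW l M] by blast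
  have Um: "U \<in> borel_measurable borel" by (rule V_measurable[OF domain_V[OF U(1)]])
  have WU: "AE x in lborel. W x = U x" by (rule resolvent_unique[OF l W(1,2) U(1,2)])
  have ff: "((\<lambda>e. L2_inner (m e) f f) \<longlongrightarrow> L2_inner lborel f f) (at_right 0)"
  proof -
    have "wl 1 (\<lambda>x. f x * f x)"
    proof (rule wl_rho[where B="F * F" and R=Rf])
      show "\<bar>f x * f x\<bar> \<le> F * F" for x unfolding abs_mult using F by (intro mult_mono) auto
    qed (use fm Rf in auto)
    then show ?thesis unfolding wl_def m_inner[OF fm fm] by (simp add: L2_inner_def)
  qed
  have energy: "jump_energy (J s) (u s) \<le> ennreal (L2_inner (m s) f f / l)" if s: "0 < s" for s
  proof -
    interpret S: sym_space "J s" "m s" by (rule J_space[OF s])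
    have fL: "f \<in> L2 (m s)" by (rule S.bounded_support_L2[OF fm F(2) Rf(2)])
    have uV: "u s \<in> S.V" by (rule S.domain_V[OF u(1)[OF s]])
    have uL: "dif (u s) \<in> L2 (jm (J s))" "u s \<in> L2 (m s)" using uV by (auto simp: S.V_def)
    let ?E = "L2_inner (jm (J s)) (dif (u s)) (dif (u s))" and ?N = "L2_inner (m s) (u s) (u s)"
    have "?E + l * ?N = L2_inner (m s) f (u s)" using ueq[OF s u(1)[OF s]] unfolding S.ip_def .
    moreover have "2 * \<bar>L2_inner (m s) (u s) f\<bar> \<le> l * ?N + L2_inner (m s) f f / l"
      by (rule L2_inner_AMGM[OF uL(2) fL l])
    moreover have "0 \<le> ?E" "0 \<le> l * ?N" using l L2_inner_nonneg by (auto simp: L2_inner_nonneg)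
    ultimately have "?E \<le> L2_inner (m s) f f / l" unfolding L2_inner_commute[of "m s" "u s" f] by linarith
    then show ?thesis unfolding S.jump_energy_jm[OF u(3)[OF s]] L2_nn_eq[OF uL(1)] by (rule ennreal_leI)
  qed
  define C where "C = (L2_inner lborel f f + 1) / l"
  have pos: "\<forall>\<^sub>F e::real in at_right 0. 0 < e" by (simp add: eventually_at_right_less)
  have "\<forall>\<^sub>F e in at_right 0. L2_inner (m e) f f < L2_inner lborel f f + 1"
    using ff by (rule order_tendstoD) simp
  then have "\<forall>\<^sub>F e in at_right 0. esssup lborel (\<lambda>x. ennreal \<bar>u e x\<bar>) + jump_energy (J e) (u e) \<le> ennreal (M + 1) + ennreal C"
    using pos
  proof eventually_elim
    case (elim e)
    have "jump_energy (J e) (u e) \<le> ennreal C"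
      using elim l unfolding C_def by (intro order_trans[OF energy] ennreal_leI divide_right_mono) auto
    moreover have "esssup lborel (\<lambda>x. ennreal \<bar>u e x\<bar>) \<le> ennreal (M + 1)"
    proof (rule esssup_I)
      show "AE x in lborel. ennreal \<bar>u e x\<bar> \<le> ennreal (M + 1)"
        using u(2)[OF elim(2)] by eventually_elim (rule ennreal_leI)
    qed (use u(3)[OF elim(2)] in measurable)
    ultimately show ?case by (intro add_mono)
  qed
  then have "Limsup (at_right 0) (\<lambda>e. esssup lborel (\<lambda>x. ennreal \<bar>u e x\<bar>) + jump_energy (J e) (u e)) \<le> ennreal (M + 1) + ennreal C"
    by (rule Limsup_bounded)
  also have "\<dots> < \<infinity>" by simp
  finally have lims: "Limsup (at_right 0) (\<lambda>e. esssup lborel (\<lambda>x. ennreal \<bar>u e x\<bar>) + jump_energy (J e) (u e)) < \<infinity>" .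
  have subseq: "\<exists>r. strict_mono (r :: nat \<Rightarrow> nat) \<and> (\<forall>s>1. (\<lambda>n. LINT x:ball 0 s|lborel. \<bar>u (e (r n)) x - U x\<bar>) \<longlonglongrightarrow> 0)"
    if e: "\<And>n::nat. 0 < e n \<and> e n \<le> 1" "e \<longlonglongrightarrow> 0" for e
  proof -
    have "\<exists>r h. strict_mono (r :: nat \<Rightarrow> nat) \<and> h \<in> L1_loc \<and> (\<forall>s>1. tendsto_L1 (ball 0 s) (\<lambda>n. u (e (r n))) h sequentially)"
      by (rule compactness[OF _ lims _ e(2)]) (use u(1) e(1) in auto)
    then obtain r h where r: "strict_mono (r :: nat \<Rightarrow> nat)" and h: "h \<in> L1_loc"
      and lim: "\<And>s. 1 < s \<Longrightarrow> tendsto_L1 (ball 0 s) (\<lambda>n. u (e (r n))) h sequentially" by blast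
    have hm: "h \<in> borel_measurable borel" using h by (simp add: L1_loc_def)
    have er: "0 < e (r n)" for n using e(1) by simp
    have er0: "(\<lambda>n. e (r n)) \<longlonglongrightarrow> 0" using LIMSEQ_subseq_LIMSEQ[OF e(2) r] by (simp add: comp_def)
    have hU: "AE x in lborel. h x = U x"
      by (rule limit_identified[where u=u and e="\<lambda>n. e (r n)", OF l f M u(1) ueq u(2) U er er0 hm lim])
    have "(\<lambda>n. LINT x:ball 0 s|lborel. \<bar>u (e (r n)) x - U x\<bar>) \<longlonglongrightarrow> 0" if "1 < s" for s
    proof -
      have "(LINT x:ball 0 s|lborel. \<bar>u (e (r n)) x - U x\<bar>) = (LINT x:ball 0 s|lborel. \<bar>u (e (r n)) x - h x\<bar>)" for n
        unfolding set_lebesgue_integral_def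
      proof (rule integral_cong_AE)
        show "AE x in lborel. indicator (ball 0 s) x *\<^sub>R \<bar>u (e (r n)) x - U x\<bar> = indicator (ball 0 s) x *\<^sub>R \<bar>u (e (r n)) x - h x\<bar>"
          using hU by eventually_elim simp
      qed (use u(3)[OF er] hm Um in measurable)
      then show ?thesis using lim[OF that] unfolding tendsto_L1_def by simp
    qed
    then show ?thesis using r by blast
  qed
  have bounded_si: "set_integrable lborel (ball 0 s) v"
    if vm: "v \<in> borel_measurable borel" and vB: "AE x in lborel. \<bar>v x\<bar> \<le> M + 1" for v :: "'a \<Rightarrow> real" and s
    unfolding set_integrable_def
  proof (rule Bochner_Integration.integrable_bound[OF cball_integrable[of "M + 1" s]])
    show "AE x in lborel. norm (indicator (ball 0 s) x *\<^sub>R v x) \<le> norm ((M + 1) * indicator (cball 0 s) x :: real)"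
      using vB by eventually_elim (use M(1) in \<open>simp add: indicator_def\<close>)
  qed (use vm in measurable)
  show "tendsto_L1 (ball 0 s) u W (at_right 0)" if s: "1 < s" for s
    unfolding tendsto_L1_def
  proof (intro conjI)
    show "set_integrable lborel (ball 0 s) W" by (rule bounded_si[OF Wm W(3)])
    show "\<forall>\<^sub>F e in at_right 0. set_integrable lborel (ball 0 s) (u e)"
      using pos by eventually_elim (intro bounded_si u)
    have "((\<lambda>e. LINT x:ball 0 s|lborel. \<bar>u e x - U x\<bar>) \<longlongrightarrow> 0) (at_right 0)"
      by (rule tendsto_at_right_0_subseq) (use subseq s in blast)
    moreover have "\<forall>\<^sub>F e in at_right 0. (LINT x:ball 0 s|lborel. \<bar>u e x - U x\<bar>) = (LINT x:ball 0 s|lborel. \<bar>u e x - W x\<bar>)"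
      using pos
    proof eventually_elim
      case (elim e)
      show ?case unfolding set_lebesgue_integral_def
      proof (rule integral_cong_AE)
        show "AE x in lborel. indicator (ball 0 s) x *\<^sub>R \<bar>u e x - U x\<bar> = indicator (ball 0 s) x *\<^sub>R \<bar>u e x - W x\<bar>"
          using WU by eventually_elim simp
      qed (use u(3)[OF elim] Um Wm in measurable)
    qed
    ultimately show "((\<lambda>e. LINT x:ball 0 s|lborel. \<bar>u e x - W x\<bar>) \<longlongrightarrow> 0) (at_right 0)"
      by (rule Lim_transform_eventually)
  qed
  show inner: "((\<lambda>e. L2_inner (m e) (u e) g) \<longlongrightarrow> L2_inner lborel W g) (at_right 0)" if g: "g \<in> Cc" for g
  proof -
    have gm: "g \<in> borel_measurable borel" by (rule Cc_measurable[OF g])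
    obtain R where R: "\<And>x. R < norm x \<Longrightarrow> g x = 0" using g compact_support_pos unfolding Cc_def by blast
    obtain G where G: "\<And>x. \<bar>g x\<bar> \<le> G" using Cc_bounded[OF g] by metis
    have "L2_inner lborel W g = L2_inner lborel U g"
      unfolding L2_inner_def
    proof (rule integral_cong_AE)
      show "AE x in lborel. W x * g x = U x * g x" using WU by eventually_elim simp
    qed (use gm Wm Um in measurable)
    moreover have "((\<lambda>e. L2_inner (m e) (u e) g) \<longlongrightarrow> L2_inner lborel U g) (at_right 0)"
    proof (rule tendsto_at_right_0_subseq)
      fix e :: "nat \<Rightarrow> real" assume e: "\<And>n. 0 < e n \<and> e n \<le> 1" "e \<longlonglongrightarrow> 0"
      obtain r where r: "strict_mono (r :: nat \<Rightarrow> nat)"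
        and lim: "\<And>s. 1 < s \<Longrightarrow> (\<lambda>n. LINT x:ball 0 s|lborel. \<bar>u (e (r n)) x - U x\<bar>) \<longlonglongrightarrow> 0"
        using subseq[OF e] by blast
      have er: "0 < e (r n)" for n using e(1) by simp
      have er0: "(\<lambda>n. e (r n)) \<longlonglongrightarrow> 0" using LIMSEQ_subseq_LIMSEQ[OF e(2) r] by (simp add: comp_def)
      have "(\<lambda>n. L2_inner (m (e (r n))) (u (e (r n))) g) \<longlonglongrightarrow> L2_inner lborel U g"
        by (rule weighted_tendsto[OF u(3)[OF er] u(2)[OF er] Um U(3) lim gm G R er er0])
      then show "\<exists>r. strict_mono (r :: nat \<Rightarrow> nat) \<and> (\<lambda>n. L2_inner (m (e (r n))) (u (e (r n))) g) \<longlonglongrightarrow> L2_inner lborel U g"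
        using r by blast
    qed
    ultimately show ?thesis by simp
  qed
  show "((\<lambda>e. jump_form (J e) (u e) g) \<longlongrightarrow> jump_form (\<lambda>x y. k (x - y)) W g) (at_right 0)" if g: "g \<in> Cc_infinity" for g
  proof -
    have g1: "g \<in> Cc_1" by (rule Cc_infinity_sub_Cc_1[OF g])
    have gC: "g \<in> Cc" using g1 Cc_1_sub_Cc by blast
    have gm: "g \<in> borel_measurable borel" by (rule Cc_measurable[OF gC])
    obtain R where R: "\<And>x. R < norm x \<Longrightarrow> g x = 0" using gC compact_support_pos unfolding Cc_def by blast
    obtain G where G: "\<And>x. \<bar>g x\<bar> \<le> G" using Cc_bounded[OF gC] by metis
    have "wl 1 (\<lambda>x. f x * g x)"
    proof (rule wl_rho[where B="F * G" and R=R])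
      show "\<bar>f x * g x\<bar> \<le> F * G" for x unfolding abs_mult using F G by (intro mult_mono) auto
    qed (use fm gm R in auto)
    then have fg: "((\<lambda>e. L2_inner (m e) f g) \<longlongrightarrow> L2_inner lborel f g) (at_right 0)"
      unfolding wl_def m_inner[OF fm gm] by (simp add: L2_inner_def)
    have gd: "g \<in> jump_domain lborel (\<lambda>x y. k (x - y))" by (rule Cc_1_domain[OF g1])
    \<comment> \<open>Testing the resolvent equation with g expresses the form through two inner
      products whose limits are already known.\<close>
    have "jump_form (\<lambda>x y. k (x - y)) W g = L2_inner lborel f g - l * L2_inner lborel W g"
      using ip_form[OF domain_V[OF W(1)] domain_V[OF gd], of l] W(2)[OF gd] by simp
    moreover have "((\<lambda>e. L2_inner (m e) f g - l * L2_inner (m e) (u e) g) \<longlongrightarrow> L2_inner lborel f g - l * L2_inner lborel W g) (at_right 0)"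
      by (intro tendsto_intros fg inner gC)
    moreover have "\<forall>\<^sub>F e in at_right 0. L2_inner (m e) f g - l * L2_inner (m e) (u e) g = jump_form (J e) (u e) g"
      using pos
    proof eventually_elim
      case (elim e)
      interpret S: sym_space "J e" "m e" by (rule J_space[OF elim])
      have gd: "g \<in> jump_domain (m e) (J e)" by (rule S.Cc_1_domain[OF g1])
      show ?case using S.ip_form[OF S.domain_V[OF u(1)[OF elim]] S.domain_V[OF gd], of l] ueq[OF elim gd] by simp
    qed
    ultimately show ?thesis using Lim_transform_eventually by fastforce
  qed
qed

end

section \<open>The random forms\<close>

text \<open>Dyadic decomposition: for large |z| the n-th term is of order 2^(-\<alpha> n), for small
  |z| of order 2^((\<alpha> - 2) n), and the two bounds on \<alpha> make both geometric series
  converge.\<close>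

lemma levy_integral_finite:
  assumes "0 < \<alpha>" "\<alpha> < 2"
  shows "(\<integral>\<^sup>+z. ennreal (min 1 ((norm z)\<^sup>2) * (1 / norm z powr (real DIM('a::euclidean_space) + \<alpha>))) \<partial>(lborel :: 'a measure)) < \<infinity>"
proof -
  let ?p = "real DIM('a) + \<alpha>" and ?c = "unit_ball_vol DIM('a)"
  let ?\<phi> = "\<lambda>z::'a. min 1 ((norm z)\<^sup>2) * (1 / norm z powr ?p)"
  \<comment> \<open>\<open>A n\<close> bounds the integrand where |z| lies between 2^n / 2 and 2^n,
    \<open>B n\<close> where it lies between 1 / 2^n and 2 / 2^n; extending these shells to full
    balls changes only constants.\<close>
  define A B :: "nat \<Rightarrow> real" where "A n = 1 / (2 ^ n / 2) powr ?p" and "B n = (2 / 2 ^ n)\<^sup>2 * (2 ^ n) powr ?p" for n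
  let ?SA = "\<lambda>z::'a. \<Sum>n. ennreal (A n) * indicator (cball 0 (2 ^ n)) z"
  let ?SB = "\<lambda>z::'a. \<Sum>n. ennreal (B n) * indicator (cball 0 (2 / 2 ^ n)) z"
  have AB: "0 \<le> A n" "0 \<le> B n" for n by (auto simp: A_def B_def)
  have single: "f n \<le> (\<Sum>n. f n)" for f :: "nat \<Rightarrow> ennreal" and n
    using sum_le_suminf[of f "{n}"] by simp
  have le: "ennreal (?\<phi> z) \<le> ?SA z + ?SB z" for z
  proof -
    consider "z = 0" | "1 \<le> norm z" | "z \<noteq> 0" "norm z \<le> 1" by linarith
    then show ?thesis
    proof cases
      case 2
      then obtain n :: nat where n: "norm z \<le> 2 ^ n" "2 ^ n \<le> 2 * norm z" by (rule dyadic_scale)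
      have "(2 ^ n / 2) powr ?p \<le> norm z powr ?p" using n assms by (intro powr_mono2) auto
      then have "?\<phi> z \<le> 1 * (1 / (2 ^ n / 2) powr ?p)"
        by (intro mult_mono frac_le) auto
      then have "ennreal (?\<phi> z) \<le> ennreal (A n) * indicator (cball 0 (2 ^ n)) z"
        using n by (simp add: A_def ennreal_leI)
      also have "\<dots> \<le> ?SA z" by (rule single)
      finally show ?thesis by (rule order_trans) simp
    next
      case 3
      then have "1 \<le> 1 / norm z" by simp
      then obtain n :: nat where n: "1 / norm z \<le> 2 ^ n" "2 ^ n \<le> 2 * (1 / norm z)" by (rule dyadic_scale)
      have z: "norm z \<le> 2 / 2 ^ n" "1 / 2 ^ n \<le> norm z" using n 3 by (auto simp: field_simps)
      have "(1 / 2 ^ n) powr ?p \<le> norm z powr ?p" using z assms by (intro powr_mono2) auto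
      then have "1 / norm z powr ?p \<le> 1 / (1 / 2 ^ n) powr ?p"
        by (intro frac_le) auto
      also have "\<dots> = (2 ^ n) powr ?p" by (simp add: powr_divide)
      finally have "?\<phi> z \<le> (2 / 2 ^ n)\<^sup>2 * (2 ^ n) powr ?p"
        using z by (intro mult_mono min.coboundedI2 power_mono) auto
      then have "ennreal (?\<phi> z) \<le> ennreal (B n) * indicator (cball 0 (2 / 2 ^ n)) z"
        using z by (simp add: B_def ennreal_leI)
      also have "\<dots> \<le> ?SB z" by (rule single)
      finally show ?thesis by (rule order_trans) simp
    qed simp
  qed
  have pw: "(2 ^ n) powr s = (2 powr s) ^ n" for s :: real and n :: nat
    by (simp add: powr_powr powr_realpow[symmetric] mult.commute)
  have "(\<integral>\<^sup>+z. ennreal (?\<phi> z) \<partial>lborel) \<le> (\<integral>\<^sup>+z. ?SA z + ?SB z \<partial>lborel)" by (intro nn_integral_mono le)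
  also have "\<dots> = (\<Sum>n. ennreal (A n) * emeasure lborel (cball (0::'a) (2 ^ n))) + (\<Sum>n. ennreal (B n) * emeasure lborel (cball (0::'a) (2 / 2 ^ n)))"
    by (subst nn_integral_add, measurable, subst (1 2) nn_integral_suminf, measurable) (simp add: nn_integral_cmult_indicator)
  also have "(\<lambda>n. ennreal (A n) * emeasure lborel (cball (0::'a) (2 ^ n))) = (\<lambda>n. ennreal ((?c * 2 powr ?p) * (2 powr - \<alpha>) ^ n))"
  proof
    fix n :: nat
    have "A n * (2 ^ n) ^ DIM('a) = 2 powr ?p * (2 ^ n) powr (- \<alpha>)"
      by (simp add: A_def powr_divide powr_add powr_minus powr_realpow field_simps)
    then have "A n * (?c * (2 ^ n) ^ DIM('a)) = (?c * 2 powr ?p) * (2 powr - \<alpha>) ^ n" unfolding pw by (simp add: mult_ac)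
    then show "ennreal (A n) * emeasure lborel (cball (0::'a) (2 ^ n)) = ennreal ((?c * 2 powr ?p) * (2 powr - \<alpha>) ^ n)"
      using AB by (simp add: emeasure_cball ennreal_mult[symmetric])
  qed
  also have "(\<lambda>n. ennreal (B n) * emeasure lborel (cball (0::'a) (2 / 2 ^ n))) = (\<lambda>n. ennreal ((4 * ?c * 2 ^ DIM('a)) * (2 powr (\<alpha> - 2)) ^ n))"
  proof
    fix n :: nat
    have "B n * (2 / 2 ^ n) ^ DIM('a) = 4 * 2 ^ DIM('a) * (2 ^ n) powr (\<alpha> - 2)"
      by (simp add: B_def powr_add powr_diff powr_realpow power_divide field_simps)
    then have "B n * (?c * (2 / 2 ^ n) ^ DIM('a)) = (4 * ?c * 2 ^ DIM('a)) * (2 powr (\<alpha> - 2)) ^ n" unfolding pw by (simp add: mult_ac)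
    then show "ennreal (B n) * emeasure lborel (cball (0::'a) (2 / 2 ^ n)) = ennreal ((4 * ?c * 2 ^ DIM('a)) * (2 powr (\<alpha> - 2)) ^ n)"
      using AB by (simp add: emeasure_cball ennreal_mult[symmetric])
  qed
  also have "(\<Sum>n. ennreal ((?c * 2 powr ?p) * (2 powr - \<alpha>) ^ n)) + (\<Sum>n. ennreal ((4 * ?c * 2 ^ DIM('a)) * (2 powr (\<alpha> - 2)) ^ n)) < \<infinity>"
  proof -
    have s: "(2::real) powr s < 1" if "s < 0" for s :: real using powr_less_mono[OF that, of 2] by simp
    have "(\<Sum>n. ennreal ((?c * 2 powr ?p) * (2 powr - \<alpha>) ^ n)) \<noteq> top"
      using s[of "- \<alpha>"] assms by (intro ennreal_suminf_neq_top summable_mult summable_geometric) auto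
    moreover have "(\<Sum>n. ennreal ((4 * ?c * 2 ^ DIM('a)) * (2 powr (\<alpha> - 2)) ^ n)) \<noteq> top"
      using s[of "\<alpha> - 2"] assms by (intro ennreal_suminf_neq_top summable_mult summable_geometric) auto
    ultimately show ?thesis by (simp add: less_top)
  qed
  finally show ?thesis .
qed

text \<open>Scaling both variables by 1/e reduces to the unscaled kernel on the ball of radius R/e.
  The minimum changes by a factor of at most max 1 (e^2) and the denominator by e^p, whence
  b.\<close>

lemma scaled_kernel_loc:
  fixes c :: "'a::euclidean_space \<Rightarrow> 'a \<Rightarrow> real"
  assumes c [measurable]: "(\<lambda>p. c (fst p) (snd p)) \<in> borel_measurable (borel \<Otimes>\<^sub>M borel)" and c0: "\<And>x y. 0 \<le> c x y"
    and loc: "nn_L1_loc (\<lambda>x. \<integral>\<^sup>+z. ennreal (min 1 ((norm z)\<^sup>2) * (c x (x + z) / norm z powr p)) \<partial>lborel)"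
    and e: "0 < e"
  shows "(\<integral>\<^sup>+x. indicator (cball 0 R) x *
      (\<integral>\<^sup>+y. ennreal (min 1 ((dist x y)\<^sup>2) * (c (x /\<^sub>R e) (y /\<^sub>R e) / norm (x - y) powr p)) \<partial>lborel) \<partial>lborel) < \<infinity>"
proof -
  let ?\<Phi> = "\<lambda>x z. ennreal (min 1 ((norm z)\<^sup>2) * (c x (x + z) / norm z powr p))"
  let ?G = "\<lambda>x. \<integral>\<^sup>+z. ?\<Phi> x z \<partial>lborel"
  define b where "b = max 1 (e\<^sup>2) / e powr p"
  have b0: "0 \<le> b" by (simp add: b_def)
  have [measurable (raw)]: "(\<lambda>x. c (f x) (g x)) \<in> borel_measurable N" if "f \<in> N \<rightarrow>\<^sub>M borel" "g \<in> N \<rightarrow>\<^sub>M borel" for f g and N :: "'b measure"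
    using measurable_compose[OF measurable_Pair[OF that] c] by simp
  have [measurable (raw)]: "(\<lambda>x. c (f x) (g x)) \<in> borel_measurable N" if "f \<in> N \<rightarrow>\<^sub>M borel" "g \<in> N \<rightarrow>\<^sub>M borel" for f g and N :: "('a \<times> 'a) measure"
    using measurable_compose[OF measurable_Pair[OF that] c] by simp
  have Gm [measurable]: "?G \<in> borel_measurable borel"
    by (rule lborel.borel_measurable_nn_integral) measurable
  have pw: "ennreal (min 1 ((dist x y)\<^sup>2) * (c (x /\<^sub>R e) (y /\<^sub>R e) / norm (x - y) powr p)) \<le> ennreal b * ?\<Phi> (x /\<^sub>R e) (y /\<^sub>R e + - (x /\<^sub>R e))" for x y
  proof -
    let ?z = "y /\<^sub>R e + - (x /\<^sub>R e)"
    have z: "norm (x - y) = e * norm ?z"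
    proof -
      have "x - y = - (e *\<^sub>R ?z)" using e by (simp add: algebra_simps)
      then show ?thesis using e by simp
    qed
    have "min 1 ((e * norm ?z)\<^sup>2) \<le> max 1 (e\<^sup>2) * min 1 ((norm ?z)\<^sup>2)"
    proof (cases "(norm ?z)\<^sup>2 \<le> 1")
      case True
      have "(e * norm ?z)\<^sup>2 \<le> max 1 (e\<^sup>2) * (norm ?z)\<^sup>2" unfolding power_mult_distrib by (intro mult_right_mono) auto
      then show ?thesis using True by (simp add: min_absorb2 min.coboundedI2)
    next
      case False
      then have "min 1 ((norm ?z)\<^sup>2) = 1" by (simp add: min_def)
      then show ?thesis by (simp add: min.coboundedI1)
    qed
    then have "min 1 ((e * norm ?z)\<^sup>2) * (c (x /\<^sub>R e) (y /\<^sub>R e) / (e powr p * norm ?z powr p)) \<le>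
       (max 1 (e\<^sup>2) * min 1 ((norm ?z)\<^sup>2)) * (c (x /\<^sub>R e) (y /\<^sub>R e) / (e powr p * norm ?z powr p))"
      using c0 by (intro mult_right_mono) auto
    also have "\<dots> = b * (min 1 ((norm ?z)\<^sup>2) * (c (x /\<^sub>R e) (x /\<^sub>R e + ?z) / norm ?z powr p))"
      by (simp add: b_def)
    finally have "min 1 ((dist x y)\<^sup>2) * (c (x /\<^sub>R e) (y /\<^sub>R e) / norm (x - y) powr p) \<le> b * (min 1 ((norm ?z)\<^sup>2) * (c (x /\<^sub>R e) (x /\<^sub>R e + ?z) / norm ?z powr p))"
      unfolding dist_norm z using e by (simp add: powr_mult)
    then show ?thesis using b0 c0 by (subst ennreal_mult[symmetric]) (auto intro!: ennreal_leI)
  qed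
  have inner: "(\<integral>\<^sup>+y. ennreal (min 1 ((dist x y)\<^sup>2) * (c (x /\<^sub>R e) (y /\<^sub>R e) / norm (x - y) powr p)) \<partial>lborel) \<le> ennreal b * (ennreal (e ^ DIM('a)) * ?G (x /\<^sub>R e))" for x
  proof -
    have "(\<integral>\<^sup>+y. ennreal (min 1 ((dist x y)\<^sup>2) * (c (x /\<^sub>R e) (y /\<^sub>R e) / norm (x - y) powr p)) \<partial>lborel) \<le> (\<integral>\<^sup>+y. ennreal b * ?\<Phi> (x /\<^sub>R e) (y /\<^sub>R e + - (x /\<^sub>R e)) \<partial>lborel)"
      by (intro nn_integral_mono pw)
    also have "\<dots> = ennreal b * (\<integral>\<^sup>+y. ?\<Phi> (x /\<^sub>R e) (y /\<^sub>R e + - (x /\<^sub>R e)) \<partial>lborel)" by (rule nn_integral_cmult) measurable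
    also have "(\<integral>\<^sup>+y. ?\<Phi> (x /\<^sub>R e) (y /\<^sub>R e + - (x /\<^sub>R e)) \<partial>lborel) = ennreal (e ^ DIM('a)) * (\<integral>\<^sup>+y. ?\<Phi> (x /\<^sub>R e) (y + - (x /\<^sub>R e)) \<partial>lborel)"
      by (rule nn_integral_lborel_scale[of "\<lambda>y. ?\<Phi> (x /\<^sub>R e) (y + - (x /\<^sub>R e))", OF _ e]) measurable
    also have "(\<integral>\<^sup>+y. ?\<Phi> (x /\<^sub>R e) (y + - (x /\<^sub>R e)) \<partial>lborel) = ?G (x /\<^sub>R e)"
      by (rule nn_integral_lborel_shift[of "?\<Phi> (x /\<^sub>R e)"]) measurable
    finally show ?thesis .
  qed
  let ?I = "indicator (cball 0 (R / e)) :: 'a \<Rightarrow> ennreal"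
  have I: "indicator (cball 0 R) x = ?I (x /\<^sub>R e)" for x :: 'a
    using e by (simp add: indicator_def field_simps)
  have "(\<integral>\<^sup>+x. indicator (cball 0 R) x *
      (\<integral>\<^sup>+y. ennreal (min 1 ((dist x y)\<^sup>2) * (c (x /\<^sub>R e) (y /\<^sub>R e) / norm (x - y) powr p)) \<partial>lborel) \<partial>lborel) \<le>
     (\<integral>\<^sup>+x. ennreal b * (ennreal (e ^ DIM('a)) * (?I (x /\<^sub>R e) * ?G (x /\<^sub>R e))) \<partial>lborel)"
  proof (rule nn_integral_mono)
    fix x
    show "indicator (cball 0 R) x * (\<integral>\<^sup>+y. ennreal (min 1 ((dist x y)\<^sup>2) * (c (x /\<^sub>R e) (y /\<^sub>R e) / norm (x - y) powr p)) \<partial>lborel) \<le>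
      ennreal b * (ennreal (e ^ DIM('a)) * (?I (x /\<^sub>R e) * ?G (x /\<^sub>R e)))"
      using mult_left_mono[OF inner[of x], of "?I (x /\<^sub>R e)"] unfolding I by (simp only: mult_ac zero_le)
  qed
  also have "\<dots> = ennreal b * (ennreal (e ^ DIM('a)) * (ennreal (e ^ DIM('a)) * (\<integral>\<^sup>+x. ?I x * ?G x \<partial>lborel)))"
    by (subst nn_integral_cmult, measurable, subst nn_integral_cmult, measurable,
        subst nn_integral_lborel_scale[of "\<lambda>x. ?I x * ?G x", OF _ e], measurable)
  also have "\<dots> < \<infinity>"
  proof -
    have "(\<integral>\<^sup>+x. ?I x * ?G x \<partial>lborel) < \<infinity>"
      using loc[unfolded nn_L1_loc_def, rule_format, OF compact_cball, of 0 "R / e"] by (simp add: mult.commute)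
    then show ?thesis by (simp add: ennreal_mult_less_top)
  qed
  finally show ?thesis .
qed

lemma env_sym_space:
  fixes \<kappa> :: "'a::euclidean_space \<Rightarrow> 'a \<Rightarrow> 'w \<Rightarrow> real"
  assumes \<rho> [measurable]: "\<rho> \<in> borel_measurable borel" and pos: "AE x in lborel. 0 < \<rho> x"
    and fin: "\<And>R. (\<integral>\<^sup>+x. indicator (cball 0 R) x * ennreal (\<rho> x) \<partial>lborel) < \<infinity>"
    and \<kappa> [measurable]: "(\<lambda>p. \<kappa> (fst p) (snd p) \<omega>) \<in> borel_measurable (borel \<Otimes>\<^sub>M borel)"
    and nn: "\<And>x y. 0 \<le> \<kappa> x y \<omega>" and sym: "\<And>x y. \<kappa> x y \<omega> = \<kappa> y x \<omega>"
    and loc: "nn_L1_loc (\<lambda>x. \<integral>\<^sup>+z. ennreal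
         (min 1 ((norm z)\<^sup>2) * (\<kappa> x (x + z) \<omega> / norm z powr (real DIM('a) + \<alpha>))) \<partial>lborel)"
    and \<Gamma>: "open \<Gamma>" "\<And>x r. x \<in> \<Gamma> \<Longrightarrow> r \<noteq> 0 \<Longrightarrow> r *\<^sub>R x \<in> \<Gamma>" and e: "0 < e"
  shows "sym_space (env_kernel \<alpha> \<Gamma> \<kappa> e \<omega>) (density lborel (\<lambda>x. ennreal (\<rho> x)))"
proof
  have [measurable]: "\<Gamma> \<in> sets borel" using \<Gamma>(1) by simp
  have [measurable (raw)]: "(\<lambda>x. \<kappa> (f x) (g x) \<omega>) \<in> borel_measurable N"
    if "f \<in> N \<rightarrow>\<^sub>M borel" "g \<in> N \<rightarrow>\<^sub>M borel" for f g and N :: "('a \<times> 'a) measure"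
    using measurable_compose[OF measurable_Pair[OF that] \<kappa>] by simp
  show "case_prod (env_kernel \<alpha> \<Gamma> \<kappa> e \<omega>) \<in> borel_measurable (borel \<Otimes>\<^sub>M borel)"
    unfolding env_kernel_def case_prod_beta' by measurable
  show "0 \<le> env_kernel \<alpha> \<Gamma> \<kappa> e \<omega> x y" for x y
    using nn by (simp add: env_kernel_def)
  have "x - y \<in> \<Gamma> \<longleftrightarrow> y - x \<in> \<Gamma>" for x y
    using \<Gamma>(2)[of "x - y" "-1"] \<Gamma>(2)[of "y - x" "-1"] by auto
  then show "env_kernel \<alpha> \<Gamma> \<kappa> e \<omega> x y = env_kernel \<alpha> \<Gamma> \<kappa> e \<omega> y x" for x y
    by (simp add: env_kernel_def sym[of "x /\<^sub>R e" "y /\<^sub>R e"] norm_minus_commute[of x y] indicator_def)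
  show "(\<integral>\<^sup>+x. indicator (cball 0 R) x * (\<integral>\<^sup>+y. ennreal (min 1 ((dist x y)\<^sup>2) * env_kernel \<alpha> \<Gamma> \<kappa> e \<omega> x y) \<partial>lborel) \<partial>lborel) < \<infinity>" for R
  proof (rule le_less_trans[OF _ scaled_kernel_loc[OF \<kappa> nn loc e, of R]], intro nn_integral_mono mult_left_mono ennreal_leI)
    show "env_kernel \<alpha> \<Gamma> \<kappa> e \<omega> x y \<le> \<kappa> (x /\<^sub>R e) (y /\<^sub>R e) \<omega> / norm (x - y) powr (real DIM('a) + \<alpha>)" for x y
      using nn by (simp add: env_kernel_def indicator_def)
  qed auto
  show "sets (density lborel (\<lambda>x. ennreal (\<rho> x))) = sets borel" by simp
  \<comment> \<open>Strict positivity of the density almost everywhere makes its null sets Lebesgue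
    null.\<close>
  show "N \<in> null_sets lborel" if "N \<in> null_sets (density lborel (\<lambda>x. ennreal (\<rho> x)))" for N
  proof -
    from that have N: "N \<in> sets lborel" "AE x in lborel. x \<in> N \<longrightarrow> ennreal (\<rho> x) = 0"
      by (auto simp: null_sets_density_iff)
    from N(2) pos have "AE x in lborel. x \<notin> N" by eventually_elim (auto simp: ennreal_eq_0_iff)
    then show ?thesis using N(1) by (simp add: AE_iff_null_sets)
  qed
  show "emeasure (density lborel (\<lambda>x. ennreal (\<rho> x))) (cball 0 R) < \<infinity>" for R
    using fin[of R] by (subst emeasure_density) (auto simp: mult.commute)
qed

text \<open>Diagonal pairs have difference 0, which \<eta> > 0 excludes from the band, so
  integrating over all pairs or off the diagonal is the same.\<close>

lemma L2_inner_restr_band: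
  assumes "jump_kernel J" and [measurable]: "f \<in> borel_measurable borel" "g \<in> borel_measurable borel"
    and J: "\<And>x y. J x y = c x y * indicator \<Gamma> (x - y)" and \<eta>: "0 < \<eta>"
  shows "L2_inner (jm (restr J (band \<eta>))) (dif f) (dif g) = 1 / 2 *
    (LINT (x, y)|(lborel \<Otimes>\<^sub>M lborel). (f x - f y) * (g x - g y) * c x y
      * indicator {z \<in> \<Gamma>. \<eta> < norm z \<and> norm z < 1 / \<eta>} (x - y))"
proof -
  interpret J: jump_kernel J by fact
  interpret R: jump_kernel "restr J (band \<eta>)" by (rule J.restr_kernel) measurable
  show ?thesis
    unfolding R.jump_form_jm[OF assms(2,3), symmetric] jump_form_def set_lebesgue_integral_def case_prod_beta'
    using \<eta> by (intro arg_cong[where f="\<lambda>t. 1 / 2 * t"] Bochner_Integration.integral_cong)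
      (auto simp: restr_def band_def J indicator_def)
qed

theorem theorem2p2:
  fixes M :: "'w measure"
    and \<tau> :: "'a::euclidean_space \<Rightarrow> 'w \<Rightarrow> 'w"
    and \<mu> :: "'w \<Rightarrow> real"
    and \<kappa> :: "'a \<Rightarrow> 'a \<Rightarrow> 'w \<Rightarrow> real"
    and \<Gamma> :: "'a set"
    and K :: "'a \<Rightarrow> real"
    and \<Omega>\<^sub>0 :: "'w set"
    and \<alpha> C\<^sub>1 C\<^sub>2 :: real
  assumes environment: "ergodic_environment M \<tau>"
    and alpha: "0 < \<alpha>" "\<alpha> < 2"
    and mu_measurable: "\<mu> \<in> borel_measurable M"
    and mu_nonneg: "\<And>\<omega>. \<omega> \<in> space M \<Longrightarrow> 0 \<le> \<mu> \<omega>"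
    and mu_mean: "integrable M \<mu>" "(LINT \<omega>|M. \<mu> \<omega>) = 1"
    and mu_pos: "\<And>\<omega>. \<omega> \<in> space M \<Longrightarrow> AE x in lborel. 0 < \<mu> (\<tau> x \<omega>)"
    and kappa_measurable:
      "(\<lambda>(x, y, \<omega>). \<kappa> x y \<omega>) \<in> borel_measurable (borel \<Otimes>\<^sub>M borel \<Otimes>\<^sub>M M)"
    and kappa_nonneg: "\<And>\<omega> x y. \<omega> \<in> space M \<Longrightarrow> 0 \<le> \<kappa> x y \<omega>"
    and kappa_sym: "\<And>\<omega> x y. \<omega> \<in> space M \<Longrightarrow> \<kappa> x y \<omega> = \<kappa> y x \<omega>"
    and kappa_shift: "\<And>\<omega> x y z. \<omega> \<in> space M \<Longrightarrow> \<kappa> (x + z) (y + z) \<omega> = \<kappa> x y (\<tau> z \<omega>)"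
    and kappa_L1_loc:
      "AE \<omega> in M. nn_L1_loc (\<lambda>x. \<integral>\<^sup>+z. ennreal
         (min 1 ((norm z)\<^sup>2) * (\<kappa> x (x + z) \<omega> / norm z powr (real DIM('a) + \<alpha>))) \<partial>lborel)"
    and cone: "\<Gamma> \<noteq> {}" "open \<Gamma>" "\<And>x r. x \<in> \<Gamma> \<Longrightarrow> r \<noteq> 0 \<Longrightarrow> r *\<^sub>R x \<in> \<Gamma>"
    and mu_moment: "\<exists>p>1. integrable M (\<lambda>\<omega>. \<mu> \<omega> powr p)"
    and K_measurable: "K \<in> borel_measurable borel"
    and K_even: "\<And>z. K (- z) = K z"
    and K_bounds: "0 < C\<^sub>1" "0 < C\<^sub>2" "\<And>z. C\<^sub>1 \<le> K z" "\<And>z. K z \<le> C\<^sub>2"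
    and full: "\<Omega>\<^sub>0 \<in> sets M" "measure M \<Omega>\<^sub>0 = 1"
    and cond_i:
      "\<And>\<omega> (f :: real \<Rightarrow> 'a \<Rightarrow> real) (e :: nat \<Rightarrow> real).
        \<omega> \<in> \<Omega>\<^sub>0 \<Longrightarrow>
        (\<And>\<epsilon>. \<epsilon> \<in> {0<..1} \<Longrightarrow> f \<epsilon> \<in> env_domain \<alpha> \<Gamma> \<tau> \<mu> \<kappa> \<epsilon> \<omega>) \<Longrightarrow>
        Limsup (at_right 0) (\<lambda>\<epsilon>. esssup lborel (\<lambda>x. ennreal \<bar>f \<epsilon> x\<bar>)
          + jump_energy (env_kernel \<alpha> \<Gamma> \<kappa> \<epsilon> \<omega>) (f \<epsilon>)) < \<infinity> \<Longrightarrow>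
        (\<And>n. e n \<in> {0<..1}) \<Longrightarrow> e \<longlonglongrightarrow> 0 \<Longrightarrow>
        \<exists>k h. strict_mono (k :: nat \<Rightarrow> nat) \<and> h \<in> L1_loc \<and>
          (\<forall>r>1. tendsto_L1 (ball 0 r) (\<lambda>n. f (e (k n))) h sequentially)"
    and cond_ii_small:
      "\<And>\<omega> g. \<omega> \<in> \<Omega>\<^sub>0 \<Longrightarrow> g \<in> Cc_infinity \<Longrightarrow>
        ((\<lambda>\<eta>. Limsup (at_right 0) (\<lambda>\<epsilon>.
            \<integral>\<^sup>+(x, y)\<in>(- Id). ennreal ((g x - g y)\<^sup>2
              * (\<kappa> (x /\<^sub>R \<epsilon>) (y /\<^sub>R \<epsilon>) \<omega> / norm (x - y) powr (real DIM('a) + \<alpha>))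
              * indicator {z. norm z \<le> \<eta>} (x - y)) \<partial>(lborel \<Otimes>\<^sub>M lborel)))
          \<longlongrightarrow> 0) (at_right 0)"
    and cond_ii_large:
      "\<And>\<omega> g. \<omega> \<in> \<Omega>\<^sub>0 \<Longrightarrow> g \<in> Cc_infinity \<Longrightarrow>
        ((\<lambda>\<eta>. Limsup (at_right 0) (\<lambda>\<epsilon>.
            \<integral>\<^sup>+(x, y). ennreal ((g x - g y)\<^sup>2
              * (\<kappa> (x /\<^sub>R \<epsilon>) (y /\<^sub>R \<epsilon>) \<omega> / norm (x - y) powr (real DIM('a) + \<alpha>))
              * indicator {z. 1 / \<eta> \<le> norm z} (x - y)) \<partial>(lborel \<Otimes>\<^sub>M lborel)))
          \<longlongrightarrow> 0) (at_right 0)"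
    and cond_iii:
      "\<And>\<omega>. \<omega> \<in> \<Omega>\<^sub>0 \<Longrightarrow>
        \<exists>p>1. \<forall>R\<ge>1. Limsup (at_right 0) (\<lambda>\<epsilon>.
          \<integral>\<^sup>+x\<in>ball 0 R. ennreal_powr
            (\<integral>\<^sup>+y\<in>ball 0 R. ennreal (\<kappa> (x /\<^sub>R \<epsilon>) (y /\<^sub>R \<epsilon>) \<omega>) \<partial>lborel) p \<partial>lborel) < \<infinity>"
    and cond_iv:
      "\<And>\<omega> \<eta> f g. \<omega> \<in> \<Omega>\<^sub>0 \<Longrightarrow> 0 < \<eta> \<Longrightarrow>
        f \<in> borel_measurable borel \<Longrightarrow> bounded (range f) \<Longrightarrow> g \<in> Cc_infinity \<Longrightarrow>
        ((\<lambda>\<epsilon>. LINT (x, y)|(lborel \<Otimes>\<^sub>M lborel). (f x - f y) * (g x - g y)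
            * (\<kappa> (x /\<^sub>R \<epsilon>) (y /\<^sub>R \<epsilon>) \<omega> / norm (x - y) powr (real DIM('a) + \<alpha>))
            * indicator {z \<in> \<Gamma>. \<eta> < norm z \<and> norm z < 1 / \<eta>} (x - y))
          \<longlongrightarrow> (LINT (x, y)|(lborel \<Otimes>\<^sub>M lborel). (f x - f y) * (g x - g y)
            * (K (x - y) / norm (x - y) powr (real DIM('a) + \<alpha>))
            * indicator {z \<in> \<Gamma>. \<eta> < norm z \<and> norm z < 1 / \<eta>} (x - y)))
          (at_right 0)"
  shows
    "\<exists>\<Omega>\<^sub>2. \<Omega>\<^sub>2 \<in> sets M \<and> measure M \<Omega>\<^sub>2 = 1 \<and>
      (\<forall>\<omega>\<in>\<Omega>\<^sub>2. \<forall>l>0. \<forall>f\<in>Cc.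
        (\<forall>r>1. tendsto_L1 (ball 0 r)
          (\<lambda>\<epsilon>. env_resolvent \<alpha> \<Gamma> \<tau> \<mu> \<kappa> \<epsilon> \<omega> l f) (limit_resolvent \<alpha> \<Gamma> K l f) (at_right 0)) \<and>
        (\<forall>g\<in>Cc.
          ((\<lambda>\<epsilon>. L2_inner (env_measure \<tau> \<mu> \<epsilon> \<omega>) (env_resolvent \<alpha> \<Gamma> \<tau> \<mu> \<kappa> \<epsilon> \<omega> l f) g)
            \<longlongrightarrow> L2_inner lborel (limit_resolvent \<alpha> \<Gamma> K l f) g) (at_right 0)) \<and>
        (\<forall>g\<in>Cc_infinity.
          ((\<lambda>\<epsilon>. env_form \<alpha> \<Gamma> \<kappa> \<epsilon> \<omega> (env_resolvent \<alpha> \<Gamma> \<tau> \<mu> \<kappa> \<epsilon> \<omega> l f) g)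
            \<longlongrightarrow> limit_form \<alpha> \<Gamma> K (limit_resolvent \<alpha> \<Gamma> K l f) g) (at_right 0)))"
proof -
  interpret ergodic_environment M \<tau> by (rule environment)
  let ?p = "real DIM('a) + \<alpha>"
  \<comment> \<open>The limit kernel depends on x - y only, which is the translation invariance that
    the uniqueness argument exploits.\<close>
  define k where "k z = K z / norm z powr ?p * indicator \<Gamma> z" for z
  have k: "limit_kernel \<alpha> \<Gamma> K = (\<lambda>x y. k (x - y))" by (simp add: limit_kernel_def k_def fun_eq_iff)
  have \<Gamma>m [measurable]: "\<Gamma> \<in> sets borel" using cone(2) by simp
  have K0: "0 \<le> K z" for z using K_bounds(1,3) less_le_trans by (metis less_imp_le)
  interpret lim_kernel k
  proof
    show "k \<in> borel_measurable borel" unfolding k_def[abs_def] using K_measurable by measurable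
    show "0 \<le> k z" for z using K0 by (simp add: k_def)
    show "k (- z) = k z" for z
      using cone(3)[of z "-1"] cone(3)[of "- z" "-1"] by (auto simp: k_def K_even indicator_def)
    have "(\<integral>\<^sup>+z. ennreal (min 1 ((norm z)\<^sup>2) * k z) \<partial>lborel) \<le>
        (\<integral>\<^sup>+z. ennreal C\<^sub>2 * ennreal (min 1 ((norm z)\<^sup>2) * (1 / norm z powr ?p)) \<partial>(lborel :: 'a measure))"
    proof (rule nn_integral_mono)
      fix z :: 'a
      have "k z \<le> C\<^sub>2 * (1 / norm z powr ?p)"
        using K0[of z] K_bounds(2) K_bounds(4)[of z] by (auto simp: k_def indicator_def intro!: divide_right_mono)
      then have "min 1 ((norm z)\<^sup>2) * k z \<le> min 1 ((norm z)\<^sup>2) * (C\<^sub>2 * (1 / norm z powr ?p))"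
        by (rule mult_left_mono) simp
      then show "ennreal (min 1 ((norm z)\<^sup>2) * k z) \<le> ennreal C\<^sub>2 * ennreal (min 1 ((norm z)\<^sup>2) * (1 / norm z powr ?p))"
        using K_bounds(2) by (subst ennreal_mult[symmetric]) (auto intro!: ennreal_leI simp: mult_ac)
    qed
    also have "\<dots> = ennreal C\<^sub>2 * (\<integral>\<^sup>+z. ennreal (min 1 ((norm z)\<^sup>2) * (1 / norm z powr ?p)) \<partial>(lborel :: 'a measure))"
      by (rule nn_integral_cmult) measurable
    also have "\<dots> < \<infinity>" using levy_integral_finite[OF alpha, where 'a='a] by (simp add: ennreal_mult_less_top)
    finally show "(\<integral>\<^sup>+z. ennreal (min 1 ((norm z)\<^sup>2) * k z) \<partial>lborel) < \<infinity>" .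
  qed
  let ?averages = "\<lambda>\<omega>. ui_density (\<lambda>e x. \<mu> (\<tau> (x /\<^sub>R e) \<omega>)) \<and>
    (\<forall>u B R. u \<in> borel_measurable borel \<longrightarrow> (\<forall>x. \<bar>u x\<bar> \<le> B) \<longrightarrow> (\<forall>x. R < norm x \<longrightarrow> u x = 0) \<longrightarrow>
      ui_density.wl (\<lambda>e x. \<mu> (\<tau> (x /\<^sub>R e) \<omega>)) 1 u)"
  define good where "good \<omega> \<longleftrightarrow> \<omega> \<in> \<Omega>\<^sub>0 \<and>
    nn_L1_loc (\<lambda>x. \<integral>\<^sup>+z. ennreal (min 1 ((norm z)\<^sup>2) * (\<kappa> x (x + z) \<omega> / norm z powr ?p)) \<partial>lborel) \<and>
    ?averages \<omega>" for \<omega>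
  have "AE \<omega> in M. ?averages \<omega>"
    by (rule ergodic_density[OF mu_mean(1), unfolded mu_mean(2), OF mu_nonneg])
  moreover have "AE \<omega> in M. \<omega> \<in> \<Omega>\<^sub>0" using AE_prob_1[of \<Omega>\<^sub>0] full by simp
  ultimately have "AE \<omega> in M. good \<omega>"
    using kappa_L1_loc unfolding good_def by eventually_elim blast
  \<comment> \<open>The set of good environments need not be measurable, so its role is taken by the
    complement of a measurable null set containing all bad ones.\<close>
  then obtain N where N: "{\<omega> \<in> space M. \<not> good \<omega>} \<subseteq> N" "N \<in> null_sets M"
    unfolding eventually_ae_filter by blast
  show ?thesis
  proof (intro exI[of _ "space M - N"] conjI ballI)
    show "space M - N \<in> events" using N(2) by auto
    show "prob (space M - N) = 1"
      using N(2) measure_eq_0_null_sets[OF N(2)] by (subst prob_compl) auto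
    fix \<omega> assume "\<omega> \<in> space M - N"
    then have \<omega>: "\<omega> \<in> space M" and good: "good \<omega>" using N(1) by auto
    have \<omega>0: "\<omega> \<in> \<Omega>\<^sub>0" using good by (simp add: good_def)
    let ?J = "\<lambda>e. env_kernel \<alpha> \<Gamma> \<kappa> e \<omega>" and ?c = "\<lambda>e x y. \<kappa> (x /\<^sub>R e) (y /\<^sub>R e) \<omega> / norm (x - y) powr ?p"
    have \<kappa>m [measurable]: "(\<lambda>p. \<kappa> (fst p) (snd p) \<omega>) \<in> borel_measurable (borel \<Otimes>\<^sub>M borel)"
    proof -
      have "(\<lambda>p. (fst p, snd p, \<omega>)) \<in> (borel \<Otimes>\<^sub>M borel :: ('a \<times> 'a) measure) \<rightarrow>\<^sub>M borel \<Otimes>\<^sub>M borel \<Otimes>\<^sub>M M"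
        using \<omega> by measurable
      from measurable_compose[OF this kappa_measurable] show ?thesis by simp
    qed
    have [measurable (raw)]: "(\<lambda>x. \<kappa> (f x) (g x) \<omega>) \<in> borel_measurable N"
      if "f \<in> N \<rightarrow>\<^sub>M borel" "g \<in> N \<rightarrow>\<^sub>M borel" for f g and N :: "('a \<times> 'a) measure"
      using measurable_compose[OF measurable_Pair[OF that] \<kappa>m] by simp
    interpret ui_density "\<lambda>e x. \<mu> (\<tau> (x /\<^sub>R e) \<omega>)" using good by (simp add: good_def)
    have J: "sym_space (?J e) (density lborel (\<lambda>x. ennreal (\<mu> (\<tau> (x /\<^sub>R e) \<omega>))))" if e: "0 < e" for e
    proof (rule env_sym_space)
      \<comment> \<open>Positivity is assumed for the unscaled path; dilations preserve null
        sets.\<close>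
      show "AE x in lborel. 0 < \<mu> (\<tau> (x /\<^sub>R e) \<omega>)" by (rule AE_lborel_scale[OF mu_pos[OF \<omega>] e])
      show "nn_L1_loc (\<lambda>x. \<integral>\<^sup>+z. ennreal (min 1 ((norm z)\<^sup>2) * (\<kappa> x (x + z) \<omega> / norm z powr ?p)) \<partial>lborel)"
        using good by (simp add: good_def)
    qed (assumption | rule rho_measurable rho_fin[OF e] \<kappa>m kappa_nonneg[OF \<omega>] kappa_sym[OF \<omega>] cone(2,3) e)+
    have Jc: "?J e x y = ?c e x y * indicator \<Gamma> (x - y)" for e x y by (simp add: env_kernel_def)
    \<comment> \<open>Beyond distance \<eta> the denominator is at least \<eta>^(d + \<alpha>),
      which explains the last parameter.\<close>
    interpret hom_path k "\<lambda>e x. \<mu> (\<tau> (x /\<^sub>R e) \<omega>)" ?J "\<lambda>e x y. \<kappa> (x /\<^sub>R e) (y /\<^sub>R e) \<omega>" "\<lambda>\<eta>. 1 / \<eta> powr ?p"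
    proof (intro hom_path.intro hom_path_axioms.intro lim_kernel_axioms ui_density_axioms)
      show "sym_space (?J e) (density lborel (\<lambda>x. ennreal (\<mu> (\<tau> (x /\<^sub>R e) \<omega>))))" if "0 < e" for e by (rule J[OF that])
      show "wl 1 u" if "u \<in> borel_measurable borel" "\<And>x. \<bar>u x\<bar> \<le> B" "\<And>x. R < norm x \<Longrightarrow> u x = 0" for u B R
        using good that unfolding good_def by blast
      show "(\<lambda>p. \<kappa> (fst p /\<^sub>R e) (snd p /\<^sub>R e) \<omega>) \<in> borel_measurable (borel \<Otimes>\<^sub>M borel)" for e by measurable
      show "0 \<le> \<kappa> (x /\<^sub>R e) (y /\<^sub>R e) \<omega>" "\<kappa> (x /\<^sub>R e) (y /\<^sub>R e) \<omega> = \<kappa> (y /\<^sub>R e) (x /\<^sub>R e) \<omega>" for e x y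
        by (rule kappa_nonneg[OF \<omega>], rule kappa_sym[OF \<omega>])
      show "?J e x y \<le> 1 / \<eta> powr ?p * \<kappa> (x /\<^sub>R e) (y /\<^sub>R e) \<omega>" if \<eta>: "0 < \<eta>" "\<eta> < norm (x - y)" for \<eta> e x y
      proof -
        have "?J e x y \<le> ?c e x y" using kappa_nonneg[OF \<omega>] by (simp add: Jc indicator_def)
        also have "\<dots> \<le> \<kappa> (x /\<^sub>R e) (y /\<^sub>R e) \<omega> / \<eta> powr ?p"
          using \<eta> alpha kappa_nonneg[OF \<omega>] by (intro frac_le powr_mono2) auto
        finally show ?thesis by simp
      qed
      show "0 \<le> 1 / \<eta> powr ?p" for \<eta> :: real by simp
      show "\<exists>r h. strict_mono (r :: nat \<Rightarrow> nat) \<and> h \<in> L1_loc \<and> (\<forall>s>1. tendsto_L1 (ball 0 s) (\<lambda>n. f (e (r n))) h sequentially)"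
        if "\<And>\<epsilon>. \<epsilon> \<in> {0<..1} \<Longrightarrow> f \<epsilon> \<in> jump_domain (density lborel (\<lambda>x. ennreal (\<mu> (\<tau> (x /\<^sub>R \<epsilon>) \<omega>)))) (?J \<epsilon>)"
          "Limsup (at_right 0) (\<lambda>\<epsilon>. esssup lborel (\<lambda>x. ennreal \<bar>f \<epsilon> x\<bar>) + jump_energy (?J \<epsilon>) (f \<epsilon>)) < \<infinity>"
          "\<And>n. e n \<in> {0<..1}" "e \<longlonglongrightarrow> 0" for f e
        by (rule cond_i[OF \<omega>0 _ that(2-4)]) (use that(1) in \<open>simp add: env_domain_def env_measure_def\<close>)
      show "\<forall>\<^sub>F \<eta> in at_right 0. \<forall>\<^sub>F e in at_right 0. (\<integral>\<^sup>+p. ennreal ((dif g p)\<^sup>2) \<partial>jm (restr (?J e) (- band \<eta>))) \<le> ennreal \<delta>"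
        if g: "g \<in> Cc_infinity" and \<delta>: "0 < \<delta>" for g \<delta>
      proof -
        have [measurable]: "g \<in> borel_measurable borel"
          using g Cc_infinity_sub_Cc_1 Cc_1_sub_Cc Cc_measurable by blast
        \<comment> \<open>The complement of the band consists of short and long increments, the two
          parts of (ii). The integrals there carry no cone indicator and therefore dominate those
          over the cone.\<close>
        let ?near = "\<lambda>\<eta> e. \<integral>\<^sup>+(x, y)\<in>(- Id). ennreal ((g x - g y)\<^sup>2 * ?c e x y * indicator {z. norm z \<le> \<eta>} (x - y)) \<partial>(lborel \<Otimes>\<^sub>M lborel)"
        let ?far = "\<lambda>\<eta> e. \<integral>\<^sup>+(x, y). ennreal ((g x - g y)\<^sup>2 * ?c e x y * indicator {z. 1 / \<eta> \<le> norm z} (x - y)) \<partial>(lborel \<Otimes>\<^sub>M lborel)"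
        have "\<forall>\<^sub>F \<eta> in at_right 0. Limsup (at_right 0) (?near \<eta>) < ennreal \<delta>"
          using order_tendstoD(2)[OF cond_ii_small[OF \<omega>0 g], of "ennreal \<delta>"] \<delta> by simp
        moreover have "\<forall>\<^sub>F \<eta> in at_right 0. Limsup (at_right 0) (?far \<eta>) < ennreal \<delta>"
          using order_tendstoD(2)[OF cond_ii_large[OF \<omega>0 g], of "ennreal \<delta>"] \<delta> by simp
        ultimately show ?thesis
        proof eventually_elim
          case (elim \<eta>)
          have "\<forall>\<^sub>F e::real in at_right 0. 0 < e" by (simp add: eventually_at_right_less)
          with Limsup_lessD[OF elim(1)] Limsup_lessD[OF elim(2)] show ?case
          proof eventually_elim
            case (elim e)
            interpret S: sym_space "?J e" "density lborel (\<lambda>x. ennreal (\<mu> (\<tau> (x /\<^sub>R e) \<omega>)))" by (rule J[OF elim(3)])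
            interpret R: jump_kernel "restr (?J e) (- band \<eta>)" by (rule S.restr_kernel) measurable
            let ?n = "\<lambda>p. ennreal ((g (fst p) - g (snd p))\<^sup>2 * ?c e (fst p) (snd p) * indicator {z. norm z \<le> \<eta>} (fst p - snd p)) * indicator (- Id) p"
            let ?f = "\<lambda>p. ennreal ((g (fst p) - g (snd p))\<^sup>2 * ?c e (fst p) (snd p) * indicator {z. 1 / \<eta> \<le> norm z} (fst p - snd p))"
            have "(\<integral>\<^sup>+p. ennreal ((dif g p)\<^sup>2) \<partial>jm (restr (?J e) (- band \<eta>))) =
                ennreal (1 / 2) * (\<integral>\<^sup>+p. ennreal ((dif g p)\<^sup>2 * restr (?J e) (- band \<eta>) (fst p) (snd p)) * indicator (- Id) p \<partial>lborel2)"
              by (rule R.nn_integral_jm) measurable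
            also have "\<dots> \<le> ennreal (1 / 2) * (\<integral>\<^sup>+p. ?n p + ?f p \<partial>lborel2)"
            proof (intro mult_left_mono nn_integral_mono)
              show "ennreal ((dif g p)\<^sup>2 * restr (?J e) (- band \<eta>) (fst p) (snd p)) * indicator (- Id) p \<le> ?n p + ?f p" for p
                by (cases "fst p - snd p \<in> \<Gamma>")
                  (auto simp: restr_def band_def Jc dif_def indicator_def not_less)
            qed simp
            also have "(\<integral>\<^sup>+p. ?n p + ?f p \<partial>lborel2) = ?near \<eta> e + ?far \<eta> e"
              unfolding case_prod_beta' by (rule nn_integral_add) measurable
            \<comment> \<open>The factor 1/2 in the jump measure absorbs the sum of two bounds
              \<delta>.\<close>
            also have "ennreal (1 / 2) * (?near \<eta> e + ?far \<eta> e) \<le> ennreal (1 / 2) * (ennreal \<delta> + ennreal \<delta>)"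
              using elim(1,2) by (intro mult_left_mono add_mono) auto
            also have "\<dots> = ennreal (1 / 2 * (\<delta> + \<delta>))"
              using \<delta> by (subst ennreal_mult, simp, simp, subst ennreal_plus) auto
            also have "1 / 2 * (\<delta> + \<delta>) = \<delta>" by simp
            finally show ?case .
          qed
        qed
      qed
      show "\<exists>p>1. \<forall>R\<ge>1. \<exists>C. \<forall>\<^sub>F e in at_right 0. (\<integral>\<^sup>+x\<in>ball 0 R. ennreal_powr
          (\<integral>\<^sup>+y\<in>ball 0 R. ennreal (\<kappa> (x /\<^sub>R e) (y /\<^sub>R e) \<omega>) \<partial>lborel) p \<partial>lborel) \<le> ennreal C"
      proof -
        \<comment> \<open>A finite upper limit of extended reals gives an eventual real bound; L + 1
          makes the comparison strict.\<close>
        have bound: "\<exists>C. \<forall>\<^sub>F e in at_right 0. F e \<le> ennreal C" if "Limsup (at_right 0) F < \<infinity>" for F :: "real \<Rightarrow> ennreal"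
        proof -
          from that obtain L where L: "Limsup (at_right 0) F = ennreal L" "0 \<le> L"
            by (cases "Limsup (at_right 0) F") auto
          then have "Limsup (at_right 0) F < ennreal (L + 1)" by (simp add: ennreal_lessI)
          from Limsup_lessD[OF this] have "\<forall>\<^sub>F e in at_right 0. F e \<le> ennreal (L + 1)"
            by eventually_elim simp
          then show ?thesis by blast
        qed
        obtain p where p: "1 < p" "\<forall>R\<ge>1. Limsup (at_right 0) (\<lambda>\<epsilon>. \<integral>\<^sup>+x\<in>ball 0 R. ennreal_powr
            (\<integral>\<^sup>+y\<in>ball 0 R. ennreal (\<kappa> (x /\<^sub>R \<epsilon>) (y /\<^sub>R \<epsilon>) \<omega>) \<partial>lborel) p \<partial>lborel) < \<infinity>"
          using cond_iii[OF \<omega>0] by (elim exE conjE)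
        show ?thesis
        proof (rule exI[of _ p], intro conjI allI impI)
          fix R :: real assume "1 \<le> R"
          show "\<exists>C. \<forall>\<^sub>F e in at_right 0. (\<integral>\<^sup>+x\<in>ball 0 R. ennreal_powr
              (\<integral>\<^sup>+y\<in>ball 0 R. ennreal (\<kappa> (x /\<^sub>R e) (y /\<^sub>R e) \<omega>) \<partial>lborel) p \<partial>lborel) \<le> ennreal C"
            by (rule bound[OF p(2)[rule_format, OF \<open>1 \<le> R\<close>]])
        qed (rule p(1))
      qed
      show "((\<lambda>e. L2_inner (jm (restr (?J e) (band \<eta>))) (dif f) (dif g)) \<longlongrightarrow>
          L2_inner (jm (restr (\<lambda>x y. k (x - y)) (band \<eta>))) (dif f) (dif g)) (at_right 0)"
        if \<eta>: "0 < \<eta>" and f: "f \<in> borel_measurable borel" "bounded (range f)" and g: "g \<in> Cc_infinity" for \<eta> f g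
      proof -
        have gm: "g \<in> borel_measurable borel"
          using g Cc_infinity_sub_Cc_1 Cc_1_sub_Cc Cc_measurable by blast
        let ?I = "\<lambda>c. LINT (x, y)|(lborel \<Otimes>\<^sub>M lborel). (f x - f y) * (g x - g y) * c x y
            * indicator {z \<in> \<Gamma>. \<eta> < norm z \<and> norm z < 1 / \<eta>} (x - y)"
        have "((\<lambda>e. 1 / 2 * ?I (?c e)) \<longlongrightarrow> 1 / 2 * ?I (\<lambda>x y. K (x - y) / norm (x - y) powr ?p)) (at_right 0)"
          by (rule tendsto_mult_left[OF cond_iv[OF \<omega>0 \<eta> f g]])
        moreover have "\<forall>\<^sub>F e in at_right 0. 1 / 2 * ?I (?c e) = L2_inner (jm (restr (?J e) (band \<eta>))) (dif f) (dif g)"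
          using eventually_at_right_less[of 0]
        proof eventually_elim
          case (elim e)
          interpret S: sym_space "?J e" "density lborel (\<lambda>x. ennreal (\<mu> (\<tau> (x /\<^sub>R e) \<omega>)))" by (rule J[OF elim])
          show ?case
            by (rule L2_inner_restr_band[OF S.jump_kernel_axioms f(1) gm Jc \<eta>, symmetric])
        qed
        moreover have "1 / 2 * ?I (\<lambda>x y. K (x - y) / norm (x - y) powr ?p) = L2_inner (jm (restr (\<lambda>x y. k (x - y)) (band \<eta>))) (dif f) (dif g)"
          by (rule L2_inner_restr_band[OF jump_kernel_axioms f(1) gm _ \<eta>, symmetric]) (simp add: k_def)
        ultimately show ?thesis using Lim_transform_eventually by fastforce
      qed
    qed
    show "\<forall>l>0. \<forall>f\<in>Cc.
        (\<forall>r>1. tendsto_L1 (ball 0 r)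
          (\<lambda>\<epsilon>. env_resolvent \<alpha> \<Gamma> \<tau> \<mu> \<kappa> \<epsilon> \<omega> l f) (limit_resolvent \<alpha> \<Gamma> K l f) (at_right 0)) \<and>
        (\<forall>g\<in>Cc.
          ((\<lambda>\<epsilon>. L2_inner (env_measure \<tau> \<mu> \<epsilon> \<omega>) (env_resolvent \<alpha> \<Gamma> \<tau> \<mu> \<kappa> \<epsilon> \<omega> l f) g)
            \<longlongrightarrow> L2_inner lborel (limit_resolvent \<alpha> \<Gamma> K l f) g) (at_right 0)) \<and>
        (\<forall>g\<in>Cc_infinity.
          ((\<lambda>\<epsilon>. env_form \<alpha> \<Gamma> \<kappa> \<epsilon> \<omega> (env_resolvent \<alpha> \<Gamma> \<tau> \<mu> \<kappa> \<epsilon> \<omega> l f) g)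
            \<longlongrightarrow> limit_form \<alpha> \<Gamma> K (limit_resolvent \<alpha> \<Gamma> K l f) g) (at_right 0))"
      unfolding env_resolvent_def env_form_def env_domain_def env_measure_def limit_resolvent_def limit_form_def limit_domain_def k
      by (intro allI impI ballI conjI resolvent_convergence)
  qed
qed

end
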